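(* Let $m>0$, let $U^{(m)}$ be the irreducible positive energy representation of mass $m$ of the two-dimensional Poincaré group on $\mathcal H=L^2(\mathbb R,d\theta)$, let $U^{(m)}_2(g):=U^{(m)}(g)\otimes U^{(m)}(g)$, and let $H\subset L^2(\mathbb R)$ be the standard subspace with modular data $(J_H\psi)(\theta)=\overline{\psi(\theta)}$, $\Delta_H^{it}=U^{(m)}(0,2\pi t)$, and Tomita operator $S_H=J_H\Delta_H^{1/2}$. (a) An operator $T\in\{U_2^{(m)}\}'$ is $J_H$-crossable if and only if it is of the form $T=M_g^-F$ with $g\in L^\infty(\mathbb R)$. It is $J_H$-crossing symmetric if and only if $g$ is real. (b) An operator $T\in\{U_2^{(m)}\}'$ is $S_H$-crossable if and only if $T=M_g^-F$ with $g\in\mathbb H^\infty(\mathbb S_\pi)$. It is $S_H$-crossing symmetric if and only if $g(\theta+i\pi)=\overline{g(\theta)}$, and unitary if and only if $g\in\mathbb H^\infty(\mathbb S_\pi)$ is inner.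
   Context: The two-dimensional Poincaré group $SO(1,1)\rtimes\mathbb R^2$ is viewed as the group of maps $(x,\lambda):\mathbb R^2\to\mathbb R^2$, $y\mapsto\Lambda_\lambda y+x$, with $x\in\mathbb R^2,\lambda\in\mathbb R$ and $\Lambda_\lambda=\begin{pmatrix}\cosh\lambda&\sinh\lambda\\\sinh\lambda&\cosh\lambda\end{pmatrix}$. The representation is $$(U^{(m)}(x,\lambda)\psi)(\theta)=e^{ip_m(\theta)\cdot x}\psi(\theta-\lambda),\qquad p_m(\theta)=m\begin{pmatrix}\cosh\theta\\\sinh\theta\end{pmatrix},$$ where $p\cdot x=p_0x_0-p_1x_1$ is the Minkowski product. $\{U_2^{(m)}\}'$ is the commutant of $U_2^{(m)}$ in $\mathcal B(\mathcal H\otimes\mathcal H)$, $\mathcal H\otimes\mathcal H=L^2(\mathbb R^2)$. $F$ is the tensor flip, $(F\Psi)(\theta_1,\theta_2)=\Psi(\theta_2,\theta_1)$, and for $g\in L^\infty(\mathbb R)$, $(M_g^-\Psi)(\theta_1,\theta_2)=g(\theta_2-\theta_1)\Psi(\theta_1,\theta_2)$. $\mathbb S_\pi=\{\zeta\in\mathbb C:0<\mathrm{Im}\,\zeta<\pi\}$; $\mathbb H^\infty(\mathbb S_\pi)$ is the space of bounded analytic functions on $\mathbb S_\pi$, identified with their boundary values on $\mathbb R$; $g(\theta+i\pi)$, $\theta\in\mathbb R$, denotes the boundary value at the upper edge, and equalities of boundary values are understood almost everywhere. As usual, a function in $\mathbb H^\infty(\mathbb S_\pi)$ is called inner if its boundary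 values on the boundary of the strip have modulus one almost everywhere. A standard subspace $H\subset\mathcal H$ is a closed real linear subspace with $H\cap iH=\{0\}$ and $\overline{H+iH}=\mathcal H$; its Tomita operator is $S_H:h_1+ih_2\mapsto h_1-ih_2$ ($h_1,h_2\in H$), with polar decomposition $S_H=J_H\Delta_H^{1/2}$. Inner products are antilinear in the first argument. For a densely defined closed antilinear involution $S$ on $\mathcal H$ (here $S=J_H$ or $S=S_H$), with adjoint given by $\langle v,Sw\rangle=\langle w,S^*v\rangle$, an operator $T\in\mathcal B(\mathcal H\otimes\mathcal H)$ is $S$-crossable if there is a (unique) bounded operator $\mathrm{Cr}_S(T)$ on $\mathcal H\otimes\mathcal H$ with $$\langle\varphi_2\otimes S^*\psi_2,\,T(S\varphi_1\otimes\psi_1)\rangle=\langle\varphi_1\otimes\varphi_2,\,\mathrm{Cr}_S(T)(\psi_1\otimes\psi_2)\rangle$$ for all $\varphi_1,\psi_1\in\mathrm{dom}(S)$, $\varphi_2,\psi_2\in\mathrm{dom}(S^* )$; it is $S$-crossing symmetric if in addition $\mathrm{Cr}_S(T)=T^*$.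
   Formalization: In (b), "unitary implies g inner" is proved only for S_H-crossing symmetric T, since it fails for merely crossable T (g(z)=exp(iz) gives a unitary T, but |g| = exp(-π) on the upper edge); "g inner implies unitary" is proved for all S_H-crossable T. *)

theory Defs
  imports "HOL-Analysis.Analysis"
begin

section \<open>The Hilbert spaces $L^2$\<close>

definition square_integrable :: "('a::euclidean_space \<Rightarrow> complex) \<Rightarrow> bool" where
  "square_integrable f \<longleftrightarrow>
     f \<in> borel_measurable borel \<and> integrable lborel (\<lambda>x. (cmod (f x))\<^sup>2)"

lemma square_integrable_zero: "square_integrable (\<lambda>x. 0)"
  by (simp add: square_integrable_def)

lemma square_integrable_bound:
  fixes f :: "'a::euclidean_space \<Rightarrow> complex"
  assumes "square_integrable f" "g \<in> borel_measurable borel"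
    and "AE x in lborel. cmod (g x) \<le> B * cmod (f x)"
  shows "square_integrable g"
proof -
  have "AE x in lborel. norm ((cmod (g x))\<^sup>2) \<le> norm (B\<^sup>2 * (cmod (f x))\<^sup>2)"
    using assms(3)
  proof eventually_elim
    case (elim x)
    then have "(cmod (g x))\<^sup>2 \<le> (B * cmod (f x))\<^sup>2"
      by (rule power_mono) simp
    then show ?case by (simp add: power_mult_distrib)
  qed
  moreover have "integrable lborel (\<lambda>x. B\<^sup>2 * (cmod (f x))\<^sup>2)"
    using assms(1) by (simp add: square_integrable_def)
  moreover have "(\<lambda>x. (cmod (g x))\<^sup>2) \<in> borel_measurable lborel"
    using assms(2) by simp
  ultimately have "integrable lborel (\<lambda>x. (cmod (g x))\<^sup>2)"
    by - (rule Bochner_Integration.integrable_bound)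
  then show ?thesis using assms(2) by (simp add: square_integrable_def)
qed

lemma square_integrable_mult:
  "square_integrable f \<Longrightarrow> square_integrable (\<lambda>x. c * f x)"
  by (rule square_integrable_bound[where B = "cmod c" and f = f])
     (auto simp: square_integrable_def norm_mult)

lemma square_integrable_add:
  assumes "square_integrable f" "square_integrable g"
  shows "square_integrable (\<lambda>x. f x + g x)"
proof -
  have meas: "f \<in> borel_measurable borel" "g \<in> borel_measurable borel"
    using assms by (auto simp: square_integrable_def)
  have "integrable lborel (\<lambda>x. (cmod (f x + g x))\<^sup>2)"
  proof (rule Bochner_Integration.integrable_bound)
    show "integrable lborel (\<lambda>x. 2 * (cmod (f x))\<^sup>2 + 2 * (cmod (g x))\<^sup>2)"
      using assms by (simp add: square_integrable_def)
    show "(\<lambda>x. (cmod (f x + g x))\<^sup>2) \<in> borel_measurable lborel"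
      using meas by simp
    have "(cmod (f x + g x))\<^sup>2 \<le> 2 * (cmod (f x))\<^sup>2 + 2 * (cmod (g x))\<^sup>2" for x
    proof -
      have "(cmod (f x + g x))\<^sup>2 \<le> (cmod (f x) + cmod (g x))\<^sup>2"
        by (intro power_mono norm_triangle_ineq) simp
      also have "\<dots> \<le> 2 * (cmod (f x))\<^sup>2 + 2 * (cmod (g x))\<^sup>2"
        using sum_squares_bound[of "cmod (f x)" "cmod (g x)"] by (simp add: power2_sum)
      finally show ?thesis .
    qed
    then show "AE x in lborel. norm ((cmod (f x + g x))\<^sup>2)
        \<le> norm (2 * (cmod (f x))\<^sup>2 + 2 * (cmod (g x))\<^sup>2)"
      by simp
  qed
  then show ?thesis using meas by (simp add: square_integrable_def)
qed

lemma square_integrable_integrable_product: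
  assumes "square_integrable f" "square_integrable g"
  shows "integrable lborel (\<lambda>x. cnj (f x) * g x)"
proof (rule Bochner_Integration.integrable_bound)
  have meas: "f \<in> borel_measurable borel" "g \<in> borel_measurable borel"
    using assms by (auto simp: square_integrable_def)
  show "integrable lborel (\<lambda>x. (cmod (f x))\<^sup>2 + (cmod (g x))\<^sup>2)"
    using assms by (simp add: square_integrable_def)
  show "(\<lambda>x. cnj (f x) * g x) \<in> borel_measurable lborel"
    using meas by (auto intro!: borel_measurable_times borel_measurable_continuous_on[of cnj]
        continuous_intros)
  have "cmod (f x) * cmod (g x) \<le> (cmod (f x))\<^sup>2 + (cmod (g x))\<^sup>2" for x
  proof -
    have "2 * (cmod (f x) * cmod (g x)) \<le> (cmod (f x))\<^sup>2 + (cmod (g x))\<^sup>2"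
      using sum_squares_bound[of "cmod (f x)" "cmod (g x)"] by (simp add: mult.assoc)
    moreover have "0 \<le> cmod (f x) * cmod (g x)" by simp
    ultimately show ?thesis by linarith
  qed
  then show "AE x in lborel. norm (cnj (f x) * g x)
      \<le> norm ((cmod (f x))\<^sup>2 + (cmod (g x))\<^sup>2)"
    by (simp add: norm_mult)
qed

definition l2_rel :: "('a::euclidean_space \<Rightarrow> complex) \<Rightarrow> ('a \<Rightarrow> complex) \<Rightarrow> bool" where
  "l2_rel f g \<longleftrightarrow>
     square_integrable f \<and> square_integrable g \<and> (AE x in lborel. f x = g x)"

quotient_type (overloaded) 'a l2 = "'a::euclidean_space \<Rightarrow> complex" / partial: l2_rel
proof (rule part_equivpI)
  show "\<exists>f::'a \<Rightarrow> complex. l2_rel f f"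
    using square_integrable_zero by (auto simp: l2_rel_def)
  show "symp (l2_rel :: ('a \<Rightarrow> complex) \<Rightarrow> _)"
    by (rule sympI) (auto simp: l2_rel_def elim: AE_mp)
  show "transp (l2_rel :: ('a \<Rightarrow> complex) \<Rightarrow> _)"
    by (rule transpI) (auto simp: l2_rel_def elim!: AE_mp)
qed

lift_definition cinner :: "'a::euclidean_space l2 \<Rightarrow> 'a l2 \<Rightarrow> complex" is
  "\<lambda>f g. LINT x|lborel. cnj (f x) * g x"
proof -
  fix f f' g g' :: "'a \<Rightarrow> complex"
  assume *: "l2_rel f f'" "l2_rel g g'"
  then have "AE x in lborel. cnj (f x) * g x = cnj (f' x) * g' x"
    by (auto simp: l2_rel_def)
  with * show "(LINT x|lborel. cnj (f x) * g x) = (LINT x|lborel. cnj (f' x) * g' x)"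
    by (intro integral_cong_AE borel_measurable_integrable
          square_integrable_integrable_product) (auto simp: l2_rel_def)
qed

lift_definition scaleC :: "complex \<Rightarrow> 'a::euclidean_space l2 \<Rightarrow> 'a l2" (infixr \<open>*\<^sub>C\<close> 75) is
  "\<lambda>c f x. c * f x"
  unfolding l2_rel_def
proof (intro conjI; elim conjE)
  fix c :: complex and f f' :: "'a \<Rightarrow> complex"
  assume "square_integrable f" "square_integrable f'" and ae: "AE x in lborel. f x = f' x"
  then show "square_integrable (\<lambda>x. c * f x)" "square_integrable (\<lambda>x. c * f' x)"
    by (simp_all only: square_integrable_mult)
  from ae show "AE x in lborel. c * f x = c * f' x"
    by eventually_elim simp
qed

instantiation l2 :: (euclidean_space) real_inner
begin

lift_definition zero_l2 :: "'a l2" is "\<lambda>x. 0"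
  by (simp add: l2_rel_def square_integrable_zero)

lift_definition plus_l2 :: "'a l2 \<Rightarrow> 'a l2 \<Rightarrow> 'a l2" is "\<lambda>f g x. f x + g x"
  unfolding l2_rel_def
proof (intro conjI; elim conjE)
  fix f f' g g' :: "'a \<Rightarrow> complex"
  assume "square_integrable f" "square_integrable f'" "square_integrable g" "square_integrable g'"
    and ae: "AE x in lborel. f x = f' x" "AE x in lborel. g x = g' x"
  then show "square_integrable (\<lambda>x. f x + g x)" "square_integrable (\<lambda>x. f' x + g' x)"
    by (simp_all only: square_integrable_add)
  from ae show "AE x in lborel. f x + g x = f' x + g' x"
    by eventually_elim simp
qed

definition uminus_l2 :: "'a l2 \<Rightarrow> 'a l2" where "uminus_l2 \<psi> = (-1) *\<^sub>C \<psi>"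
definition minus_l2 :: "'a l2 \<Rightarrow> 'a l2 \<Rightarrow> 'a l2" where "minus_l2 \<phi> \<psi> = \<phi> + (-1) *\<^sub>C \<psi>"
definition scaleR_l2 :: "real \<Rightarrow> 'a l2 \<Rightarrow> 'a l2" where "scaleR_l2 r \<psi> = of_real r *\<^sub>C \<psi>"
definition inner_l2 :: "'a l2 \<Rightarrow> 'a l2 \<Rightarrow> real" where "inner_l2 \<phi> \<psi> = Re (cinner \<phi> \<psi>)"
definition norm_l2 :: "'a l2 \<Rightarrow> real" where "norm_l2 \<psi> = sqrt (inner \<psi> \<psi>)"
definition sgn_l2 :: "'a l2 \<Rightarrow> 'a l2" where "sgn_l2 \<psi> = inverse (norm \<psi>) *\<^sub>R \<psi>"
definition dist_l2 :: "'a l2 \<Rightarrow> 'a l2 \<Rightarrow> real" where "dist_l2 \<phi> \<psi> = norm (\<phi> - \<psi>)"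
definition uniformity_l2 :: "('a l2 \<times> 'a l2) filter" where
  "uniformity_l2 = (INF e\<in>{0 <..}. principal {(x, y). dist x y < e})"
definition open_l2 :: "'a l2 set \<Rightarrow> bool" where
  "open_l2 U = (\<forall>x\<in>U. eventually (\<lambda>(x', y). x' = x \<longrightarrow> y \<in> U) uniformity)"

instance
proof
  fix a b c :: "'a l2" and r s :: real and U :: "'a l2 set"
  show "a + b + c = a + (b + c)"
    by transfer (auto simp: l2_rel_def add.assoc intro!: square_integrable_add)
  show "a + b = b + a"
    by transfer (auto simp: l2_rel_def add.commute intro!: square_integrable_add)
  show "0 + a = a"
    by transfer (auto simp: l2_rel_def)
  show "- a + a = 0"
    unfolding uminus_l2_def
    by transfer (auto simp: l2_rel_def square_integrable_zero)
  show "a - b = a + - b"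
    by (simp add: uminus_l2_def minus_l2_def)
  show "r *\<^sub>R (a + b) = r *\<^sub>R a + r *\<^sub>R b"
    unfolding scaleR_l2_def
    by transfer (auto simp: l2_rel_def distrib_left intro!: square_integrable_add square_integrable_mult)
  show "(r + s) *\<^sub>R a = r *\<^sub>R a + s *\<^sub>R a"
    unfolding scaleR_l2_def
    by transfer (auto simp: l2_rel_def distrib_right intro!: square_integrable_add square_integrable_mult)
  show "r *\<^sub>R s *\<^sub>R a = (r * s) *\<^sub>R a"
    unfolding scaleR_l2_def
    by transfer (auto simp: l2_rel_def mult.assoc intro!: square_integrable_mult)
  show "1 *\<^sub>R a = a"
    unfolding scaleR_l2_def by transfer (auto simp: l2_rel_def)
  show "dist a b = norm (a - b)" by (simp add: dist_l2_def)
  show "sgn a = inverse (norm a) *\<^sub>R a" by (simp add: sgn_l2_def)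
  show "uniformity = (INF e\<in>{0 <..}. principal {(x, y::'a l2). dist x y < e})"
    by (simp add: uniformity_l2_def)
  show "open U = (\<forall>x\<in>U. eventually (\<lambda>(x', y). x' = x \<longrightarrow> y \<in> U) uniformity)"
    by (simp add: open_l2_def)
  have cnj_cinner: "cinner b a = cnj (cinner a b)"
    by transfer (simp add: mult.commute flip: Bochner_Integration.integral_cnj)
  show "inner a b = inner b a"
    by (simp add: inner_l2_def cnj_cinner)
  have "cinner (a + b) c = cinner a c + cinner b c"
  proof transfer
    fix a b c :: "'a \<Rightarrow> complex"
    assume "l2_rel a a" "l2_rel b b" "l2_rel c c"
    then show "(LINT x|lborel. cnj (a x + b x) * c x)
        = (LINT x|lborel. cnj (a x) * c x) + (LINT x|lborel. cnj (b x) * c x)"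
      by (subst Bochner_Integration.integral_add[symmetric])
         (auto simp: l2_rel_def distrib_right intro: square_integrable_integrable_product)
  qed
  then show "inner (a + b) c = inner a c + inner b c"
    by (simp add: inner_l2_def)
  have "cinner (of_real r *\<^sub>C a) b = of_real r * cinner a b"
    by transfer (simp add: mult.assoc)
  then show "inner (r *\<^sub>R a) b = r * inner a b"
    by (simp add: inner_l2_def scaleR_l2_def)
  have *: "Re (LINT x|lborel. cnj (f x) * f x) = (LINT x|lborel. (cmod (f x))\<^sup>2)"
    for f :: "'a \<Rightarrow> complex"
  proof -
    have "(\<lambda>x. cnj (f x) * f x) = (\<lambda>x. complex_of_real ((cmod (f x))\<^sup>2))"
      by (simp only: complex_norm_square mult.commute)
    then show ?thesis by (simp only: integral_complex_of_real Re_complex_of_real)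
  qed
  show "0 \<le> inner a a"
    unfolding inner_l2_def by transfer (simp add: *)
  show "inner a a = 0 \<longleftrightarrow> a = 0"
    unfolding inner_l2_def
  proof transfer
    fix f :: "'a \<Rightarrow> complex"
    assume "l2_rel f f"
    then have f: "square_integrable f" by (simp add: l2_rel_def)
    then have "(LINT x|lborel. (cmod (f x))\<^sup>2) = 0 \<longleftrightarrow> (AE x in lborel. (cmod (f x))\<^sup>2 = 0)"
      by (intro integral_nonneg_eq_0_iff_AE) (auto simp: square_integrable_def)
    then show "Re (LINT x|lborel. cnj (f x) * f x) = 0 \<longleftrightarrow> l2_rel f (\<lambda>x. 0)"
      using f by (simp add: * l2_rel_def square_integrable_zero)
  qed
  show "norm a = sqrt (inner a a)" by (simp add: norm_l2_def)
qed

end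

section \<open>Operators\<close>

definition bounded_clinear :: "('a::euclidean_space l2 \<Rightarrow> 'b::euclidean_space l2) \<Rightarrow> bool" where
  "bounded_clinear T \<longleftrightarrow> bounded_linear T \<and> (\<forall>c \<psi>. T (c *\<^sub>C \<psi>) = c *\<^sub>C T \<psi>)"

definition is_adjoint :: "('a::euclidean_space l2 \<Rightarrow> 'a l2) \<Rightarrow> ('a l2 \<Rightarrow> 'a l2) \<Rightarrow> bool" where
  "is_adjoint T T' \<longleftrightarrow> (\<forall>\<phi> \<psi>. cinner (T' \<phi>) \<psi> = cinner \<phi> (T \<psi>))"

definition unitary :: "('a::euclidean_space l2 \<Rightarrow> 'a l2) \<Rightarrow> bool" where
  "unitary T \<longleftrightarrow>
     bounded_clinear T \<and> (\<exists>T'. is_adjoint T T' \<and> T' \<circ> T = id \<and> T \<circ> T' = id)"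

definition antiunitary :: "('a::euclidean_space l2 \<Rightarrow> 'a l2) \<Rightarrow> bool" where
  "antiunitary J \<longleftrightarrow>
     surj J \<and> (\<forall>\<phi> \<psi>. J (\<phi> + \<psi>) = J \<phi> + J \<psi>) \<and> (\<forall>c \<psi>. J (c *\<^sub>C \<psi>) = cnj c *\<^sub>C J \<psi>) \<and>
     (\<forall>\<phi> \<psi>. cinner (J \<phi>) (J \<psi>) = cinner \<psi> \<phi>)"

definition commutant :: "('a::euclidean_space l2 \<Rightarrow> 'a l2) set \<Rightarrow> ('a l2 \<Rightarrow> 'a l2) set" where
  "commutant A = {T. bounded_clinear T \<and> (\<forall>W\<in>A. T \<circ> W = W \<circ> T)}"

text \<open>Unbounded operators, linear or antilinear, are identified with their graphs, so that
  \<^const>\<open>Domain\<close> is the domain, and \<open>A O B\<close> is the operator \<open>A\<close> followed by \<open>B\<close>.\<close>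

definition graph :: "('a \<Rightarrow> 'b) \<Rightarrow> ('a \<times> 'b) set" where
  "graph f = {(x, f x) | x. True}"

definition antilinear_adjoint :: "('a::euclidean_space l2 \<times> 'a l2) set \<Rightarrow> ('a l2 \<times> 'a l2) set" where
  "antilinear_adjoint S = {(v, u). \<forall>(w, w') \<in> S. cinner v w' = cinner w u}"

section \<open>Spectral measures and functional calculus\<close>

definition spectral_measure :: "(real set \<Rightarrow> 'a::euclidean_space l2 \<Rightarrow> 'a l2) \<Rightarrow> bool" where
  "spectral_measure E \<longleftrightarrow>
     (\<forall>A \<in> sets borel. bounded_clinear (E A) \<and> is_adjoint (E A) (E A) \<and> E A \<circ> E A = E A) \<and>
     E UNIV = id \<and>
     (\<forall>A \<in> sets borel. \<forall>B \<in> sets borel. E (A \<inter> B) = E A \<circ> E B) \<and>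
     (\<forall>A :: nat \<Rightarrow> real set. range A \<subseteq> sets borel \<longrightarrow> disjoint_family A \<longrightarrow>
        (\<forall>\<psi>. (\<lambda>n. E (A n) \<psi>) sums E (\<Union>n. A n) \<psi>))"

definition scalar_measure ::
  "(real set \<Rightarrow> 'a::euclidean_space l2 \<Rightarrow> 'a l2) \<Rightarrow> 'a l2 \<Rightarrow> real measure" where
  "scalar_measure E \<psi> = measure_of UNIV (sets borel) (\<lambda>A. ennreal (Re (cinner \<psi> (E A \<psi>))))"

definition spectral_domain ::
  "(real set \<Rightarrow> 'a::euclidean_space l2 \<Rightarrow> 'a l2) \<Rightarrow> (real \<Rightarrow> complex) \<Rightarrow> 'a l2 set" where
  "spectral_domain E f = {\<psi>. integrable (scalar_measure E \<psi>) (\<lambda>s. (cmod (f s))\<^sup>2)}"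

text \<open>The integral of \<open>f\<close> against the complex measure \<open>\<langle>\<phi>, E(\<cdot>) \<psi>\<rangle>\<close>, which is a combination of
  positive measures by polarization.\<close>

definition spectral_form :: "(real set \<Rightarrow> 'a::euclidean_space l2 \<Rightarrow> 'a l2) \<Rightarrow>
    (real \<Rightarrow> complex) \<Rightarrow> 'a l2 \<Rightarrow> 'a l2 \<Rightarrow> complex" where
  "spectral_form E f \<phi> \<psi> =
     (\<Sum>k<4. \<i> ^ k * (LINT s|scalar_measure E (\<psi> + \<i> ^ k *\<^sub>C \<phi>). f s)) / 4"

text \<open>The operator \<open>\<integral> f(s) dE(s)\<close>, i.e. \<open>f(A)\<close> for the self-adjoint operator \<open>A = \<integral> s dE(s)\<close>.\<close>

definition spectral_op :: "(real set \<Rightarrow> 'a::euclidean_space l2 \<Rightarrow> 'a l2) \<Rightarrow>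
    (real \<Rightarrow> complex) \<Rightarrow> ('a l2 \<times> 'a l2) set" where
  "spectral_op E f = {(\<psi>, \<eta>). \<psi> \<in> spectral_domain E f \<and>
     (\<forall>\<phi> \<in> spectral_domain E f. cinner \<phi> \<eta> = spectral_form E f \<phi> \<psi>)}"

section \<open>Standard subspaces and modular data\<close>

definition standard_subspace :: "'a::euclidean_space l2 set \<Rightarrow> bool" where
  "standard_subspace H \<longleftrightarrow> subspace H \<and> closed H \<and> H \<inter> scaleC \<i> ` H = {0} \<and>
     closure {h\<^sub>1 + \<i> *\<^sub>C h\<^sub>2 | h\<^sub>1 h\<^sub>2. h\<^sub>1 \<in> H \<and> h\<^sub>2 \<in> H} = UNIV"

definition tomita :: "'a::euclidean_space l2 set \<Rightarrow> ('a l2 \<times> 'a l2) set" where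
  "tomita H = {(h\<^sub>1 + \<i> *\<^sub>C h\<^sub>2, h\<^sub>1 - \<i> *\<^sub>C h\<^sub>2) | h\<^sub>1 h\<^sub>2. h\<^sub>1 \<in> H \<and> h\<^sub>2 \<in> H}"

text \<open>\<open>J\<close> is the modular conjugation of \<open>H\<close>, and \<open>E\<close> is the spectral measure of its modular
  operator \<open>\<Delta> = \<integral> s dE(s)\<close>, a positive nonsingular self-adjoint operator. The last clause is the
  polar decomposition \<open>S\<^sub>H = J \<Delta>\<^sup>1\<^sup>/\<^sup>2\<close>.\<close>

definition modular_data :: "'a::euclidean_space l2 set \<Rightarrow> ('a l2 \<Rightarrow> 'a l2) \<Rightarrow>
    (real set \<Rightarrow> 'a l2 \<Rightarrow> 'a l2) \<Rightarrow> bool" where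
  "modular_data H J E \<longleftrightarrow> antiunitary J \<and> spectral_measure E \<and> E {0<..} = id \<and>
     tomita H = spectral_op E (\<lambda>s. of_real (sqrt s)) O graph J"

text \<open>\<open>\<Delta>\<^sup>i\<^sup>t\<close> for \<open>\<Delta> = \<integral> s dE(s)\<close>, with \<open>s\<^sup>i\<^sup>t = exp(i t log s)\<close>.\<close>

definition imaginary_power ::
  "(real set \<Rightarrow> 'a::euclidean_space l2 \<Rightarrow> 'a l2) \<Rightarrow> real \<Rightarrow> ('a l2 \<times> 'a l2) set" where
  "imaginary_power E t = spectral_op E (\<lambda>s. cis (t * ln s))"

section \<open>The tensor square of $L^2(\mathbb R)$\<close>

lemma AE_lborel_fst_snd:
  fixes P :: "real \<Rightarrow> bool"
  assumes "AE x in lborel. P x"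
  shows "AE z in (lborel :: (real \<times> real) measure). P (fst z)"
    and "AE z in (lborel :: (real \<times> real) measure). P (snd z)"
proof -
  obtain N where N: "{x. \<not> P x} \<subseteq> N" "N \<in> null_sets lborel"
    using assms by (auto simp: eventually_ae_filter)
  have "N \<times> UNIV \<in> null_sets (lborel \<Otimes>\<^sub>M (lborel :: real measure))"
    using N(2) by (auto simp: null_sets_def lborel.emeasure_pair_measure_Times
      intro!: pair_measureI)
  then have "AE z in (lborel :: (real \<times> real) measure). z \<notin> N \<times> UNIV"
    unfolding lborel_prod[symmetric] by (rule AE_not_in)
  then show "AE z in (lborel :: (real \<times> real) measure). P (fst z)"
    by eventually_elim (use N in auto)
  have "UNIV \<times> N \<in> null_sets ((lborel :: real measure) \<Otimes>\<^sub>M lborel)"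
    using N(2) by (auto simp: null_sets_def lborel.emeasure_pair_measure_Times
      intro!: pair_measureI)
  then have "AE z in (lborel :: (real \<times> real) measure). z \<notin> UNIV \<times> N"
    unfolding lborel_prod[symmetric] by (rule AE_not_in)
  then show "AE z in (lborel :: (real \<times> real) measure). P (snd z)"
    by eventually_elim (use N in auto)
qed

lemma square_integrable_tensor:
  fixes f g :: "real \<Rightarrow> complex"
  assumes "square_integrable f" "square_integrable g"
  shows "square_integrable (\<lambda>(x, y). f x * g y)"
proof -
  have [measurable]: "f \<in> borel_measurable borel" "g \<in> borel_measurable borel"
    using assms by (auto simp: square_integrable_def)
  have meas: "(\<lambda>(x, y). f x * g y) \<in> borel_measurable (borel :: (real \<times> real) measure)"
    unfolding borel_prod[symmetric] by measurable
  have "integrable (lborel \<Otimes>\<^sub>M lborel) (\<lambda>(x, y). (cmod (f x))\<^sup>2 * (cmod (g y))\<^sup>2)"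
    using assms by (intro lborel_pair.Fubini_integrable)
      (auto simp: square_integrable_def)
  then have "integrable lborel (\<lambda>z::real \<times> real. (cmod ((\<lambda>(x, y). f x * g y) z))\<^sup>2)"
    by (simp add: lborel_prod case_prod_beta' norm_mult power_mult_distrib)
  with meas show ?thesis by (simp add: square_integrable_def)
qed

lift_definition tensor :: "real l2 \<Rightarrow> real l2 \<Rightarrow> (real \<times> real) l2" (infixr \<open>\<otimes>\<close> 70) is
  "\<lambda>f g (x, y). f x * g y"
proof -
  fix f f' g g' :: "real \<Rightarrow> complex"
  assume *: "l2_rel f f'" "l2_rel g g'"
  then have "AE z in (lborel :: (real \<times> real) measure). f (fst z) = f' (fst z)"
      "AE z in (lborel :: (real \<times> real) measure). g (snd z) = g' (snd z)"
    by (auto simp: l2_rel_def intro: AE_lborel_fst_snd)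
  then have "AE z in lborel. (case z of (x, y) \<Rightarrow> f x * g y) = (case z of (x, y) \<Rightarrow> f' x * g' y)"
    by eventually_elim (simp add: case_prod_beta)
  with * show "l2_rel (\<lambda>(x, y). f x * g y) (\<lambda>(x, y). f' x * g' y)"
    by (simp add: l2_rel_def square_integrable_tensor)
qed

text \<open>\<open>A \<otimes> B\<close> for bounded \<open>A\<close>, \<open>B\<close>; uniqueness holds because the simple tensors are total.\<close>

definition tensor_op :: "(real l2 \<Rightarrow> real l2) \<Rightarrow> (real l2 \<Rightarrow> real l2) \<Rightarrow>
    (real \<times> real) l2 \<Rightarrow> (real \<times> real) l2" where
  "tensor_op A B = (THE W. bounded_clinear W \<and> (\<forall>\<phi> \<psi>. W (\<phi> \<otimes> \<psi>) = A \<phi> \<otimes> B \<psi>))"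

lemma lborel_distr_swap:
  "distr lborel borel (\<lambda>(x, y). (y, x)) = (lborel :: (real \<times> real) measure)"
proof -
  have "(lborel :: (real \<times> real) measure) = distr lborel lborel (\<lambda>(x, y). (y, x))"
    unfolding lborel_prod[symmetric] by (rule lborel_pair.distr_pair_swap)
  also have "\<dots> = distr lborel borel (\<lambda>(x, y). (y, x))"
    by (rule distr_cong) auto
  finally show ?thesis by simp
qed

lift_definition flip :: "(real \<times> real) l2 \<Rightarrow> (real \<times> real) l2" is
  "\<lambda>\<Psi> (\<theta>\<^sub>1, \<theta>\<^sub>2). \<Psi> (\<theta>\<^sub>2, \<theta>\<^sub>1)"
proof -
  fix f g :: "real \<times> real \<Rightarrow> complex"
  assume *: "l2_rel f g"
  have sw[measurable]: "(\<lambda>(x, y). (y, x)) \<in> measurable lborel (borel :: (real \<times> real) measure)"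
    unfolding case_prod_beta' measurable_lborel2
    by (intro borel_measurable_continuous_onI continuous_intros)
  have eq: "(\<lambda>(x, y). h (y, x)) = (\<lambda>z. h (case z of (x, y) \<Rightarrow> (y, x)))"
    for h :: "real \<times> real \<Rightarrow> complex" by auto
  have si: "square_integrable (\<lambda>(x, y). h (y, x))"
    if h: "square_integrable h" for h :: "real \<times> real \<Rightarrow> complex"
  proof -
    have hm: "h \<in> borel_measurable borel" using h by (simp add: square_integrable_def)
    have "integrable (distr lborel borel (\<lambda>(x, y). (y, x))) (\<lambda>z. (cmod (h z))\<^sup>2)"
      using h by (simp add: lborel_distr_swap square_integrable_def)
    from integrable_distr[OF sw this]
    have "integrable lborel (\<lambda>z. (cmod (h (case z of (x, y) \<Rightarrow> (y, x))))\<^sup>2)" .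
    moreover have "(\<lambda>z. h (case z of (x, y) \<Rightarrow> (y, x))) \<in> borel_measurable borel"
      using measurable_compose[OF sw hm] by simp
    ultimately show ?thesis by (simp add: eq square_integrable_def)
  qed
  have "AE z in distr lborel borel (\<lambda>(x, y). (y, x)). f z = g z"
    using * unfolding lborel_distr_swap by (simp add: l2_rel_def)
  then have "AE z in lborel. f (case z of (x, y) \<Rightarrow> (y, x)) = g (case z of (x, y) \<Rightarrow> (y, x))"
    by (rule AE_distrD[OF sw])
  with * show "l2_rel (\<lambda>(x, y). f (y, x)) (\<lambda>(x, y). g (y, x))"
    using si[of f] si[of g] by (simp add: l2_rel_def eq)
qed

section \<open>Multiplication by functions of the rapidity difference\<close>

definition Linf :: "(real \<Rightarrow> complex) set" where
  "Linf = {g. g \<in> borel_measurable borel \<and> (\<exists>B. AE \<theta> in lborel. cmod (g \<theta>) \<le> B)}"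

lemma AE_lborel_diff:
  fixes P :: "real \<Rightarrow> bool"
  assumes "AE x in lborel. P x"
  shows "AE (x, y) in (lborel :: (real \<times> real) measure). P (y - x)"
proof -
  obtain N where N: "{x. \<not> P x} \<subseteq> N" "N \<in> null_sets lborel"
    using assms by (auto simp: eventually_ae_filter)
  then have [measurable]: "N \<in> sets borel" by auto
  have N_ae: "AE x in lborel. x \<notin> N" using N(2) by (rule AE_not_in)
  have "AE z in ((lborel :: real measure) \<Otimes>\<^sub>M (lborel :: real measure)). snd z - fst z \<notin> N"
  proof (rule lborel_pair.AE_pair_measure)
    show "{z \<in> space ((lborel :: real measure) \<Otimes>\<^sub>M (lborel :: real measure)). snd z - fst z \<notin> N}
        \<in> sets (lborel \<Otimes>\<^sub>M lborel)"
      by measurable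
    have "AE y in lborel. y - x \<notin> N" for x
      using AE_borel_affine[of 1 "\<lambda>x. x \<notin> N" "-x"] N_ae by simp
    then show "AE x in lborel. AE y in lborel. snd (x, y) - fst (x, y) \<notin> N" by simp
  qed
  then have "AE z in (lborel :: (real \<times> real) measure). snd z - fst z \<notin> N"
    unfolding lborel_prod .
  then show ?thesis by eventually_elim (use N in auto)
qed

text \<open>The operator \<open>M\<^sub>g\<^sup>-\<close>; the value 0 for \<open>g \<notin> L\<^sup>\<infinity>\<close> is a dummy.\<close>

lift_definition mult_diff :: "(real \<Rightarrow> complex) \<Rightarrow> (real \<times> real) l2 \<Rightarrow> (real \<times> real) l2" is
  "\<lambda>g \<Psi>. if g \<in> Linf then (\<lambda>(\<theta>\<^sub>1, \<theta>\<^sub>2). g (\<theta>\<^sub>2 - \<theta>\<^sub>1) * \<Psi> (\<theta>\<^sub>1, \<theta>\<^sub>2)) else (\<lambda>_. 0)"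
proof -
  fix g :: "real \<Rightarrow> complex" and f f' :: "real \<times> real \<Rightarrow> complex"
  assume *: "l2_rel f f'"
  have si: "square_integrable (\<lambda>(x, y). g (y - x) * h (x, y))"
    if g: "g \<in> Linf" and h: "square_integrable h" for h
  proof -
    obtain B where B: "AE \<theta> in lborel. cmod (g \<theta>) \<le> B" and
      [measurable]: "g \<in> borel_measurable borel" "h \<in> borel_measurable (borel \<Otimes>\<^sub>M borel)"
      using g h by (auto simp: Linf_def square_integrable_def borel_prod)
    have "(\<lambda>(x, y). g (y - x) * h (x, y)) \<in> borel_measurable borel"
      unfolding borel_prod[symmetric] by measurable
    moreover have "AE z in lborel. cmod (case z of (x, y) \<Rightarrow> g (y - x) * h (x, y)) \<le> B * cmod (h z)"
      using AE_lborel_diff[OF B]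
      by eventually_elim (auto simp: norm_mult mult_right_mono)
    ultimately show ?thesis using h by (rule square_integrable_bound[rotated])
  qed
  have "AE z in lborel. (case z of (x, y) \<Rightarrow> g (y - x) * f (x, y))
      = (case z of (x, y) \<Rightarrow> g (y - x) * f' (x, y))"
    using * by (auto simp: l2_rel_def case_prod_beta elim: AE_mp)
  then show "l2_rel
      (if g \<in> Linf then (\<lambda>(x, y). g (y - x) * f (x, y)) else (\<lambda>_. 0))
      (if g \<in> Linf then (\<lambda>(x, y). g (y - x) * f' (x, y)) else (\<lambda>_. 0))"
    using * by (simp add: l2_rel_def si square_integrable_zero)
qed

section \<open>The representation of the Poincare group and the conjugation\<close>

definition minkowski :: "real \<times> real \<Rightarrow> real \<times> real \<Rightarrow> real" where
  "minkowski p x = fst p * fst x - snd p * snd x"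

definition mass_shell :: "real \<Rightarrow> real \<Rightarrow> real \<times> real" where
  "mass_shell m \<theta> = (m * cosh \<theta>, m * sinh \<theta>)"

lift_definition U :: "real \<Rightarrow> (real \<times> real) \<times> real \<Rightarrow> real l2 \<Rightarrow> real l2" is
  "\<lambda>m (x, lam) \<psi> \<theta>. exp (\<i> * of_real (minkowski (mass_shell m \<theta>) x)) * \<psi> (\<theta> - lam)"
proof -
  fix m :: real and g :: "(real \<times> real) \<times> real" and f f' :: "real \<Rightarrow> complex"
  assume *: "l2_rel f f'"
  obtain x lam where g: "g = (x, lam)" by (cases g)
  let ?c = "\<lambda>\<theta>. exp (\<i> * complex_of_real (minkowski (mass_shell m \<theta>) x))"
  have "continuous_on UNIV ?c"
    unfolding minkowski_def mass_shell_def by (auto intro!: continuous_intros)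
  then have [measurable]: "?c \<in> borel_measurable borel"
    by (rule borel_measurable_continuous_onI)
  have si: "square_integrable (\<lambda>\<theta>. ?c \<theta> * h (\<theta> - lam))" if h: "square_integrable h" for h
  proof -
    have [measurable]: "h \<in> borel_measurable borel"
      using h by (simp add: square_integrable_def)
    have "integrable lborel (\<lambda>\<theta>. (cmod (h (- lam + 1 * \<theta>)))\<^sup>2)"
      using h by (intro lborel_integrable_real_affine) (auto simp: square_integrable_def)
    then show ?thesis
      by (simp add: square_integrable_def norm_mult)
  qed
  have "AE \<theta> in lborel. f (\<theta> - lam) = f' (\<theta> - lam)"
  proof -
    obtain N where N: "{x. f x \<noteq> f' x} \<subseteq> N" "N \<in> null_sets lborel"
      using * by (auto simp: l2_rel_def eventually_ae_filter)
    then have [measurable]: "N \<in> sets borel" by auto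
    have "AE \<theta> in lborel. \<theta> - lam \<notin> N"
      using AE_borel_affine[of 1 "\<lambda>x. x \<notin> N" "- lam"] AE_not_in[OF N(2)] by simp
    then show ?thesis by eventually_elim (use N in auto)
  qed
  with * show "l2_rel
     ((case g of (x, lam) \<Rightarrow> \<lambda>\<psi> \<theta>. exp (\<i> * of_real (minkowski (mass_shell m \<theta>) x)) * \<psi> (\<theta> - lam)) f)
     ((case g of (x, lam) \<Rightarrow> \<lambda>\<psi> \<theta>. exp (\<i> * of_real (minkowski (mass_shell m \<theta>) x)) * \<psi> (\<theta> - lam)) f')"
    by (auto simp: g l2_rel_def si)
qed

definition U2 :: "real \<Rightarrow> (real \<times> real) \<times> real \<Rightarrow> (real \<times> real) l2 \<Rightarrow> (real \<times> real) l2" where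
  "U2 m g = tensor_op (U m g) (U m g)"

lift_definition conj_l2 :: "real l2 \<Rightarrow> real l2" is "\<lambda>\<psi> \<theta>. cnj (\<psi> \<theta>)"
  by (auto simp: l2_rel_def square_integrable_def
      intro!: borel_measurable_continuous_on[of cnj] continuous_intros)

section \<open>Crossing\<close>

text \<open>\<open>C\<close> is the crossed operator of \<open>T\<close>. It is unique whenever \<open>S\<close> and its adjoint are densely
  defined.\<close>

definition is_crossed :: "(real l2 \<times> real l2) set \<Rightarrow> ((real \<times> real) l2 \<Rightarrow> (real \<times> real) l2) \<Rightarrow>
    ((real \<times> real) l2 \<Rightarrow> (real \<times> real) l2) \<Rightarrow> bool" where
  "is_crossed S T C \<longleftrightarrow> bounded_clinear C \<and>
     (\<forall>(\<phi>\<^sub>1, S\<phi>\<^sub>1) \<in> S. \<forall>\<psi>\<^sub>1 \<in> Domain S.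
      \<forall>\<phi>\<^sub>2 \<in> Domain (antilinear_adjoint S). \<forall>(\<psi>\<^sub>2, S'\<psi>\<^sub>2) \<in> antilinear_adjoint S.
        cinner (\<phi>\<^sub>2 \<otimes> S'\<psi>\<^sub>2) (T (S\<phi>\<^sub>1 \<otimes> \<psi>\<^sub>1)) = cinner (\<phi>\<^sub>1 \<otimes> \<phi>\<^sub>2) (C (\<psi>\<^sub>1 \<otimes> \<psi>\<^sub>2)))"

definition crossable :: "(real l2 \<times> real l2) set \<Rightarrow> ((real \<times> real) l2 \<Rightarrow> (real \<times> real) l2) \<Rightarrow> bool"
  where "crossable S T \<longleftrightarrow> (\<exists>C. is_crossed S T C)"

definition crossing_symmetric ::
  "(real l2 \<times> real l2) set \<Rightarrow> ((real \<times> real) l2 \<Rightarrow> (real \<times> real) l2) \<Rightarrow> bool"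
  where "crossing_symmetric S T \<longleftrightarrow> (\<exists>C. is_crossed S T C \<and> is_adjoint T C)"

section \<open>Bounded analytic functions on the strip\<close>

definition strip :: "complex set" where
  "strip = {\<zeta>. 0 < Im \<zeta> \<and> Im \<zeta> < pi}"

definition Hinf :: "(complex \<Rightarrow> complex) set" where
  "Hinf = {G. G holomorphic_on strip \<and> bounded (G ` strip)}"

text \<open>Boundary values at \<open>\<theta>\<close> and at \<open>\<theta> + i\<pi>\<close>. For \<open>G \<in> H\<^sup>\<infinity>\<close> both limits exist for almost every
  \<open>\<theta>\<close> by Fatou's theorem.\<close>

definition lower_bv :: "(complex \<Rightarrow> complex) \<Rightarrow> real \<Rightarrow> complex" where
  "lower_bv G \<theta> = Lim (at_right 0) (\<lambda>\<eta>. G (Complex \<theta> \<eta>))"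

definition upper_bv :: "(complex \<Rightarrow> complex) \<Rightarrow> real \<Rightarrow> complex" where
  "upper_bv G \<theta> = Lim (at_left pi) (\<lambda>\<eta>. G (Complex \<theta> \<eta>))"

definition inner_function :: "(complex \<Rightarrow> complex) \<Rightarrow> bool" where
  "inner_function G \<longleftrightarrow> G \<in> Hinf \<and>
     (AE \<theta> in lborel. cmod (lower_bv G \<theta>) = 1 \<and> cmod (upper_bv G \<theta>) = 1)"

end

theory Submission
  imports Defs "HOL-Probability.Probability" "HOL-Complex_Analysis.Complex_Analysis" "HOL-Real_Asymp.Real_Asymp"
begin

text \<open>
  Multiplication by \<open>exp (i p \<cdot> x)\<close> on two particles of equal mass involves only the total momentum,
  which determines the two rapidities up to their order. Hence an operator \<open>T\<close> in the commutant
  commutes with every symmetric multiplier and has the form \<open>T = M\<^sub>a + M\<^sub>b F\<close>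
  (\<open>commutant_two_multipliers\<close>). Commutation with the boosts makes \<open>a\<close> and \<open>b\<close> functions \<open>f\<close> and
  \<open>g\<close> of the rapidity difference (\<open>commutant_form\<close>). It remains to see which of these \<open>T\<close> are
  crossable.

  Write \<open>S = J K\<close>, where \<open>K\<close> is the identity in part (a) and \<open>\<Delta>\<^sup>1\<^sup>/\<^sup>2\<close> in part (b). Since \<open>K\<close> is
  self-adjoint and densely defined, the crossing relation becomes an identity for two pairs \<open>(a, K a)\<close>,
  \<open>(b, K b)\<close> and two arbitrary vectors \<open>\<phi>\<close>, \<open>\<psi>\<close> (\<open>crossing_identity\<close>).

  In part (a) the exchange part \<open>M\<^sub>g F\<close> is crossed to \<open>M\<^sub>h F\<close> with \<open>h u = g (- u)\<close>. The matrix elements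
  that \<open>M\<^sub>f\<close> requires of the rest of the crossed operator depend on \<open>a\<close> and \<open>\<phi>\<close> only through their
  pointwise product, so they live on the diagonal, a null set, and \<open>f = 0\<close>
  (\<open>crossable_conj_form\<close>).

  In part (b), \<open>\<Delta>\<^sup>i\<^sup>t\<close> is translation by \<open>2 \<pi> t\<close>, so \<open>\<Delta>\<^sup>1\<^sup>/\<^sup>2\<close> is analytic continuation from the real line to
  its translate by \<open>i \<pi>\<close>. Convolution with complex translates of a Gaussian, which is a bounded function
  of \<open>\<Delta>\<close>, makes this precise. Entire functions with Gaussian decay on the strip give pairs in the
  graph of \<open>\<Delta>\<^sup>1\<^sup>/\<^sup>2\<close> (\<open>strip_gaussian_sqrt_op\<close>), and a pair of vectors lies in the graph as soon as
  it passes the symmetry test against them (\<open>gaussian_core\<close>). For \<open>g\<close> the boundary value of a function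
  \<open>G\<close> in \<open>H\<^sup>\<infinity>\<close>, the crossing identity on such pairs is the shift of the line of integration from one
  edge of the strip to the other (\<open>boundary_pairing\<close>); applying \<open>gaussian_core\<close> once in each argument
  gives it on the whole graph (\<open>exchange_crossing_strip\<close>). The crossed operator is unique, so crossing
  symmetry and unitarity are read off from the boundary values of \<open>G\<close>.

  Conversely, let \<open>T = M\<^sub>f + M\<^sub>g F\<close> be crossable. Gaussians with a large frequency grow without bound
  from the lower to the upper edge while the norm of the crossed operator is fixed; this forces
  \<open>f = 0\<close> (\<open>tomita_multiplication_part_zero\<close>). Concentrating \<open>\<phi> = \<psi>\<close> at a point bounds the
  convolutions of \<open>g\<close> with narrow Gaussians on the upper edge by the norm of the crossed operator
  (\<open>mollify_upper_bound\<close>). They are entire and bounded by the supremum of \<open>g\<close> on the lower edge, hence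
  uniformly bounded on the strip by the three lines theorem. By Montel's theorem a subsequence converges
  to some \<open>G\<close> in \<open>H\<^sup>\<infinity>\<close>, whose boundary values are \<open>g\<close> (\<open>tomita_exchange_analytic\<close>).

  Boundary values of functions in \<open>H\<^sup>\<infinity>\<close> exist by Fatou's theorem: a primitive extends to a
  Lipschitz function on the closed strip, it is differentiable almost everywhere on the edge, and at
  such points the vertical limit of its complex derivative exists (\<open>vertical_limit_deriv\<close>).
\<close>

section \<open>Calculus in the Hilbert spaces\<close>

lemma square_integrable_rep: "square_integrable (rep_l2 \<psi>)"
 using Quotient3_rep_reflp[OF Quotient3_l2] by (auto simp: l2_rel_def)

lemma abs_rep_l2 [simp]: "abs_l2 (rep_l2 \<psi>) = \<psi>"
 by (rule Quotient3_abs_rep[OF Quotient3_l2])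

lemma l2_rel_refl: "square_integrable f \<Longrightarrow> l2_rel f f"
 by (simp add: l2_rel_def)

lemma abs_l2_eq_iff:
 assumes "square_integrable f" "square_integrable g"
 shows "abs_l2 f = abs_l2 g \<longleftrightarrow> (AE x in lborel. f x = g x)"
 using Quotient3_rel[OF Quotient3_l2, of f g] assms by (auto simp: l2_rel_def)

lemma rep_abs_l2:
 assumes "square_integrable f"
 shows "AE x in lborel. rep_l2 (abs_l2 f) x = f x"
 using abs_l2_eq_iff[OF square_integrable_rep assms, of "abs_l2 f"] by simp

lemma l2_obtain:
 obtains f where "square_integrable f" "\<psi> = abs_l2 f"
 using square_integrable_rep[of \<psi>] abs_rep_l2[of \<psi>] by metis

lemma square_integrable_measurable [measurable_dest]:
 "square_integrable f \<Longrightarrow> f \<in> borel_measurable borel"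
 by (simp add: square_integrable_def)

lemma square_integrable_diff:
 "square_integrable f \<Longrightarrow> square_integrable g \<Longrightarrow> square_integrable (\<lambda>x. f x - g x)"
 using square_integrable_add[of f "\<lambda>x. -1 * g x"] square_integrable_mult[of g "-1"] by simp

lemma cinner_abs:
 assumes "square_integrable f" "square_integrable g"
 shows "cinner (abs_l2 f) (abs_l2 g) = (LINT x|lborel. cnj (f x) * g x)"
 using assms by (simp add: cinner.abs_eq l2_rel_refl)

lemma plus_abs:
 assumes "square_integrable f" "square_integrable g"
 shows "abs_l2 f + abs_l2 g = abs_l2 (\<lambda>x. f x + g x)"
 using assms by (simp add: plus_l2.abs_eq l2_rel_refl)

lemma scaleC_abs: "square_integrable f \<Longrightarrow> c *\<^sub>C abs_l2 f = abs_l2 (\<lambda>x. c * f x)"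
 by (simp add: scaleC.abs_eq l2_rel_refl)

lemma minus_abs:
 assumes "square_integrable f" "square_integrable g"
 shows "abs_l2 f - abs_l2 g = abs_l2 (\<lambda>x. f x - g x)"
 using assms plus_abs[OF assms(1) square_integrable_mult[OF assms(2), of "-1"]]
 by (simp add: minus_l2_def scaleC_abs)

lemma zero_abs: "(0::'a::euclidean_space l2) = abs_l2 (\<lambda>x. 0)"
 by (simp add: zero_l2_def)

lemma scaleC_add_right: "c *\<^sub>C (a + b) = c *\<^sub>C a + c *\<^sub>C b"
 by transfer (auto simp: l2_rel_def distrib_left intro!: square_integrable_add square_integrable_mult)

lemma scaleC_add_left: "(c + d) *\<^sub>C a = c *\<^sub>C a + d *\<^sub>C a"
 by transfer (auto simp: l2_rel_def distrib_right intro!: square_integrable_add square_integrable_mult)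

lemma scaleC_scaleC [simp]: "c *\<^sub>C d *\<^sub>C a = (c * d) *\<^sub>C a"
 by transfer (auto simp: l2_rel_def mult.assoc intro!: square_integrable_mult)

lemma scaleC_one [simp]: "1 *\<^sub>C a = a"
 by transfer (auto simp: l2_rel_def)

lemma scaleC_zero_left [simp]: "0 *\<^sub>C a = 0"
 by transfer (auto simp: l2_rel_def square_integrable_zero)

lemma scaleC_zero_right [simp]: "c *\<^sub>C (0::'a::euclidean_space l2) = 0"
 by transfer (auto simp: l2_rel_def square_integrable_zero)

lemma scaleC_of_real: "of_real r *\<^sub>C a = r *\<^sub>R a"
 by (simp add: scaleR_l2_def)

lemma scaleC_minus_right: "c *\<^sub>C (- a) = - (c *\<^sub>C a)"
 by (simp add: uminus_l2_def mult.commute)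

lemma scaleC_diff_right: "c *\<^sub>C (a - b) = c *\<^sub>C a - c *\<^sub>C b"
 by (simp only: diff_conv_add_uminus scaleC_add_right scaleC_minus_right)

lemma cinner_commute: "cinner a b = cnj (cinner b a)"
 by transfer (simp add: mult.commute flip: Bochner_Integration.integral_cnj)

lemma cinner_add_right: "cinner a (b + c) = cinner a b + cinner a c"
proof transfer
 fix a b c :: "'a \<Rightarrow> complex"
 assume "l2_rel a a" "l2_rel b b" "l2_rel c c"
 then show "(LINT x|lborel. cnj (a x) * (b x + c x))
   = (LINT x|lborel. cnj (a x) * b x) + (LINT x|lborel. cnj (a x) * c x)"
  by (subst Bochner_Integration.integral_add[symmetric])
    (auto simp: l2_rel_def distrib_left intro: square_integrable_integrable_product)
qed

lemma cinner_scaleC_right: "cinner a (c *\<^sub>C b) = c * cinner a b"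
 by transfer (simp add: mult.left_commute)

lemma cinner_add_left: "cinner (a + b) c = cinner a c + cinner b c"
 by (metis cinner_add_right cinner_commute complex_cnj_add)

lemma cinner_scaleC_left: "cinner (c *\<^sub>C a) b = cnj c * cinner a b"
 by (metis cinner_scaleC_right cinner_commute complex_cnj_mult)

lemma cinner_scaleR_right: "cinner a (r *\<^sub>R b) = r *\<^sub>R cinner a b"
 by (simp add: scaleR_l2_def cinner_scaleC_right scaleR_conv_of_real)

lemma cinner_scaleR_left: "cinner (r *\<^sub>R a) b = r *\<^sub>R cinner a b"
 by (simp add: scaleR_l2_def cinner_scaleC_left scaleR_conv_of_real)

lemma cinner_minus_right: "cinner a (- b) = - cinner a b"
 by (simp add: uminus_l2_def cinner_scaleC_right)

lemma cinner_diff_right: "cinner a (b - c) = cinner a b - cinner a c"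
 by (simp only: diff_conv_add_uminus cinner_add_right cinner_minus_right)

lemma cinner_zero [simp]: "cinner a 0 = 0" "cinner 0 a = 0"
 using cinner_scaleC_right[of a 0 a] cinner_scaleC_left[of 0 a a] by auto

lemma cinner_self: "cinner a a = of_real ((norm a)\<^sup>2)"
proof -
 have "Im (cinner a a) = 0"
  using cinner_commute[of a a] by (metis complex_cnj cnj.simps(2) neg_equal_zero)
 then show ?thesis
  by (simp add: complex_eq_iff power2_norm_eq_inner inner_l2_def)
qed

lemma norm_abs:
 assumes "square_integrable f"
 shows "(norm (abs_l2 f))\<^sup>2 = (LINT x|lborel. (cmod (f x))\<^sup>2)"
proof -
 have "complex_of_real ((norm (abs_l2 f))\<^sup>2) = (LINT x|lborel. complex_of_real ((cmod (f x))\<^sup>2))"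
  using assms by (simp only: cinner_abs complex_norm_square mult.commute flip: cinner_self)
 then show ?thesis
  by (metis integral_complex_of_real of_real_eq_iff)
qed

lemma norm_scaleC [simp]: "norm (c *\<^sub>C a) = cmod c * norm a"
proof -
 have "complex_of_real ((norm (c *\<^sub>C a))\<^sup>2) = of_real ((cmod c * norm a)\<^sup>2)"
  by (simp only: cinner_scaleC_left cinner_scaleC_right cinner_self[symmetric] power_mult_distrib
    of_real_mult complex_norm_square mult.assoc mult.commute mult.left_commute)
 then have "(norm (c *\<^sub>C a))\<^sup>2 = (cmod c * norm a)\<^sup>2"
  by (simp only: of_real_eq_iff)
 then show ?thesis by (rule power2_eq_imp_eq) auto
qed

lemma cinner_Cauchy_Schwarz: "cmod (cinner a b) \<le> norm a * norm b"
proof (cases "cinner a b = 0")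
 case False
 define c where "c = cnj (cinner a b) / cmod (cinner a b)"
 have c: "cmod c = 1" "c * cinner a b = cmod (cinner a b)"
  using False by (auto simp: c_def norm_divide complex_norm_square[symmetric] field_simps power2_eq_square)
 have "cmod (cinner a b) = Re (cinner a (c *\<^sub>C b))"
  by (simp add: cinner_scaleC_right c)
 also have "\<dots> \<le> norm a * norm (c *\<^sub>C b)"
  unfolding inner_l2_def[symmetric] by (rule norm_cauchy_schwarz)
 finally show ?thesis by (simp add: c)
qed simp

lemma bounded_bilinear_cinner: "bounded_bilinear cinner"
 by (rule bounded_bilinear.intro)
   (auto simp: cinner_add_left cinner_add_right cinner_scaleR_left cinner_scaleR_right
    intro!: exI[of _ 1] cinner_Cauchy_Schwarz)

lemmas tendsto_cinner = bounded_bilinear.tendsto[OF bounded_bilinear_cinner]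

lemma bounded_linear_scaleC: "bounded_linear (scaleC c)"
 by (rule bounded_linear_intro[where K = "cmod c"])
   (auto simp: scaleC_add_right scaleR_l2_def mult.commute)

lemmas tendsto_scaleC = bounded_linear.tendsto[OF bounded_linear_scaleC]

lemma cinner_ext: "(\<And>\<phi>. cinner \<phi> a = cinner \<phi> b) \<Longrightarrow> a = b"
proof -
 assume "\<And>\<phi>. cinner \<phi> a = cinner \<phi> b"
 then have "cinner (a - b) (a - b) = 0" by (simp add: cinner_diff_right)
 then show ?thesis by (simp add: cinner_self)
qed

lemma bounded_clinearD:
 assumes "bounded_clinear T"
 shows "T (a + b) = T a + T b" "T (c *\<^sub>C a) = c *\<^sub>C T a" "T (a - b) = T a - T b" "T 0 = 0"
  "bounded_linear T"
 using assms by (auto simp: bounded_clinear_def bounded_linear.linear linear_add linear_diff linear_0)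

lemma bounded_clinearI:
 assumes "\<And>a b. T (a + b) = T a + T b" "\<And>c a. T (c *\<^sub>C a) = c *\<^sub>C T a"
  "\<And>a. norm (T a) \<le> B * norm a"
 shows "bounded_clinear T"
 unfolding bounded_clinear_def
 by (auto intro!: bounded_linear_intro[where K = B] simp: assms mult.commute simp flip: scaleC_of_real)

lemma bounded_clinear_compose:
 assumes "bounded_clinear S" "bounded_clinear T"
 shows "bounded_clinear (S \<circ> T)"
 using assms by (auto simp: bounded_clinear_def o_def bounded_linear_compose)

text \<open>Dominated convergence, in the form in which all strong limits below are taken.\<close>

lemma l2_dominated_convergence:
 fixes f :: "nat \<Rightarrow> 'a::euclidean_space \<Rightarrow> complex"
 assumes f: "\<And>n. f n \<in> borel_measurable borel" and g: "g \<in> borel_measurable borel"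
  and h: "square_integrable h"
  and lim: "AE x in lborel. (\<lambda>n. f n x) \<longlonglongrightarrow> g x"
  and bound: "\<And>n. AE x in lborel. cmod (f n x) \<le> B * cmod (h x)"
 shows "square_integrable g" "(\<lambda>n. abs_l2 (f n)) \<longlonglongrightarrow> abs_l2 g"
proof -
 have sf: "square_integrable (f n)" for n
  by (rule square_integrable_bound[OF h f bound])
 have all: "AE x in lborel. \<forall>n. cmod (f n x) \<le> B * cmod (h x)"
  using bound by (simp add: AE_all_countable)
 have gb: "AE x in lborel. cmod (g x) \<le> B * cmod (h x)"
  using lim all
 proof eventually_elim
  case (elim x)
  then show ?case
   by (intro LIMSEQ_le_const2[OF tendsto_norm[OF elim(1)]]) auto
 qed
 show sg: "square_integrable g"
  by (rule square_integrable_bound[OF h g gb])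
 note [measurable] = f g
 have "(\<lambda>n. LINT x|lborel. (cmod (f n x - g x))\<^sup>2) \<longlonglongrightarrow> (LINT x|(lborel::'a measure). 0)"
 proof (rule integral_dominated_convergence[where w = "\<lambda>x. (2 * B)\<^sup>2 * (cmod (h x))\<^sup>2"])
  show "integrable lborel (\<lambda>x. (2 * B)\<^sup>2 * (cmod (h x))\<^sup>2)"
   using h by (simp add: square_integrable_def)
  show "AE x in lborel. (\<lambda>n. (cmod (f n x - g x))\<^sup>2) \<longlonglongrightarrow> 0"
   using lim by eventually_elim (auto intro!: tendsto_eq_intros)
  show "AE x in lborel. norm ((cmod (f n x - g x))\<^sup>2) \<le> (2 * B)\<^sup>2 * (cmod (h x))\<^sup>2" for n
   using all gb
  proof eventually_elim
   case (elim x)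
   have "cmod (f n x - g x) \<le> cmod (f n x) + cmod (g x)" by (rule norm_triangle_ineq4)
   also have "\<dots> \<le> 2 * B * cmod (h x)" using elim(1)[rule_format, of n] elim(2) by simp
   finally have "(cmod (f n x - g x))\<^sup>2 \<le> (2 * B * cmod (h x))\<^sup>2" by (rule power_mono) simp
   then show ?case by (simp only: power_mult_distrib) simp
  qed
 qed measurable
 then have "(\<lambda>n. (norm (abs_l2 (f n) - abs_l2 g))\<^sup>2) \<longlonglongrightarrow> 0"
  by (simp add: minus_abs norm_abs sf sg square_integrable_diff)
 then have "(\<lambda>n. norm (abs_l2 (f n) - abs_l2 g)) \<longlonglongrightarrow> 0"
  using tendsto_real_sqrt by fastforce
 then show "(\<lambda>n. abs_l2 (f n)) \<longlonglongrightarrow> abs_l2 g"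
  by (simp add: LIM_zero_iff tendsto_norm_zero_iff)
qed

subsection \<open>Dense sets\<close>

lemma square_integrable_bounded_support:
 fixes f :: "'a::euclidean_space \<Rightarrow> complex"
 assumes "f \<in> borel_measurable borel" "\<And>x. cmod (f x) \<le> B" "\<And>x. x \<notin> cball 0 r \<Longrightarrow> f x = 0"
 shows "square_integrable f"
proof -
 note [measurable] = assms(1)
 have "integrable lborel (\<lambda>x::'a. B\<^sup>2 * indicator (cball 0 r) x :: real)"
  using emeasure_compact_finite[of "cball (0::'a) r"]
  by (intro integrable_mult_right integrable_real_indicator) auto
 then have "integrable lborel (\<lambda>x. (cmod (f x))\<^sup>2)"
  by (rule Bochner_Integration.integrable_bound)
    (auto simp: indicator_def assms intro!: AE_I2 power_mono)
 then show ?thesis using assms(1) by (simp add: square_integrable_def)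
qed

lemma square_integrable_indicator:
 fixes A :: "'a::euclidean_space set"
 assumes "A \<in> sets borel" "A \<subseteq> cball 0 r"
 shows "square_integrable (indicator A)"
 using assms by (intro square_integrable_bounded_support[of _ 1 r]) (auto simp: indicator_def)

text \<open>Linear combinations of indicators of bounded Borel sets are dense.\<close>

lemma l2_indicator_induct:
 fixes X :: "'a::euclidean_space l2 set"
 assumes cl: "closed X" and add: "\<And>a b. a \<in> X \<Longrightarrow> b \<in> X \<Longrightarrow> a + b \<in> X"
  and scale: "\<And>c a. a \<in> X \<Longrightarrow> c *\<^sub>C a \<in> X"
  and ind: "\<And>A r. A \<in> sets borel \<Longrightarrow> A \<subseteq> cball 0 r \<Longrightarrow> abs_l2 (indicator A) \<in> X"
 shows "\<psi> \<in> X"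
proof -
 have zero: "0 \<in> X"
  using scale[OF ind[of "{}" 0], of 0] by simp
 have simple: "abs_l2 s \<in> X"
  if s: "simple_function borel s" "\<And>x. x \<notin> cball 0 r \<Longrightarrow> s x = 0" for s :: "'a \<Rightarrow> complex" and r
 proof -
  have fin: "finite (range s)" using s(1) by (simp add: simple_function_def)
  define A where "A y = (if y = 0 then {} else s -` {y})" for y
  have A1: "A y \<in> sets borel" for y
   using simple_functionD(2)[OF s(1), of "{y}"] by (simp add: A_def)
  have A2: "A y \<subseteq> cball 0 r" for y
  proof
   fix x assume "x \<in> A y"
   then have "s x \<noteq> 0" by (auto simp: A_def split: if_splits)
   then show "x \<in> cball 0 r" using s(2) by blast
  qed
  note A = A1 A2
  have si: "square_integrable (indicator (A y) :: 'a \<Rightarrow> complex)" for y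
   by (rule square_integrable_indicator[OF A])
  have step: "finite F \<Longrightarrow> square_integrable (\<lambda>x. \<Sum>y\<in>F. y * indicator (A y) x) \<and>
    abs_l2 (\<lambda>x. \<Sum>y\<in>F. y * indicator (A y) x) \<in> X" for F
  proof (induction F rule: finite_induct)
   case empty
   then show ?case using zero by (simp add: zero_abs square_integrable_zero)
  next
   case (insert z F)
   have "abs_l2 (\<lambda>x. \<Sum>y\<in>insert z F. y * indicator (A y) x) =
     z *\<^sub>C abs_l2 (indicator (A z)) + abs_l2 (\<lambda>x. \<Sum>y\<in>F. y * indicator (A y) x)"
    using insert plus_abs[OF square_integrable_mult[OF si, of z], of "\<lambda>x. \<Sum>y\<in>F. y * indicator (A y) x"]
    by (simp only: scaleC_abs[OF si] sum.insert not_False_eq_True)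
   moreover have "\<dots> \<in> X"
    using insert by (intro add scale ind[OF A]) auto
   moreover have "square_integrable (\<lambda>x. \<Sum>y\<in>insert z F. y * indicator (A y) x)"
    using insert square_integrable_add[OF square_integrable_mult[OF si, of z]]
    by (simp only: sum.insert not_False_eq_True)
   ultimately show ?case by simp
  qed
  have "s = (\<lambda>x. \<Sum>y\<in>range s. y * indicator (A y) x)"
  proof
   fix x
   have "(\<Sum>y\<in>range s. y * indicator (A y) x) = (\<Sum>y\<in>{s x}. y * indicator (A y) x)"
    by (rule sum.mono_neutral_right[OF fin]) (auto simp: A_def indicator_def)
   also have "\<dots> = s x" by (simp add: A_def indicator_def del: sum_mult_of_bool_eq)
   finally show "s x = (\<Sum>y\<in>range s. y * indicator (A y) x)" by (rule sym)
  qed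
  then show ?thesis using step[OF fin] by simp
 qed
 obtain f where f: "square_integrable f" "\<psi> = abs_l2 f" by (rule l2_obtain)
 note [measurable] = square_integrable_measurable[OF f(1)]
 have trunc: "abs_l2 (\<lambda>x. indicator (cball 0 r) x * f x) \<in> X" (is "abs_l2 ?f \<in> X") for r
 proof -
  have m: "?f \<in> borel_measurable borel"
   using f(1) by (auto intro!: borel_measurable_times borel_measurable_indicator simp: square_integrable_def)
  obtain F where F: "\<And>i. simple_function borel (F i)" "\<And>x. (\<lambda>i. F i x) \<longlonglongrightarrow> ?f x"
   "\<And>i x. cmod (F i x) \<le> 2 * cmod (?f x)"
   using borel_measurable_implies_sequence_metric[OF m, of 0] by auto
  have "(\<lambda>i. abs_l2 (F i)) \<longlonglongrightarrow> abs_l2 ?f"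
  proof (rule l2_dominated_convergence(2)[OF _ m f(1)])
   show "F i \<in> borel_measurable borel" for i
    using borel_measurable_simple_function[OF F(1)] .
   have "2 * cmod (?f x) \<le> 2 * cmod (f x)" for x by (auto simp: indicator_def)
   then show "AE x in lborel. cmod (F i x) \<le> 2 * cmod (f x)" for i
    using F(3) order_trans by (intro AE_I2) blast
  qed (use F in auto)
  moreover have "abs_l2 (F i) \<in> X" for i
  proof (rule simple[OF F(1), of r])
   show "F i x = 0" if "x \<notin> cball 0 r" for x
    using F(3)[of i x] that by simp
  qed
  ultimately show ?thesis
   using closed_sequentially[OF cl, of "\<lambda>i. abs_l2 (F i)"] by metis
 qed
 have "(\<lambda>n. abs_l2 (\<lambda>x. indicator (cball 0 (real n)) x * f x)) \<longlonglongrightarrow> abs_l2 f"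
 proof (rule l2_dominated_convergence(2)[OF _ _ f(1), where B = 1])
  have "(\<lambda>n. indicator (cball 0 (real n)) x * f x) \<longlonglongrightarrow> f x" for x
  proof (rule tendsto_eventually)
   have "eventually (\<lambda>n. norm x \<le> real n) sequentially"
    using eventually_ge_at_top[of "nat \<lceil>norm x\<rceil>"] by eventually_elim linarith
   then show "\<forall>\<^sub>F n in sequentially. indicator (cball 0 (real n)) x * f x = f x"
    by eventually_elim (simp add: indicator_def)
  qed
  then show "AE x in lborel. (\<lambda>n. indicator (cball 0 (real n)) x * f x) \<longlonglongrightarrow> f x" by simp
 qed (auto simp: indicator_def)
 then show ?thesis
  unfolding f(2) by (rule closed_sequentially[OF cl trunc])
qed

lemma tensor_abs:
 "square_integrable f \<Longrightarrow> square_integrable g \<Longrightarrow>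
  abs_l2 f \<otimes> abs_l2 g = abs_l2 (\<lambda>(x, y). f x * g y)"
 by (simp add: tensor.abs_eq l2_rel_refl)

text \<open>Simple tensors are total: a Dynkin class argument, starting from rectangles.\<close>

lemma l2_tensor_induct:
 fixes X :: "(real \<times> real) l2 set"
 assumes cl: "closed X" and add: "\<And>a b. a \<in> X \<Longrightarrow> b \<in> X \<Longrightarrow> a + b \<in> X"
  and scale: "\<And>c a. a \<in> X \<Longrightarrow> c *\<^sub>C a \<in> X"
  and tens: "\<And>\<phi> \<psi>. \<phi> \<otimes> \<psi> \<in> X"
 shows "\<Psi> \<in> X"
proof (rule l2_indicator_induct[OF cl add scale])
 fix A :: "(real \<times> real) set" and r :: real
 assume A: "A \<in> sets borel" "A \<subseteq> cball 0 r"
 define I where "I = {-\<bar>r\<bar>..\<bar>r\<bar>}"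
 define ib where "ib B = abs_l2 (indicator (B \<inter> I \<times> I) :: real \<times> real \<Rightarrow> complex)" for B
 have I[measurable]: "I \<in> sets borel" by (simp add: I_def)
 have II[measurable]: "I \<times> I \<in> sets (borel :: (real \<times> real) measure)"
  unfolding borel_prod[symmetric] by simp
 have Isub: "I \<times> I \<subseteq> cball 0 (2 * \<bar>r\<bar>)"
  by (auto simp: I_def norm_Pair) (smt (verit) real_norm_def sqrt_sum_squares_le_sum_abs abs_le_iff)
 have si: "square_integrable (indicator (B \<inter> I \<times> I) :: real \<times> real \<Rightarrow> complex)"
  if "B \<in> sets borel" for B
  using that Isub by (intro square_integrable_indicator[of _ "2 * \<bar>r\<bar>"]) auto
 have siI: "square_integrable (indicator (B \<inter> I) :: real \<Rightarrow> complex)" if "B \<in> sets borel" for B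
  using that by (intro square_integrable_indicator[of _ "\<bar>r\<bar>"]) (auto simp: I_def)
 have rect: "ib (B \<times> C) \<in> X" if BC: "B \<in> sets borel" "C \<in> sets borel" for B C
 proof -
  have "ib (B \<times> C) = abs_l2 (indicator (B \<inter> I)) \<otimes> abs_l2 (indicator (C \<inter> I))"
   unfolding ib_def
   by (subst tensor_abs) (auto simp: siI BC indicator_def fun_eq_iff intro!: arg_cong[where f = abs_l2])
  then show ?thesis using tens by simp
 qed
 let ?G = "{B \<times> C | B C. B \<in> sets (borel :: real measure) \<and> C \<in> sets (borel :: real measure)}"
 have sets_eq: "sets (borel :: (real \<times> real) measure) = sigma_sets UNIV ?G"
  unfolding borel_prod[symmetric] sets_pair_measure by simp
 have "ib {} = 0"
  by (simp add: ib_def zero_abs indicator_def[abs_def])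
 then have zero: "ib {} \<in> X"
  using scale[OF rect[of UNIV UNIV], of 0] by simp
 have stable: "Int_stable ?G"
  by (auto simp: Int_stable_def) (metis Times_Int_Times sets.Int)
 have sub: "?G \<subseteq> Pow UNIV" by simp
 have "A \<in> sigma_sets UNIV ?G" using A(1) sets_eq by simp
 with stable sub have "ib A \<in> X"
 proof (induction rule: sigma_sets_induct_disjoint)
  case (basic A)
  then show ?case using rect by auto
 next
  case empty
  show ?case by (rule zero)
 next
  case A: (compl A)
  then have A'1: "A \<in> sets borel" by (simp only: sets_eq)
  note A' = A'1 borel_comp[OF A'1, unfolded Compl_eq_Diff_UNIV]
  have UU: "UNIV \<times> UNIV \<in> sets (borel :: (real \<times> real) measure)" by simp
  have "ib (UNIV - A) = ib (UNIV \<times> UNIV) + (-1) *\<^sub>C ib A"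
   unfolding ib_def
   unfolding scaleC_abs[OF si[OF A'(1)]] plus_abs[OF si[OF UU]
     square_integrable_mult[OF si[OF A'(1)]]]
   by (rule arg_cong[where f = abs_l2]) (auto simp: indicator_def fun_eq_iff)
  moreover have "ib (UNIV \<times> UNIV) + (-1) *\<^sub>C ib A \<in> X"
   by (intro add scale rect A) auto
  ultimately show ?case by metis
 next
  case A: (union A)
  have A': "A i \<in> sets borel" for i using A(2) unfolding sets_eq by blast
  have part: "ib (\<Union>i<n. A i) \<in> X" for n
  proof (induction n)
   case 0
   show ?case using zero by simp
  next
   case (Suc n)
   have "A n \<inter> A i = {}" if "i < n" for i
    using disjoint_family_onD[OF A(1), of n i] that by simp
   then have disj: "A n \<inter> (\<Union>i<n. A i) = {}" by blast
   have ind: "indicator ((\<Union>i<Suc n. A i) \<inter> I \<times> I) x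
     = (indicator ((\<Union>i<n. A i) \<inter> I \<times> I) x + indicator (A n \<inter> I \<times> I) x :: complex)" for x
   proof (cases "x \<in> A n")
    case True
    then have "x \<notin> (\<Union>i<n. A i)" using disj by blast
    then show ?thesis using True by (auto simp: indicator_def)
   next
    case False
    then have "x \<in> (\<Union>i<Suc n. A i) \<longleftrightarrow> x \<in> (\<Union>i<n. A i)"
     by (auto simp: less_Suc_eq)
    then show ?thesis using False by (simp add: indicator_def)
   qed
   have m: "(\<Union>i<n. A i) \<in> sets borel"
    by (intro sets.finite_UN A' finite_lessThan)
   have "ib (\<Union>i<n. A i) + ib (A n) = ib (\<Union>i<Suc n. A i)"
    unfolding ib_def plus_abs[OF si[OF m] si[OF A']]
    by (intro arg_cong[where f = abs_l2] ext ind[symmetric])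
   then show ?case using add[OF Suc A(3)] by metis
  qed
  have m1: "(\<Union>i<n. A i) \<in> sets borel" for n
   by (intro sets.finite_UN A' finite_lessThan)
  have m2: "(\<Union>i. A i) \<in> sets borel"
   by (rule sets.countable_UN) (simp add: image_subset_iff A')
  have "(\<lambda>n. ib (\<Union>i<n. A i)) \<longlonglongrightarrow> ib (\<Union>i. A i)"
   unfolding ib_def
  proof (rule l2_dominated_convergence(2)[OF _ _ si[of UNIV], where B = 1])
   show "AE x in lborel. (\<lambda>n. indicator ((\<Union>i<n. A i) \<inter> I \<times> I) x :: complex)
     \<longlonglongrightarrow> indicator ((\<Union>i. A i) \<inter> I \<times> I) x"
    unfolding indicator_inter_arith
    by (intro AE_I2 tendsto_mult_right LIMSEQ_indicator_UN)
   show "indicator ((\<Union>i<n. A i) \<inter> I \<times> I) \<in> borel_measurable borel" for n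
    by (rule borel_measurable_indicator[OF sets.Int[OF m1 II]])
   show "indicator ((\<Union>i. A i) \<inter> I \<times> I) \<in> borel_measurable borel"
    by (rule borel_measurable_indicator[OF sets.Int[OF m2 II]])
   show "AE x in lborel. cmod (indicator ((\<Union>i<n. A i) \<inter> I \<times> I) x)
     \<le> 1 * cmod (indicator (UNIV \<inter> I \<times> I) x)" for n
    by (rule AE_I2) (simp add: indicator_def)
   show "UNIV \<in> sets borel" by simp
  qed
  then show ?case
   by (rule closed_sequentially[OF cl part])
 qed
 moreover have "A \<inter> I \<times> I = A"
 proof -
  have "z \<in> I \<times> I" if "z \<in> A" for z
  proof -
   have "norm z \<le> r"
    using subsetD[OF A(2) that] by (simp only: mem_cball_0)
   then have "\<bar>fst z\<bar> \<le> r" "\<bar>snd z\<bar> \<le> r"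
    using norm_fst_le[of "fst z" "snd z"] norm_snd_le[of "snd z" "fst z"] by simp_all
   then show ?thesis by (simp add: I_def mem_Times_iff abs_le_iff)
  qed
  then have "A \<subseteq> I \<times> I" by (rule subsetI)
  then show ?thesis by (rule Int_absorb2)
 qed
 ultimately show "abs_l2 (indicator A) \<in> X" by (simp only: ib_def)
qed

lemma closed_eq_bounded_clinear:
 assumes "bounded_clinear W" "bounded_clinear W'"
 shows "closed {\<Psi>. W \<Psi> = W' \<Psi>}"
 using assms by (intro closed_Collect_eq) (auto simp: bounded_clinear_def intro: linear_continuous_on)

lemma bounded_clinear_eq_tensor:
 assumes "bounded_clinear W" "bounded_clinear W'" "\<And>\<phi> \<psi>. W (\<phi> \<otimes> \<psi>) = W' (\<phi> \<otimes> \<psi>)"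
 shows "W = W'"
proof
 fix \<Psi>
 have "\<Psi> \<in> {\<Psi>. W \<Psi> = W' \<Psi>}"
  by (rule l2_tensor_induct[OF closed_eq_bounded_clinear])
    (use assms in \<open>auto simp: bounded_clinearD\<close>)
 then show "W \<Psi> = W' \<Psi>" by simp
qed

text \<open>Simple tensors are total, so the definition of \<open>tensor_op\<close> has at most one solution.\<close>

lemma tensor_op_eq:
 assumes "bounded_clinear W" "\<And>\<phi> \<psi>. W (\<phi> \<otimes> \<psi>) = A \<phi> \<otimes> B \<psi>"
 shows "tensor_op A B = W"
 unfolding tensor_op_def
proof (rule the_equality)
 show "V = W" if "bounded_clinear V \<and> (\<forall>\<phi> \<psi>. V (\<phi> \<otimes> \<psi>) = A \<phi> \<otimes> B \<psi>)" for V
  using bounded_clinear_eq_tensor[of V W] that assms by simp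
qed (use assms in auto)

section \<open>Multiplication and translation operators\<close>

definition bounded_borel :: "('a::euclidean_space \<Rightarrow> complex) \<Rightarrow> bool" where
 "bounded_borel h \<longleftrightarrow> h \<in> borel_measurable borel \<and> (\<exists>B. \<forall>x. cmod (h x) \<le> B)"

lemma bounded_borelI:
 "h \<in> borel_measurable borel \<Longrightarrow> (\<And>x. cmod (h x) \<le> B) \<Longrightarrow> bounded_borel h"
 by (auto simp: bounded_borel_def)

lemma bounded_borel_measurable [measurable_dest]:
 "bounded_borel h \<Longrightarrow> h \<in> borel_measurable borel"
 by (simp add: bounded_borel_def)

lemma bounded_borel_obtain:
 assumes "bounded_borel h"
 obtains B where "B \<ge> 0" "\<And>x. cmod (h x) \<le> B"
 using assms unfolding bounded_borel_def by (meson norm_ge_zero order_trans)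

lemma bounded_borel_const: "bounded_borel (\<lambda>x. c)"
 by (rule bounded_borelI[where B = "cmod c"]) auto

lemma bounded_borel_add:
 assumes "bounded_borel h" "bounded_borel k"
 shows "bounded_borel (\<lambda>x. h x + k x)"
proof -
 obtain A B where "\<And>x. cmod (h x) \<le> A" "\<And>x. cmod (k x) \<le> B"
  using assms by (meson bounded_borel_obtain)
 then show ?thesis
  using assms by (intro bounded_borelI[where B = "A + B"]) (auto simp: bounded_borel_def intro: norm_triangle_mono)
qed

lemma bounded_borel_mult:
 assumes "bounded_borel h" "bounded_borel k"
 shows "bounded_borel (\<lambda>x. h x * k x)"
proof -
 obtain A B where "A \<ge> 0" "\<And>x. cmod (h x) \<le> A" "\<And>x. cmod (k x) \<le> B"
  using assms by (meson bounded_borel_obtain)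
 then show ?thesis
  using assms by (intro bounded_borelI[where B = "A * B"])
   (auto simp: bounded_borel_def norm_mult intro!: mult_mono)
qed

lemma square_integrable_mul:
 assumes "bounded_borel h" "square_integrable f"
 shows "square_integrable (\<lambda>x. h x * f x)"
proof -
 obtain B where B: "\<And>x. cmod (h x) \<le> B" using bounded_borel_obtain[OF assms(1)] by auto
 note [measurable] = bounded_borel_measurable[OF assms(1)] square_integrable_measurable[OF assms(2)]
 show ?thesis
  by (rule square_integrable_bound[OF assms(2), where B = B])
    (auto simp: norm_mult intro!: AE_I2 mult_right_mono B)
qed

definition mul_l2 :: "('a::euclidean_space \<Rightarrow> complex) \<Rightarrow> 'a l2 \<Rightarrow> 'a l2" where
 "mul_l2 h \<psi> = abs_l2 (\<lambda>x. h x * rep_l2 \<psi> x)"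

lemma mul_abs:
 assumes "bounded_borel h" "square_integrable f"
 shows "mul_l2 h (abs_l2 f) = abs_l2 (\<lambda>x. h x * f x)"
 unfolding mul_l2_def
 by (subst abs_l2_eq_iff)
   (use assms rep_abs_l2[OF assms(2)] in \<open>auto intro!: square_integrable_mul square_integrable_rep elim: eventually_mono\<close>)

lemma norm_abs_le:
 assumes "square_integrable f" "square_integrable g" "B \<ge> 0"
  and "AE x in lborel. cmod (g x) \<le> B * cmod (f x)"
 shows "norm (abs_l2 g) \<le> B * norm (abs_l2 f)"
proof (rule power2_le_imp_le)
 have "(norm (abs_l2 g))\<^sup>2 \<le> (LINT x|lborel. B\<^sup>2 * (cmod (f x))\<^sup>2)"
  unfolding norm_abs[OF assms(2)]
 proof (rule integral_mono_AE)
  show "AE x in lborel. (cmod (g x))\<^sup>2 \<le> B\<^sup>2 * (cmod (f x))\<^sup>2"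
   using assms(4)
  proof eventually_elim
   case (elim x)
   then show ?case using power_mono[OF elim, of 2] by (simp add: power_mult_distrib)
  qed
 qed (use assms in \<open>auto simp: square_integrable_def\<close>)
 then show "(norm (abs_l2 g))\<^sup>2 \<le> (B * norm (abs_l2 f))\<^sup>2"
  by (simp add: power_mult_distrib norm_abs assms(1))
qed (use assms(3) in simp)

lemma mul_bounded_clinear:
 assumes "bounded_borel h"
 shows "bounded_clinear (mul_l2 h)"
proof -
 obtain B where B: "B \<ge> 0" "\<And>x. cmod (h x) \<le> B" using bounded_borel_obtain[OF assms] by auto
 show ?thesis
 proof (rule bounded_clinearI[where B = B])
  fix a b :: "'a l2" and c
  obtain f g where f: "square_integrable f" "a = abs_l2 f" and g: "square_integrable g" "b = abs_l2 g"
   by (meson l2_obtain)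
  show "mul_l2 h (a + b) = mul_l2 h a + mul_l2 h b"
   using assms f g
   by (simp add: plus_abs mul_abs square_integrable_add square_integrable_mul distrib_left)
  show "mul_l2 h (c *\<^sub>C a) = c *\<^sub>C mul_l2 h a"
   using assms f
   by (simp add: scaleC_abs mul_abs square_integrable_mult square_integrable_mul mult.left_commute)
  show "norm (mul_l2 h a) \<le> B * norm a"
   unfolding f(2) mul_abs[OF assms f(1)]
   by (rule norm_abs_le[OF f(1) square_integrable_mul[OF assms f(1)] B(1)])
     (auto simp: norm_mult intro!: AE_I2 mult_right_mono B)
 qed
qed

lemma mul_mul:
 assumes "bounded_borel h" "bounded_borel k"
 shows "mul_l2 h (mul_l2 k \<psi>) = mul_l2 (\<lambda>x. h x * k x) \<psi>"
proof -
 obtain f where f: "square_integrable f" "\<psi> = abs_l2 f" by (rule l2_obtain)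
 then show ?thesis
  using assms by (simp add: mul_abs square_integrable_mul bounded_borel_mult mult.assoc)
qed

lemma mul_add:
 assumes "bounded_borel h" "bounded_borel k"
 shows "mul_l2 (\<lambda>x. h x + k x) \<psi> = mul_l2 h \<psi> + mul_l2 k \<psi>"
proof -
 obtain f where f: "square_integrable f" "\<psi> = abs_l2 f" by (rule l2_obtain)
 then show ?thesis
  using assms by (simp add: mul_abs plus_abs square_integrable_mul bounded_borel_add distrib_right)
qed

lemma mul_const: "mul_l2 (\<lambda>x. c) \<psi> = c *\<^sub>C \<psi>"
proof -
 obtain f where f: "square_integrable f" "\<psi> = abs_l2 f" by (rule l2_obtain)
 then show ?thesis by (simp add: mul_abs bounded_borel_const scaleC_abs)
qed

lemma mul_tendsto:
 assumes h: "\<And>n. h n \<in> borel_measurable borel" "\<And>n x. cmod (h n x) \<le> B"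
  and k: "k \<in> borel_measurable borel" "\<And>x. (\<lambda>n. h n x) \<longlonglongrightarrow> k x"
 shows "bounded_borel k" "(\<lambda>n. mul_l2 (h n) \<psi>) \<longlonglongrightarrow> mul_l2 k \<psi>"
proof -
 have kB: "cmod (k x) \<le> B" for x
  by (rule LIMSEQ_le_const2[OF tendsto_norm[OF k(2)]]) (use h(2) in auto)
 show kb: "bounded_borel k" by (rule bounded_borelI[OF k(1) kB])
 have hb: "bounded_borel (h n)" for n by (rule bounded_borelI[OF h])
 obtain f where f: "square_integrable f" "\<psi> = abs_l2 f" by (rule l2_obtain)
 note [measurable] = square_integrable_measurable[OF f(1)] k(1) h(1)
 show "(\<lambda>n. mul_l2 (h n) \<psi>) \<longlonglongrightarrow> mul_l2 k \<psi>"
  unfolding f(2) mul_abs[OF kb f(1)] mul_abs[OF hb f(1)]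
  by (rule l2_dominated_convergence(2)[OF _ _ f(1), where B = B])
    (auto simp: norm_mult intro!: AE_I2 mult_right_mono h tendsto_mult_right k)
qed

definition trans_l2 :: "'a::euclidean_space \<Rightarrow> 'a l2 \<Rightarrow> 'a l2" where
 "trans_l2 v \<psi> = abs_l2 (\<lambda>x. rep_l2 \<psi> (x - v))"

lemma lborel_distr_minus: "distr lborel borel (\<lambda>x. x - v) = (lborel :: 'a::euclidean_space measure)"
proof -
 have "(\<lambda>x. x - v) = (+) (- v)" by auto
 then show ?thesis using lborel_distr_plus[of "- v"] by simp
qed

lemma AE_translate:
 fixes v :: "'a::euclidean_space"
 assumes "AE x in lborel. P x"
 shows "AE x in lborel. P (x - v)"
proof -
 have f: "(\<lambda>x::'a. x - v) \<in> measurable lborel borel" by simp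
 show ?thesis
  using AE_distrD[OF f, of P] assms by (simp only: lborel_distr_minus)
qed

lemma integral_translate:
 fixes f :: "'a::euclidean_space \<Rightarrow> 'b::{banach, second_countable_topology}"
 assumes "f \<in> borel_measurable borel"
 shows "(LINT x|lborel. f (x - v)) = (LINT x|lborel. f x)"
proof -
 have "(LINT x|lborel. f x) = (LINT x|distr lborel borel (\<lambda>x. x - v). f x)"
  by (simp only: lborel_distr_minus)
 also have "\<dots> = (LINT x|lborel. f (x - v))"
  by (rule integral_distr) (use assms in simp_all)
 finally show ?thesis by simp
qed

lemma integrable_translate:
 fixes f :: "'a::euclidean_space \<Rightarrow> 'b::{banach, second_countable_topology}"
 assumes "integrable lborel f"
 shows "integrable lborel (\<lambda>x. f (x - v))"
 by (rule integrable_distr[of _ lborel borel]) (use assms in \<open>simp_all add: lborel_distr_minus\<close>)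

lemma square_integrable_translate:
 assumes "square_integrable f"
 shows "square_integrable (\<lambda>x. f (x - v))"
 using assms integrable_translate[of "\<lambda>x. (cmod (f x))\<^sup>2" v]
 by (auto simp: square_integrable_def)

lemma trans_abs:
 assumes "square_integrable f"
 shows "trans_l2 v (abs_l2 f) = abs_l2 (\<lambda>x. f (x - v))"
 unfolding trans_l2_def
 by (subst abs_l2_eq_iff)
   (intro square_integrable_translate square_integrable_rep assms AE_translate rep_abs_l2)+

lemma cinner_trans: "cinner (trans_l2 v \<phi>) (trans_l2 v \<psi>) = cinner \<phi> \<psi>"
proof -
 obtain f g where f: "square_integrable f" "\<phi> = abs_l2 f" and g: "square_integrable g" "\<psi> = abs_l2 g"
  by (meson l2_obtain)
 have "(\<lambda>x. cnj (f x) * g x) \<in> borel_measurable borel"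
  using square_integrable_integrable_product[OF f(1) g(1)] by (simp add: borel_measurable_integrable)
 then show ?thesis
  by (simp add: f g trans_abs cinner_abs square_integrable_translate integral_translate[of "\<lambda>x. cnj (f x) * g x"])
qed

lemma norm_trans: "norm (trans_l2 v \<psi>) = norm \<psi>"
 using cinner_trans[of v \<psi> \<psi>] by (simp add: cinner_self flip: of_real_power)

lemma trans_bounded_clinear: "bounded_clinear (trans_l2 v)"
proof (rule bounded_clinearI[where B = 1])
 fix a b :: "'a l2" and c
 obtain f g where f: "square_integrable f" "a = abs_l2 f" and g: "square_integrable g" "b = abs_l2 g"
  by (meson l2_obtain)
 show "trans_l2 v (a + b) = trans_l2 v a + trans_l2 v b"
  using f g by (simp add: plus_abs trans_abs square_integrable_add square_integrable_translate)
 show "trans_l2 v (c *\<^sub>C a) = c *\<^sub>C trans_l2 v a"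
  using f by (simp add: scaleC_abs trans_abs square_integrable_mult square_integrable_translate)
qed (simp add: norm_trans)

lemma trans_trans: "trans_l2 v (trans_l2 w \<psi>) = trans_l2 (v + w) \<psi>"
proof -
 obtain f where f: "square_integrable f" "\<psi> = abs_l2 f" by (rule l2_obtain)
 then show ?thesis by (simp add: trans_abs square_integrable_translate algebra_simps)
qed

lemma trans_zero [simp]: "trans_l2 0 \<psi> = \<psi>"
 by (simp add: trans_l2_def)

lemma flip_abs: "square_integrable f \<Longrightarrow> flip (abs_l2 f) = abs_l2 (\<lambda>(x, y). f (y, x))"
 by (simp add: flip.abs_eq l2_rel_refl)

lemma measurable_swap: "(\<lambda>z. (snd z, fst z)) \<in> borel_measurable (borel :: (real \<times> real) measure)"
 by (intro borel_measurable_continuous_onI continuous_intros)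

lemma lborel_distr_swap': "distr lborel borel (\<lambda>z. (snd z, fst z)) = (lborel :: (real \<times> real) measure)"
 using lborel_distr_swap by (simp add: case_prod_beta')

lemma integral_swap:
 fixes f :: "real \<times> real \<Rightarrow> 'b::{banach, second_countable_topology}"
 assumes "f \<in> borel_measurable borel"
 shows "(LINT z|lborel. f (snd z, fst z)) = (LINT z|lborel. f z)"
proof -
 have "(LINT z|lborel. f z) = (LINT z|distr lborel borel (\<lambda>z. (snd z, fst z)). f z)"
  by (simp only: lborel_distr_swap')
 also have "\<dots> = (LINT z|lborel. f (snd z, fst z))"
  by (rule integral_distr) (use assms measurable_swap in simp_all)
 finally show ?thesis by simp
qed

lemma square_integrable_swap:
 fixes f :: "real \<times> real \<Rightarrow> complex"
 assumes "square_integrable f"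
 shows "square_integrable (\<lambda>(x, y). f (y, x))"
proof -
 have "integrable lborel (\<lambda>z. (cmod (f (snd z, fst z)))\<^sup>2)"
  by (rule integrable_distr[of "\<lambda>z. (snd z, fst z)" lborel borel "\<lambda>z. (cmod (f z))\<^sup>2"])
    (use assms measurable_swap in \<open>simp_all add: lborel_distr_swap' square_integrable_def\<close>)
 moreover have "(\<lambda>z. f (snd z, fst z)) \<in> borel_measurable borel"
  using measurable_compose[OF measurable_swap square_integrable_measurable[OF assms]] .
 ultimately show ?thesis by (simp add: square_integrable_def case_prod_beta')
qed

lemma square_integrable_swap':
 fixes f :: "real \<times> real \<Rightarrow> complex"
 assumes "square_integrable f"
 shows "square_integrable (\<lambda>z. f (snd z, fst z))"
 using square_integrable_swap[OF assms] by (simp add: case_prod_beta')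

lemma flip_abs': "square_integrable f \<Longrightarrow> flip (abs_l2 f) = abs_l2 (\<lambda>z. f (snd z, fst z))"
 by (simp add: flip_abs case_prod_beta')

lemma norm_flip: "norm (flip \<Psi>) = norm \<Psi>"
proof -
 obtain f where f: "square_integrable f" "\<Psi> = abs_l2 f" by (rule l2_obtain)
 have "(norm (flip \<Psi>))\<^sup>2 = (norm \<Psi>)\<^sup>2"
  using integral_swap[of "\<lambda>z. (cmod (f z))\<^sup>2"] square_integrable_measurable[OF f(1)]
  by (simp add: f flip_abs' norm_abs square_integrable_swap')
 then show ?thesis by simp
qed

lemma flip_bounded_clinear: "bounded_clinear flip"
proof (rule bounded_clinearI[where B = 1])
 fix a b :: "(real \<times> real) l2" and c
 obtain f g where f: "square_integrable f" "a = abs_l2 f" and g: "square_integrable g" "b = abs_l2 g"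
  by (meson l2_obtain)
 show "flip (a + b) = flip a + flip b"
  using f g by (simp add: plus_abs flip_abs' square_integrable_add square_integrable_swap')
 show "flip (c *\<^sub>C a) = c *\<^sub>C flip a"
  using f by (simp add: scaleC_abs flip_abs' square_integrable_mult square_integrable_swap')
qed (simp add: norm_flip)

lemma flip_flip [simp]: "flip (flip \<Psi>) = \<Psi>"
proof -
 obtain f where f: "square_integrable f" "\<Psi> = abs_l2 f" by (rule l2_obtain)
 then show ?thesis by (simp add: flip_abs' square_integrable_swap')
qed

subsection \<open>The two-particle representation\<close>

definition mass_phase :: "real \<Rightarrow> real \<times> real \<Rightarrow> real \<Rightarrow> complex" where
 "mass_phase m x \<theta> = exp (\<i> * of_real (minkowski (mass_shell m \<theta>) x))"

lemma bounded_borel_mass_phase: "bounded_borel (mass_phase m x)"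
 by (rule bounded_borelI[where B = 1])
   (auto simp: mass_phase_def minkowski_def mass_shell_def
    intro!: borel_measurable_continuous_onI continuous_intros)

lemma U_abs: "square_integrable f \<Longrightarrow>
  U m (x, lam) (abs_l2 f) = abs_l2 (\<lambda>\<theta>. mass_phase m x \<theta> * f (\<theta> - lam))"
 by (simp add: U.abs_eq l2_rel_refl mass_phase_def)

lemma U_boost: "U m ((0, 0), a) = trans_l2 a"
proof
 fix \<psi> :: "real l2"
 obtain f where f: "square_integrable f" "\<psi> = abs_l2 f" by (rule l2_obtain)
 then show "U m ((0, 0), a) \<psi> = trans_l2 a \<psi>"
  by (simp add: U_abs trans_abs mass_phase_def minkowski_def)
qed

lemma U2_eq: "U2 m (x, lam) =
  mul_l2 (\<lambda>z. mass_phase m x (fst z) * mass_phase m x (snd z)) \<circ> trans_l2 (lam, lam)"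
 (is "_ = mul_l2 ?h \<circ> _")
 unfolding U2_def
proof (rule tensor_op_eq)
 have m: "mass_phase m x \<in> borel_measurable borel"
  using bounded_borel_mass_phase by (rule bounded_borel_measurable)
 have "?h \<in> borel_measurable (borel \<Otimes>\<^sub>M borel)"
  using m by measurable
 then have bh: "bounded_borel ?h"
  by (intro bounded_borelI[where B = 1]) (auto simp: mass_phase_def norm_mult borel_prod)
 show "bounded_clinear (mul_l2 ?h \<circ> trans_l2 (lam, lam))"
  by (intro bounded_clinear_compose mul_bounded_clinear trans_bounded_clinear bh)
 fix \<phi> \<psi> :: "real l2"
 obtain f g where f: "square_integrable f" "\<phi> = abs_l2 f" and g: "square_integrable g" "\<psi> = abs_l2 g"
  by (meson l2_obtain)
 have t: "square_integrable (\<lambda>\<theta>. mass_phase m x \<theta> * h (\<theta> - lam))" if "square_integrable h" for h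
  by (intro square_integrable_mul bounded_borel_mass_phase square_integrable_translate that)
 have st: "square_integrable (\<lambda>z. (\<lambda>(x, y). f x * g y) (z - (lam, lam)))"
  by (intro square_integrable_translate square_integrable_tensor f g)
 have "(mul_l2 ?h \<circ> trans_l2 (lam, lam)) (\<phi> \<otimes> \<psi>) = abs_l2 (\<lambda>z. ?h z * (\<lambda>(x, y). f x * g y) (z - (lam, lam)))"
  using f g by (simp add: tensor_abs trans_abs mul_abs[OF bh st] square_integrable_tensor)
 also have "\<dots> = U m (x, lam) \<phi> \<otimes> U m (x, lam) \<psi>"
  by (simp add: f g U_abs tensor_abs t case_prod_beta' mult_ac)
 finally show "(mul_l2 ?h \<circ> trans_l2 (lam, lam)) (\<phi> \<otimes> \<psi>) = U m (x, lam) \<phi> \<otimes> U m (x, lam) \<psi>" .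
qed

section \<open>The commutant\<close>

subsection \<open>Multipliers commuting with an operator\<close>

definition commutes_mul :: "('a::euclidean_space l2 \<Rightarrow> 'a l2) \<Rightarrow> ('a \<Rightarrow> complex) \<Rightarrow> bool" where
 "commutes_mul T h \<longleftrightarrow> bounded_borel h \<and> (\<forall>\<Psi>. T (mul_l2 h \<Psi>) = mul_l2 h (T \<Psi>))"

lemma commutes_mul_const:
 "bounded_clinear T \<Longrightarrow> commutes_mul T (\<lambda>x. c)"
 by (simp add: commutes_mul_def bounded_borel_const mul_const bounded_clinearD)

lemma commutes_mul_add:
 "bounded_clinear T \<Longrightarrow> commutes_mul T h \<Longrightarrow> commutes_mul T k \<Longrightarrow> commutes_mul T (\<lambda>x. h x + k x)"
 by (auto simp: commutes_mul_def bounded_borel_add mul_add bounded_clinearD)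

lemma commutes_mul_mult:
 "commutes_mul T h \<Longrightarrow> commutes_mul T k \<Longrightarrow> commutes_mul T (\<lambda>x. h x * k x)"
 by (auto simp: commutes_mul_def bounded_borel_mult simp flip: mul_mul)

text \<open>Bounded pointwise limits of multipliers are strong limits of the operators.\<close>

lemma commutes_mul_limit:
 assumes T: "bounded_clinear T" and h: "\<And>n. commutes_mul T (h n)" "\<And>n x. cmod (h n x) \<le> B"
  and k: "\<And>x. (\<lambda>n. h n x) \<longlonglongrightarrow> k x"
 shows "commutes_mul T k"
proof -
 have hm: "h n \<in> borel_measurable borel" for n
  using h(1) by (auto simp: commutes_mul_def bounded_borel_def)
 have km: "k \<in> borel_measurable borel"
  by (rule borel_measurable_LIMSEQ_metric[OF hm k])
 note lim = mul_tendsto[OF hm h(2) km k]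
 have "T (mul_l2 k \<Psi>) = mul_l2 k (T \<Psi>)" for \<Psi>
 proof (rule LIMSEQ_unique)
  show "(\<lambda>n. T (mul_l2 (h n) \<Psi>)) \<longlonglongrightarrow> T (mul_l2 k \<Psi>)"
   by (rule bounded_linear.tendsto[OF bounded_clinearD(5)[OF T] lim(2)])
  show "(\<lambda>n. T (mul_l2 (h n) \<Psi>)) \<longlonglongrightarrow> mul_l2 k (T \<Psi>)"
   using lim(2) h(1) by (simp add: commutes_mul_def)
 qed
 then show ?thesis using lim(1) by (simp add: commutes_mul_def)
qed

lemma commutes_mul_polynomial:
 assumes T: "bounded_clinear T" and v: "commutes_mul T (\<lambda>x. of_real (v x))"
  and p: "real_polynomial_function p"
 shows "commutes_mul T (\<lambda>x. of_real (p (v x)))"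
 using p
proof induction
 case (linear f)
 then obtain c where "f = (\<lambda>x. x * c)" by (auto simp: real_bounded_linear)
 then show ?case using commutes_mul_mult[OF v commutes_mul_const[OF T, of "of_real c"]] by simp
qed (auto intro: commutes_mul_const[OF T] commutes_mul_add[OF T] commutes_mul_mult)

text \<open>Periodic functions of \<open>X\<close> are reached through polynomials in \<open>sin (t X)\<close>. Since
 \<open>n sin (X / n)\<close> tends to \<open>X\<close>, Weierstrass approximation on \<open>[-n, n]\<close> yields every bounded
 continuous function of \<open>X\<close> as a bounded pointwise limit.\<close>

lemma commutes_mul_continuous:
 assumes T: "bounded_clinear T" and X: "\<And>t. commutes_mul T (\<lambda>x. cis (t * X x))"
  and g: "continuous_on UNIV g" "\<And>s. \<bar>g s\<bar> \<le> B"
 shows "commutes_mul T (\<lambda>x. of_real (g (X x)))"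
proof -
 have s: "commutes_mul T (\<lambda>x. of_real (c * sin (t * X x)))" for c t
 proof -
  have "(\<lambda>x. complex_of_real (c * sin (t * X x))) =
    (\<lambda>x. (of_real c / (2 * \<i>)) * cis (t * X x) + (- of_real c / (2 * \<i>)) * cis (- t * X x))"
   by (simp add: fun_eq_iff complex_eq_iff cis.ctr Re_divide Im_divide)
  then show ?thesis
   by (simp only:) (intro commutes_mul_add[OF T] commutes_mul_mult commutes_mul_const[OF T] X)
 qed
 have "\<exists>p. real_polynomial_function p \<and> (\<forall>s\<in>{- real (Suc n)..real (Suc n)}. \<bar>g s - p s\<bar> < 1 / real (Suc n))" for n
  using Stone_Weierstrass_real_polynomial_function[of "{- real (Suc n)..real (Suc n)}" g "1 / real (Suc n)"]
   g(1) continuous_on_subset by (metis compact_Icc subset_UNIV of_nat_0_less_iff zero_less_Suc zero_less_divide_1_iff)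
 then obtain p where p: "\<And>n. real_polynomial_function (p n)"
  "\<And>n s. s \<in> {- real (Suc n)..real (Suc n)} \<Longrightarrow> \<bar>g s - p n s\<bar> < 1 / real (Suc n)"
  by metis
 define u where "u n x = real (Suc n) * sin (1 / real (Suc n) * X x)" for n x
 have u: "u n x \<in> {- real (Suc n)..real (Suc n)}" for n x
 proof -
  have "\<bar>u n x\<bar> \<le> real (Suc n) * 1"
   unfolding u_def abs_mult by (intro mult_mono) (auto simp: abs_sin_le_one)
  then show ?thesis by auto
 qed
 show ?thesis
 proof (rule commutes_mul_limit[OF T, where h = "\<lambda>n x. of_real (p n (u n x))" and B = "B + 1"])
  show "commutes_mul T (\<lambda>x. complex_of_real (p n (u n x)))" for n
   unfolding u_def by (rule commutes_mul_polynomial[OF T s p(1)])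
  show "cmod (complex_of_real (p n (u n x))) \<le> B + 1" for n x
  proof -
   have "1 / real (Suc n) \<le> 1" by simp
   then show ?thesis using p(2)[OF u, of n x] g(2)[of "u n x"] by (simp only: norm_of_real)
  qed
  fix x
  have "(\<lambda>n. u n x) \<longlonglongrightarrow> X x"
   unfolding u_def by real_asymp
  then have "(\<lambda>n. g (u n x)) \<longlonglongrightarrow> g (X x)"
   using g(1) by (auto simp: continuous_on_eq_continuous_at intro: isCont_tendsto_compose)
  moreover have "(\<lambda>n. g (u n x) - p n (u n x)) \<longlonglongrightarrow> 0"
  proof (rule Lim_null_comparison)
   show "\<forall>\<^sub>F n in sequentially. norm (g (u n x) - p n (u n x)) \<le> 1 / real (Suc n)"
    unfolding real_norm_def by (intro always_eventually allI less_imp_le p(2)[OF u])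
   show "(\<lambda>n. 1 / real (Suc n)) \<longlonglongrightarrow> 0" by real_asymp
  qed
  ultimately have "(\<lambda>n. g (u n x) - (g (u n x) - p n (u n x))) \<longlonglongrightarrow> g (X x) - 0"
   by (rule tendsto_diff)
  then show "(\<lambda>n. complex_of_real (p n (u n x))) \<longlonglongrightarrow> complex_of_real (g (X x))"
   by (intro tendsto_of_real) simp
 qed
qed

text \<open>The sets whose indicators commute with \<open>T\<close> form a \<open>\<sigma>\<close>-algebra.\<close>

definition commuting_algebra :: "('a::euclidean_space l2 \<Rightarrow> 'a l2) \<Rightarrow> 'a measure" where
 "commuting_algebra T = sigma UNIV {A. commutes_mul T (indicator A)}"

lemma sets_commuting_algebra:
 assumes T: "bounded_clinear T"
 shows "sets (commuting_algebra T) = {A. commutes_mul T (indicator A)}"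
proof -
 have "sigma_algebra UNIV {A. commutes_mul T (indicator A)}"
  unfolding sigma_algebra_iff2
 proof (intro conjI ballI allI impI)
  show "{} \<in> {A. commutes_mul T (indicator A)}"
   using commutes_mul_const[OF T, of 0] by (simp add: indicator_def[abs_def])
  fix A assume "A \<in> {A. commutes_mul T (indicator A)}"
  then have "commutes_mul T (\<lambda>x. 1 + (-1) * indicator A x)"
   by (intro commutes_mul_add[OF T] commutes_mul_mult commutes_mul_const[OF T]) auto
  then show "UNIV - A \<in> {A. commutes_mul T (indicator A)}"
   by (auto elim!: back_subst[of "commutes_mul T"] simp: indicator_def fun_eq_iff)
 next
  fix A :: "nat \<Rightarrow> 'a set" assume A: "range A \<subseteq> {A. commutes_mul T (indicator A)}"
  have un: "commutes_mul T (indicator (\<Union>i<n. A i))" for n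
  proof (induction n)
   case 0
   show ?case using commutes_mul_const[OF T, of 0] by (simp add: indicator_def[abs_def])
  next
   case (Suc n)
   let ?a = "indicator (A n) :: 'a \<Rightarrow> complex" and ?b = "indicator (\<Union>i<n. A i) :: 'a \<Rightarrow> complex"
   have "commutes_mul T ?a" using A by auto
   then have "commutes_mul T (\<lambda>x. ?a x + ?b x + (-1) * (?a x * ?b x))"
    by (intro commutes_mul_add[OF T] commutes_mul_mult commutes_mul_const[OF T] Suc)
   moreover have "indicator (\<Union>i<Suc n. A i) = (\<lambda>x. ?a x + ?b x + (-1) * (?a x * ?b x))"
    by (rule ext) (simp add: lessThan_Suc indicator_def)
   ultimately show ?case by simp
  qed
  have "commutes_mul T (indicator (\<Union>i. A i))"
   by (rule commutes_mul_limit[OF T un, where B = 1]) (simp add: indicator_def, rule LIMSEQ_indicator_UN)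
  then show "(\<Union>i. A i) \<in> {A. commutes_mul T (indicator A)}" by simp
 qed simp
 then show ?thesis
  unfolding commuting_algebra_def by (simp add: sigma_algebra.sigma_sets_eq)
qed

lemma commuting_algebra_measurable:
 assumes T: "bounded_clinear T" and X: "\<And>t. commutes_mul T (\<lambda>x. cis (t * X x))"
 shows "X \<in> borel_measurable (commuting_algebra T)"
proof -
 have sp: "space (commuting_algebra T) = UNIV"
  by (simp add: commuting_algebra_def space_measure_of_conv)
 have "commutes_mul T (indicator {x. a < X x})" for a
 proof (rule commutes_mul_limit[OF T, where h = "\<lambda>n x. of_real (min 1 (max 0 (real n * (X x - a))))" and B = 1])
  show "commutes_mul T (\<lambda>x. complex_of_real (min 1 (max 0 (real n * (X x - a)))))" for n
   by (rule commutes_mul_continuous[OF T X, where B = 1]) (auto intro!: continuous_intros)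
  show "(\<lambda>n. complex_of_real (min 1 (max 0 (real n * (X x - a))))) \<longlonglongrightarrow> indicator {x. a < X x} x" for x
  proof (cases "a < X x")
   case True
   have "eventually (\<lambda>n. 1 / (X x - a) \<le> real n) sequentially"
    using eventually_ge_at_top[of "nat \<lceil>1 / (X x - a)\<rceil>"] by eventually_elim linarith
   then have "eventually (\<lambda>n. complex_of_real (min 1 (max 0 (real n * (X x - a)))) = 1) sequentially"
    by eventually_elim (use True in \<open>simp add: field_simps min_def max_def\<close>)
   then show ?thesis using True by (auto intro: tendsto_eventually)
  next
   case False
   then have "real n * (X x - a) \<le> 0" for n by (simp add: mult_le_0_iff)
   then have "max 0 (real n * (X x - a)) = 0" for n by (simp add: max_absorb1)
   then show ?thesis using False by simp
  qed
 qed auto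
 then show ?thesis
  by (simp add: borel_measurable_iff_greater sp sets_commuting_algebra[OF T])
qed

lemma commutes_mul_measurable:
 assumes T: "bounded_clinear T" and h: "h \<in> borel_measurable (commuting_algebra T)" "\<And>x. cmod (h x) \<le> B"
 shows "commutes_mul T h"
proof -
 obtain F where F: "\<And>i. simple_function (commuting_algebra T) (F i)" "\<And>x. (\<lambda>i. F i x) \<longlonglongrightarrow> h x"
  "\<And>i x. cmod (F i x) \<le> 2 * cmod (h x)"
  using borel_measurable_implies_sequence_metric[OF h(1), of 0]
  by (auto simp: commuting_algebra_def space_measure_of_conv)
 show ?thesis
 proof (rule commutes_mul_limit[OF T _ _ F(2), where B = "2 * B"])
  show "cmod (F i x) \<le> 2 * B" for i x using F(3)[of i x] h(2)[of x] by simp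
  fix i
  have fin: "finite (range (F i))"
   using F(1)[of i] by (simp add: simple_function_def commuting_algebra_def space_measure_of_conv)
  have ind: "commutes_mul T (indicator (F i -` {y}))" for y
   using simple_functionD(2)[OF F(1)[of i], of "{y}"] sets_commuting_algebra[OF T]
   by (simp add: commuting_algebra_def space_measure_of_conv)
  have "finite S \<Longrightarrow> commutes_mul T (\<lambda>x. \<Sum>y\<in>S. y * indicator (F i -` {y}) x)" for S
   by (induction S rule: finite_induct)
     (simp_all add: commutes_mul_const[OF T] commutes_mul_add[OF T] commutes_mul_mult ind del: sum_mult_indicator sum_mult_of_bool_eq)
  from this[OF fin] show "commutes_mul T (F i)"
  proof (rule back_subst[of "commutes_mul T"])
   show "(\<lambda>x. \<Sum>y\<in>range (F i). y * indicator (F i -` {y}) x) = F i"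
   proof
    fix x
    have "(\<Sum>y\<in>range (F i). y * indicator (F i -` {y}) x) = (\<Sum>y\<in>{F i x}. y * indicator (F i -` {y}) x)"
     by (rule sum.mono_neutral_right[OF fin]) (auto simp: indicator_def)
    then show "(\<Sum>y\<in>range (F i). y * indicator (F i -` {y}) x) = F i x" by simp
   qed
  qed
 qed
qed

text \<open>The total momentum of two particles of equal mass determines their rapidities up to order:
 \<open>exp \<theta>\<^sub>1\<close> and \<open>exp \<theta>\<^sub>2\<close> are the roots of \<open>z\<^sup>2 - u z + v\<close>, where \<open>u\<close> and \<open>u / v\<close> are the light cone
 components of the momentum. So every symmetric multiplier commutes with \<open>T\<close>.\<close>

lemma symmetric_multiplier_commutes:
 assumes m: "m > 0" and T: "T \<in> commutant (range (U2 m))"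
  and hb: "bounded_borel h"
 shows "commutes_mul T (\<lambda>(x, y). h (max x y, min x y))"
proof -
 obtain B where h: "h \<in> borel_measurable borel" "\<And>z. cmod (h z) \<le> B"
  using hb unfolding bounded_borel_def by blast
 have Tb: "bounded_clinear T" using T by (simp add: commutant_def)
 define X where "X z = m * cosh (fst z) + m * cosh (snd z)" for z :: "real \<times> real"
 define Y where "Y z = m * sinh (fst z) + m * sinh (snd z)" for z :: "real \<times> real"
 have phase: "commutes_mul T (\<lambda>z. mass_phase m x (fst z) * mass_phase m x (snd z))" for x
 proof -
  have mp: "mass_phase m x \<in> borel_measurable borel"
   using bounded_borel_mass_phase by (rule bounded_borel_measurable)
  have "(\<lambda>z. mass_phase m x (fst z) * mass_phase m x (snd z)) \<in> borel_measurable (borel \<Otimes>\<^sub>M borel)"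
   using mp by measurable
  then have bh: "bounded_borel (\<lambda>z. mass_phase m x (fst z) * mass_phase m x (snd z))"
   by (intro bounded_borelI[where B = 1]) (auto simp: mass_phase_def norm_mult borel_prod)
  have "T \<circ> U2 m (x, 0) = U2 m (x, 0) \<circ> T" using T unfolding commutant_def by blast
  then show ?thesis
   using bh by (simp add: commutes_mul_def U2_eq fun_eq_iff flip: zero_prod_def)
 qed
 have X: "commutes_mul T (\<lambda>z. cis (t * X z))" for t
  using phase[of "(t, 0)"]
  by (simp add: mass_phase_def minkowski_def mass_shell_def X_def cis_conv_exp algebra_simps flip: exp_add)
 have Y: "commutes_mul T (\<lambda>z. cis (t * Y z))" for t
  using phase[of "(0, - t)"]
  by (simp add: mass_phase_def minkowski_def mass_shell_def Y_def cis_conv_exp algebra_simps flip: exp_add)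
 note [measurable] = commuting_algebra_measurable[OF Tb X] commuting_algebra_measurable[OF Tb Y]
 define u where "u z = (X z + Y z) / m" for z
 define v where "v z = u z / ((X z - Y z) / m)" for z
 have u: "u (x, y) = exp x + exp y" for x y
  using m by (simp add: u_def X_def Y_def cosh_def sinh_def field_simps)
 have w: "(X (x, y) - Y (x, y)) / m = exp (- x) + exp (- y)" for x y
  using m by (simp add: X_def Y_def cosh_def sinh_def field_simps)
 have v: "v (x, y) = exp x * exp y" for x y
 proof -
  have "exp (- x) + exp (- y) > 0" by (intro add_pos_pos) auto
  then show ?thesis
   unfolding v_def u w by (simp add: exp_minus field_simps)
 qed
 have sq: "sqrt ((u (x, y))\<^sup>2 - 4 * v (x, y)) = \<bar>exp x - exp y\<bar>" for x y
 proof -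
  have "(u (x, y))\<^sup>2 - 4 * v (x, y) = (exp x - exp y)\<^sup>2"
   unfolding u v by (simp add: power2_eq_square algebra_simps)
  then show ?thesis by simp
 qed
 have mx: "ln ((u (x, y) + sqrt ((u (x, y))\<^sup>2 - 4 * v (x, y))) / 2) = max x y" for x y
  unfolding sq unfolding u by (cases "x \<le> y") (simp_all add: max_def abs_if not_le)
 have mn: "ln ((u (x, y) - sqrt ((u (x, y))\<^sup>2 - 4 * v (x, y))) / 2) = min x y" for x y
  unfolding sq unfolding u by (cases "x \<le> y") (simp_all add: min_def abs_if not_le)
 let ?Q = "\<lambda>z. (ln ((u z + sqrt ((u z)\<^sup>2 - 4 * v z)) / 2), ln ((u z - sqrt ((u z)\<^sup>2 - 4 * v z)) / 2))"
 have "?Q \<in> borel_measurable (commuting_algebra T)"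
  unfolding v_def u_def by measurable
 then have "(\<lambda>z. h (?Q z)) \<in> borel_measurable (commuting_algebra T)"
  using h(1) by (rule measurable_compose)
 then have "commutes_mul T (\<lambda>z. h (?Q z))"
  by (rule commutes_mul_measurable[OF Tb]) (rule h(2))
 then show ?thesis
  by (rule back_subst[of "commutes_mul T"]) (auto simp: fun_eq_iff mx mn)
qed

subsection \<open>The general form of an operator in the commutant\<close>

lemma AE_off_diagonal: "AE z in (lborel :: (real \<times> real) measure). fst z \<noteq> snd z"
 using AE_lborel_diff[of "\<lambda>x. x \<noteq> 0"] AE_lborel_singleton[of "0::real"]
 by (auto elim!: eventually_mono)

definition gauss2 :: "real \<times> real \<Rightarrow> complex" where
 "gauss2 z = of_real (exp (- (fst z)\<^sup>2) * exp (- (snd z)\<^sup>2))"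

lemma gauss2_measurable [measurable]: "gauss2 \<in> borel_measurable borel"
 unfolding gauss2_def
 by (intro borel_measurable_continuous_onI continuous_intros)

lemma gauss2_pos: "0 < cmod (gauss2 z)" "gauss2 z \<noteq> 0"
 by (simp_all add: gauss2_def norm_mult)

lemma cmod_gauss2: "cmod (gauss2 z) = exp (- (fst z)\<^sup>2) * exp (- (snd z)\<^sup>2)"
 by (simp only: gauss2_def norm_of_real abs_mult abs_exp_cancel)

lemma gauss2_swap: "gauss2 (y, x) = gauss2 (x, y)"
 by (simp add: gauss2_def mult.commute)

lemma square_integrable_gauss: "square_integrable (\<lambda>x::real. complex_of_real (exp (- x\<^sup>2)))"
proof -
 have "integrable lborel (\<lambda>x. sqrt pi * normal_density 0 (1/2) x)"
  by (intro integrable_mult_right integrable_normal_density) auto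
 also have "(\<lambda>x. sqrt pi * normal_density 0 (1/2) x) = (\<lambda>x. sqrt 2 * (exp (- x\<^sup>2))\<^sup>2)"
  by (rule ext) (simp add: normal_density_def real_sqrt_mult real_sqrt_divide field_simps power2_eq_square flip: exp_add)
 finally have "integrable lborel (\<lambda>x::real. (exp (- x\<^sup>2))\<^sup>2)" by simp
 then show ?thesis
  unfolding square_integrable_def
  by (auto intro!: borel_measurable_continuous_onI continuous_intros)
qed

lemma square_integrable_gauss2: "square_integrable gauss2"
 using square_integrable_tensor[OF square_integrable_gauss square_integrable_gauss]
 by (simp add: gauss2_def[abs_def] case_prod_beta')

lemma square_integrable_indicator_mul:
 fixes f :: "'a::euclidean_space \<Rightarrow> complex"
 assumes "square_integrable f" "A \<in> sets borel"
 shows "square_integrable (\<lambda>x. indicator A x * f x)"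
 by (rule square_integrable_mul[OF _ assms(1)])
   (use assms(2) in \<open>auto intro!: bounded_borelI[where B = 1] simp: indicator_def\<close>)

definition gauss_dominated :: "(real \<times> real \<Rightarrow> complex) \<Rightarrow> bool" where
 "gauss_dominated F \<longleftrightarrow>
   F \<in> borel_measurable borel \<and> (\<exists>c. \<forall>z. cmod (F z) \<le> c * cmod (gauss2 z))"

lemma gauss_dominatedI:
 "F \<in> borel_measurable borel \<Longrightarrow> (\<And>z. cmod (F z) \<le> c * cmod (gauss2 z)) \<Longrightarrow> gauss_dominated F"
 by (auto simp: gauss_dominated_def)

text \<open>On functions dominated by a Gaussian, an operator commuting with symmetric multipliers acts by
 two functions: its values on the two halves of the symmetric Gaussian cut along the diagonal.\<close>

lemma symmetric_commuting_form:
 assumes T: "bounded_clinear T"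
  and sym: "\<And>h. bounded_borel h \<Longrightarrow> commutes_mul T (\<lambda>(x, y). h (max x y, min x y))"
 obtains a b where "a \<in> borel_measurable borel" "b \<in> borel_measurable borel"
  "\<And>F. gauss_dominated F \<Longrightarrow>
   AE z in lborel. rep_l2 (T (abs_l2 F)) z = a z * F z + b z * F (snd z, fst z)"
proof -
 define D where "D = {z :: real \<times> real. fst z > snd z}"
 have D[measurable]: "D \<in> sets borel"
  unfolding D_def by (intro borel_open open_Collect_less continuous_intros)
 define G1 where "G1 z = indicator D z * gauss2 z" for z
 define G2 where "G2 z = indicator (- D) z * gauss2 z" for z
 have G: "square_integrable G1" "square_integrable G2"
  unfolding G1_def G2_def by (intro square_integrable_indicator_mul square_integrable_gauss2; simp)+
 define u where "u = rep_l2 (T (abs_l2 G1))"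
 define v where "v = rep_l2 (T (abs_l2 G2))"
 have uv: "square_integrable u" "square_integrable v" "T (abs_l2 G1) = abs_l2 u" "T (abs_l2 G2) = abs_l2 v"
  by (simp_all add: u_def v_def square_integrable_rep)
 have [measurable]: "u \<in> borel_measurable borel" "v \<in> borel_measurable borel"
  using uv by (simp_all add: square_integrable_def)
 define a where "a z = (if z \<in> D then u z else v z) / gauss2 z" for z
 define b where "b z = (if z \<in> D then v z else u z) / gauss2 z" for z
 show thesis
 proof
  show "a \<in> borel_measurable borel" "b \<in> borel_measurable borel"
   unfolding a_def b_def by measurable
  fix F assume "gauss_dominated F"
  then obtain c where F[measurable]: "F \<in> borel_measurable borel"
   and bd: "\<And>z. cmod (F z) \<le> c * cmod (gauss2 z)"
   unfolding gauss_dominated_def by blast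
  define h1 where "h1 z = F z / gauss2 z" for z
  define h2 where "h2 z = F (snd z, fst z) / gauss2 z" for z
  have swm: "(\<lambda>z. F (snd z, fst z)) \<in> borel_measurable borel"
   by (rule measurable_compose[OF measurable_swap F])
  have hm: "h1 \<in> borel_measurable borel" "h2 \<in> borel_measurable borel"
   unfolding h1_def h2_def using swm by (auto intro!: borel_measurable_divide)
  have hb: "cmod (h1 z) \<le> c" "cmod (h2 z) \<le> c" for z
   using bd[of z] bd[of "(snd z, fst z)"] gauss2_pos[of z] gauss2_swap[of "snd z" "fst z"]
   by (simp_all add: h1_def h2_def norm_divide divide_le_eq)
  define k1 where "k1 = (\<lambda>(x, y). h1 (max x y, min x y))"
  define k2 where "k2 = (\<lambda>(x, y). h2 (max x y, min x y))"
  have k: "commutes_mul T k1" "commutes_mul T k2"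
   unfolding k1_def k2_def using sym[OF bounded_borelI[OF hm(1) hb(1)]] sym[OF bounded_borelI[OF hm(2) hb(2)]] by auto
  have kb: "bounded_borel k1" "bounded_borel k2" using k by (auto simp: commutes_mul_def)
  have k1: "k1 z = (if z \<in> D then F z else F (snd z, fst z)) / gauss2 z" for z
   by (cases z) (auto simp: k1_def h1_def D_def max_def min_def gauss2_swap)
  have k2: "k2 z = (if z \<in> D then F (snd z, fst z) else F z) / gauss2 z" for z
   by (cases z) (auto simp: k2_def h2_def D_def max_def min_def gauss2_swap)
  have "F = (\<lambda>z. k1 z * G1 z + k2 z * G2 z)"
   using gauss2_pos by (auto simp: fun_eq_iff k1 k2 G1_def G2_def indicator_def)
  then have "abs_l2 F = mul_l2 k1 (abs_l2 G1) + mul_l2 k2 (abs_l2 G2)"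
   by (simp add: mul_abs kb G plus_abs square_integrable_mul)
  then have "T (abs_l2 F) = mul_l2 k1 (abs_l2 u) + mul_l2 k2 (abs_l2 v)"
   using k uv by (simp add: bounded_clinearD(1)[OF T] commutes_mul_def)
  then have *: "T (abs_l2 F) = abs_l2 (\<lambda>z. k1 z * u z + k2 z * v z)"
   by (simp add: mul_abs kb uv plus_abs square_integrable_mul)
  have "square_integrable (\<lambda>z. k1 z * u z + k2 z * v z)"
   by (intro square_integrable_add square_integrable_mul kb uv)
  from rep_abs_l2[OF this] show "AE z in lborel. rep_l2 (T (abs_l2 F)) z = a z * F z + b z * F (snd z, fst z)"
   unfolding * by eventually_elim (simp add: k1 k2 a_def b_def mult.commute)
 qed
qed

text \<open>The two coefficients are bounded by the norm of the operator: away from the diagonal, the two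
 terms can be made to act on functions with disjoint supports.\<close>

lemma coefficient_bound:
 assumes T: "\<And>\<Psi>. norm (T \<Psi>) \<le> C * norm \<Psi>" "C \<ge> 0"
  and ab: "a \<in> borel_measurable borel" "b \<in> borel_measurable borel"
  and form: "\<And>F. gauss_dominated F \<Longrightarrow>
   AE z in lborel. rep_l2 (T (abs_l2 F)) z = a z * F z + b z * F (snd z, fst z)"
  and D: "D \<in> sets borel" "\<And>x y. (x, y) \<in> D \<Longrightarrow> (y, x) \<notin> D"
 shows "AE z in lborel. z \<in> D \<longrightarrow> cmod (a z) \<le> C" "AE z in lborel. z \<in> D \<longrightarrow> cmod (b z) \<le> C"
proof -
 note [measurable] = ab D(1)
 have key: "AE z in lborel. z \<in> D \<longrightarrow> cmod (k z) \<le> C"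
  if k[measurable]: "k \<in> borel_measurable borel"
  and disj: "\<And>A. A \<in> sets borel \<Longrightarrow> A \<subseteq> D \<Longrightarrow> \<exists>F r. square_integrable F \<and>
   norm (abs_l2 F) = norm (abs_l2 (\<lambda>z. indicator A z * gauss2 z)) \<and> square_integrable r \<and>
   T (abs_l2 F) = abs_l2 r \<and> (AE z in lborel. z \<in> A \<longrightarrow> cmod (r z) = cmod (k z) * cmod (gauss2 z))" for k
 proof -
  define A where "A = {z \<in> D. C < cmod (k z)}"
  have A[measurable]: "A \<in> sets borel"
  proof -
   have "A = D \<inter> {z. C < cmod (k z)}" by (auto simp: A_def)
   moreover have "{z. C < cmod (k z)} \<in> sets borel" by measurable
   ultimately show ?thesis using D(1) by auto
  qed
  obtain F r where F: "square_integrable F" and nF: "norm (abs_l2 F) = norm (abs_l2 (\<lambda>z. indicator A z * gauss2 z))"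
   and r: "square_integrable r" "T (abs_l2 F) = abs_l2 r"
   and eq: "AE z in lborel. z \<in> A \<longrightarrow> cmod (r z) = cmod (k z) * cmod (gauss2 z)"
   using disj[OF A] by (auto simp: A_def)
  have G: "square_integrable (\<lambda>z. indicator A z * gauss2 z)"
   by (intro square_integrable_indicator_mul square_integrable_gauss2 A)
  have Gi: "integrable lborel (\<lambda>z. C\<^sup>2 * (cmod (indicator A z * gauss2 z))\<^sup>2)"
   using G by (simp add: square_integrable_def)
  have Ri: "integrable lborel (\<lambda>z. (cmod (r z))\<^sup>2)" using r by (simp add: square_integrable_def)
  have rm: "r \<in> borel_measurable borel" using r by (simp add: square_integrable_def)
  have RAi: "integrable lborel (\<lambda>z. indicator A z * (cmod (r z))\<^sup>2)"
   by (rule Bochner_Integration.integrable_bound[OF Ri])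
     (use rm in \<open>auto intro!: AE_I2 borel_measurable_times simp: indicator_def\<close>)
  have "(LINT z|lborel. indicator A z * (cmod (r z))\<^sup>2) \<le> (LINT z|lborel. (cmod (r z))\<^sup>2)"
   by (rule integral_mono[OF RAi Ri]) (auto simp: indicator_def)
  also have "\<dots> = (norm (T (abs_l2 F)))\<^sup>2" by (simp add: r norm_abs)
  also have "\<dots> \<le> (C * norm (abs_l2 F))\<^sup>2" using T by (intro power_mono) auto
  also have "\<dots> = (LINT z|lborel. C\<^sup>2 * (cmod (indicator A z * gauss2 z))\<^sup>2)"
   by (simp add: power_mult_distrib nF norm_abs[OF G])
  finally have le: "(LINT z|lborel. indicator A z * (cmod (r z))\<^sup>2 - C\<^sup>2 * (cmod (indicator A z * gauss2 z))\<^sup>2) \<le> 0"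
   using RAi Gi by (simp add: Bochner_Integration.integral_diff)
  have pos: "AE z in lborel. z \<in> A \<longrightarrow> indicator A z * (cmod (r z))\<^sup>2 - C\<^sup>2 * (cmod (indicator A z * gauss2 z))\<^sup>2 > 0"
   using eq
  proof eventually_elim
   case (elim z)
   show ?case
   proof
    assume z: "z \<in> A"
    then have "C\<^sup>2 < (cmod (k z))\<^sup>2" using T(2) by (intro power_strict_mono) (auto simp: A_def)
    then have "C\<^sup>2 * (cmod (gauss2 z))\<^sup>2 < (cmod (k z))\<^sup>2 * (cmod (gauss2 z))\<^sup>2"
     using gauss2_pos(1)[of z] by simp
    then show "indicator A z * (cmod (r z))\<^sup>2 - C\<^sup>2 * (cmod (indicator A z * gauss2 z))\<^sup>2 > 0"
     using z elim by (simp add: power_mult_distrib)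
   qed
  qed
  then have nn: "AE z in lborel. indicator A z * (cmod (r z))\<^sup>2 - C\<^sup>2 * (cmod (indicator A z * gauss2 z))\<^sup>2 \<ge> 0"
   by eventually_elim (auto simp: indicator_def)
  then have "AE z in lborel. indicator A z * (cmod (r z))\<^sup>2 - C\<^sup>2 * (cmod (indicator A z * gauss2 z))\<^sup>2 = 0"
   using le integral_nonneg_AE[OF nn]
   by (subst integral_nonneg_eq_0_iff_AE[symmetric]) (auto intro!: Bochner_Integration.integrable_diff RAi Gi)
  with pos show ?thesis
  proof eventually_elim
   case (elim z)
   then have "z \<notin> A" by (metis less_irrefl)
   then show ?case by (simp add: A_def not_less)
  qed
 qed
 have swap: "(snd z, fst z) \<notin> A" if "A \<subseteq> D" "z \<in> A" for A z
  using D(2)[of "fst z" "snd z"] that by auto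
 have dom: "\<exists>F r. square_integrable F \<and>
   norm (abs_l2 F) = norm (abs_l2 (\<lambda>z. indicator A z * gauss2 z)) \<and> square_integrable r \<and>
   T (abs_l2 F) = abs_l2 r \<and> (AE z in lborel. z \<in> A \<longrightarrow> cmod (r z) = cmod (a z) * cmod (gauss2 z))"
  if A: "A \<in> sets borel" "A \<subseteq> D" for A
 proof (intro exI conjI)
  let ?F = "\<lambda>z. indicator A z * gauss2 z"
  show "square_integrable ?F" "square_integrable (rep_l2 (T (abs_l2 ?F)))" "T (abs_l2 ?F) = abs_l2 (rep_l2 (T (abs_l2 ?F)))"
   by (auto intro: square_integrable_indicator_mul square_integrable_gauss2 A square_integrable_rep)
  have "AE z in lborel. rep_l2 (T (abs_l2 ?F)) z = a z * ?F z + b z * ?F (snd z, fst z)"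
   by (rule form, rule gauss_dominatedI[where c = 1]) (use A in \<open>auto simp: indicator_def\<close>)
  then show "AE z in lborel. z \<in> A \<longrightarrow> cmod (rep_l2 (T (abs_l2 ?F)) z) = cmod (a z) * cmod (gauss2 z)"
   by eventually_elim (use swap[OF A(2)] in \<open>auto simp: norm_mult\<close>)
 qed simp
 show "AE z in lborel. z \<in> D \<longrightarrow> cmod (a z) \<le> C"
  by (rule key[OF ab(1) dom])
 have dom2: "\<exists>F r. square_integrable F \<and>
   norm (abs_l2 F) = norm (abs_l2 (\<lambda>z. indicator A z * gauss2 z)) \<and> square_integrable r \<and>
   T (abs_l2 F) = abs_l2 r \<and> (AE z in lborel. z \<in> A \<longrightarrow> cmod (r z) = cmod (b z) * cmod (gauss2 z))"
  if A: "A \<in> sets borel" "A \<subseteq> D" for A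
 proof (intro exI conjI)
  let ?G = "\<lambda>z. indicator A z * gauss2 z"
  let ?F = "\<lambda>z. ?G (snd z, fst z)"
  have siG: "square_integrable ?G"
   by (auto intro: square_integrable_indicator_mul square_integrable_gauss2 A square_integrable_rep)
  show siF: "square_integrable ?F" by (rule square_integrable_swap'[OF siG])
  show "square_integrable (rep_l2 (T (abs_l2 ?F)))" "T (abs_l2 ?F) = abs_l2 (rep_l2 (T (abs_l2 ?F)))"
   by (auto intro: square_integrable_rep)
  show "norm (abs_l2 ?F) = norm (abs_l2 ?G)"
   using norm_flip[of "abs_l2 ?G"] by (simp only: flip_abs'[OF siG])
  have "AE z in lborel. rep_l2 (T (abs_l2 ?F)) z = a z * ?F z + b z * ?F (snd z, fst z)"
   by (rule form, rule gauss_dominatedI[where c = 1]) (use siF in \<open>auto simp: square_integrable_def indicator_def gauss2_def norm_mult\<close>)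
  then show "AE z in lborel. z \<in> A \<longrightarrow> cmod (rep_l2 (T (abs_l2 ?F)) z) = cmod (b z) * cmod (gauss2 z)"
   by eventually_elim (use swap[OF A(2)] in \<open>auto simp: norm_mult\<close>)
 qed
 show "AE z in lborel. z \<in> D \<longrightarrow> cmod (b z) \<le> C"
  by (rule key[OF ab(2) dom2])
qed

lemma bounded_clinear_norm_le:
 assumes "bounded_clinear T"
 obtains C where "C \<ge> 0" "\<And>\<Psi>. norm (T \<Psi>) \<le> C * norm \<Psi>"
 using bounded_linear.nonneg_bounded[OF bounded_clinearD(5)[OF assms]] by (metis mult.commute)

lemma indicator_gauss2_dominated:
 assumes "A \<subseteq> cball 0 r"
 shows "cmod (indicator A z) \<le> exp (2 * r\<^sup>2) * cmod (gauss2 z)"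
proof (cases "z \<in> A")
 case True
 then have "norm z \<le> r" using subsetD[OF assms True] by (simp only: mem_cball_0)
 then have "\<bar>fst z\<bar> \<le> r" "\<bar>snd z\<bar> \<le> r"
  using norm_fst_le[of "fst z" "snd z"] norm_snd_le[of "snd z" "fst z"] by simp_all
 then have "(fst z)\<^sup>2 \<le> r\<^sup>2" "(snd z)\<^sup>2 \<le> r\<^sup>2"
  by (metis abs_ge_zero power2_abs power_mono)+
 then have "0 \<le> 2 * r\<^sup>2 - (fst z)\<^sup>2 - (snd z)\<^sup>2" by simp
 then have "1 \<le> exp (2 * r\<^sup>2 - (fst z)\<^sup>2 - (snd z)\<^sup>2)" by simp
 also have "\<dots> = exp (2 * r\<^sup>2) * cmod (gauss2 z)"
  by (simp add: cmod_gauss2 exp_diff exp_minus exp_add field_simps)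
 finally show ?thesis using True by simp
qed simp

text \<open>The bound on the coefficients makes both multiplication operators bounded, so the identity on
 functions dominated by a Gaussian extends to the whole space by continuity.\<close>

lemma commutant_two_multipliers:
 assumes T: "bounded_clinear T"
  and sym: "\<And>h. bounded_borel h \<Longrightarrow> commutes_mul T (\<lambda>(x, y). h (max x y, min x y))"
 obtains a b where "bounded_borel a" "bounded_borel b"
  "\<And>\<Psi>. T \<Psi> = mul_l2 a \<Psi> + mul_l2 b (flip \<Psi>)"
proof -
 obtain a b where ab[measurable]: "a \<in> borel_measurable borel" "b \<in> borel_measurable borel"
  and form: "\<And>F. gauss_dominated F \<Longrightarrow>
   AE z in lborel. rep_l2 (T (abs_l2 F)) z = a z * F z + b z * F (snd z, fst z)"
  using symmetric_commuting_form[OF T sym] by blast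
 obtain C where C: "C \<ge> 0" "\<And>\<Psi>. norm (T \<Psi>) \<le> C * norm \<Psi>"
  using bounded_clinear_norm_le[OF T] by blast
 have D: "{z :: real \<times> real. fst z > snd z} \<in> sets borel" "{z :: real \<times> real. fst z < snd z} \<in> sets borel"
  by (intro borel_open open_Collect_less continuous_intros)+
 have bd: "AE z in lborel. z \<in> D \<longrightarrow> cmod (a z) \<le> C \<and> cmod (b z) \<le> C"
  if "D \<in> sets borel" "\<And>x y. (x, y) \<in> D \<Longrightarrow> (y, x) \<notin> D" for D
 proof -
  have "AE z in lborel. z \<in> D \<longrightarrow> cmod (a z) \<le> C"
   by (rule coefficient_bound(1)[OF C(2,1) ab form that])
  moreover have "AE z in lborel. z \<in> D \<longrightarrow> cmod (b z) \<le> C"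
   by (rule coefficient_bound(2)[OF C(2,1) ab form that])
  ultimately show ?thesis by eventually_elim simp
 qed
 have "AE z in lborel. cmod (a z) \<le> C \<and> cmod (b z) \<le> C"
 proof -
  have 1: "AE z in lborel. z \<in> {z. fst z > snd z} \<longrightarrow> cmod (a z) \<le> C \<and> cmod (b z) \<le> C"
   by (rule bd[OF D(1)]) auto
  have 2: "AE z in lborel. z \<in> {z. fst z < snd z} \<longrightarrow> cmod (a z) \<le> C \<and> cmod (b z) \<le> C"
   by (rule bd[OF D(2)]) auto
  show ?thesis
   using 1 2 AE_off_diagonal by eventually_elim (auto simp: neq_iff)
 qed
 then have aC: "AE z in lborel. cmod (a z) \<le> C" and bC: "AE z in lborel. cmod (b z) \<le> C"
  by (auto elim: eventually_mono)
 define a' where "a' z = (if cmod (a z) \<le> C then a z else 0)" for z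
 define b' where "b' z = (if cmod (b z) \<le> C then b z else 0)" for z
 have ab': "bounded_borel a'" "bounded_borel b'"
  unfolding a'_def b'_def using C(1) by (auto intro!: bounded_borelI[where B = C])
 show thesis
 proof
  show "bounded_borel a'" "bounded_borel b'" by fact+
  fix \<Psi>
  define W where "W \<Psi> = mul_l2 a' \<Psi> + mul_l2 b' (flip \<Psi>)" for \<Psi>
  have Wb: "bounded_clinear W"
  proof -
   have 1: "bounded_clinear (mul_l2 a')" "bounded_clinear (mul_l2 b' \<circ> flip)"
    by (intro bounded_clinear_compose mul_bounded_clinear flip_bounded_clinear ab')+
   then show ?thesis
    using bounded_linear_add[OF bounded_clinearD(5)[OF 1(1)] bounded_clinearD(5)[OF 1(2)]]
     bounded_clinearD(2)[OF 1(1)] bounded_clinearD(2)[OF 1(2)]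
    unfolding W_def bounded_clinear_def by (simp add: scaleC_add_right o_def)
  qed
  have "\<Psi> \<in> {\<Psi>. T \<Psi> = W \<Psi>}"
  proof (rule l2_indicator_induct[OF closed_eq_bounded_clinear[OF T Wb]])
   fix A :: "(real \<times> real) set" and r assume A: "A \<in> sets borel" "A \<subseteq> cball 0 r"
   let ?F = "indicator A :: real \<times> real \<Rightarrow> complex"
   have F: "square_integrable ?F" by (rule square_integrable_indicator[OF A])
   have F': "square_integrable (\<lambda>z. ?F (snd z, fst z))" by (rule square_integrable_swap'[OF F])
   have "AE z in lborel. rep_l2 (T (abs_l2 ?F)) z = a z * ?F z + b z * ?F (snd z, fst z)"
    by (rule form[OF gauss_dominatedI[OF _ indicator_gauss2_dominated[OF A(2)]]]) (use A in simp)
   then have "AE z in lborel. rep_l2 (T (abs_l2 ?F)) z = a' z * ?F z + b' z * ?F (snd z, fst z)"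
    using aC bC by eventually_elim (simp add: a'_def b'_def)
   then have "T (abs_l2 ?F) = abs_l2 (\<lambda>z. a' z * ?F z + b' z * ?F (snd z, fst z))"
    by (subst abs_rep_l2[symmetric], subst abs_l2_eq_iff)
      (intro square_integrable_rep square_integrable_add square_integrable_mul ab' F F')+
   also have "\<dots> = W (abs_l2 ?F)"
    by (simp only: W_def flip_abs'[OF F] mul_abs ab' F F' plus_abs square_integrable_mul)
   finally show "abs_l2 ?F \<in> {\<Psi>. T \<Psi> = W \<Psi>}" by simp
  qed (use T Wb in \<open>auto simp: bounded_clinearD\<close>)
  then show "T \<Psi> = mul_l2 a' \<Psi> + mul_l2 b' (flip \<Psi>)" by (simp add: W_def)
 qed
qed

lemma bounded_borel_minus:
 assumes "bounded_borel h" "bounded_borel k"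
 shows "bounded_borel (\<lambda>x. h x - k x)"
 using bounded_borel_add[OF assms(1) bounded_borel_mult[OF bounded_borel_const[of "-1"] assms(2)]] by simp

lemma mul_minus:
 assumes "bounded_borel h" "bounded_borel k"
 shows "mul_l2 (\<lambda>x. h x - k x) \<psi> = mul_l2 h \<psi> - mul_l2 k \<psi>"
proof -
 obtain f where f: "square_integrable f" "\<psi> = abs_l2 f" by (rule l2_obtain)
 then show ?thesis
  using assms by (simp add: mul_abs minus_abs square_integrable_mul bounded_borel_minus left_diff_distrib)
qed

text \<open>Applied to Gaussians cut off along the diagonal, the two terms have disjoint supports and cannot
 cancel.\<close>

lemma two_multipliers_unique:
 assumes ab: "bounded_borel a" "bounded_borel b"
  and zero: "\<And>\<Psi>. mul_l2 a \<Psi> + mul_l2 b (flip \<Psi>) = 0"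
 shows "AE z in lborel. a z = 0 \<and> b z = 0"
proof -
 have *: "AE z in lborel. a z * (indicator D z * gauss2 z) + b z * (indicator D (snd z, fst z) * gauss2 z) = 0"
  if D: "D \<in> sets borel" for D
 proof -
  let ?F = "\<lambda>z. indicator D z * gauss2 z"
  have F: "square_integrable ?F" by (intro square_integrable_indicator_mul square_integrable_gauss2 D)
  note F' = square_integrable_swap'[OF F]
  have "abs_l2 (\<lambda>z. a z * ?F z + b z * ?F (snd z, fst z)) = 0"
   using zero[of "abs_l2 ?F"] F F' ab by (simp only: flip_abs'[OF F] mul_abs plus_abs square_integrable_mul)
  then have "AE z in lborel. a z * ?F z + b z * ?F (snd z, fst z) = 0"
   unfolding zero_abs
   by (subst (asm) abs_l2_eq_iff) (intro square_integrable_add square_integrable_mul ab F F' square_integrable_zero)+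
  then show ?thesis by eventually_elim (simp add: gauss2_swap)
 qed
 have D: "{z :: real \<times> real. fst z > snd z} \<in> sets borel" "{z :: real \<times> real. fst z < snd z} \<in> sets borel"
  by (intro borel_open open_Collect_less continuous_intros)+
 show ?thesis
  using *[OF D(1)] *[OF D(2)] AE_off_diagonal
 proof eventually_elim
  case (elim z)
  then show ?case using gauss2_pos(2)[of z]
   by (cases "fst z < snd z") (auto simp: indicator_def)
 qed
qed

lemma mul_cong_AE:
 assumes "bounded_borel h" "bounded_borel k" "AE x in lborel. h x = k x"
 shows "mul_l2 h = mul_l2 k"
proof
 fix \<psi> :: "'a l2"
 obtain f where f: "square_integrable f" "\<psi> = abs_l2 f" by (rule l2_obtain)
 have "AE x in lborel. h x * f x = k x * f x" using assms(3) by eventually_elim simp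
 then show "mul_l2 h \<psi> = mul_l2 k \<psi>"
  by (simp add: f mul_abs assms abs_l2_eq_iff square_integrable_mul)
qed

text \<open>A function invariant under boosts, in the almost everywhere sense, depends on the rapidity
 difference only: averaging it over the orbit with a Gaussian weight gives the function of one
 variable.\<close>

lemma boost_invariant_function:
 fixes a :: "real \<times> real \<Rightarrow> complex"
 assumes a: "bounded_borel a" and inv: "\<And>l. AE z in lborel. a (z - (l, l)) = a z"
 obtains f where "bounded_borel f" "AE z in lborel. a z = f (snd z - fst z)"
proof -
 obtain B where B: "\<And>z. cmod (a z) \<le> B" using bounded_borel_obtain[OF a] by blast
 have am: "a \<in> borel_measurable (borel \<Otimes>\<^sub>M borel)"
  using a by (simp add: bounded_borel_def borel_prod)
 define f where "f u = (LINT t|lborel. std_normal_density t *\<^sub>R a (t, t + u))" for u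
 have "(\<lambda>(u, t). std_normal_density t *\<^sub>R a (t, t + u)) \<in> borel_measurable (borel \<Otimes>\<^sub>M lborel)"
  using am by measurable
 then have fm: "f \<in> borel_measurable borel"
  unfolding f_def by (rule lborel.borel_measurable_lebesgue_integral)
 have int: "integrable lborel (\<lambda>t. std_normal_density t *\<^sub>R a (t, t + u))" for u
 proof (rule Bochner_Integration.integrable_bound)
  show "integrable lborel (\<lambda>t. B * std_normal_density t)"
   by (intro integrable_mult_right integrable_normal_density) auto
  show "(\<lambda>t. std_normal_density t *\<^sub>R a (t, t + u)) \<in> borel_measurable lborel"
   using am by measurable
  show "AE t in lborel. norm (std_normal_density t *\<^sub>R a (t, t + u)) \<le> norm (B * std_normal_density t)"
  proof (rule AE_I2)
   fix t
   have "std_normal_density t * cmod (a (t, t + u)) \<le> std_normal_density t * B"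
    by (intro mult_left_mono B) simp
   also have "\<dots> \<le> norm (B * std_normal_density t)"
    by (metis abs_ge_self mult.commute real_norm_def)
   finally show "norm (std_normal_density t *\<^sub>R a (t, t + u)) \<le> norm (B * std_normal_density t)" by simp
  qed
 qed
 have tot: "(LINT t|lborel. std_normal_density t) = 1"
  using integral_normal_density[of 1 0] by simp
 have fB: "cmod (f u) \<le> B" for u
 proof -
  have "cmod (f u) \<le> (LINT t|lborel. std_normal_density t * B)"
   unfolding f_def
  proof (rule Bochner_Integration.integral_norm_bound_integral[OF int])
   show "integrable lborel (\<lambda>t. std_normal_density t * B)"
    by (intro integrable_mult_left integrable_normal_density) auto
   show "norm (std_normal_density t *\<^sub>R a (t, t + u)) \<le> std_normal_density t * B" for t
    by (auto intro!: mult_left_mono B)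
  qed
  then show ?thesis using tot by simp
 qed
 show thesis
 proof
  show "bounded_borel f" by (rule bounded_borelI[OF fm fB])
  have "AE l in lborel. AE z in lborel. a (z - (l, l)) = a z" using inv by simp
  have am': "a \<in> borel_measurable borel" using a by (simp add: bounded_borel_def)
  have "(\<lambda>p :: real \<times> real \<times> real. snd p - (fst p, fst p)) \<in> borel_measurable borel"
   by (intro borel_measurable_continuous_onI continuous_intros)
  then have "(\<lambda>p. a (snd p - (fst p, fst p))) \<in> borel_measurable (borel \<Otimes>\<^sub>M borel)"
   unfolding borel_prod by (rule measurable_compose) (rule am')
  moreover have "(\<lambda>p::real \<times> real \<times> real. a (snd p)) \<in> borel_measurable (borel \<Otimes>\<^sub>M borel)"
   using am' by measurable
  ultimately have "(\<lambda>p. a (snd p - (fst p, fst p)) - a (snd p)) \<in> borel_measurable (borel \<Otimes>\<^sub>M borel)"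
   by (rule borel_measurable_diff)
  then have "Measurable.pred (borel \<Otimes>\<^sub>M borel) (\<lambda>p. a (snd p - (fst p, fst p)) - a (snd p) = 0)"
   by (intro pred_eq_const1) auto
  then have "{p \<in> space (borel \<Otimes>\<^sub>M borel). a (snd p - (fst p, fst p)) = a (snd p)} \<in> sets (borel \<Otimes>\<^sub>M borel)"
   by (simp add: pred_def)
  then have ms: "{p \<in> space ((lborel :: real measure) \<Otimes>\<^sub>M (lborel :: (real \<times> real) measure)).
    a (snd p - (fst p, fst p)) = a (snd p)} \<in> sets (lborel \<Otimes>\<^sub>M lborel)"
   by (simp add: space_pair_measure cong: sets_pair_measure_cong)

  have "AE z in lborel. AE l in lborel. a (z - (l, l)) = a z"
   using lborel_pair.AE_commute[of "\<lambda>l z. a (z - (l, l)) = a z"] ms inv by (simp add: case_prod_beta')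
  then show "AE z in lborel. a z = f (snd z - fst z)"
  proof eventually_elim
   case (elim z)
   have "(\<lambda>l. z - (l, l)) \<in> borel_measurable borel"
    by (intro borel_measurable_continuous_onI continuous_intros)
   then have "(\<lambda>l. a (z - (l, l))) \<in> borel_measurable borel"
    by (rule measurable_compose) (rule am')
   then have "Measurable.pred borel (\<lambda>l. a (z - (l, l)) = a z)"
    by (intro pred_eq_const1) auto
   from AE_borel_affine[OF _ this, of "-1" "fst z"] elim
   have "AE t in lborel. a (z - (fst z - t, fst z - t)) = a z" by simp
   then have "AE t in lborel. std_normal_density t *\<^sub>R a (t, t + (snd z - fst z)) = std_normal_density t *\<^sub>R a z"
   proof eventually_elim
    case (elim t)
    have "z - (fst z - t, fst z - t) = (t, t + (snd z - fst z))" by (cases z) simp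
    then show ?case using elim by simp
   qed
   then have "f (snd z - fst z) = (LINT t|lborel. std_normal_density t *\<^sub>R a z)"
    unfolding f_def by (intro integral_cong_AE) (use int in \<open>auto dest: borel_measurable_integrable\<close>)
   also have "\<dots> = a z"
    by (subst integral_scaleR_left) (auto simp: tot intro!: integrable_normal_density)
   finally show ?case by simp
  qed
 qed
qed

lemma mult_diff_abs:
 assumes "g \<in> Linf" "square_integrable F"
 shows "mult_diff g (abs_l2 F) = abs_l2 (\<lambda>z. g (snd z - fst z) * F z)"
 using assms by (simp add: mult_diff.abs_eq l2_rel_refl case_prod_beta')

lemma bounded_borel_Linf: "bounded_borel g \<Longrightarrow> g \<in> Linf"
 by (auto simp: bounded_borel_def Linf_def)

lemma bounded_borel_rapidity_diff:
 assumes "bounded_borel f"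
 shows "bounded_borel (\<lambda>z::real \<times> real. f (snd z - fst z))"
proof -
 obtain B where B: "\<And>x. cmod (f x) \<le> B" using bounded_borel_obtain[OF assms] by auto
 have "(\<lambda>z::real \<times> real. snd z - fst z) \<in> borel_measurable borel"
  by (intro borel_measurable_continuous_onI continuous_intros)
 from measurable_compose[OF this bounded_borel_measurable[OF assms]] show ?thesis
  by (rule bounded_borelI) (rule B)
qed

lemma mult_diff_eq_mul:
 assumes "bounded_borel f"
 shows "mult_diff f = mul_l2 (\<lambda>z. f (snd z - fst z))"
proof
 fix \<Psi> :: "(real \<times> real) l2"
 obtain F where F: "square_integrable F" "\<Psi> = abs_l2 F" by (rule l2_obtain)
 then show "mult_diff f \<Psi> = mul_l2 (\<lambda>z. f (snd z - fst z)) \<Psi>"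
  by (simp add: mult_diff_abs bounded_borel_Linf assms mul_abs bounded_borel_rapidity_diff)
qed

text \<open>Commutation with a boost shifts the arguments of both coefficients; as these are unique, they are
 boost invariant.\<close>

theorem commutant_form:
 assumes m: "m > 0" and T: "T \<in> commutant (range (U2 m))"
 obtains f g where "bounded_borel f" "bounded_borel g"
  "\<And>\<Psi>. T \<Psi> = mult_diff f \<Psi> + mult_diff g (flip \<Psi>)"
proof -
 have Tb: "bounded_clinear T" using T by (simp add: commutant_def)
 obtain a b where ab: "bounded_borel a" "bounded_borel b"
  and form: "\<And>\<Psi>. T \<Psi> = mul_l2 a \<Psi> + mul_l2 b (flip \<Psi>)"
  using commutant_two_multipliers[OF Tb symmetric_multiplier_commutes[OF m T]] by blast
 have inv: "AE z in lborel. a (z - (l, l)) = a z \<and> b (z - (l, l)) = b z" for l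
 proof -
  have TU: "T (trans_l2 (l, l) \<Psi>) = trans_l2 (l, l) (T \<Psi>)" for \<Psi>
  proof -
   have "T \<circ> U2 m (0, l) = U2 m (0, l) \<circ> T" using T unfolding commutant_def by blast
   moreover have "U2 m (0, l) = trans_l2 (l, l)"
    unfolding U2_eq by (simp add: fun_eq_iff mass_phase_def minkowski_def mul_const)
   ultimately show ?thesis by (simp add: fun_eq_iff)
  qed
  define a' where "a' z = a (z - (l, l))" for z
  define b' where "b' z = b (z - (l, l))" for z
  have shift: "bounded_borel (\<lambda>z. h (z - (l, l)))" if h: "bounded_borel h" for h :: "real \<times> real \<Rightarrow> complex"
  proof -
   obtain B where B: "\<And>x. cmod (h x) \<le> B" using bounded_borel_obtain[OF h] by blast
   have "(\<lambda>z::real \<times> real. z - (l, l)) \<in> borel_measurable borel" by simp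
   from measurable_compose[OF this bounded_borel_measurable[OF h]] show ?thesis
    by (rule bounded_borelI) (rule B)
  qed
  have ab': "bounded_borel a'" "bounded_borel b'" unfolding a'_def b'_def using shift ab by auto
  have "mul_l2 (\<lambda>z. a z - a' z) \<Psi> + mul_l2 (\<lambda>z. b z - b' z) (flip \<Psi>) = 0" for \<Psi>
  proof -
   define \<Phi> where "\<Phi> = trans_l2 (- l, - l) \<Psi>"
   have \<Psi>: "\<Psi> = trans_l2 (l, l) \<Phi>" by (simp add: \<Phi>_def trans_trans flip: zero_prod_def)
   have mt: "trans_l2 (l, l) (mul_l2 h \<Phi>) = mul_l2 (\<lambda>z. h (z - (l, l))) (trans_l2 (l, l) \<Phi>)"
    if h: "bounded_borel h" for h \<Phi>
   proof -
    obtain F where F: "square_integrable F" "\<Phi> = abs_l2 F" by (rule l2_obtain)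
    then show ?thesis
     by (simp add: mul_abs h shift trans_abs square_integrable_mul square_integrable_translate)
   qed
   have ft: "trans_l2 (l, l) (flip \<Phi>) = flip (trans_l2 (l, l) \<Phi>)" for \<Phi>
   proof -
    obtain F where F: "square_integrable F" "\<Phi> = abs_l2 F" by (rule l2_obtain)
    have "(\<lambda>z. F (snd (z - (l, l)), fst (z - (l, l)))) = (\<lambda>z. F ((snd z, fst z) - (l, l)))"
     by simp
    then show ?thesis
     by (simp only: F flip_abs' trans_abs square_integrable_swap' square_integrable_translate)
   qed
   have "mul_l2 a \<Psi> + mul_l2 b (flip \<Psi>) = mul_l2 a' \<Psi> + mul_l2 b' (flip \<Psi>)"
    using TU[of \<Phi>] form[of \<Psi>] form[of \<Phi>]
    by (simp add: \<Psi>[symmetric] bounded_clinearD(1)[OF trans_bounded_clinear] mt ab ft a'_def[abs_def] b'_def[abs_def])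
   then show ?thesis
    by (simp add: mul_minus ab ab' algebra_simps)
  qed
  from two_multipliers_unique[OF _ _ this]
  have "AE z in lborel. a z - a' z = 0 \<and> b z - b' z = 0"
   by (auto intro!: bounded_borel_minus ab ab')
  then show ?thesis by eventually_elim (simp add: a'_def b'_def)
 qed
 obtain f where f: "bounded_borel f" "AE z in lborel. a z = f (snd z - fst z)"
  by (rule boost_invariant_function[OF ab(1)]) (use inv in \<open>auto elim: eventually_mono\<close>)
 obtain g where g: "bounded_borel g" "AE z in lborel. b z = g (snd z - fst z)"
  by (rule boost_invariant_function[OF ab(2)]) (use inv in \<open>auto elim: eventually_mono\<close>)
 have "mul_l2 a = mult_diff f" "mul_l2 b = mult_diff g"
  unfolding mult_diff_eq_mul[OF f(1)] mult_diff_eq_mul[OF g(1)]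
  using mul_cong_AE[OF ab(1) bounded_borel_rapidity_diff[OF f(1)] f(2)]
   mul_cong_AE[OF ab(2) bounded_borel_rapidity_diff[OF g(1)] g(2)] by auto
 then show thesis using that[OF f(1) g(1)] form by simp
qed

section \<open>Boundary values of bounded analytic functions\<close>

subsection \<open>Lebesgue points of bounded functions\<close>

text \<open>Disjoint small intervals inside an open set of little excess over \<open>A\<close>, each missing \<open>A\<close> in a fixed
 proportion, have small total length; by Vitali's theorem such intervals cover the exceptional set.\<close>

lemma density_points:
 fixes A :: "real set"
 assumes A: "A \<in> sets lebesgue" and c: "c > 0"
 shows "negligible {x \<in> A. \<forall>d>0. \<exists>r. 0 < r \<and> r < d \<and> c * r < measure lebesgue (cball x r - A)}"
  (is "negligible ?S")
 unfolding negligible_outer_le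
proof (intro allI impI)
 fix e :: real assume e: "e > 0"
 obtain T where T: "open T" "A \<subseteq> T" "T - A \<in> lmeasurable" "emeasure lebesgue (T - A) < ennreal (c * e / 2)"
  using sets_lebesgue_outer_open[OF A, of "c * e / 2"] c e by auto
 have mT: "measure lebesgue (T - A) \<le> c * e / 2"
  using T(3,4) c e by (simp add: emeasure_eq_measure2 ennreal_less_iff less_imp_le)
 define K where "K = {(x, r). x \<in> ?S \<and> 0 < r \<and> cball x r \<subseteq> T \<and> c * r < measure lebesgue (cball x r - A)}"
 have cov: "\<exists>i. i \<in> K \<and> x \<in> cball (fst i) (snd i) \<and> snd i < d" if x: "x \<in> ?S" and d: "0 < d" for x d
 proof -
  have xS: "x \<in> A" "\<forall>d>0. \<exists>r. 0 < r \<and> r < d \<and> c * r < measure lebesgue (cball x r - A)"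
   using x by simp_all
  have "x \<in> T" using xS(1) T(2) by (rule subsetD[rotated])
  then obtain k where k: "k > 0" "cball x k \<subseteq> T"
   using T(1) by (meson open_contains_cball)
  have "min d k > 0" using d k(1) by simp
  then obtain r where r: "0 < r" "r < min d k" "c * r < measure lebesgue (cball x r - A)"
   using xS(2) by meson
  have "cball x r \<subseteq> cball x k" using r(2) by (intro subset_cball) simp
  then have "cball x r \<subseteq> T" using k(2) by (rule subset_trans)
  then show ?thesis using r x by (intro exI[of _ "(x, r)"]) (auto simp: K_def)
 qed
 have Kp: "0 < snd i" "cball (fst i) (snd i) \<subseteq> T" "c * snd i < measure lebesgue (cball (fst i) (snd i) - A)"
  if "i \<in> K" for i
  using that unfolding K_def by (cases i, simp)+
 obtain C where C: "countable C" "C \<subseteq> K"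
  and disj: "pairwise (\<lambda>i j. disjnt (cball (fst i) (snd i)) (cball (fst j) (snd j))) C"
  and neg: "negligible (?S - (\<Union>i\<in>C. cball (fst i) (snd i)))"
  by (rule Vitali_covering_theorem_cballs[OF Kp(1) cov]; (assumption | (rule that; assumption)))
 define V where "V = (\<Union>i\<in>C. cball (fst i) (snd i))"
 have fin: "measure lebesgue (\<Union>i\<in>F. cball (fst i) (snd i)) \<le> e" if F: "F \<subseteq> C" "finite F" for F
 proof -
  have FK: "i \<in> K" if "i \<in> F" for i using that F(1) C(2) by (meson subsetD)
  have lm: "cball (fst i) (snd i) - A \<in> lmeasurable" for i
   using A by (intro fmeasurable_Diff) auto
  have "(\<Sum>i\<in>F. measure lebesgue (cball (fst i) (snd i) - A)) = measure lebesgue (\<Union>i\<in>F. cball (fst i) (snd i) - A)"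
  proof (rule measure_UNION'[OF F(2) lm, symmetric])
   show "pairwise (\<lambda>i j. disjnt (cball (fst i) (snd i) - A) (cball (fst j) (snd j) - A)) F"
    by (rule pairwise_mono[OF disj _ F(1)]) (auto simp: disjnt_def)
  qed
  also have "\<dots> \<le> measure lebesgue (T - A)"
  proof (rule measure_mono_fmeasurable[OF _ _ T(3)])
   show "(\<Union>i\<in>F. cball (fst i) (snd i) - A) \<subseteq> T - A" using Kp(2)[OF FK] by (intro UN_least Diff_mono) auto
   show "(\<Union>i\<in>F. cball (fst i) (snd i) - A) \<in> sets lebesgue"
    using lm F(2) by (intro sets.finite_UN) (auto simp: fmeasurableD)
  qed
  finally have sum: "(\<Sum>i\<in>F. measure lebesgue (cball (fst i) (snd i) - A)) \<le> c * e / 2"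
   using mT by simp
  have "measure lebesgue (\<Union>i\<in>F. cball (fst i) (snd i)) \<le> (\<Sum>i\<in>F. measure lebesgue (cball (fst i) (snd i)))"
   by (rule measure_UNION_le[OF F(2)]) auto
  also have "\<dots> = (\<Sum>i\<in>F. 2 * snd i)"
   by (rule sum.cong) (use Kp(1)[OF FK] in \<open>simp_all add: cball_eq_atLeastAtMost less_imp_le\<close>)
  also have "\<dots> \<le> (\<Sum>i\<in>F. 2 / c * measure lebesgue (cball (fst i) (snd i) - A))"
  proof (rule sum_mono)
   fix i assume "i \<in> F"
   then have "c * snd i < measure lebesgue (cball (fst i) (snd i) - A)" by (intro Kp FK)
   then show "2 * snd i \<le> 2 / c * measure lebesgue (cball (fst i) (snd i) - A)"
    using c by (simp add: field_simps)
  qed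
  also have "\<dots> = 2 / c * (\<Sum>i\<in>F. measure lebesgue (cball (fst i) (snd i) - A))"
   by (simp add: sum_distrib_left)
  also have "\<dots> \<le> 2 / c * (c * e / 2)" using sum c by (intro mult_left_mono) auto
  also have "\<dots> = e" using c by simp
  finally show ?thesis .
 qed
 have V: "V \<in> lmeasurable" "measure lebesgue V \<le> e"
  unfolding V_def
  by (rule fmeasurable_UN_bound[OF C(1), where B = e] measure_UN_bound[OF C(1), where B = e]; (rule fin)?; simp)+
 have N: "?S - V \<in> lmeasurable" "measure lebesgue (?S - V) = 0"
  using neg unfolding V_def by (auto intro: negligible_imp_measurable negligible_imp_measure0)
 have "(?S - V) \<union> V \<in> lmeasurable" using N V by (intro fmeasurable.Un) auto
 moreover have "measure lebesgue ((?S - V) \<union> V) \<le> e"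
  using measure_Un_le[of "?S - V" lebesgue V] N V by (simp add: fmeasurableD)
 ultimately show "\<exists>T. ?S \<subseteq> T \<and> T \<in> lmeasurable \<and> measure lebesgue T \<le> e"
  by (intro exI[of _ "(?S - V) \<union> V"]) auto
qed

lemma AE_lborel_negligible: "negligible N \<Longrightarrow> AE x in lborel. x \<notin> N"
 using AE_completion_iff[of "\<lambda>x. x \<notin> N" lborel] AE_not_in[of N lebesgue]
 by (simp add: negligible_iff_null_sets)

text \<open>Almost every \<open>x\<close> is a density point of every set containing it on which \<open>g\<close> is close to a constant
 from a countable dense set; outside that set the bound of \<open>g\<close> suffices.\<close>

lemma lebesgue_points:
 fixes g :: "real \<Rightarrow> complex"
 assumes g[measurable]: "g \<in> borel_measurable borel" and B: "\<And>x. cmod (g x) \<le> B"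
 shows "AE x in lborel. \<forall>e>0. \<exists>d>0. \<forall>r. 0 < r \<and> r < d \<longrightarrow>
  (LINT t|lborel. indicator (cball x r) t * cmod (g t - g x)) \<le> e * r"
proof -
 obtain D :: "complex set" where D: "countable D" "\<And>X. open X \<Longrightarrow> X \<noteq> {} \<Longrightarrow> \<exists>d\<in>D. d \<in> X"
  using countable_dense_exists by (metis (full_types))
 define A where "A q n = {t. cmod (g t - q) < 1 / real (Suc n)}" for q n
 have A[measurable]: "A q n \<in> sets borel" for q n unfolding A_def by measurable
 define N where "N q n k = {x \<in> A q n. \<forall>d>0. \<exists>r. 0 < r \<and> r < d \<and>
  1 / real (Suc k) * r < measure lebesgue (cball x r - A q n)}" for q n k
 have "negligible (N q n k)" for q n k
  unfolding N_def by (rule density_points) (use A in auto)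
 then have ae1: "AE x in lborel. x \<notin> N q n k" for q n k by (rule AE_lborel_negligible)
 have ae: "AE x in lborel. \<forall>q\<in>D. \<forall>n k. x \<notin> N q n k"
  using ae1 D(1) by (simp add: AE_ball_countable AE_all_countable)
 have B0: "B \<ge> 0" using B[of 0] norm_ge_zero order_trans by blast
 show ?thesis
  using ae
 proof eventually_elim
  case (elim x)
  show ?case
  proof (intro allI impI)
   fix e :: real assume e: "e > 0"
   obtain n where n: "8 / e < real (Suc n)" using reals_Archimedean2[of "8 / e"] by (meson less_SucI of_nat_less_iff less_trans lessI)
   obtain k where k: "4 * B / e < real (Suc k)" using reals_Archimedean2[of "4 * B / e"] by (meson of_nat_less_iff less_trans lessI)
   obtain q where q: "q \<in> D" "q \<in> ball (g x) (1 / real (Suc n))"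
    using D(2)[of "ball (g x) (1 / real (Suc n))"] by auto
   then have xA: "x \<in> A q n" by (simp add: A_def dist_norm)
   then obtain d where d: "d > 0" "\<And>r. 0 < r \<Longrightarrow> r < d \<Longrightarrow> measure lebesgue (cball x r - A q n) \<le> 1 / real (Suc k) * r"
   proof -
    have "x \<notin> N q n k" using elim q(1) by blast
    then have "\<exists>d>0. \<forall>r. 0 < r \<and> r < d \<longrightarrow> \<not> 1 / real (Suc k) * r < measure lebesgue (cball x r - A q n)"
     using xA unfolding N_def by blast
    then show thesis using that by (metis not_less)
   qed
   show "\<exists>d>0. \<forall>r. 0 < r \<and> r < d \<longrightarrow> (LINT t|lborel. indicator (cball x r) t * cmod (g t - g x)) \<le> e * r"
   proof (intro exI[of _ d] conjI allI impI d(1))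
    fix r assume r: "0 < r \<and> r < d"
    have fin: "emeasure lborel (cball x r) < \<infinity>" "emeasure lborel (cball x r - A q n) < \<infinity>"
     using emeasure_compact_finite[of "cball x r"] emeasure_mono[of "cball x r - A q n" "cball x r" lborel]
     by (auto simp: less_top[symmetric] top_unique)
    have i1: "integrable lborel (\<lambda>t. indicator (cball x r) t * (2 / real (Suc n)))"
     "integrable lborel (\<lambda>t. indicator (cball x r - A q n) t * (2 * B))"
     by (intro integrable_mult_left integrable_real_indicator; use fin in simp)+
    have "(LINT t|lborel. indicator (cball x r) t * cmod (g t - g x))
      \<le> (LINT t|lborel. indicator (cball x r) t * (2 / real (Suc n)) + indicator (cball x r - A q n) t * (2 * B))"
    proof (rule integral_mono')
     show "integrable lborel (\<lambda>t. indicator (cball x r) t * (2 / real (Suc n)) + indicator (cball x r - A q n) t * (2 * B))"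
      using i1 by (rule Bochner_Integration.integrable_add)
     fix t
     have n0: "0 \<le> 2 / real (Suc n)" by simp
     have "cmod (g t - g x) \<le> 2 / real (Suc n)" if "t \<in> A q n"
     proof -
      have "cmod (g t - g x) \<le> cmod (g t - q) + cmod (g x - q)"
       using norm_triangle_ineq4[of "g t - q" "g x - q"] by simp
      then show ?thesis using that xA by (simp add: A_def)
     qed
     moreover have "cmod (g t - g x) \<le> 2 * B"
      using norm_triangle_ineq4[of "g t" "g x"] B[of t] B[of x] by simp
     ultimately show "indicator (cball x r) t * cmod (g t - g x)
       \<le> indicator (cball x r) t * (2 / real (Suc n)) + indicator (cball x r - A q n) t * (2 * B)"
      using B0 add_increasing[OF n0, of "cmod (g t - g x)" "2 * B"]
      by (cases "t \<in> cball x r"; cases "t \<in> A q n") (simp_all del: of_nat_Suc)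
     show "0 \<le> indicator (cball x r) t * (2 / real (Suc n)) + indicator (cball x r - A q n) t * (2 * B)"
      using n0 B0 by (intro add_nonneg_nonneg mult_nonneg_nonneg) auto
    qed
    also have "\<dots> = measure lebesgue (cball x r) * (2 / real (Suc n)) + measure lebesgue (cball x r - A q n) * (2 * B)"
     using i1 by (subst Bochner_Integration.integral_add) (auto simp: measure_completion)
    also have "\<dots> \<le> 2 * r * (2 / real (Suc n)) + 1 / real (Suc k) * r * (2 * B)"
     using d(2)[of r] r B0 by (intro add_mono mult_right_mono) (auto simp: cball_eq_atLeastAtMost)
    also have "\<dots> \<le> e / 2 * r + e / 2 * r"
    proof (rule add_mono)
     have "4 / real (Suc n) \<le> e / 2" using n e by (simp add: field_simps del: of_nat_Suc)
     then show "2 * r * (2 / real (Suc n)) \<le> e / 2 * r"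
      using mult_right_mono[of "4 / real (Suc n)" "e / 2" r] r by simp
     have "2 * B / real (Suc k) \<le> e / 2" using k e by (simp add: field_simps del: of_nat_Suc)
     then show "1 / real (Suc k) * r * (2 * B) \<le> e / 2 * r"
      using mult_right_mono[of "2 * B / real (Suc k)" "e / 2" r] r by (simp add: mult_ac)
    qed
    finally show "(LINT t|lborel. indicator (cball x r) t * cmod (g t - g x)) \<le> e * r" by simp
   qed
  qed
 qed
qed

subsection \<open>Lipschitz functions are differentiable almost everywhere\<close>

text \<open>If \<open>f\<close> is Lipschitz with constant \<open>L\<close>, then \<open>H x = f x + 2 L x\<close> is an increasing bijection
 that preserves null sets, so the Radon-Nikodym theorem applies to the measure of intervals
 \<open>H b - H a\<close>.\<close>

lemma increasing_lipschitz_density: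
 fixes H :: "real \<Rightarrow> real"
 assumes L: "L > 0" and low: "\<And>x y. x \<le> y \<Longrightarrow> L * (y - x) \<le> H y - H x"
  and up: "\<And>x y. x \<le> y \<Longrightarrow> H y - H x \<le> M * (y - x)"
 obtains h :: "real \<Rightarrow> ennreal" where "h \<in> borel_measurable borel"
  "\<And>a b. a \<le> b \<Longrightarrow> (\<integral>\<^sup>+x. h x * indicator {a<..<b} x \<partial>lborel) = ennreal (H b - H a)"
proof -
 have inc: "H x < H y" if "x < y" for x y
 proof -
  have "0 < L * (y - x)" using L that by simp
  also have "\<dots> \<le> H y - H x" using that by (intro low) simp
  finally show ?thesis by simp
 qed
 have "strict_mono H" by (rule strict_monoI) (rule inc)
 then have le_iff: "H x \<le> H y \<longleftrightarrow> x \<le> y" "H x < H y \<longleftrightarrow> x < y" for x y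
  by (simp_all add: strict_mono_less_eq strict_mono_less)
 have inj: "inj H" using \<open>strict_mono H\<close> by (rule strict_mono_imp_inj_on)
 have lip: "\<bar>H y - H x\<bar> \<le> M * \<bar>y - x\<bar>" for x y
  using up[of x y] up[of y x] le_iff(1)[of x y] le_iff(1)[of y x] by (cases "x \<le> y") auto
 have cont: "continuous_on UNIV H"
 proof (rule continuous_at_imp_continuous_on, rule ballI)
  fix x
  have "((\<lambda>y. M * \<bar>y - x\<bar>) \<longlongrightarrow> M * \<bar>x - x\<bar>) (at x)" by (intro tendsto_intros)
  then have lim: "((\<lambda>y. M * \<bar>y - x\<bar>) \<longlongrightarrow> 0) (at x)" by simp
  have "((\<lambda>y. H y - H x) \<longlongrightarrow> 0) (at x)"
   by (rule Lim_null_comparison[OF _ lim]) (simp add: lip)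
  then show "isCont H x" by (simp add: isCont_def LIM_zero_iff)
 qed
 have surj: "\<exists>x. H x = y" for y
 proof -
  define K where "K = \<bar>y - H 0\<bar> / L"
  have K: "K \<ge> 0" "L * K = \<bar>y - H 0\<bar>" using L by (auto simp: K_def)
  have "- K \<le> K" using K(1) by simp
  moreover have "y \<le> H K" "H (- K) \<le> y" using low[of 0 K] low[of "- K" 0] K by auto
  moreover have "continuous_on {- K..K} H" using cont by (rule continuous_on_subset) simp
  ultimately show ?thesis using IVT'[of H "- K" y K] by blast
 qed
 obtain J where HJ1: "\<And>y. H (J y) = y" using surj by metis
 have HJ2: "J (H x) = x" for x using injD[OF inj HJ1] .
 note HJ = HJ1 HJ2
 have "J x \<le> J y" if "x \<le> y" for x y
  using that le_iff(1)[of "J x" "J y"] by (simp add: HJ1)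
 then have "mono J" by (rule monoI)
 then have J[measurable]: "J \<in> borel_measurable borel" by (rule borel_measurable_mono)
 define \<mu> where "\<mu> = distr lborel borel J"
 have vim: "J -` A = H ` A" for A
 proof (intro equalityI subsetI)
  show "x \<in> H ` A" if "x \<in> J -` A" for x
   using that HJ1[of x] by (metis imageI vimageD)
 qed (auto simp: HJ2)
 have "absolutely_continuous lborel \<mu>"
  unfolding absolutely_continuous_def
 proof
  fix A :: "real set" assume A: "A \<in> null_sets lborel"
  then have [measurable]: "A \<in> sets borel" by auto
  have "negligible A" using A by (simp add: negligible_iff_null_sets null_sets_completionI)
  then have "negligible (H ` A)"
   by (rule negligible_locally_Lipschitz_image[rotated]) (auto intro!: exI[of _ UNIV] exI[of _ M] lip)
  then have "H ` A \<in> null_sets lebesgue" by (simp add: negligible_iff_null_sets)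
  moreover have "H ` A \<in> sets lborel"
   using measurable_sets[OF J, of A] by (simp add: vim)
  ultimately have "H ` A \<in> null_sets lborel"
   by (simp add: null_sets_completion_iff)
  then have "emeasure lborel (J -` A) = 0" by (simp add: vim null_sets_def)
  then show "A \<in> null_sets \<mu>" by (simp add: \<mu>_def null_sets_def emeasure_distr)
 qed
 then obtain h where h: "h \<in> borel_measurable lborel" "density lborel h = \<mu>"
  using sigma_finite_measure.Radon_Nikodym[OF sigma_finite_lborel, of \<mu>] by (auto simp: \<mu>_def)
 show thesis
 proof
  show "h \<in> borel_measurable borel" using h(1) by simp
  fix a b :: real assume ab: "a \<le> b"
  have "(\<integral>\<^sup>+x. h x * indicator {a<..<b} x \<partial>lborel) = emeasure \<mu> {a<..<b}"
   using h by (simp add: emeasure_density flip: h(2))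
  also have "\<dots> = emeasure lborel (H ` {a<..<b})"
   by (simp add: \<mu>_def emeasure_distr vim)
  also have "H ` {a<..<b} = {H a<..<H b}"
  proof
   show "H ` {a<..<b} \<subseteq> {H a<..<H b}" using inc by auto
   show "{H a<..<H b} \<subseteq> H ` {a<..<b}"
   proof
    fix y assume "y \<in> {H a<..<H b}"
    then have "H a < H (J y)" "H (J y) < H b" by (simp_all add: HJ)
    then have "J y \<in> {a<..<b}" by (simp add: le_iff)
    then show "y \<in> H ` {a<..<b}" using HJ(1)[of y] by (metis imageI)
   qed
  qed
  finally show "(\<integral>\<^sup>+x. h x * indicator {a<..<b} x \<partial>lborel) = ennreal (H b - H a)"
   using ab le_iff by simp
 qed
qed

text \<open>Both \<open>2 L x + f x\<close> and \<open>2 L x - f x\<close> increase; the densities of their interval measures yield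
 the derivative.\<close>

lemma real_lipschitz_primitive:
 fixes f :: "real \<Rightarrow> real"
 assumes L: "L > 0" and lip: "\<And>x y. \<bar>f y - f x\<bar> \<le> L * \<bar>y - x\<bar>"
 obtains g where "g \<in> borel_measurable borel" "\<And>x. \<bar>g x\<bar> \<le> 2 * L"
  "\<And>a b. a \<le> b \<Longrightarrow> f b - f a = (LINT x|lborel. indicator {a<..<b} x * g x)"
proof -
 have lip2: "f y - f x \<le> L * (y - x)" "- (L * (y - x)) \<le> f y - f x" if "x \<le> y" for x y
  using lip[of y x] that by (auto simp: abs_le_iff)
 have H1: "L * (y - x) \<le> (f y + 2 * L * y) - (f x + 2 * L * x)"
   "(f y + 2 * L * y) - (f x + 2 * L * x) \<le> 3 * L * (y - x)"
   "L * (y - x) \<le> (2 * L * y - f y) - (2 * L * x - f x)"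
   "(2 * L * y - f y) - (2 * L * x - f x) \<le> 3 * L * (y - x)" if "x \<le> y" for x y
  using lip2[OF that] by (simp_all add: algebra_simps)
 obtain h1 where h1[measurable]: "h1 \<in> borel_measurable borel" and
  i1: "\<And>a b. a \<le> b \<Longrightarrow> (\<integral>\<^sup>+x. h1 x * indicator {a<..<b} x \<partial>lborel) = ennreal ((f b + 2 * L * b) - (f a + 2 * L * a))"
  using increasing_lipschitz_density[OF L H1(1) H1(2)] by blast
 obtain h2 where h2[measurable]: "h2 \<in> borel_measurable borel" and
  i2: "\<And>a b. a \<le> b \<Longrightarrow> (\<integral>\<^sup>+x. h2 x * indicator {a<..<b} x \<partial>lborel) = ennreal ((2 * L * b - f b) - (2 * L * a - f a))"
  using increasing_lipschitz_density[OF L H1(3) H1(4)] by blast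
 have "lborel = density lborel (\<lambda>x. ennreal (1 / (4 * L)) * (h1 x + h2 x))"
 proof (rule lborel_eqI)
  fix l u :: real assume "\<And>b. b \<in> Basis \<Longrightarrow> l \<bullet> b \<le> u \<bullet> b"
  then have lu: "l \<le> u" by simp
  have f: "\<bar>f u - f l\<bar> \<le> L * (u - l)" using lip[of u l] lu by simp
  have p: "0 \<le> L * (u - l)" using L lu by simp
  have "emeasure (density lborel (\<lambda>x. ennreal (1 / (4 * L)) * (h1 x + h2 x))) {l<..<u}
    = (\<integral>\<^sup>+x. ennreal (1 / (4 * L)) * (h1 x * indicator {l<..<u} x + h2 x * indicator {l<..<u} x) \<partial>lborel)"
   by (subst emeasure_density) (auto simp: algebra_simps)
  also have "\<dots> = ennreal (1 / (4 * L)) * ((\<integral>\<^sup>+x. h1 x * indicator {l<..<u} x \<partial>lborel) + (\<integral>\<^sup>+x. h2 x * indicator {l<..<u} x \<partial>lborel))"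
   by (simp add: nn_integral_cmult nn_integral_add)
  also have "\<dots> = ennreal (1 / (4 * L)) * ennreal (4 * L * (u - l))"
   unfolding i1[OF lu] i2[OF lu]
   by (subst ennreal_plus[symmetric]) (use f p in \<open>auto simp: algebra_simps abs_le_iff\<close>)
  also have "\<dots> = ennreal (u - l)"
   using L lu by (subst ennreal_mult[symmetric]) auto
  finally show "emeasure (density lborel (\<lambda>x. ennreal (1 / (4 * L)) * (h1 x + h2 x))) (box l u) = (\<Prod>b\<in>Basis. (u - l) \<bullet> b)"
   by simp
 qed simp
 then have "AE x in lborel. ennreal (1 / (4 * L)) * (h1 x + h2 x) = 1"
  by (intro sigma_finite_measure.density_unique[OF sigma_finite_lborel]) (auto simp: density_1)
 then have h1le: "AE x in lborel. h1 x \<le> ennreal (4 * L)"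
 proof eventually_elim
  case (elim x)
  have "ennreal (4 * L) * ennreal (1 / (4 * L)) = 1"
   using L by (subst ennreal_mult[symmetric]) (auto simp: ennreal_1)
  then have "h1 x + h2 x = ennreal (4 * L) * (ennreal (1 / (4 * L)) * (h1 x + h2 x))"
   by (simp add: mult.assoc[symmetric])
  also have "\<dots> = ennreal (4 * L)" using elim by simp
  finally show ?case by (metis add.commute le_iff_add)
 qed
 define g where "g x = enn2real (min (h1 x) (ennreal (4 * L))) - 2 * L" for x
 show thesis
 proof
  show gm[measurable]: "g \<in> borel_measurable borel" unfolding g_def by measurable
  have mle: "enn2real (min (h1 x) (ennreal (4 * L))) \<le> 4 * L" for x
   using L enn2real_mono[of "min (h1 x) (ennreal (4 * L))" "ennreal (4 * L)"] by simp
  show gb: "\<bar>g x\<bar> \<le> 2 * L" for x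
   using mle[of x] enn2real_nonneg[of "min (h1 x) (ennreal (4 * L))"] unfolding g_def by linarith
  fix a b :: real assume ab: "a \<le> b"
  have ii: "integrable lborel (\<lambda>x. indicator {a<..<b} x * k)" for k :: real
   using ab by (intro integrable_mult_left integrable_real_indicator) auto
  have gi: "integrable lborel (\<lambda>x. indicator {a<..<b} x * g x)"
   by (rule Bochner_Integration.integrable_bound[OF ii[of "2 * L"]])
     (use gb L in \<open>auto simp: indicator_def\<close>)
  have p: "0 \<le> (f b + 2 * L * b) - (f a + 2 * L * a)"
  proof -
   have "\<bar>f b - f a\<bar> \<le> L * (b - a)" using lip[of b a] ab by simp
   moreover have "0 \<le> L * (b - a)" using L ab by simp
   ultimately show ?thesis by (simp add: algebra_simps abs_le_iff)
  qed
  have "(LINT x|lborel. indicator {a<..<b} x * (g x + 2 * L)) = (f b + 2 * L * b) - (f a + 2 * L * a)"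
  proof -
   have "(\<integral>\<^sup>+x. ennreal (indicator {a<..<b} x * (g x + 2 * L)) \<partial>lborel) = (\<integral>\<^sup>+x. h1 x * indicator {a<..<b} x \<partial>lborel)"
   proof (rule nn_integral_cong_AE)
    show "AE x in lborel. ennreal (indicator {a<..<b} x * (g x + 2 * L)) = h1 x * indicator {a<..<b} x"
     using h1le
    proof eventually_elim
     case (elim x)
     then have "h1 x < top" using ennreal_less_top le_less_trans by blast
     then show ?case using elim by (simp add: g_def min_absorb1 indicator_def ennreal_enn2real)
    qed
   qed
   then have "(\<integral>\<^sup>+x. ennreal (indicator {a<..<b} x * (g x + 2 * L)) \<partial>lborel) = ennreal ((f b + 2 * L * b) - (f a + 2 * L * a))"
    by (simp only: i1[OF ab])
   moreover have "AE x in lborel. 0 \<le> indicator {a<..<b} x * (g x + 2 * L)"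
    using gb by (intro AE_I2) (auto simp: indicator_def abs_le_iff, smt (verit))
   ultimately show ?thesis
    using p by (intro integral_eq_nn_integral[THEN trans]) (auto)
  qed
  then have "(LINT x|lborel. indicator {a<..<b} x * g x + indicator {a<..<b} x * (2 * L)) = (f b + 2 * L * b) - (f a + 2 * L * a)"
   by (simp add: distrib_left)
  then show "f b - f a = (LINT x|lborel. indicator {a<..<b} x * g x)"
   using ab by (subst (asm) Bochner_Integration.integral_add[OF gi ii]) (simp add: algebra_simps)
 qed
qed

text \<open>The difference quotient at a Lebesgue point of the derivative converges; both components of a complex
 function are primitives of bounded functions.\<close>

theorem lipschitz_differentiable_AE:
 fixes f :: "real \<Rightarrow> complex"
 assumes lip: "\<And>x y. cmod (f y - f x) \<le> L * \<bar>y - x\<bar>"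
 shows "AE x in lborel. \<exists>c. \<forall>e>0. \<exists>d>0. \<forall>t. \<bar>t - x\<bar> < d \<longrightarrow> cmod (f t - f x - of_real (t - x) * c) \<le> e * \<bar>t - x\<bar>"
proof -
 define M where "M = \<bar>L\<bar> + 1"
 have M: "M > 0" "cmod (f y - f x) \<le> M * \<bar>y - x\<bar>" for x y
 proof -
  show "M > 0" by (simp add: M_def)
  have "L * \<bar>y - x\<bar> \<le> M * \<bar>y - x\<bar>" by (intro mult_right_mono) (auto simp: M_def)
  then show "cmod (f y - f x) \<le> M * \<bar>y - x\<bar>" using lip[of y x] by linarith
 qed
 have lipR: "\<bar>Re (f y) - Re (f x)\<bar> \<le> M * \<bar>y - x\<bar>" and lipI: "\<bar>Im (f y) - Im (f x)\<bar> \<le> M * \<bar>y - x\<bar>" for x y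
  using abs_Re_le_cmod[of "f y - f x"] abs_Im_le_cmod[of "f y - f x"] M(2)[of y x] by simp_all
 obtain g1 where g1[measurable]: "g1 \<in> borel_measurable borel" "\<And>x. \<bar>g1 x\<bar> \<le> 2 * M"
  and i1: "\<And>a b. a \<le> b \<Longrightarrow> Re (f b) - Re (f a) = (LINT x|lborel. indicator {a<..<b} x * g1 x)"
  using real_lipschitz_primitive[OF M(1) lipR] by blast
 obtain g2 where g2[measurable]: "g2 \<in> borel_measurable borel" "\<And>x. \<bar>g2 x\<bar> \<le> 2 * M"
  and i2: "\<And>a b. a \<le> b \<Longrightarrow> Im (f b) - Im (f a) = (LINT x|lborel. indicator {a<..<b} x * g2 x)"
  using real_lipschitz_primitive[OF M(1) lipI] by blast
 define g where "g x = Complex (g1 x) (g2 x)" for x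
 have gm[measurable]: "g \<in> borel_measurable borel"
  unfolding g_def by (simp add: borel_measurable_complex_iff)
 have gb: "cmod (g x) \<le> 4 * M" for x
  using cmod_le[of "g x"] g1(2)[of x] g2(2)[of x] by (simp add: g_def)
 have gi: "integrable lborel (\<lambda>x. indicator S x *\<^sub>R g x)" if S: "S \<in> sets borel" "emeasure lborel S < \<infinity>" for S
 proof (rule Bochner_Integration.integrable_bound)
  show "integrable lborel (\<lambda>x. indicator S x * (4 * M))"
   using S by (intro integrable_mult_left integrable_real_indicator) auto
  show "AE x in lborel. norm (indicator S x *\<^sub>R g x) \<le> norm (indicator S x * (4 * M))"
   using gb M(1) by (auto simp: indicator_def)
 qed (use S in simp)
 have i: "f b - f a = (LINT x|lborel. indicator {a<..<b} x *\<^sub>R g x)" if "a \<le> b" for a b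
 proof (rule complex_eqI)
  have int: "integrable lborel (\<lambda>x. indicator {a<..<b} x *\<^sub>R g x)" using that by (intro gi) auto
  show "Re (f b - f a) = Re (LINT x|lborel. indicator {a<..<b} x *\<^sub>R g x)"
   using i1[OF that] by (subst integral_Re[OF int, symmetric]) (simp add: g_def)
  show "Im (f b - f a) = Im (LINT x|lborel. indicator {a<..<b} x *\<^sub>R g x)"
   using i2[OF that] by (subst integral_Im[OF int, symmetric]) (simp add: g_def)
 qed
 have key: "cmod (f b - f a - of_real (b - a) * c) \<le> (LINT t|lborel. indicator (cball x r) t * cmod (g t - c))"
  if ab: "a \<le> b" "{a<..<b} \<subseteq> cball x r" for a b x r c
 proof -
  have ri: "integrable lborel (\<lambda>x. indicator S x :: real)" if "S \<in> sets borel" "emeasure lborel S < \<infinity>" for S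
   using that by (intro integrable_real_indicator) auto
  have ci: "integrable lborel (\<lambda>x. indicator S x *\<^sub>R c)" if "S \<in> sets borel" "emeasure lborel S < \<infinity>" for S
   by (rule integrable_scaleR_left[OF ri[OF that]])
  have fin: "emeasure lborel {a<..<b} < \<infinity>" "emeasure lborel (cball x r) < \<infinity>"
   using ab(1) emeasure_compact_finite[of "cball x r"] by auto
  have "(LINT x|lborel. indicator {a<..<b} x *\<^sub>R c) = (LINT x|lborel. indicator {a<..<b} x) *\<^sub>R c"
   by (rule integral_scaleR_left) (rule ri, use fin in auto)
  also have "\<dots> = of_real (b - a) * c" using ab(1) by (simp add: scaleR_conv_of_real)
  finally have "f b - f a - of_real (b - a) * c = (LINT x|lborel. indicator {a<..<b} x *\<^sub>R g x) - (LINT x|lborel. indicator {a<..<b} x *\<^sub>R c)"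
   using i[OF ab(1)] by simp
  also have "\<dots> = (LINT x|lborel. indicator {a<..<b} x *\<^sub>R g x - indicator {a<..<b} x *\<^sub>R c)"
   by (rule Bochner_Integration.integral_diff[symmetric]) (rule gi ci, use fin in auto)+
  also have "cmod \<dots> \<le> (LINT t|lborel. indicator (cball x r) t * cmod (g t - c))"
  proof (rule Bochner_Integration.integral_norm_bound_integral)
   show "integrable lborel (\<lambda>x. indicator {a<..<b} x *\<^sub>R g x - indicator {a<..<b} x *\<^sub>R c)"
    by (rule Bochner_Integration.integrable_diff) (rule gi ci, use fin in auto)+
   have "integrable lborel (\<lambda>t. indicator (cball x r) t *\<^sub>R g t - indicator (cball x r) t *\<^sub>R c)"
    by (rule Bochner_Integration.integrable_diff) (rule gi ci, use fin in auto)+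
   then have "integrable lborel (\<lambda>t. cmod (indicator (cball x r) t *\<^sub>R g t - indicator (cball x r) t *\<^sub>R c))"
    by (rule integrable_norm)
   moreover have "(\<lambda>t. cmod (indicator (cball x r) t *\<^sub>R g t - indicator (cball x r) t *\<^sub>R c)) = (\<lambda>t. indicator (cball x r) t * cmod (g t - c))"
    by (auto simp: fun_eq_iff indicator_def)
   ultimately show "integrable lborel (\<lambda>t. indicator (cball x r) t * cmod (g t - c))" by simp
   show "norm (indicator {a<..<b} t *\<^sub>R g t - indicator {a<..<b} t *\<^sub>R c) \<le> indicator (cball x r) t * cmod (g t - c)" for t
   proof (cases "t \<in> {a<..<b}")
    case True
    then have "t \<in> cball x r" using ab(2) by blast
    then show ?thesis using True by simp
   qed simp
  qed
  finally show ?thesis .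
 qed
 show ?thesis
  using lebesgue_points[OF gm gb]
 proof eventually_elim
  case (elim x)
  show ?case
  proof (intro exI[of _ "g x"] allI impI)
   fix e :: real assume "e > 0"
   then obtain d where d: "d > 0" "\<And>r. 0 < r \<Longrightarrow> r < d \<Longrightarrow>
     (LINT t|lborel. indicator (cball x r) t * cmod (g t - g x)) \<le> e * r"
    using elim by blast
   show "\<exists>d>0. \<forall>t. \<bar>t - x\<bar> < d \<longrightarrow> cmod (f t - f x - of_real (t - x) * g x) \<le> e * \<bar>t - x\<bar>"
   proof (intro exI[of _ d] conjI allI impI d(1))
    fix t assume t: "\<bar>t - x\<bar> < d"
    consider "t = x" | "t > x" | "t < x" by linarith
    then show "cmod (f t - f x - of_real (t - x) * g x) \<le> e * \<bar>t - x\<bar>"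
    proof cases
     case 2
     then have "cmod (f t - f x - of_real (t - x) * g x) \<le> (LINT s|lborel. indicator (cball x (t - x)) s * cmod (g s - g x))"
      by (intro key) (auto simp: dist_real_def)
     then show ?thesis using d(2)[of "t - x"] 2 t by simp
    next
     case 3
     have "cmod (f t - f x - of_real (t - x) * g x) = cmod (f x - f t - of_real (x - t) * g x)"
      by (subst norm_minus_cancel[symmetric]) (simp add: algebra_simps)
     also have "\<dots> \<le> (LINT s|lborel. indicator (cball x (x - t)) s * cmod (g s - g x))"
      using 3 by (intro key) (auto simp: dist_real_def)
     finally show ?thesis using d(2)[of "x - t"] 3 t by simp
    qed simp
   qed
  qed
 qed
qed

subsection \<open>Fatou's theorem\<close>

text \<open>Cauchy's formula for the derivative, with the reflected point used to improve the kernel.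
 The difference of the two Cauchy kernels is odd around the foot point and its modulus is
 bounded by \<open>4 \<eta> / ((t - x)\<^sup>2 + \<eta>\<^sup>2) / \<bar>t - x\<bar>\<close> on the real line, so that a first order
 expansion of the boundary values is enough.\<close>

lemma deriv_reflected_kernel:
 fixes F :: "complex \<Rightarrow> complex"
 assumes cont: "continuous_on (cbox a b) F" and hol: "F holomorphic_on box a b"
  and z: "z \<in> box a b" and z': "z' \<notin> cbox a b"
 shows "((\<lambda>w. F w * (1 / (w - z)\<^sup>2 - 1 / (w - z')\<^sup>2)) has_contour_integral (2 * pi * \<i> * deriv F z)) (rectpath a b)"
proof -
 have le: "Re a \<le> Re b" "Im a \<le> Im b" using z by (auto simp: in_box_complex_iff)
 let ?g = "rectpath a b"
 have g: "valid_path ?g" "path_image ?g \<subseteq> cbox a b" "pathfinish ?g = pathstart ?g"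
  using path_image_rectpath_subset_cbox[OF le] by auto
 have zg: "z \<notin> path_image ?g"
  using path_image_rectpath_inter_box[OF le] z by blast
 have int: "interior (cbox a b) = box a b" by (rule interior_cbox)
 define h where "h w = (if w = z then deriv F z else (F w - F z) / (w - z))" for w
 have hh: "h holomorphic_on box a b"
  unfolding h_def by (rule pole_lemma[OF hol]) (use z in \<open>simp add: interior_open[OF open_box]\<close>)
 have hc: "continuous_on (cbox a b) h"
  unfolding continuous_on_eq_continuous_within
 proof
  fix w assume w: "w \<in> cbox a b"
  show "continuous (at w within cbox a b) h"
  proof (cases "w = z")
   case True
   have "continuous_on (box a b) h" by (rule holomorphic_on_imp_continuous_on[OF hh])
   then have "isCont h w"
    unfolding True using z continuous_on_eq_continuous_at[OF open_box] by blast
   then show ?thesis by (rule continuous_at_imp_continuous_at_within)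
  next
   case False
   have "continuous (at w within cbox a b) F"
    using cont w by (simp add: continuous_on_eq_continuous_within)
   then have "continuous (at w within cbox a b) (\<lambda>w. (F w - F z) / (w - z))"
    using False by (intro continuous_intros) auto
   then show ?thesis
   proof (rule continuous_transform_within[where \<delta> = "dist w z"])
    show "(F v - F z) / (v - z) = h v" if "dist v w < dist w z" for v
    proof -
     have "v \<noteq> z" using that by (auto simp: dist_commute)
     then show ?thesis by (simp add: h_def)
    qed
   qed (use False w in auto)
  qed
 qed
 have "((\<lambda>w. h w / (w - z)) has_contour_integral (2 * pi * \<i> * winding_number ?g z * h z)) ?g"
 proof (rule Cauchy_integral_formula_weak[where S = "cbox a b" and k = "{}"])
  show "h field_differentiable at w" if "w \<in> interior (cbox a b) - {}" for w
   using that by (intro holomorphic_on_imp_differentiable_at[OF hh open_box]) (simp add: int)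
  show "z \<in> interior (cbox a b) - {}" using z by (simp add: int)
  show "path_image ?g \<subseteq> cbox a b - {z}" using g(2) zg by blast
 qed (rule convex_box hc g finite.emptyI)+
 then have 1: "((\<lambda>w. h w / (w - z)) has_contour_integral (2 * pi * \<i> * deriv F z)) ?g"
  using winding_number_rectpath[OF z] by (simp add: h_def)
 have "((\<lambda>w. F z / (w - z)\<^sup>2) has_contour_integral 0) ?g"
 proof (rule Cauchy_theorem_primitive[where S = "- {z}" and f = "\<lambda>w. - F z / (w - z)"])
  show "((\<lambda>w. - F z / (w - z)) has_field_derivative F z / (w - z)\<^sup>2) (at w within - {z})" if "w \<in> - {z}" for w
   using that by (auto intro!: derivative_eq_intros simp: power2_eq_square)
 qed (use g zg in auto)
 note 12 = has_contour_integral_add[OF 1 this]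
 have "((\<lambda>w. F w / (w - z)\<^sup>2) has_contour_integral (2 * pi * \<i> * deriv F z + 0)) ?g"
 proof (rule has_contour_integral_eq[OF 12])
  show "h w / (w - z) + F z / (w - z)\<^sup>2 = F w / (w - z)\<^sup>2" if "w \<in> path_image ?g" for w
  proof -
   have "w \<noteq> z" using that zg by auto
   then show ?thesis by (simp add: h_def power2_eq_square diff_divide_distrib)
  qed
 qed
 then have 2: "((\<lambda>w. F w / (w - z)\<^sup>2) has_contour_integral (2 * pi * \<i> * deriv F z)) ?g" by simp
 have 3: "((\<lambda>w. F w / (w - z')\<^sup>2) has_contour_integral 0) ?g"
 proof (rule Cauchy_theorem_convex[where S = "cbox a b" and K = "{}"])
  show "continuous_on (cbox a b) (\<lambda>w. F w / (w - z')\<^sup>2)"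
   using z' by (intro continuous_intros cont) auto
  show "(\<lambda>w. F w / (w - z')\<^sup>2) field_differentiable at w" if "w \<in> interior (cbox a b) - {}" for w
  proof -
   have w: "w \<in> box a b" using that by (simp add: int)
   then have "F field_differentiable at w"
    by (rule holomorphic_on_imp_differentiable_at[OF hol open_box])
   moreover have "w \<noteq> z'" using w z' box_subset_cbox by blast
   ultimately show ?thesis by (auto intro!: derivative_intros)
  qed
 qed (use g in auto)
 show ?thesis
  using has_contour_integral_diff[OF 2 3] by (simp add: right_diff_distrib)
qed

lemma reflected_kernel_eq:
 assumes "w \<noteq> Complex x y" "w \<noteq> Complex x (- y)"
 shows "1 / (w - Complex x y)\<^sup>2 - 1 / (w - Complex x (- y))\<^sup>2
  = 4 * \<i> * of_real y * (w - of_real x) / ((w - Complex x y)\<^sup>2 * (w - Complex x (- y))\<^sup>2)"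
proof -
 have "(w - Complex x (- y))\<^sup>2 - (w - Complex x y)\<^sup>2 = 4 * \<i> * of_real y * (w - of_real x)"
  by (simp add: power2_eq_square complex_eq_iff algebra_simps)
 then show ?thesis
  using assms by (subst diff_frac_eq) (auto simp: mult.commute)
qed

lemma reflected_kernel_bound:
 assumes y: "0 < y" and r: "0 < r" "r \<le> cmod (w - Complex x y)" "r \<le> cmod (w - Complex x (- y))"
  and R: "cmod (w - of_real x) \<le> R"
 shows "cmod (1 / (w - Complex x y)\<^sup>2 - 1 / (w - Complex x (- y))\<^sup>2) \<le> 4 * R / r ^ 4 * y"
proof -
 have "w \<noteq> Complex x y" "w \<noteq> Complex x (- y)" using r by auto
 note eq = reflected_kernel_eq[OF this]
 have "cmod (1 / (w - Complex x y)\<^sup>2 - 1 / (w - Complex x (- y))\<^sup>2)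
   = 4 * y * cmod (w - of_real x) / ((cmod (w - Complex x y))\<^sup>2 * (cmod (w - Complex x (- y)))\<^sup>2)"
  unfolding eq using y by (simp add: norm_mult norm_divide norm_power)
 also have "\<dots> \<le> 4 * y * R / (r\<^sup>2 * r\<^sup>2)"
  using r y R by (intro frac_le mult_mono power_mono mult_left_mono mult_nonneg_nonneg) (auto intro: order_trans[OF norm_ge_zero R])
 also have "\<dots> = 4 * R / r ^ 4 * y" by (simp add: power4_eq_xxxx power2_eq_square mult_ac)
 finally show ?thesis .
qed

lemma arctan_kernel_integral:
 fixes x y d :: real
 assumes y: "y > 0" and d: "d > 0"
 shows "((\<lambda>t. y / ((t - x)\<^sup>2 + y\<^sup>2)) has_integral (arctan (d / y) - arctan (- d / y))) {x - d..x + d}"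
proof -
 have "((\<lambda>t. arctan ((t - x) / y)) has_vector_derivative (y / ((t - x)\<^sup>2 + y\<^sup>2))) (at t within {x - d..x + d})" for t
  unfolding has_real_derivative_iff_has_vector_derivative[symmetric]
  using y by (auto intro!: derivative_eq_intros simp: power2_eq_square field_simps)
 then have "((\<lambda>t. y / ((t - x)\<^sup>2 + y\<^sup>2)) has_integral (arctan ((x + d - x) / y) - arctan ((x - d - x) / y))) {x - d..x + d}"
  using d by (intro fundamental_theorem_of_calculus) auto
 then show ?thesis by simp
qed

text \<open>The reflected kernel is integrable against a first order error uniformly in the height, and it
 reproduces linear functions; so only the differential of the boundary values at \<open>x\<close> enters.\<close>

lemma vertical_limit_deriv:
 fixes F :: "complex \<Rightarrow> complex"
 assumes cont: "continuous_on (cbox (Complex (x - 1) 0) (Complex (x + 1) 1)) F"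
  and hol: "F holomorphic_on box (Complex (x - 1) 0) (Complex (x + 1) 1)"
  and diff: "\<And>e. e > 0 \<Longrightarrow> \<exists>d>0. \<forall>t. \<bar>t - x\<bar> < d \<longrightarrow>
   cmod (F (of_real t) - F (of_real x) - of_real (t - x) * c) \<le> e * \<bar>t - x\<bar>"
 shows "((\<lambda>y. deriv F (Complex x y)) \<longlongrightarrow> c) (at_right 0)"
proof (rule tendstoI)
 fix e0 :: real assume e0: "e0 > 0"
 define e where "e = e0 / 4"
 have e: "e > 0" using e0 by (simp add: e_def)
 obtain d' where d': "d' > 0" "\<And>t. \<bar>t - x\<bar> < d' \<Longrightarrow>
   cmod (F (of_real t) - F (of_real x) - of_real (t - x) * c) \<le> e * \<bar>t - x\<bar>"
  using diff[OF e] by blast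
 define d where "d = min (d' / 2) (1 / 2)"
 have d: "0 < d" "d \<le> 1 / 2" "d < d'" using d'(1) by (auto simp: d_def)
 define a where "a = complex_of_real (x - d)"
 define b where "b = Complex (x + d) 1"
 define F1 where "F1 w = F w - F (of_real x) - c * (w - of_real x)" for w
 have sub: "cbox a b \<subseteq> cbox (Complex (x - 1) 0) (Complex (x + 1) 1)"
  "box a b \<subseteq> box (Complex (x - 1) 0) (Complex (x + 1) 1)"
  using d by (auto simp: a_def b_def in_cbox_complex_iff in_box_complex_iff)
 have cont1: "continuous_on (cbox a b) F1"
  unfolding F1_def by (intro continuous_intros continuous_on_subset[OF cont sub(1)])
 have hol0: "F holomorphic_on box a b" by (rule holomorphic_on_subset[OF hol sub(2)])
 have hol1: "F1 holomorphic_on box a b"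
  unfolding F1_def by (intro holomorphic_intros hol0)
 have "compact (F1 ` cbox a b)" by (intro compact_continuous_image cont1 compact_cbox)
 then obtain M where M: "\<And>w. w \<in> cbox a b \<Longrightarrow> cmod (F1 w) \<le> M"
  by (meson bounded_iff compact_imp_bounded imageI)
 have "a \<in> cbox a b" using d by (auto simp: a_def b_def in_cbox_complex_iff)
 then have M0: "M \<ge> 0" using M norm_ge_zero order_trans by blast
 have bot: "cmod (F1 (of_real t)) \<le> e * \<bar>t - x\<bar>" if "\<bar>t - x\<bar> \<le> d" for t
  using d'(2)[of t] that d(3) by (simp add: F1_def mult.commute)
 define C where "C = M * (4 * 2 / d ^ 4) * 4"
 have C0: "C \<ge> 0" using M0 d by (simp add: C_def)
 have main: "cmod (deriv F (Complex x y) - c) \<le> 2 * e + C * y" if y: "0 < y" "y < 1 / 2" for y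
 proof -
  define z where "z = Complex x y"
  define z' where "z' = Complex x (- y)"
  have zb: "z \<in> box a b" and z'b: "z' \<notin> cbox a b"
   using y d by (auto simp: z_def z'_def a_def b_def in_box_complex_iff in_cbox_complex_iff)
  define k where "k w = F1 w * (1 / (w - z)\<^sup>2 - 1 / (w - z')\<^sup>2)" for w
  have dF: "deriv F1 z = deriv F z - c"
  proof -
   have "F field_differentiable at z"
    by (rule holomorphic_on_imp_differentiable_at[OF hol0 open_box zb])
   then have "(F has_field_derivative deriv F z) (at z)" by (simp add: DERIV_deriv_iff_field_differentiable)
   then have "(F1 has_field_derivative (deriv F z - c)) (at z)"
    unfolding F1_def by (auto intro!: derivative_eq_intros)
   then show ?thesis by (rule DERIV_imp_deriv)
  qed
  have ci: "(k has_contour_integral (2 * pi * \<i> * (deriv F z - c))) (rectpath a b)"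
   using deriv_reflected_kernel[OF cont1 hol1 zb z'b] unfolding k_def dF .
  define a2 where "a2 = complex_of_real (x + d)"
  define a4 where "a4 = Complex (x - d) 1"
  have rp: "rectpath a b = linepath a a2 +++ linepath a2 b +++ linepath b a4 +++ linepath a4 a"
   by (simp add: rectpath_def Let_def a_def b_def a2_def a4_def complex_of_real_def)
  have kint: "k contour_integrable_on rectpath a b" using ci by (auto simp: contour_integrable_on_def)
  have i1: "k contour_integrable_on linepath a a2" and i2: "k contour_integrable_on linepath a2 b"
   and i3: "k contour_integrable_on linepath b a4" and i4: "k contour_integrable_on linepath a4 a"
   using kint unfolding rp by (auto dest!: contour_integrable_joinD1 contour_integrable_joinD2)
  have eq: "2 * pi * \<i> * (deriv F z - c) = contour_integral (linepath a a2) k +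
    (contour_integral (linepath a2 b) k + (contour_integral (linepath b a4) k + contour_integral (linepath a4 a) k))"
   using contour_integral_unique[OF ci] i1 i2 i3 i4 unfolding rp
   by (simp add: contour_integrable_join)
  have side: "cmod (k w) \<le> M * (4 * 2 / d ^ 4) * y"
   if w: "w \<in> cbox a b" "\<bar>Re w - x\<bar> = d \<or> Im w = 1" for w
  proof -
   have "d \<le> cmod (w - z) \<and> d \<le> cmod (w - z')"
   proof (cases "Im w = 1")
    case True
    then show ?thesis
     using abs_Im_le_cmod[of "w - z"] abs_Im_le_cmod[of "w - z'"] y d by (auto simp: z_def z'_def)
   next
    case False
    then show ?thesis
     using abs_Re_le_cmod[of "w - z"] abs_Re_le_cmod[of "w - z'"] w by (auto simp: z_def z'_def)
   qed
   moreover have "cmod (w - of_real x) \<le> 2"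
   proof -
    have "\<bar>Re (w - of_real x)\<bar> \<le> 1" "\<bar>Im (w - of_real x)\<bar> \<le> 1"
     using w(1) d by (auto simp: a_def b_def in_cbox_complex_iff)
    then show ?thesis using cmod_le[of "w - of_real x"] by linarith
   qed
   ultimately have "cmod (1 / (w - z)\<^sup>2 - 1 / (w - z')\<^sup>2) \<le> 4 * 2 / d ^ 4 * y"
    unfolding z_def z'_def using y d by (intro reflected_kernel_bound) auto
   then have "cmod (F1 w) * cmod (1 / (w - z)\<^sup>2 - 1 / (w - z')\<^sup>2) \<le> M * (4 * 2 / d ^ 4 * y)"
    using M[OF w(1)] M0 by (intro mult_mono) auto
   then show ?thesis by (simp add: k_def norm_mult mult.assoc)
  qed
  have segs: "closed_segment a2 b \<subseteq> cbox a b" "closed_segment b a4 \<subseteq> cbox a b" "closed_segment a4 a \<subseteq> cbox a b"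
  proof -
   have "a \<in> cbox a b" "b \<in> cbox a b" "a2 \<in> cbox a b" "a4 \<in> cbox a b"
    using d by (simp_all add: a_def b_def a2_def a4_def in_cbox_complex_iff)
   then show "closed_segment a2 b \<subseteq> cbox a b" "closed_segment b a4 \<subseteq> cbox a b" "closed_segment a4 a \<subseteq> cbox a b"
    by (simp_all only: closed_segment_subset convex_box)
  qed
  have B0: "0 \<le> M * (4 * 2 / d ^ 4) * y" using M0 d y by simp
  have s2: "cmod (contour_integral (linepath a2 b) k) \<le> M * (4 * 2 / d ^ 4) * y * cmod (b - a2)"
  proof (rule contour_integral_bound_linepath[OF i2 B0 side])
   fix w assume w: "w \<in> closed_segment a2 b"
   then show "w \<in> cbox a b" using segs by blast
   have "Re w = x + d"
    using w unfolding in_segment by clarify (simp add: a2_def b_def algebra_simps)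
   then show "\<bar>Re w - x\<bar> = d \<or> Im w = 1" using d by auto
  qed
  have s3: "cmod (contour_integral (linepath b a4) k) \<le> M * (4 * 2 / d ^ 4) * y * cmod (a4 - b)"
  proof (rule contour_integral_bound_linepath[OF i3 B0 side])
   fix w assume w: "w \<in> closed_segment b a4"
   then show "w \<in> cbox a b" using segs by blast
   have "Im w = 1"
    using w unfolding in_segment by clarify (simp add: a4_def b_def algebra_simps)
   then show "\<bar>Re w - x\<bar> = d \<or> Im w = 1" by auto
  qed
  have s4: "cmod (contour_integral (linepath a4 a) k) \<le> M * (4 * 2 / d ^ 4) * y * cmod (a - a4)"
  proof (rule contour_integral_bound_linepath[OF i4 B0 side])
   fix w assume w: "w \<in> closed_segment a4 a"
   then show "w \<in> cbox a b" using segs by blast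
   have "Re w = x - d"
    using w unfolding in_segment by clarify (simp add: a4_def a_def algebra_simps)
   then show "\<bar>Re w - x\<bar> = d \<or> Im w = 1" using d by auto
  qed
  have len: "cmod (b - a2) = 1" "cmod (a4 - b) = 2 * d" "cmod (a - a4) = 1"
  proof -
   have "b - a2 = \<i>" "a4 - b = of_real (- 2 * d)" "a - a4 = - \<i>"
    by (simp_all add: a_def b_def a2_def a4_def complex_eq_iff)
   then show "cmod (b - a2) = 1" "cmod (a4 - b) = 2 * d" "cmod (a - a4) = 1"
    using d(1) by (simp_all only: norm_minus_cancel norm_ii norm_of_real)
  qed
  have s1: "cmod (contour_integral (linepath a a2) k) \<le> 4 * e * pi"
  proof -
   have ar: "a \<in> \<real>" "a2 \<in> \<real>" "Re a < Re a2" using d by (auto simp: a_def a2_def)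
   have ki: "(\<lambda>t. k (of_real t)) integrable_on {x - d..x + d}"
    using i1 unfolding contour_integrable_on_def has_contour_integral_linepath_Reals_iff[OF ar] integrable_on_def
    by (simp add: a_def a2_def)
   note at = arctan_kernel_integral[OF y(1) d(1), of x]
   have at4: "((\<lambda>t. 4 * e * (y / ((t - x)\<^sup>2 + y\<^sup>2))) has_integral 4 * e * (arctan (d / y) - arctan (- d / y))) {x - d..x + d}"
    by (rule has_integral_mult_right[OF at])
   have kb: "cmod (k (of_real t)) \<le> 4 * e * (y / ((t - x)\<^sup>2 + y\<^sup>2))" if t: "t \<in> {x - d..x + d}" for t
   proof -
    have td: "\<bar>t - x\<bar> \<le> d" using t by auto
    have ne: "of_real t \<noteq> z" "of_real t \<noteq> z'" using y by (auto simp: z_def z'_def complex_eq_iff)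
    have cm: "(cmod (of_real t - z))\<^sup>2 = (t - x)\<^sup>2 + y\<^sup>2" "(cmod (of_real t - z'))\<^sup>2 = (t - x)\<^sup>2 + y\<^sup>2"
     by (simp_all add: z_def z'_def cmod_power2)
    define Q where "Q = (t - x)\<^sup>2 + y\<^sup>2"
    have Q: "Q > 0" "(t - x)\<^sup>2 \<le> Q" using y by (auto simp: Q_def add_nonneg_pos)
    have tx: "cmod (complex_of_real t - complex_of_real x) = \<bar>t - x\<bar>"
     by (metis norm_of_real of_real_diff)
    have "cmod (1 / (of_real t - z)\<^sup>2 - 1 / (of_real t - z')\<^sup>2) = 4 * y * \<bar>t - x\<bar> / (Q * Q)"
     using ne unfolding z_def z'_def
     by (subst reflected_kernel_eq)
       (use y cm tx in \<open>auto simp: norm_mult norm_divide norm_power Q_def z_def z'_def\<close>)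
    then have "cmod (k (of_real t)) = cmod (F1 (of_real t)) * (4 * y * \<bar>t - x\<bar> / (Q * Q))"
     by (simp add: k_def norm_mult)
    also have "\<dots> \<le> (e * \<bar>t - x\<bar>) * (4 * y * \<bar>t - x\<bar> / (Q * Q))"
     using bot[OF td] y Q by (intro mult_right_mono) auto
    also have "\<dots> = 4 * e * y * ((t - x)\<^sup>2 / (Q * Q))"
     by (simp add: power2_eq_square)
    also have "(t - x)\<^sup>2 / (Q * Q) \<le> Q / (Q * Q)"
     using Q by (intro divide_right_mono) auto
    also have "4 * e * y * (Q / (Q * Q)) = 4 * e * (y / Q)" using Q by simp
    finally show ?thesis using e y by (simp add: Q_def mult_left_mono)
   qed
   have "cmod (integral {x - d..x + d} (\<lambda>t. k (of_real t))) \<le> integral {x - d..x + d} (\<lambda>t. 4 * e * (y / ((t - x)\<^sup>2 + y\<^sup>2)))"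
    by (rule Henstock_Kurzweil_Integration.integral_norm_bound_integral[OF ki has_integral_integrable[OF at4] kb])
   also have "\<dots> = 4 * e * (arctan (d / y) - arctan (- d / y))"
    by (rule integral_unique[OF at4])
   also have "\<dots> \<le> 4 * e * pi"
    using arctan_bounded[of "d / y"] arctan_bounded[of "- d / y"] e by (intro mult_left_mono) auto
   finally show ?thesis
    using contour_integral_linepath_Reals_eq[OF ar, of k] by (simp add: a_def a2_def)
  qed
  have "2 * pi * cmod (deriv F z - c) = cmod (2 * pi * \<i> * (deriv F z - c))"
   by (simp add: norm_mult)
  also have "\<dots> \<le> cmod (contour_integral (linepath a a2) k) + (cmod (contour_integral (linepath a2 b) k)
    + (cmod (contour_integral (linepath b a4) k) + cmod (contour_integral (linepath a4 a) k)))"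
   unfolding eq by (rule norm_triangle_mono[OF order_refl norm_triangle_mono[OF order_refl norm_triangle_ineq]])
  also have "\<dots> \<le> 4 * e * pi + (M * (4 * 2 / d ^ 4) * y * 1 + (M * (4 * 2 / d ^ 4) * y * 2 + M * (4 * 2 / d ^ 4) * y * 1))"
  proof (intro add_mono s1)
   show "cmod (contour_integral (linepath b a4) k) \<le> M * (4 * 2 / d ^ 4) * y * 2"
    using s3 mult_left_mono[OF _ B0, of "2 * d" 2] d len by simp
  qed (use s2 s4 len in simp_all)
  also have "\<dots> = 4 * e * pi + C * y" by (simp add: C_def)
  also have "\<dots> \<le> 4 * e * pi + C * y * (2 * pi)"
  proof (rule add_left_mono)
   have "C * y * 1 \<le> C * y * (2 * pi)"
    by (rule mult_left_mono) (use pi_gt3 C0 y in auto)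
   then show "C * y \<le> C * y * (2 * pi)" by simp
  qed
  finally have "2 * pi * cmod (deriv F z - c) \<le> 2 * pi * (2 * e + C * y)"
   by (simp add: algebra_simps)
  then show ?thesis by (simp add: z_def)
 qed
 have "((\<lambda>y. 2 * e + C * y) \<longlongrightarrow> 2 * e + C * 0) (at_right 0)" by (intro tendsto_intros)
 moreover have "2 * e + C * 0 < e0" using e0 by (simp add: e_def)
 ultimately have "eventually (\<lambda>y. 2 * e + C * y < e0) (at_right 0)"
  by (rule order_tendstoD(2))
 moreover have "eventually (\<lambda>y. 0 < y \<and> y < 1 / 2) (at_right (0::real))"
  by (rule eventually_at_rightI[of 0 "1/2"]) auto
 ultimately show "eventually (\<lambda>y. dist (deriv F (Complex x y)) c < e0) (at_right 0)"
 proof eventually_elim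
  case (elim y)
  then show ?case using main[of y] by (simp add: dist_norm)
 qed
qed

lemma open_strip: "open strip" and convex_strip: "convex strip"
proof -
 have eq: "strip = {z. 0 < Im z} \<inter> {z. Im z < pi}" by (auto simp: strip_def)
 show "open strip" unfolding eq by (intro open_Int open_halfspace_Im_gt open_halfspace_Im_lt)
 show "convex strip" unfolding eq by (intro convex_Int convex_halfspace_Im_gt convex_halfspace_Im_lt)
qed

lemma Complex_in_strip [simp]: "Complex x y \<in> strip \<longleftrightarrow> 0 < y \<and> y < pi"
 by (simp add: strip_def)

lemma Hinf_bound:
 assumes "G \<in> Hinf"
 obtains B where "B \<ge> 0" "\<And>z. z \<in> strip \<Longrightarrow> cmod (G z) \<le> B"
proof -
 obtain B where B: "\<And>z. z \<in> strip \<Longrightarrow> cmod (G z) \<le> B"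
  using assms unfolding Hinf_def bounded_iff by auto
 have "Complex 0 1 \<in> strip" using pi_gt3 by simp
 then have "B \<ge> 0" using B norm_ge_zero order_trans by blast
 then show thesis using that B by blast
qed

text \<open>The function is the derivative of its primitive, which is Lipschitz with the bound of the function as
 constant and therefore has Lipschitz boundary values.\<close>

theorem Fatou_lower:
 assumes G: "G \<in> Hinf"
 shows "AE x in lborel. \<exists>l. ((\<lambda>y. G (Complex x y)) \<longlongrightarrow> l) (at_right 0)"
proof -
 have hol: "G holomorphic_on strip" using G by (simp add: Hinf_def)
 obtain B where B: "B \<ge> 0" "\<And>z. z \<in> strip \<Longrightarrow> cmod (G z) \<le> B"
  using Hinf_bound[OF G] by blast
 obtain F where F: "\<And>z. z \<in> strip \<Longrightarrow> (F has_field_derivative G z) (at z within strip)"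
  using holomorphic_convex_primitive'[OF convex_strip open_strip hol] by blast
 have "B-lipschitz_on strip F"
  by (rule lipschitz_onI) (use field_differentiable_bound[OF convex_strip F B(2)] B(1) in \<open>auto simp: dist_norm norm_minus_commute\<close>)
 then obtain F' where F': "B-lipschitz_on (closure strip) F'" "\<And>z. z \<in> strip \<Longrightarrow> F' z = F z"
  using lipschitz_extend_closure by blast
 have cl: "Complex x y \<in> closure strip" if "0 \<le> y" "y \<le> 1" for x y
 proof (rule closure_sequential[THEN iffD2], intro exI conjI allI)
  fix n
  have "y + (1 - y / 2) / real (Suc n) \<le> 2"
  proof -
   have "(1 - y / 2) / real (Suc n) \<le> (1 - y / 2) / 1" using that by (intro divide_left_mono) auto
   then show ?thesis using that by simp
  qed
  moreover have "0 < y + (1 - y / 2) / real (Suc n)" using that by (intro add_nonneg_pos) auto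
  ultimately show "Complex x (y + (1 - y / 2) / real (Suc n)) \<in> strip"
   using pi_gt3 by simp
  show "(\<lambda>n. Complex x (y + (1 - y / 2) / real (Suc n))) \<longlonglongrightarrow> Complex x y"
   by (rule tendsto_Complex) (auto intro: tendsto_const, real_asymp)
 qed
 have lip: "cmod (F' (of_real t) - F' (of_real s)) \<le> B * \<bar>t - s\<bar>" for s t
 proof -
  have "complex_of_real u \<in> closure strip" for u using cl[of 0 u] by (simp add: complex_of_real_def)
  then have "dist (F' (of_real t)) (F' (of_real s)) \<le> B * dist (of_real t) (of_real s :: complex)"
   using lipschitz_onD[OF F'(1)] by blast
  then show ?thesis by (simp add: dist_norm flip: of_real_diff)
 qed
 show ?thesis
  using lipschitz_differentiable_AE[of "\<lambda>t. F' (of_real t)" B, OF lip]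
 proof eventually_elim
  case (elim x)
  then obtain c where c: "\<And>e. e > 0 \<Longrightarrow> \<exists>d>0. \<forall>t. \<bar>t - x\<bar> < d \<longrightarrow>
    cmod (F' (of_real t) - F' (of_real x) - of_real (t - x) * c) \<le> e * \<bar>t - x\<bar>" by blast
  have sub: "cbox (Complex (x - 1) 0) (Complex (x + 1) 1) \<subseteq> closure strip"
   "box (Complex (x - 1) 0) (Complex (x + 1) 1) \<subseteq> strip"
  proof -
   show "cbox (Complex (x - 1) 0) (Complex (x + 1) 1) \<subseteq> closure strip"
   proof
    fix w assume "w \<in> cbox (Complex (x - 1) 0) (Complex (x + 1) 1)"
    then show "w \<in> closure strip" using cl[of "Im w" "Re w"] by (simp add: in_cbox_complex_iff)
   qed
   show "box (Complex (x - 1) 0) (Complex (x + 1) 1) \<subseteq> strip"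
    using pi_gt3 by (auto simp: in_box_complex_iff strip_def)
  qed
  have dF': "(F' has_field_derivative G z) (at z)" if "z \<in> strip" for z
   using F[OF that] has_field_derivative_transform_within_open[of F "G z" z strip F'] F'(2) that open_strip
   by (simp add: at_within_open[OF that open_strip])
  have "((\<lambda>y. deriv F' (Complex x y)) \<longlongrightarrow> c) (at_right 0)"
  proof (rule vertical_limit_deriv[OF _ _ c])
   show "continuous_on (cbox (Complex (x - 1) 0) (Complex (x + 1) 1)) F'"
    using continuous_on_subset[OF lipschitz_on_continuous_on[OF F'(1)] sub(1)] .
   show "F' holomorphic_on box (Complex (x - 1) 0) (Complex (x + 1) 1)"
    unfolding holomorphic_on_def field_differentiable_def
    by (rule ballI, rule exI, rule has_field_derivative_at_within, rule dF', erule subsetD[OF sub(2)])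
  qed
  moreover have "eventually (\<lambda>y. deriv F' (Complex x y) = G (Complex x y)) (at_right 0)"
  proof -
   have "eventually (\<lambda>y. 0 < y \<and> y < pi) (at_right (0::real))"
    by (rule eventually_at_rightI[of 0 pi]) auto
   then show ?thesis by eventually_elim (intro DERIV_imp_deriv dF', simp)
  qed
  ultimately have "((\<lambda>y. G (Complex x y)) \<longlongrightarrow> c) (at_right 0)"
   by (rule Lim_transform_eventually)
  then show ?case by blast
 qed
qed

lemma lower_bv_tendsto:
 assumes "\<exists>l. ((\<lambda>y. G (Complex x y)) \<longlongrightarrow> l) (at_right 0)"
 shows "((\<lambda>y. G (Complex x y)) \<longlongrightarrow> lower_bv G x) (at_right 0)"
proof -
 obtain l where l: "((\<lambda>y. G (Complex x y)) \<longlongrightarrow> l) (at_right 0)" using assms by blast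
 then have "lower_bv G x = l"
  unfolding lower_bv_def by (intro tendsto_Lim) auto
 then show ?thesis using l by simp
qed

text \<open>In this form of the Cauchy criterion the outer quantifiers are countable.\<close>

lemma right_limit_iff_Cauchy:
 fixes F :: "real \<Rightarrow> complex"
 shows "(\<exists>l. (F \<longlongrightarrow> l) (at_right 0)) \<longleftrightarrow>
  (\<forall>k::nat. \<exists>n::nat. \<forall>q r. 0 < q \<longrightarrow> q < 1 / real (Suc n) \<longrightarrow> 0 < r \<longrightarrow> r < 1 / real (Suc n) \<longrightarrow>
   dist (F q) (F r) \<le> 1 / real (Suc k))" (is "?L \<longleftrightarrow> ?R")
proof
 assume ?L
 then obtain l where l: "(F \<longlongrightarrow> l) (at_right 0)" by blast
 show ?R
 proof
  fix k :: nat
  have "eventually (\<lambda>y. dist (F y) l < 1 / real (Suc k) / 2) (at_right 0)"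
   by (rule tendstoD[OF l]) simp
  then obtain b where b: "b > 0" "\<And>y. 0 < y \<Longrightarrow> y < b \<Longrightarrow> dist (F y) l < 1 / real (Suc k) / 2"
   unfolding eventually_at_right_field by blast
  obtain n where n: "1 / real (Suc n) < b" using b(1) nat_approx_posE by blast
  show "\<exists>n::nat. \<forall>q r. 0 < q \<longrightarrow> q < 1 / real (Suc n) \<longrightarrow> 0 < r \<longrightarrow> r < 1 / real (Suc n) \<longrightarrow>
   dist (F q) (F r) \<le> 1 / real (Suc k)"
  proof (intro exI[of _ n] allI impI)
   fix q r :: real assume qr: "0 < q" "q < 1 / real (Suc n)" "0 < r" "r < 1 / real (Suc n)"
   have "dist (F q) (F r) \<le> dist (F q) l + dist (F r) l" by (rule dist_triangle2)
   also have "\<dots> \<le> 1 / real (Suc k) / 2 + 1 / real (Suc k) / 2"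
    using b(2)[of q] b(2)[of r] qr n by (intro add_mono less_imp_le) auto
   finally show "dist (F q) (F r) \<le> 1 / real (Suc k)" by (simp only: field_sum_of_halves)
  qed
 qed
next
 assume cauchy: ?R
 have "Cauchy (\<lambda>j. F (1 / real (Suc j + 1)))"
 proof (rule metric_CauchyI)
  fix e :: real assume "e > 0"
  then obtain k where k: "1 / real (Suc k) < e" using nat_approx_posE by blast
  obtain n where n: "\<And>q r. 0 < q \<Longrightarrow> q < 1 / real (Suc n) \<Longrightarrow> 0 < r \<Longrightarrow> r < 1 / real (Suc n) \<Longrightarrow>
   dist (F q) (F r) \<le> 1 / real (Suc k)" using cauchy by meson
  have lt: "1 / real (Suc i + 1) < 1 / real (Suc n)" if "n \<le> i" for i
   using that by (intro divide_strict_left_mono) auto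
  show "\<exists>M. \<forall>i\<ge>M. \<forall>j\<ge>M. dist (F (1 / real (Suc i + 1))) (F (1 / real (Suc j + 1))) < e"
   using n lt k by (intro exI[of _ n] allI impI) (rule le_less_trans[OF n k]; auto)
 qed
 then obtain l where l: "(\<lambda>j. F (1 / real (Suc j + 1))) \<longlonglongrightarrow> l"
  by (metis Cauchy_convergent convergent_def)
 have "(F \<longlongrightarrow> l) (at_right 0)"
 proof (rule tendstoI)
  fix e :: real assume "e > 0"
  then obtain k where k: "1 / real (Suc k) < e" using nat_approx_posE by blast
  obtain n where n: "\<And>q r. 0 < q \<Longrightarrow> q < 1 / real (Suc n) \<Longrightarrow> 0 < r \<Longrightarrow> r < 1 / real (Suc n) \<Longrightarrow>
   dist (F q) (F r) \<le> 1 / real (Suc k)" using cauchy by meson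
  have "dist (F y) l \<le> 1 / real (Suc k)" if y: "0 < y" "y < 1 / real (Suc n)" for y
  proof (rule LIMSEQ_le_const2[OF tendsto_dist[OF tendsto_const l]])
   have "dist (F y) (F (1 / real (Suc i + 1))) \<le> 1 / real (Suc k)" if "n \<le> i" for i
    using that y by (intro n) (auto intro!: divide_strict_left_mono)
   then show "\<exists>N. \<forall>i\<ge>N. dist (F y) (F (1 / real (Suc i + 1))) \<le> 1 / real (Suc k)" by blast
  qed
  then show "eventually (\<lambda>y. dist (F y) l < e) (at_right 0)"
   by (intro eventually_at_rightI[of 0 "1 / real (Suc n)"]) (use k in \<open>auto intro: le_less_trans\<close>)
 qed
 then show ?L by blast
qed

lemma continuous_on_Complex: "continuous_on S (\<lambda>x. Complex x y)" "continuous_on S (Complex x)"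
 unfolding continuous_on_def by (auto intro!: tendsto_Complex tendsto_const tendsto_ident_at)

lemma lower_bv_measurable:
 assumes G: "G \<in> Hinf"
 shows "lower_bv G \<in> borel_measurable borel"
proof -
 have cont: "continuous_on strip G"
  using G by (simp add: Hinf_def holomorphic_on_imp_continuous_on)
 have mc: "continuous_on UNIV (\<lambda>x. G (Complex x y))" if "0 < y" "y < pi" for y
  by (rule continuous_on_compose2[OF cont continuous_on_Complex(1)]) (use that in auto)
 note m = borel_measurable_continuous_onI[OF mc]
 define E where "E = {x. \<exists>l. ((\<lambda>y. G (Complex x y)) \<longlongrightarrow> l) (at_right 0)}"
 define D where "D n k = (\<Inter>q\<in>{0<..<1 / real (Suc n)}. \<Inter>r\<in>{0<..<1 / real (Suc n)}.
   {x. dist (G (Complex x q)) (G (Complex x r)) \<le> 1 / real (Suc k)})" for n k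
 \<comment> \<open>For fixed heights the condition is closed in \<open>x\<close>, so uncountably many heights do no harm.\<close>
 have D: "D n k \<in> sets borel" for n k
 proof -
  have "closed {x. dist (G (Complex x q)) (G (Complex x r)) \<le> 1 / real (Suc k)}"
   if "0 < q" "q < 1 / real (Suc n)" "0 < r" "r < 1 / real (Suc n)" for q r
  proof -
   have "1 / real (Suc n) \<le> 1" by simp
   then have "q < pi" "r < pi" using that pi_gt3 by linarith+
   then show ?thesis
    using that by (intro closed_Collect_le continuous_on_dist continuous_on_const mc)
  qed
  then have "closed (D n k)" unfolding D_def by (intro closed_INT ballI) simp
  then show ?thesis by (rule borel_closed)
 qed
 have mem: "x \<in> D n k \<longleftrightarrow> (\<forall>q r. 0 < q \<longrightarrow> q < 1 / real (Suc n) \<longrightarrow> 0 < r \<longrightarrow> r < 1 / real (Suc n) \<longrightarrow>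
   dist (G (Complex x q)) (G (Complex x r)) \<le> 1 / real (Suc k))" for x n k
  unfolding D_def by auto
 have "E = (\<Inter>k. \<Union>n. D n k)"
  by (simp only: set_eq_iff E_def right_limit_iff_Cauchy INT_iff UN_iff mem_Collect_eq mem ball_UNIV bex_UNIV)
   simp
 then have E[measurable]: "E \<in> sets borel" using D by auto
 define s where "s n x = G (Complex x (1 / real (Suc n)))" for n x
 have sm: "s n \<in> borel_measurable borel" for n
 proof -
  have "1 / real (Suc n) \<le> 1" by simp
  then have "1 / real (Suc n) < pi" using pi_gt3 by linarith
  then show ?thesis unfolding s_def by (intro m) auto
 qed
 have "lower_bv G = (\<lambda>x. if x \<in> E then lim (\<lambda>n. s n x) else (THE l. False))"
 proof
  fix x
  show "lower_bv G x = (if x \<in> E then lim (\<lambda>n. s n x) else (THE l. False))"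
  proof (cases "x \<in> E")
   case True
   then have "((\<lambda>y. G (Complex x y)) \<longlongrightarrow> lower_bv G x) (at_right 0)"
    by (intro lower_bv_tendsto) (simp add: E_def)
   moreover have "filterlim (\<lambda>n. 1 / real (Suc n)) (at_right 0) sequentially"
    by real_asymp
   ultimately have "(\<lambda>n. s n x) \<longlonglongrightarrow> lower_bv G x"
    unfolding s_def by (rule filterlim_compose)
   then show ?thesis using True by (simp add: limI)
  next
   case False
   then have "\<not> ((\<lambda>y. G (Complex x y)) \<longlongrightarrow> l) (at_right 0)" for l by (auto simp: E_def)
   then show ?thesis using False by (simp add: lower_bv_def t2_space_class.Lim_def)
  qed
 qed
 moreover have "(\<lambda>x. if x \<in> E then lim (\<lambda>n. s n x) else (THE l. False)) \<in> borel_measurable borel"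
  using sm by measurable
 ultimately show ?thesis by simp
qed

lemma lower_bv_AE:
 assumes "G \<in> Hinf"
 shows "AE x in lborel. ((\<lambda>y. G (Complex x y)) \<longlongrightarrow> lower_bv G x) (at_right 0)"
 using Fatou_lower[OF assms] by eventually_elim (rule lower_bv_tendsto)

lemma lower_bv_bound:
 assumes "G \<in> Hinf" and B: "\<And>z. z \<in> strip \<Longrightarrow> cmod (G z) \<le> B"
 shows "AE x in lborel. cmod (lower_bv G x) \<le> B"
 using lower_bv_AE[OF assms(1)]
proof eventually_elim
 case (elim x)
 have "eventually (\<lambda>y. cmod (G (Complex x y)) \<le> B) (at_right 0)"
  by (rule eventually_at_rightI[of 0 pi]) (auto intro!: B)
 then show ?case
  by (rule tendsto_upperbound[OF tendsto_norm[OF elim]]) simp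
qed

lemma lower_bv_Linf: "G \<in> Hinf \<Longrightarrow> lower_bv G \<in> Linf"
proof -
 assume G: "G \<in> Hinf"
 obtain B where "\<And>z. z \<in> strip \<Longrightarrow> cmod (G z) \<le> B" using Hinf_bound[OF G] by blast
 then have "AE x in lborel. cmod (lower_bv G x) \<le> B" by (rule lower_bv_bound[OF G])
 then show "lower_bv G \<in> Linf" using lower_bv_measurable[OF G] by (auto simp: Linf_def)
qed

text \<open>The reflection \<open>\<zeta> \<mapsto> cnj (\<zeta>) + i \<pi>\<close> exchanges the two edges of the strip.\<close>

definition strip_reflect :: "(complex \<Rightarrow> complex) \<Rightarrow> complex \<Rightarrow> complex" where
 "strip_reflect G z = cnj (G (cnj z + \<i> * of_real pi))"

lemma strip_reflect_Complex: "strip_reflect G (Complex x y) = cnj (G (Complex x (pi - y)))"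
proof -
 have "cnj (Complex x y) + \<i> * of_real pi = Complex x (pi - y)" by (simp add: complex_eq_iff)
 then show ?thesis by (simp add: strip_reflect_def)
qed

lemma strip_reflect_Hinf:
 assumes "G \<in> Hinf"
 shows "strip_reflect G \<in> Hinf"
proof -
 have hol: "G holomorphic_on strip" and bdd: "bounded (G ` strip)" using assms by (auto simp: Hinf_def)
 have ms: "cnj z + \<i> * of_real pi \<in> strip" if "z \<in> strip" for z using that by (simp add: strip_def)
 have "(\<lambda>w. G (w + \<i> * of_real pi)) holomorphic_on cnj ` strip"
 proof -
  have 1: "(\<lambda>w. w + \<i> * of_real pi) holomorphic_on cnj ` strip" by (intro holomorphic_intros)
  have "(\<lambda>w. w + \<i> * of_real pi) ` cnj ` strip \<subseteq> strip" using ms by auto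
  from holomorphic_on_compose_gen[OF 1 hol this] show ?thesis by (simp only: o_def)
 qed
 from holomorphic_on_compose_cnj_cnj[OF this open_strip]
 have "strip_reflect G holomorphic_on strip"
  by (simp add: strip_reflect_def[abs_def] o_def)
 moreover have "bounded (strip_reflect G ` strip)"
  using bdd ms unfolding bounded_iff strip_reflect_def by fastforce
 ultimately show ?thesis by (simp add: Hinf_def)
qed

lemma upper_bv_AE:
 assumes "G \<in> Hinf"
 shows "AE x in lborel. upper_bv G x = cnj (lower_bv (strip_reflect G) x) \<and>
  ((\<lambda>y. G (Complex x y)) \<longlongrightarrow> upper_bv G x) (at_left pi)"
 using lower_bv_AE[OF strip_reflect_Hinf[OF assms]]
proof eventually_elim
 case (elim x)
 have "((\<lambda>y. pi - y) \<longlongrightarrow> pi - pi) (at_left pi)" by (intro tendsto_intros)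
 then have "filterlim (\<lambda>y. pi - y) (at_right 0) (at_left pi)"
  by (auto simp: filterlim_at intro!: eventually_at_leftI[of 0])
 from filterlim_compose[OF elim this]
 have "((\<lambda>y. cnj (G (Complex x y))) \<longlongrightarrow> lower_bv (strip_reflect G) x) (at_left pi)"
  by (simp add: strip_reflect_Complex)
 from tendsto_cnj[OF this]
 have lim: "((\<lambda>y. G (Complex x y)) \<longlongrightarrow> cnj (lower_bv (strip_reflect G) x)) (at_left pi)" by simp
 then have "upper_bv G x = cnj (lower_bv (strip_reflect G) x)"
  unfolding upper_bv_def by (intro tendsto_Lim) auto
 then show ?case using lim by simp
qed

subsection \<open>Shifting the line of integration\<close>

lemma integrable_gauss:
 assumes "c > 0"
 shows "integrable lborel (\<lambda>x::real. C * exp (- c * x\<^sup>2))"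
proof -
 have "integrable lborel (\<lambda>x. C * sqrt (2 * pi * (1 / (2 * c))) * normal_density 0 (sqrt (1 / (2 * c))) x)"
  using assms by (intro integrable_mult_right integrable_normal_density) simp
 then show ?thesis
  using assms by (simp add: normal_density_def mult_ac)
qed

lemma gauss_tendsto_0:
 assumes "c > 0"
 shows "(\<lambda>n. C * exp (- c * (real n)\<^sup>2)) \<longlonglongrightarrow> 0"
proof -
 have "(\<lambda>n. exp (- c * (real n)\<^sup>2)) \<longlonglongrightarrow> 0"
 proof (rule Lim_null_comparison[OF always_eventually])
  show "\<forall>n. norm (exp (- c * (real n)\<^sup>2)) \<le> exp (- c) ^ n"
  proof
   fix n
   have "real n \<le> (real n)\<^sup>2" by (cases n) (auto simp: power2_eq_square)
   then have "- c * (real n)\<^sup>2 \<le> real n * - c" using assms by simp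
   then show "norm (exp (- c * (real n)\<^sup>2)) \<le> exp (- c) ^ n"
    by (simp only: exp_of_nat_mult[symmetric] norm_exp real_norm_def abs_exp_cancel exp_le_cancel_iff)
  qed
  show "(\<lambda>n. exp (- c) ^ n) \<longlonglongrightarrow> 0" by (rule LIMSEQ_power_zero) (use assms in simp)
 qed
 from tendsto_mult[OF tendsto_const[of C] this] show ?thesis by simp
qed

text \<open>Cauchy's theorem on a rectangle; the vertical sides vanish in the limit because of the Gaussian decay.\<close>

lemma strip_shift:
 fixes f :: "complex \<Rightarrow> complex"
 assumes hol: "f holomorphic_on {z. \<alpha> < Im z \<and> Im z < \<beta>}" and y: "\<alpha> < y0" "y0 \<le> y1" "y1 < \<beta>"
  and c: "c > 0" and bd: "\<And>x y. y0 \<le> y \<Longrightarrow> y \<le> y1 \<Longrightarrow> cmod (f (Complex x y)) \<le> C * exp (- c * x\<^sup>2)"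
 shows "(LINT x|lborel. f (Complex x y0)) = (LINT x|lborel. f (Complex x y1))"
proof -
 define S where "S = {z. \<alpha> < Im z \<and> Im z < \<beta>}"
 have S_eq: "S = {z. \<alpha> < Im z} \<inter> {z. Im z < \<beta>}" by (auto simp: S_def)
 have oS: "open S" and cS: "convex S"
  unfolding S_eq by (intro open_Int open_halfspace_Im_gt open_halfspace_Im_lt
    convex_Int convex_halfspace_Im_gt convex_halfspace_Im_lt)+
 have hol': "f holomorphic_on S" using hol by (simp add: S_def)
 obtain F where F0: "\<And>z. z \<in> S \<Longrightarrow> (F has_field_derivative f z) (at z within S)"
  using holomorphic_convex_primitive'[OF cS oS hol'] by blast
 have F: "(F has_field_derivative f z) (at z)" if "z \<in> S" for z
  using F0[OF that] by (simp add: at_within_open[OF that oS])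
 have fc: "continuous_on S f" using hol' by (rule holomorphic_on_imp_continuous_on)
 have lim: "(\<lambda>n. F (Complex (real n) y) - F (Complex (- real n) y)) \<longlonglongrightarrow> (LINT x|lborel. f (Complex x y))"
  if y': "y0 \<le> y" "y \<le> y1" for y
 proof -
  have inS: "Complex x y \<in> S" for x using y y' by (simp add: S_def)
  have fcy: "continuous_on A (\<lambda>x. f (Complex x y))" for A
   by (rule continuous_on_compose2[OF fc continuous_on_Complex(1)]) (use inS in auto)
  have ftc: "(LINT x|lborel. indicator {- real n..real n} x *\<^sub>R f (Complex x y))
    = F (Complex (real n) y) - F (Complex (- real n) y)" for n
  proof (rule integral_FTC_Icc)
   show "((\<lambda>x. F (Complex x y)) has_vector_derivative f (Complex x y)) (at x within {- real n..real n})" for x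
   proof -
    have "((\<lambda>x. Complex x y) has_vector_derivative 1) (at x within {- real n..real n})"
     unfolding Complex_eq by (auto intro!: derivative_eq_intros)
    from field_vector_diff_chain_within[OF this has_field_derivative_at_within[OF F[OF inS]]]
    show ?thesis by (simp add: o_def)
   qed
  qed (use fcy in auto)
  have "(\<lambda>n. LINT x|lborel. indicator {- real n..real n} x *\<^sub>R f (Complex x y)) \<longlonglongrightarrow> (LINT x|lborel. f (Complex x y))"
  proof (rule integral_dominated_convergence)
   show fm: "(\<lambda>x. f (Complex x y)) \<in> borel_measurable lborel"
    using borel_measurable_continuous_onI[OF fcy] by simp
   then show "(\<lambda>x. indicator {- real n..real n} x *\<^sub>R f (Complex x y)) \<in> borel_measurable lborel" for n
    by measurable
   show "integrable lborel (\<lambda>x. C * exp (- c * x\<^sup>2))" by (rule integrable_gauss[OF c])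
   show "AE x in lborel. (\<lambda>n. indicator {- real n..real n} x *\<^sub>R f (Complex x y)) \<longlonglongrightarrow> f (Complex x y)"
   proof (rule AE_I2, rule tendsto_eventually)
    fix x :: real
    have "eventually (\<lambda>n. \<bar>x\<bar> \<le> real n) sequentially"
     using eventually_ge_at_top[of "nat \<lceil>\<bar>x\<bar>\<rceil>"] by eventually_elim linarith
    then show "eventually (\<lambda>n. indicator {- real n..real n} x *\<^sub>R f (Complex x y) = f (Complex x y)) sequentially"
     by eventually_elim (auto simp: indicator_def)
   qed
   show "AE x in lborel. norm (indicator {- real n..real n} x *\<^sub>R f (Complex x y)) \<le> C * exp (- c * x\<^sup>2)" for n
    using bd[OF y'] order_trans[OF norm_ge_zero bd[OF y']] by (intro AE_I2) (auto simp: indicator_def)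
  qed
  then show ?thesis unfolding ftc .
 qed
 have side: "cmod (F (Complex x y1) - F (Complex x y0)) \<le> (C * exp (- c * x\<^sup>2)) * (y1 - y0)" for x
 proof -
  have seg: "w \<in> S \<and> cmod (f w) \<le> C * exp (- c * x\<^sup>2)" if "w \<in> closed_segment (Complex x y0) (Complex x y1)" for w
  proof -
   have "Re w = x" "Im w \<in> closed_segment y0 y1"
    using that by (auto simp: closed_segment_same_Re)
   then have w: "w = Complex x (Im w)" "y0 \<le> Im w" "Im w \<le> y1"
    using y by (auto simp: closed_segment_eq_real_ivl complex_eq_iff)
   then show ?thesis using bd[of "Im w" x] y by (metis (mono_tags, lifting) S_def le_less_trans less_le_trans mem_Collect_eq)
  qed
  have "cmod (F (Complex x y1) - F (Complex x y0)) \<le> (C * exp (- c * x\<^sup>2)) * cmod (Complex x y1 - Complex x y0)"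
   by (rule field_differentiable_bound[OF convex_closed_segment[of "Complex x y0" "Complex x y1"],
      where f' = f]) (use seg F in \<open>auto intro: has_field_derivative_at_within\<close>)
  also have "cmod (Complex x y1 - Complex x y0) = y1 - y0"
   using y by (simp add: cmod_def)
  finally show ?thesis .
 qed
 have lim0: "(\<lambda>n. (C * exp (- c * (real n)\<^sup>2)) * (y1 - y0)) \<longlonglongrightarrow> 0"
  by (rule tendsto_mult_left_zero[OF gauss_tendsto_0[OF c]])
 have z1: "(\<lambda>n. F (Complex (real n) y1) - F (Complex (real n) y0)) \<longlonglongrightarrow> 0"
  by (rule Lim_null_comparison[OF always_eventually lim0]) (rule allI, rule side)
 have "cmod (F (Complex (- real n) y1) - F (Complex (- real n) y0)) \<le> (C * exp (- c * (real n)\<^sup>2)) * (y1 - y0)" for n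
  using side[of "- real n"] by simp
 then have z2: "(\<lambda>n. F (Complex (- real n) y1) - F (Complex (- real n) y0)) \<longlonglongrightarrow> 0"
  by (intro Lim_null_comparison[OF always_eventually lim0] allI)
 have "(\<lambda>n. (F (Complex (real n) y1) - F (Complex (- real n) y1)) - (F (Complex (real n) y0) - F (Complex (- real n) y0))) \<longlonglongrightarrow>
   (LINT x|lborel. f (Complex x y1)) - (LINT x|lborel. f (Complex x y0))"
  using y by (intro tendsto_diff lim) auto
 moreover have "(\<lambda>n. (F (Complex (real n) y1) - F (Complex (- real n) y1)) - (F (Complex (real n) y0) - F (Complex (- real n) y0))) \<longlonglongrightarrow> 0"
  using tendsto_diff[OF z1 z2] by (simp add: algebra_simps)
 ultimately have "(LINT x|lborel. f (Complex x y1)) - (LINT x|lborel. f (Complex x y0)) = 0"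
  by (rule LIMSEQ_unique)
 then show ?thesis by simp
qed

text \<open>The shift holds between lines inside the strip. As they tend to the edges, the bounded function
 converges almost everywhere and the Gaussian decay gives a dominating function.\<close>

lemma boundary_shift:
 assumes G: "G \<in> Hinf" and hol: "f holomorphic_on UNIV"
  and c: "c > 0" and bd: "\<And>x y. 0 \<le> y \<Longrightarrow> y \<le> pi \<Longrightarrow> cmod (f (Complex x y)) \<le> C * exp (- c * x\<^sup>2)"
 shows "(LINT x|lborel. f (Complex x 0) * lower_bv G x) = (LINT x|lborel. f (Complex x pi) * cnj (lower_bv (strip_reflect G) x))"
  and "0 < y \<Longrightarrow> y < pi \<Longrightarrow> (LINT x|lborel. f (Complex x 0) * lower_bv G x) = (LINT x|lborel. f (Complex x y) * G (Complex x y))"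
proof -
 obtain B where B: "B \<ge> 0" "\<And>z. z \<in> strip \<Longrightarrow> cmod (G z) \<le> B" using Hinf_bound[OF G] by blast
 have Gh: "G holomorphic_on strip" using G by (simp add: Hinf_def)
 have fc: "continuous_on UNIV f" using hol by (rule holomorphic_on_imp_continuous_on)
 have fcy: "continuous_on A (\<lambda>x. f (Complex x y))" "continuous_on A (\<lambda>y. f (Complex x y))" for A x y
  by (rule continuous_on_compose2[OF fc], rule continuous_on_Complex, simp)+
 have fm[measurable]: "(\<lambda>x. f (Complex x y)) \<in> borel_measurable borel" for y
  by (rule borel_measurable_continuous_onI[OF fcy(1)])
 have Gm: "(\<lambda>x. G (Complex x y)) \<in> borel_measurable borel" if "0 < y" "y < pi" for y
  by (rule borel_measurable_continuous_onI,
    rule continuous_on_compose2[OF holomorphic_on_imp_continuous_on[OF Gh] continuous_on_Complex(1)]) (use that in auto)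
 have bdG: "cmod (f (Complex x y) * G (Complex x y)) \<le> (C * B) * exp (- c * x\<^sup>2)" if "0 < y" "y < pi" for x y
 proof -
  have "cmod (f (Complex x y)) * cmod (G (Complex x y)) \<le> (C * exp (- c * x\<^sup>2)) * B"
   using bd[of y x] that B order_trans[OF norm_ge_zero bd[of y x]] by (intro mult_mono) auto
  then show ?thesis by (simp add: norm_mult mult_ac)
 qed
 have const: "(LINT x|lborel. f (Complex x y) * G (Complex x y)) = (LINT x|lborel. f (Complex x y') * G (Complex x y'))"
  if "0 < y" "y \<le> y'" "y' < pi" for y y'
  by (rule strip_shift[where \<alpha> = 0 and \<beta> = pi and f = "\<lambda>z. f z * G z" and C = "C * B", OF _ that c])
    (use that bdG hol Gh in \<open>auto intro!: holomorphic_intros holomorphic_on_subset[OF hol] simp: strip_def[symmetric]\<close>)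
 define v where "v n = 1 / real (Suc n)" for n
 have v: "0 < v n" "v n < pi / 2" "v n < pi" for n
 proof -
  have "v n \<le> 1" by (simp add: v_def)
  then show "v n < pi / 2" "v n < pi" using pi_gt3 by linarith+
 qed (simp add: v_def)
 have v0: "filterlim v (at_right 0) sequentially" unfolding v_def by real_asymp
 have vp: "filterlim (\<lambda>n. pi - v n) (at_left pi) sequentially" unfolding v_def by real_asymp
 have low: "(\<lambda>n. LINT x|lborel. f (Complex x (v n)) * G (Complex x (v n))) \<longlonglongrightarrow> (LINT x|lborel. f (Complex x 0) * lower_bv G x)"
 proof (rule integral_dominated_convergence)
  show "integrable lborel (\<lambda>x. (C * B) * exp (- c * x\<^sup>2))" by (rule integrable_gauss[OF c])
  show "(\<lambda>x. f (Complex x 0) * lower_bv G x) \<in> borel_measurable lborel"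
   using lower_bv_measurable[OF G] fm[of 0] by measurable
  show "(\<lambda>x. f (Complex x (v n)) * G (Complex x (v n))) \<in> borel_measurable lborel" for n
   using Gm[OF v(1,3)] fm[of "v n"] by measurable
  show "AE x in lborel. norm (f (Complex x (v n)) * G (Complex x (v n))) \<le> (C * B) * exp (- c * x\<^sup>2)" for n
   using bdG[OF v(1,3)] by simp
  show "AE x in lborel. (\<lambda>n. f (Complex x (v n)) * G (Complex x (v n))) \<longlonglongrightarrow> f (Complex x 0) * lower_bv G x"
   using lower_bv_AE[OF G]
  proof eventually_elim
   case (elim x)
   have "isCont (\<lambda>y. f (Complex x y)) 0" using fcy(2)[of UNIV x] by (simp add: continuous_on_eq_continuous_at)
   moreover have "v \<longlonglongrightarrow> 0" using v0 by (simp add: filterlim_at)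
   ultimately have "(\<lambda>n. f (Complex x (v n))) \<longlonglongrightarrow> f (Complex x 0)" by (rule isCont_tendsto_compose)
   then show ?case by (intro tendsto_mult filterlim_compose[OF elim v0])
  qed
 qed
 have "(\<lambda>n. LINT x|lborel. f (Complex x (pi - v n)) * G (Complex x (pi - v n))) \<longlonglongrightarrow>
   (LINT x|lborel. f (Complex x pi) * cnj (lower_bv (strip_reflect G) x))"
 proof (rule integral_dominated_convergence)
  show "integrable lborel (\<lambda>x. (C * B) * exp (- c * x\<^sup>2))" by (rule integrable_gauss[OF c])
  have "(\<lambda>x. cnj (lower_bv (strip_reflect G) x)) \<in> borel_measurable borel"
   by (rule borel_measurable_continuous_on[OF _ lower_bv_measurable[OF strip_reflect_Hinf[OF G]]]) (intro continuous_intros)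
  then show "(\<lambda>x. f (Complex x pi) * cnj (lower_bv (strip_reflect G) x)) \<in> borel_measurable lborel"
   using fm[of pi] by measurable
  have v': "0 < pi - v n" "pi - v n < pi" for n using v by auto
  show "(\<lambda>x. f (Complex x (pi - v n)) * G (Complex x (pi - v n))) \<in> borel_measurable lborel" for n
   using Gm[OF v'] fm[of "pi - v n"] by measurable
  show "AE x in lborel. norm (f (Complex x (pi - v n)) * G (Complex x (pi - v n))) \<le> (C * B) * exp (- c * x\<^sup>2)" for n
   using bdG[OF v'] by simp
  show "AE x in lborel. (\<lambda>n. f (Complex x (pi - v n)) * G (Complex x (pi - v n))) \<longlonglongrightarrow> f (Complex x pi) * cnj (lower_bv (strip_reflect G) x)"
   using upper_bv_AE[OF G]
  proof eventually_elim
   case (elim x)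
   have "isCont (\<lambda>y. f (Complex x y)) pi" using fcy(2)[of UNIV x] by (simp add: continuous_on_eq_continuous_at)
   moreover have "(\<lambda>n. pi - v n) \<longlonglongrightarrow> pi" using vp by (simp add: filterlim_at)
   ultimately have fl: "(\<lambda>n. f (Complex x (pi - v n))) \<longlonglongrightarrow> f (Complex x pi)" by (rule isCont_tendsto_compose)
   have Gl: "((\<lambda>y. G (Complex x y)) \<longlongrightarrow> cnj (lower_bv (strip_reflect G) x)) (at_left pi)"
    using conjunct2[OF elim] unfolding conjunct1[OF elim] .
   show ?case by (rule tendsto_mult[OF fl filterlim_compose[OF Gl vp]])
  qed
 qed
 note up = this
 have "(LINT x|lborel. f (Complex x (v n)) * G (Complex x (v n))) = (LINT x|lborel. f (Complex x (pi - v n)) * G (Complex x (pi - v n)))" for n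
  by (rule const) (use v[of n] in auto)
 then show "(LINT x|lborel. f (Complex x 0) * lower_bv G x) = (LINT x|lborel. f (Complex x pi) * cnj (lower_bv (strip_reflect G) x))"
  by (intro LIMSEQ_unique[OF low]) (simp only: up)
 assume y: "0 < y" "y < pi"
 have "eventually (\<lambda>n. v n < y) sequentially"
  using order_tendstoD(2)[of v 0 sequentially y] v0 y by (simp add: filterlim_at)
 then have "eventually (\<lambda>n. (LINT x|lborel. f (Complex x (v n)) * G (Complex x (v n))) = (LINT x|lborel. f (Complex x y) * G (Complex x y))) sequentially"
 proof eventually_elim
  case (elim n)
  then show ?case by (intro const) (use v(1)[of n] y in auto)
 qed
 then show "(LINT x|lborel. f (Complex x 0) * lower_bv G x) = (LINT x|lborel. f (Complex x y) * G (Complex x y))"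
  by (rule LIMSEQ_unique[OF low tendsto_eventually])
qed

section \<open>Convolution with integrable kernels\<close>

definition conv_l2 :: "(real \<Rightarrow> complex) \<Rightarrow> real l2 \<Rightarrow> real l2" where
 "conv_l2 k \<psi> = abs_l2 (\<lambda>x. LINT t|lborel. k t * rep_l2 \<psi> (x - t))"

lemma square_integrable_conv:
 assumes k: "integrable lborel k" and f: "square_integrable f"
 shows "square_integrable (\<lambda>x. LINT t|lborel. k t * f (x - t))"
proof -
 have km[measurable]: "k \<in> borel_measurable borel" using k by (auto dest: borel_measurable_integrable)
 have fm[measurable]: "f \<in> borel_measurable borel" using f by (simp add: square_integrable_def)
 have hm: "(\<lambda>x. LINT t|lborel. k t * f (x - t)) \<in> borel_measurable borel"
  by (rule lborel.borel_measurable_lebesgue_integral) measurable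
 define K where "K = (\<integral>\<^sup>+t. ennreal (cmod (k t)) \<partial>lborel)"
 have Kfin: "K < \<infinity>" using k unfolding K_def integrable_iff_bounded by simp
 define F where "F = (\<integral>\<^sup>+x. ennreal ((cmod (f x))\<^sup>2) \<partial>lborel)"
 have Ffin: "F < \<infinity>" using f unfolding F_def square_integrable_def integrable_iff_bounded by simp
 have pt: "ennreal ((cmod (LINT t|lborel. k t * f (x - t)))\<^sup>2)
   \<le> K * (\<integral>\<^sup>+t. ennreal (cmod (k t)) * ennreal ((cmod (f (x - t)))\<^sup>2) \<partial>lborel)" for x
 proof -
  have "ennreal (cmod (LINT t|lborel. k t * f (x - t))) \<le> (\<integral>\<^sup>+t. ennreal (cmod (k t * f (x - t))) \<partial>lborel)"
  proof (cases "integrable lborel (\<lambda>t. k t * f (x - t))")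
   case True
   then show ?thesis by (rule integral_norm_bound_ennreal)
  next
   case False
   then show ?thesis by (simp add: not_integrable_integral_eq)
  qed
  also have "\<dots> = (\<integral>\<^sup>+t. ennreal (sqrt (cmod (k t))) * ennreal (sqrt (cmod (k t)) * cmod (f (x - t))) \<partial>lborel)"
   by (intro nn_integral_cong) (simp add: norm_mult flip: ennreal_mult mult.assoc)
  finally have "(ennreal (cmod (LINT t|lborel. k t * f (x - t))))\<^sup>2 \<le>
    (\<integral>\<^sup>+t. ennreal (sqrt (cmod (k t))) * ennreal (sqrt (cmod (k t)) * cmod (f (x - t))) \<partial>lborel)\<^sup>2"
   by (rule power_mono) simp
  also have "\<dots> \<le> (\<integral>\<^sup>+t. (ennreal (sqrt (cmod (k t))))\<^sup>2 \<partial>lborel) * (\<integral>\<^sup>+t. (ennreal (sqrt (cmod (k t)) * cmod (f (x - t))))\<^sup>2 \<partial>lborel)"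
   by (rule Cauchy_Schwarz_nn_integral) measurable
  also have "(\<integral>\<^sup>+t. (ennreal (sqrt (cmod (k t))))\<^sup>2 \<partial>lborel) = K"
   unfolding K_def by (intro nn_integral_cong) (simp add: ennreal_power)
  also have "(\<integral>\<^sup>+t. (ennreal (sqrt (cmod (k t)) * cmod (f (x - t))))\<^sup>2 \<partial>lborel) =
    (\<integral>\<^sup>+t. ennreal (cmod (k t)) * ennreal ((cmod (f (x - t)))\<^sup>2) \<partial>lborel)"
   by (intro nn_integral_cong) (simp add: ennreal_power power_mult_distrib flip: ennreal_mult)
  finally show ?thesis by (simp add: ennreal_power)
 qed
 have shift: "(\<integral>\<^sup>+x. ennreal ((cmod (f (x - t)))\<^sup>2) \<partial>lborel) = F" for t
 proof -
  have "F = (\<integral>\<^sup>+x. ennreal ((cmod (f x))\<^sup>2) \<partial>distr lborel borel (\<lambda>x. x - t))"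
   unfolding F_def by (simp only: lborel_distr_minus)
  also have "\<dots> = (\<integral>\<^sup>+x. ennreal ((cmod (f (x - t)))\<^sup>2) \<partial>lborel)"
   by (rule nn_integral_distr) measurable
  finally show ?thesis by simp
 qed
 have "(\<integral>\<^sup>+x. ennreal ((cmod (LINT t|lborel. k t * f (x - t)))\<^sup>2) \<partial>lborel)
   \<le> (\<integral>\<^sup>+x. K * (\<integral>\<^sup>+t. ennreal (cmod (k t)) * ennreal ((cmod (f (x - t)))\<^sup>2) \<partial>lborel) \<partial>lborel)"
  by (intro nn_integral_mono pt)
 also have "\<dots> = K * (\<integral>\<^sup>+x. \<integral>\<^sup>+t. ennreal (cmod (k t)) * ennreal ((cmod (f (x - t)))\<^sup>2) \<partial>lborel \<partial>lborel)"
  by (rule nn_integral_cmult) measurable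
 also have "(\<integral>\<^sup>+x. \<integral>\<^sup>+t. ennreal (cmod (k t)) * ennreal ((cmod (f (x - t)))\<^sup>2) \<partial>lborel \<partial>lborel) =
   (\<integral>\<^sup>+t. \<integral>\<^sup>+x. ennreal (cmod (k t)) * ennreal ((cmod (f (x - t)))\<^sup>2) \<partial>lborel \<partial>lborel)"
  by (rule lborel_pair.Fubini') measurable
 also have "\<dots> = (\<integral>\<^sup>+t. ennreal (cmod (k t)) * F \<partial>lborel)"
  by (intro nn_integral_cong) (simp add: nn_integral_cmult shift)
 also have "\<dots> = K * F" unfolding K_def by (rule nn_integral_multc) measurable
 also have "K * (K * F) < \<infinity>" using Kfin Ffin by (simp add: ennreal_mult_less_top)
 finally show ?thesis
  unfolding square_integrable_def integrable_iff_bounded using hm by simp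
qed

text \<open>The convolution is the weak integral of the translates; its operator properties follow from this.\<close>

lemma cinner_conv:
 assumes k: "integrable lborel k"
 shows "cinner \<phi> (conv_l2 k \<psi>) = (LINT t|lborel. k t * cinner \<phi> (trans_l2 t \<psi>))"
  and "integrable lborel (\<lambda>t. k t * cinner \<phi> (trans_l2 t \<psi>))"
proof -
 define f where "f = rep_l2 \<psi>"
 define g where "g = rep_l2 \<phi>"
 have f: "square_integrable f" "\<psi> = abs_l2 f" and g: "square_integrable g" "\<phi> = abs_l2 g"
  by (simp_all add: f_def g_def square_integrable_rep)
 have km[measurable]: "k \<in> borel_measurable borel" using k by (auto dest: borel_measurable_integrable)
 have fm[measurable]: "f \<in> borel_measurable borel" using f by (simp add: square_integrable_def)
 have gm[measurable]: "g \<in> borel_measurable borel" using g by (simp add: square_integrable_def)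
 have cg[measurable]: "(\<lambda>x. cnj (g x)) \<in> borel_measurable borel"
  by (rule borel_measurable_continuous_on[OF _ gm]) (intro continuous_intros)
 have fi: "integrable lborel (\<lambda>x. (cmod (f (x - t)))\<^sup>2)" for t
  using square_integrable_translate[OF f(1)] by (simp add: square_integrable_def)
 have gi: "integrable lborel (\<lambda>x. (cmod (g x))\<^sup>2)"
  using g(1) by (simp add: square_integrable_def)
 have prod: "integrable lborel (\<lambda>x. cnj (g x) * f (x - t))" for t
  by (rule square_integrable_integrable_product[OF g(1) square_integrable_translate[OF f(1)]])
 define C where "C = (LINT x|lborel. (cmod (g x))\<^sup>2) + (LINT x|lborel. (cmod (f x))\<^sup>2)"
 have bd: "(LINT x|lborel. norm (k t * (cnj (g x) * f (x - t)))) \<le> C * cmod (k t)" for t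
 proof -
  have "(LINT x|lborel. cmod (g x) * cmod (f (x - t))) \<le> (LINT x|lborel. (cmod (g x))\<^sup>2 + (cmod (f (x - t)))\<^sup>2)"
  proof (rule integral_mono')
   show "integrable lborel (\<lambda>x. (cmod (g x))\<^sup>2 + (cmod (f (x - t)))\<^sup>2)" by (intro Bochner_Integration.integrable_add gi fi)
   show "cmod (g x) * cmod (f (x - t)) \<le> (cmod (g x))\<^sup>2 + (cmod (f (x - t)))\<^sup>2" for x
    using sum_squares_bound[of "cmod (g x)" "cmod (f (x - t))"] mult_nonneg_nonneg[OF norm_ge_zero norm_ge_zero, of "g x" "f (x - t)"]
    by linarith
  qed simp
  also have "\<dots> = C"
   using integral_translate[of "\<lambda>x. (cmod (f x))\<^sup>2" t] by (simp add: C_def gi fi)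
  finally have "cmod (k t) * (LINT x|lborel. cmod (g x) * cmod (f (x - t))) \<le> cmod (k t) * C"
   by (intro mult_left_mono) auto
  then show ?thesis by (simp add: norm_mult mult.commute)
 qed
 have int: "integrable (lborel \<Otimes>\<^sub>M lborel) (\<lambda>(t, x). k t * (cnj (g x) * f (x - t)))"
 proof (rule lborel_pair.Fubini_integrable)
  show m: "(\<lambda>(t, x). k t * (cnj (g x) * f (x - t))) \<in> borel_measurable (lborel \<Otimes>\<^sub>M lborel)"
   by measurable
  show "AE t in lborel. integrable lborel (\<lambda>x. case (t, x) of (t, x) \<Rightarrow> k t * (cnj (g x) * f (x - t)))"
   using prod by simp
  show "integrable lborel (\<lambda>t. LINT x|lborel. norm (case (t, x) of (t, x) \<Rightarrow> k t * (cnj (g x) * f (x - t))))"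
  proof (rule Bochner_Integration.integrable_bound)
   show "integrable lborel (\<lambda>t. C * cmod (k t))" using k by simp
   show "(\<lambda>t. LINT x|lborel. norm (case (t, x) of (t, x) \<Rightarrow> k t * (cnj (g x) * f (x - t)))) \<in> borel_measurable lborel"
    by (rule lborel.borel_measurable_lebesgue_integral) measurable
   show "AE t in lborel. norm (LINT x|lborel. norm (case (t, x) of (t, x) \<Rightarrow> k t * (cnj (g x) * f (x - t)))) \<le> norm (C * cmod (k t))"
   proof (rule AE_I2)
    fix t
    have "0 \<le> (LINT x|lborel. norm (k t * (cnj (g x) * f (x - t))))" by simp
    then show "norm (LINT x|lborel. norm (case (t, x) of (t, x) \<Rightarrow> k t * (cnj (g x) * f (x - t)))) \<le> norm (C * cmod (k t))"
     using bd[of t] by simp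
   qed
  qed
 qed
 have cin: "k t * cinner \<phi> (trans_l2 t \<psi>) = (LINT x|lborel. k t * (cnj (g x) * f (x - t)))" for t
  by (simp add: f(2) g(2) trans_abs f(1) cinner_abs g(1) square_integrable_translate)
 show "integrable lborel (\<lambda>t. k t * cinner \<phi> (trans_l2 t \<psi>))"
  unfolding cin using lborel_pair.integrable_fst'[OF int] by simp
 have "cinner \<phi> (conv_l2 k \<psi>) = (LINT x|lborel. cnj (g x) * (LINT t|lborel. k t * f (x - t)))"
  unfolding conv_l2_def f_def[symmetric] g(2)
  by (rule cinner_abs[OF g(1) square_integrable_conv[OF k f(1)]])
 also have "\<dots> = (LINT x|lborel. LINT t|lborel. k t * (cnj (g x) * f (x - t)))"
  by (subst integral_mult_right_zero[symmetric]) (simp add: mult_ac)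
 also have "\<dots> = (LINT t|lborel. LINT x|lborel. k t * (cnj (g x) * f (x - t)))"
  by (rule lborel_pair.Fubini_integral[OF int])
 finally show "cinner \<phi> (conv_l2 k \<psi>) = (LINT t|lborel. k t * cinner \<phi> (trans_l2 t \<psi>))"
  by (simp add: cin)
qed

lemma norm_conv_le:
 assumes k: "integrable lborel k"
 shows "norm (conv_l2 k \<psi>) \<le> (LINT t|lborel. cmod (k t)) * norm \<psi>"
proof (cases "norm (conv_l2 k \<psi>) = 0")
 case False
 let ?\<phi> = "conv_l2 k \<psi>"
 have "(norm ?\<phi>)\<^sup>2 = cmod (cinner ?\<phi> ?\<phi>)" by (simp add: cinner_self norm_power)
 also have "\<dots> = cmod (LINT t|lborel. k t * cinner ?\<phi> (trans_l2 t \<psi>))" by (simp only: cinner_conv(1)[OF k])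
 also have "\<dots> \<le> (LINT t|lborel. cmod (k t) * (norm ?\<phi> * norm \<psi>))"
 proof (rule Bochner_Integration.integral_norm_bound_integral[OF cinner_conv(2)[OF k]])
  show "integrable lborel (\<lambda>t. cmod (k t) * (norm ?\<phi> * norm \<psi>))" using k by simp
  show "norm (k t * cinner ?\<phi> (trans_l2 t \<psi>)) \<le> cmod (k t) * (norm ?\<phi> * norm \<psi>)" for t
   using cinner_Cauchy_Schwarz[of ?\<phi> "trans_l2 t \<psi>"] by (simp add: norm_mult norm_trans mult_left_mono)
 qed
 also have "\<dots> = (LINT t|lborel. cmod (k t)) * norm \<psi> * norm ?\<phi>" by simp
 finally show ?thesis using False by (simp add: power2_eq_square)
qed (use k in \<open>simp add: integral_nonneg_AE\<close>)

lemma conv_bounded_clinear: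
 assumes k: "integrable lborel k"
 shows "bounded_clinear (conv_l2 k)"
proof (rule bounded_clinearI[OF _ _ norm_conv_le[OF k]])
 note [simp] = bounded_clinearD(1,2)[OF trans_bounded_clinear]
 show "conv_l2 k (a + b) = conv_l2 k a + conv_l2 k b" for a b
  by (rule cinner_ext)
    (simp add: cinner_conv(1)[OF k] cinner_add_right distrib_left Bochner_Integration.integral_add cinner_conv(2)[OF k])
 show "conv_l2 k (c *\<^sub>C a) = c *\<^sub>C conv_l2 k a" for c a
  by (rule cinner_ext) (simp add: cinner_conv(1)[OF k] cinner_scaleC_right mult.left_commute)
qed

lemma cinner_trans_left: "cinner (trans_l2 t \<phi>) \<psi> = cinner \<phi> (trans_l2 (- t) \<psi>)"
 using cinner_trans[of "- t" "trans_l2 t \<phi>" \<psi>] by (simp add: trans_trans)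

lemma integral_reflect:
 fixes f :: "real \<Rightarrow> 'b::{banach, second_countable_topology}"
 shows "(LINT x|lborel. f (- x)) = (LINT x|lborel. f x)"
 using lborel_integral_real_affine[of "-1" f 0] by simp

lemma conv_adjoint:
 assumes k: "integrable lborel k" and sym: "\<And>t. k (- t) = cnj (k t)"
 shows "cinner (conv_l2 k \<phi>) \<psi> = cinner \<phi> (conv_l2 k \<psi>)"
proof -
 have "cinner (conv_l2 k \<phi>) \<psi> = cnj (LINT t|lborel. k t * cinner \<psi> (trans_l2 t \<phi>))"
  by (subst cinner_commute) (simp only: cinner_conv(1)[OF k])
 also have "\<dots> = (LINT t|lborel. cnj (k t) * cinner (trans_l2 t \<phi>) \<psi>)"
  by (simp add: cinner_commute[symmetric] flip: Bochner_Integration.integral_cnj)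
 also have "\<dots> = (LINT t|lborel. k (- t) * cinner \<phi> (trans_l2 (- t) \<psi>))"
  by (simp add: sym cinner_trans_left)
 also have "\<dots> = (LINT t|lborel. k t * cinner \<phi> (trans_l2 t \<psi>))"
  by (rule integral_reflect)
 finally show ?thesis by (simp only: cinner_conv(1)[OF k])
qed

lemma conv_commutes:
 assumes k: "integrable lborel k" and W: "bounded_clinear W" "\<And>\<phi> \<psi>. cinner (W \<phi>) \<psi> = cinner \<phi> (W \<psi>)"
  and com: "\<And>t \<psi>. W (trans_l2 t \<psi>) = trans_l2 t (W \<psi>)"
 shows "W (conv_l2 k \<psi>) = conv_l2 k (W \<psi>)"
proof (rule cinner_ext)
 fix \<phi>
 have "cinner \<phi> (W (conv_l2 k \<psi>)) = (LINT t|lborel. k t * cinner (W \<phi>) (trans_l2 t \<psi>))"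
  by (simp only: W(2)[symmetric] cinner_conv(1)[OF k])
 also have "\<dots> = cinner \<phi> (conv_l2 k (W \<psi>))"
  by (simp only: W(2) com cinner_conv(1)[OF k])
 finally show "cinner \<phi> (W (conv_l2 k \<psi>)) = cinner \<phi> (conv_l2 k (W \<psi>))" .
qed

subsection \<open>Gaussian kernels\<close>

definition gauss_kernel :: "real \<Rightarrow> complex \<Rightarrow> complex" where
 "gauss_kernel e z = exp (- z\<^sup>2 / of_real (2 * e)) / of_real (sqrt (2 * pi * e))"

lemma gauss_kernel_holomorphic: "gauss_kernel e holomorphic_on A"
 if "e > 0" unfolding gauss_kernel_def[abs_def] using that by (intro holomorphic_intros) auto

lemma gauss_kernel_Complex:
 assumes "e > 0"
 shows "gauss_kernel e (Complex t y) =
  of_real (normal_density 0 (sqrt e) t) * of_real (exp (y\<^sup>2 / (2 * e))) * cis (- (t * (y / e)))"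
proof -
 have sq: "(Complex t y)\<^sup>2 = Complex (t\<^sup>2 - y\<^sup>2) (2 * t * y)"
  by (simp add: power2_eq_square complex_eq_iff)
 have "- (Complex t y)\<^sup>2 / of_real (2 * e) = of_real (- t\<^sup>2 / (2 * e)) + of_real (y\<^sup>2 / (2 * e)) + \<i> * of_real (- (t * (y / e)))"
  unfolding sq using assms by (simp add: complex_eq_iff field_simps)
 then have "exp (- (Complex t y)\<^sup>2 / of_real (2 * e)) = of_real (exp (- t\<^sup>2 / (2 * e))) * of_real (exp (y\<^sup>2 / (2 * e))) * cis (- (t * (y / e)))"
  by (simp only: exp_add cis_conv_exp exp_of_real)
 then show ?thesis
  using assms by (simp add: gauss_kernel_def normal_density_def)
qed

lemma cmod_gauss_kernel:
 assumes "e > 0"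
 shows "cmod (gauss_kernel e (Complex t y)) = normal_density 0 (sqrt e) t * exp (y\<^sup>2 / (2 * e))"
 unfolding gauss_kernel_Complex[OF assms] by (simp add: norm_mult)

lemma integrable_gauss_kernel:
 assumes "e > 0"
 shows "integrable lborel (\<lambda>t. gauss_kernel e (Complex t y))"
proof (rule Bochner_Integration.integrable_bound)
 show "integrable lborel (\<lambda>t. normal_density 0 (sqrt e) t * exp (y\<^sup>2 / (2 * e)))"
  using assms by (intro integrable_mult_left integrable_normal_density) auto
 have "continuous_on UNIV (\<lambda>t. gauss_kernel e (Complex t y))"
  by (rule continuous_on_compose2[OF holomorphic_on_imp_continuous_on[OF gauss_kernel_holomorphic[OF assms, of UNIV]] continuous_on_Complex(1)]) simp
 then show "(\<lambda>t. gauss_kernel e (Complex t y)) \<in> borel_measurable lborel"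
  by (simp add: borel_measurable_continuous_onI)
qed (simp add: cmod_gauss_kernel[OF assms])

lemma gauss_kernel_uminus: "gauss_kernel e (- z) = gauss_kernel e z"
 by (simp add: gauss_kernel_def)

lemma gauss_kernel_cnj: "cnj (gauss_kernel e z) = gauss_kernel e (cnj z)"
 by (simp add: gauss_kernel_def exp_cnj)

lemma gauss_kernel_sym: "gauss_kernel e (Complex (- t) y) = cnj (gauss_kernel e (Complex t y))"
proof -
 have "Complex (- t) y = - cnj (Complex t y)" by (simp add: complex_eq_iff)
 then show ?thesis by (simp only: gauss_kernel_uminus gauss_kernel_cnj)
qed

text \<open>A complex translate of a Gaussian is a modulated Gaussian, so this is the characteristic function of a
 normal distribution at a shifted frequency.\<close>

lemma gauss_fourier:
 assumes e: "e > 0"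
 shows "(LINT t|lborel. gauss_kernel e (Complex t y) * cis (t * r)) = of_real (exp (y * r - e * r\<^sup>2 / 2))"
proof -
 have base: "(LINT t|lborel. of_real (normal_density 0 (sqrt e) t) * cis (t * s)) = complex_of_real (exp (- (e * s\<^sup>2 / 2)))" for s
 proof -
  have "complex_of_real (exp (- ((sqrt e * s)\<^sup>2) / 2)) = char std_normal_distribution (sqrt e * s)"
   by (simp add: char_std_normal_distribution)
  also have "\<dots> = (LINT x|lborel. std_normal_density x *\<^sub>R iexp (sqrt e * s * x))"
   unfolding char_def by (subst integral_density) auto
  also have "\<dots> = (LINT x|lborel. of_real (std_normal_density x) * cis (sqrt e * s * x))"
   by (simp add: scaleR_conv_of_real cis_conv_exp)
  also have "\<dots> = inverse (sqrt e) *\<^sub>R (LINT t|lborel. of_real (std_normal_density (inverse (sqrt e) * t)) * cis (t * s))"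
   using lborel_integral_real_affine[of "inverse (sqrt e)" "\<lambda>x. of_real (std_normal_density x) * cis (sqrt e * s * x)" 0] e
   by (simp add: field_simps)
  also have "\<dots> = (LINT t|lborel. inverse (sqrt e) *\<^sub>R (of_real (std_normal_density (inverse (sqrt e) * t)) * cis (t * s)))"
   by simp
  also have "\<dots> = (LINT t|lborel. of_real (normal_density 0 (sqrt e) t) * cis (t * s))"
   using e by (intro Bochner_Integration.integral_cong)
    (auto simp: normal_density_def scaleR_conv_of_real real_sqrt_mult field_simps power_mult_distrib power_divide)
  finally show ?thesis using e by (simp add: power_mult_distrib)
 qed
 have "(LINT t|lborel. gauss_kernel e (Complex t y) * cis (t * r)) =
   (LINT t|lborel. of_real (exp (y\<^sup>2 / (2 * e))) * (of_real (normal_density 0 (sqrt e) t) * cis (t * (r - y / e))))"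
 proof (rule Bochner_Integration.integral_cong[OF refl])
  fix t
  have "cis (- (t * (y / e))) * cis (t * r) = cis (t * (r - y / e))"
   by (simp only: cis_mult) (simp add: algebra_simps)
  then show "gauss_kernel e (Complex t y) * cis (t * r) = of_real (exp (y\<^sup>2 / (2 * e))) * (of_real (normal_density 0 (sqrt e) t) * cis (t * (r - y / e)))"
  proof -
   have "(N * C * a) * b = C * (N * (a * b))" for N C a b :: complex by (simp add: mult_ac)
   then show ?thesis
    unfolding gauss_kernel_Complex[OF e] \<open>cis (- (t * (y / e))) * cis (t * r) = cis (t * (r - y / e))\<close>[symmetric] .
  qed
 qed
 also have "\<dots> = of_real (exp (y\<^sup>2 / (2 * e))) * of_real (exp (- (e * (r - y / e)\<^sup>2 / 2)))"
  by (simp only: integral_mult_right_zero base)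
 also have "\<dots> = of_real (exp (y\<^sup>2 / (2 * e) - e * (r - y / e)\<^sup>2 / 2))"
 proof -
  have "complex_of_real (exp a) * of_real (exp (- b)) = of_real (exp (a - b))" for a b :: real
   by (simp only: of_real_mult[symmetric] exp_add[symmetric]) simp
  then show ?thesis .
 qed
 also have "y\<^sup>2 / (2 * e) - e * (r - y / e)\<^sup>2 / 2 = y * r - e * r\<^sup>2 / 2"
  using e by (simp add: power2_eq_square field_simps)
 finally show ?thesis .
qed

section \<open>Spectral measures\<close>

text \<open>The polarization used in the definition of \<open>spectral_form\<close>.\<close>

lemma polarization:
 assumes "bounded_clinear W"
 shows "(\<Sum>k<4. \<i> ^ k * cinner (\<psi> + \<i> ^ k *\<^sub>C \<phi>) (W (\<psi> + \<i> ^ k *\<^sub>C \<phi>))) / 4 = cinner \<phi> (W \<psi>)"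
proof -
 have expand: "cinner (\<psi> + z *\<^sub>C \<phi>) (W (\<psi> + z *\<^sub>C \<phi>)) =
   cinner \<psi> (W \<psi>) + z * cinner \<psi> (W \<phi>) + cnj z * cinner \<phi> (W \<psi>) + cnj z * z * cinner \<phi> (W \<phi>)" for z
  by (simp add: bounded_clinearD[OF assms] cinner_add_left cinner_add_right cinner_scaleC_left cinner_scaleC_right algebra_simps)
 have 4: "(\<Sum>k<4. f k) = f 0 + f 1 + f 2 + f (3::nat)" for f :: "nat \<Rightarrow> complex"
  by (simp add: eval_nat_numeral)
 have 3: "\<i> ^ 3 = - \<i>" by (simp add: power3_eq_cube)
 show ?thesis
  unfolding 4 expand by (simp add: 3 algebra_simps)
qed

lemma bounded_clinear_eqI:
 assumes W: "bounded_clinear W" "bounded_clinear V" and eq: "\<And>\<psi>. cinner \<psi> (W \<psi>) = cinner \<psi> (V \<psi>)"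
 shows "W \<psi> = V \<psi>"
proof (rule cinner_ext)
 fix \<phi>
 show "cinner \<phi> (W \<psi>) = cinner \<phi> (V \<psi>)"
  using polarization[OF W(1), of \<psi> \<phi>] polarization[OF W(2), of \<psi> \<phi>] unfolding eq by simp
qed

text \<open>Levy's uniqueness theorem is for probability measures; finite measures are reduced to it by
 normalization, their mass being the value at zero.\<close>

lemma char_unique_finite:
 fixes M N :: "real measure"
 assumes M: "finite_measure M" "sets M = sets borel" and N: "finite_measure N" "sets N = sets borel"
  and eq: "\<And>t. (LINT x|M. cis (t * x)) = (LINT x|N. cis (t * x))"
 shows "M = N"
proof -
 interpret M: finite_measure M by fact
 interpret N: finite_measure N by fact
 have sp: "space M = UNIV" "space N = UNIV"
  using sets_eq_imp_space_eq[OF M(2)] sets_eq_imp_space_eq[OF N(2)] by auto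
 define c where "c = measure M UNIV"
 have "complex_of_real (measure M UNIV) = complex_of_real (measure N UNIV)"
  using eq[of 0] by (simp add: sp scaleR_conv_of_real)
 then have c: "measure M UNIV = c" "measure N UNIV = c" by (simp_all add: c_def)
 show ?thesis
 proof (cases "c = 0")
  case True
  have "emeasure M A = 0" "emeasure N A = 0" for A
   using emeasure_space[of M A] emeasure_space[of N A] c True
   by (simp_all add: sp M.emeasure_eq_measure N.emeasure_eq_measure)
  then show ?thesis using M(2) N(2) by (intro measure_eqI) auto
 next
  case False
  then have c0: "c > 0" using measure_nonneg[of M UNIV] by (simp add: c_def less_le)
  define D where "D P = density P (\<lambda>_. ennreal (1 / c))" for P :: "real measure"
  have emD: "emeasure (D P) A = ennreal (1 / c) * emeasure P A" if "A \<in> sets P" for P A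
   using that by (simp add: D_def emeasure_density nn_integral_cmult_indicator)
  have rd: "real_distribution (D P)" if P: "finite_measure P" "sets P = sets borel" "measure P UNIV = c" for P
  proof -
   interpret P: finite_measure P by fact
   have "emeasure (D P) UNIV = ennreal (1 / c) * ennreal c"
    using P by (subst emD) (auto simp: P.emeasure_eq_measure)
   also have "\<dots> = 1" using c0 by (simp flip: ennreal_mult)
   finally have "prob_space (D P)"
    using sets_eq_imp_space_eq[OF P(2)] by (intro prob_spaceI) (simp add: D_def)
   then show ?thesis
    using P(2) sets_eq_imp_space_eq[OF P(2)] unfolding real_distribution_def real_distribution_axioms_def
    by (simp add: D_def)
  qed
  have ch: "char (D P) t = of_real (1 / c) * (LINT x|P. cis (t * x))" if "sets P = sets borel" for P t
  proof -
   have "(\<lambda>x. cis (t * x)) \<in> borel_measurable borel"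
    by (intro borel_measurable_continuous_onI continuous_intros)
   then have "(\<lambda>x. cis (t * x)) \<in> borel_measurable P"
    by (subst measurable_cong_sets[OF that refl])
   then show ?thesis
    unfolding char_def D_def using c0
    by (subst integral_density) (auto simp: cis_conv_exp scaleR_conv_of_real)
  qed
  have "char (D M) = char (D N)"
   by (rule ext) (simp only: ch M(2) N(2) eq)
  then have DD: "D M = D N" by (rule Levy_uniqueness[OF rd[OF M c(1)] rd[OF N c(2)]])
  show ?thesis
  proof (rule measure_eqI)
   fix A assume A: "A \<in> sets M"
   have "ennreal (1 / c) * emeasure M A = ennreal (1 / c) * emeasure N A"
    using emD[of A M] emD[of A N] A M(2) N(2) DD by simp
   then show "emeasure M A = emeasure N A"
    using c0 by (simp add: ennreal_mult_cancel_left)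
  qed (simp add: M N)
 qed
qed

text \<open>Simple functions below a multiple of \<open>f\<close> tend to \<open>f\<close>; dominated convergence applies.\<close>

lemma combination_of_measures_eq:
 fixes M N :: "nat \<Rightarrow> real measure" and g h :: "nat \<Rightarrow> real \<Rightarrow> complex" and f :: "real \<Rightarrow> complex"
 assumes sets: "\<And>k. sets (M k) = sets borel" "\<And>k. sets (N k) = sets borel"
  and g: "\<And>k. integrable (M k) (g k)" and h: "\<And>k. integrable (N k) (h k)"
  and eq: "\<And>A. A \<in> sets borel \<Longrightarrow>
   (\<Sum>k<n. c k * (LINT s|M k. indicator A s * g k s)) = (\<Sum>k<n. c k * (LINT s|N k. indicator A s * h k s))"
  and f: "f \<in> borel_measurable borel" "\<And>k. integrable (M k) (\<lambda>s. f s * g k s)" "\<And>k. integrable (N k) (\<lambda>s. f s * h k s)"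
 shows "(\<Sum>k<n. c k * (LINT s|M k. f s * g k s)) = (\<Sum>k<n. c k * (LINT s|N k. f s * h k s))"
proof -
 obtain F where F: "\<And>i. simple_function borel (F i)" "\<And>x. (\<lambda>i. F i x) \<longlonglongrightarrow> f x"
  "\<And>i x. cmod (F i x) \<le> 2 * cmod (f x)"
  using borel_measurable_implies_sequence_metric[OF f(1), of 0] by (auto simp del: power_Suc)
 have lim: "(\<lambda>i. LINT s|P. F i s * u s) \<longlonglongrightarrow> (LINT s|P. f s * u s)"
  if P: "sets P = sets borel" "integrable P u" "integrable P (\<lambda>s. f s * u s)" for P u
 proof (rule integral_dominated_convergence)
  show "(\<lambda>s. f s * u s) \<in> borel_measurable P" using P(3) by (rule borel_measurable_integrable)
  have "F i \<in> borel_measurable P" for i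
   by (subst measurable_cong_sets[OF P(1) refl]) (rule borel_measurable_simple_function[OF F(1)])
  then show "(\<lambda>s. F i s * u s) \<in> borel_measurable P" for i
   using borel_measurable_integrable[OF P(2)] by (rule borel_measurable_times)
  show "integrable P (\<lambda>s. 2 * cmod (f s * u s))" using P(3) by simp
  show "AE s in P. (\<lambda>i. F i s * u s) \<longlonglongrightarrow> f s * u s"
   by (intro AE_I2 tendsto_mult F(2) tendsto_const)
  show "AE s in P. norm (F i s * u s) \<le> 2 * cmod (f s * u s)" for i
  proof (rule AE_I2)
   fix s
   have "cmod (F i s) * cmod (u s) \<le> 2 * cmod (f s) * cmod (u s)" by (intro mult_right_mono F(3)) simp
   then show "norm (F i s * u s) \<le> 2 * cmod (f s * u s)" by (simp add: norm_mult)
  qed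
 qed
 have step: "(\<Sum>k<n. c k * (LINT s|M k. F i s * g k s)) = (\<Sum>k<n. c k * (LINT s|N k. F i s * h k s))" for i
 proof -
  have fin: "finite (range (F i))" using F(1)[of i] by (simp add: simple_function_def)
  define A where "A y = F i -` {y}" for y
  have A: "A y \<in> sets borel" for y using simple_functionD(2)[OF F(1)[of i], of "{y}"] by (simp add: A_def)
  have Fs: "F i s = (\<Sum>y\<in>range (F i). y * indicator (A y) s)" for s
  proof -
   have "(\<Sum>y\<in>range (F i). y * indicator (A y) s) = (\<Sum>y\<in>{F i s}. y * indicator (A y) s)"
    by (rule sum.mono_neutral_right[OF fin]) (auto simp: A_def indicator_def)
   then show ?thesis by (simp add: A_def)
  qed
  have expand: "(LINT s|P. F i s * u s) = (\<Sum>y\<in>range (F i). y * (LINT s|P. indicator (A y) s * u s))"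
   if P: "sets P = sets borel" "integrable P u" for P u
  proof -
   have iA: "integrable P (\<lambda>s. indicator (A y) s * u s)" for y
   proof (rule Bochner_Integration.integrable_bound[OF P(2)])
    show "(\<lambda>s. indicator (A y) s * u s) \<in> borel_measurable P"
     using A P by (intro borel_measurable_times borel_measurable_indicator borel_measurable_integrable) auto
   qed (auto simp: indicator_def)
   have "(LINT s|P. F i s * u s) = (LINT s|P. (\<Sum>y\<in>range (F i). y * (indicator (A y) s * u s)))"
    by (subst Fs) (simp only: sum_distrib_right mult.assoc)
   also have "\<dots> = (\<Sum>y\<in>range (F i). y * (LINT s|P. indicator (A y) s * u s))"
    using iA by (subst Bochner_Integration.integral_sum) auto
   finally show ?thesis .
  qed
  have "(\<Sum>k<n. c k * (\<Sum>y\<in>range (F i). y * (LINT s|P k. indicator (A y) s * u k s)))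
   = (\<Sum>y\<in>range (F i). y * (\<Sum>k<n. c k * (LINT s|P k. indicator (A y) s * u k s)))"
   for P :: "nat \<Rightarrow> real measure" and u
   by (simp only: sum_distrib_left mult.left_commute) (rule sum.swap)
  then show ?thesis
   by (simp only: expand sets g h eq[OF A])
 qed
 show ?thesis
 proof (rule LIMSEQ_unique)
  show "(\<lambda>i. \<Sum>k<n. c k * (LINT s|M k. F i s * g k s)) \<longlonglongrightarrow> (\<Sum>k<n. c k * (LINT s|M k. f s * g k s))"
   by (intro tendsto_sum tendsto_mult tendsto_const lim sets g f)
  show "(\<lambda>i. \<Sum>k<n. c k * (LINT s|M k. F i s * g k s)) \<longlonglongrightarrow> (\<Sum>k<n. c k * (LINT s|N k. f s * h k s))"
   unfolding step by (intro tendsto_sum tendsto_mult tendsto_const lim sets h f)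
 qed
qed

subsection \<open>The boost generator\<close>

text \<open>The spectral measure \<open>E\<close> of the modular operator enters only through the fact that its imaginary
 powers are the translations.\<close>

locale boost_spectrum =
 fixes E :: "real set \<Rightarrow> real l2 \<Rightarrow> real l2"
 assumes spectral: "spectral_measure E" and positive: "E {0<..} = id"
  and power: "\<And>t. imaginary_power E t = graph (trans_l2 (2 * pi * t))"
begin

lemma E_clinear: "A \<in> sets borel \<Longrightarrow> bounded_clinear (E A)"
 using spectral by (auto simp: spectral_measure_def)

lemma E_self_adjoint: "A \<in> sets borel \<Longrightarrow> cinner (E A \<phi>) \<psi> = cinner \<phi> (E A \<psi>)"
 using spectral by (simp add: spectral_measure_def is_adjoint_def)

lemma E_Int: "A \<in> sets borel \<Longrightarrow> B \<in> sets borel \<Longrightarrow> E A (E B \<psi>) = E (A \<inter> B) \<psi>"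
 using spectral by (simp add: spectral_measure_def)

lemma E_UNIV: "E UNIV \<psi> = \<psi>"
 using spectral by (simp add: spectral_measure_def)

lemma E_sums: "range A \<subseteq> sets borel \<Longrightarrow> disjoint_family A \<Longrightarrow> (\<lambda>n. E (A n) \<psi>) sums E (\<Union>n. A n) \<psi>"
 for A :: "nat \<Rightarrow> real set"
 using spectral unfolding spectral_measure_def by blast

lemma E_empty: "E {} \<psi> = 0"
proof -
 have "(\<lambda>n. E {} \<psi>) sums E {} \<psi>"
  using E_sums[of "\<lambda>_. {}" \<psi>] by (simp add: disjoint_family_on_def)
 then have "(\<lambda>n. E {} \<psi>) \<longlonglongrightarrow> 0" by (intro summable_LIMSEQ_zero sums_summable)
 then show ?thesis by (simp add: LIMSEQ_const_iff)
qed

lemma cinner_E: "A \<in> sets borel \<Longrightarrow> cinner \<psi> (E A \<psi>) = of_real ((norm (E A \<psi>))\<^sup>2)"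
proof -
 assume A: "A \<in> sets borel"
 have "cinner \<psi> (E A \<psi>) = cinner \<psi> (E A (E A \<psi>))" by (simp only: E_Int[OF A A] Int_absorb)
 also have "\<dots> = cinner (E A \<psi>) (E A \<psi>)" by (rule E_self_adjoint[OF A, symmetric])
 finally show ?thesis by (simp only: cinner_self)
qed

abbreviation \<mu> :: "real l2 \<Rightarrow> real measure" where "\<mu> \<psi> \<equiv> scalar_measure E \<psi>"

lemma sets_mu [simp, measurable_cong]: "sets (\<mu> \<psi>) = sets borel"
 by (simp add: scalar_measure_def sets_measure_of_conv sets.sigma_sets_eq[of "borel :: real measure", simplified])

lemma space_mu [simp]: "space (\<mu> \<psi>) = UNIV"
 by (simp add: scalar_measure_def space_measure_of_conv)

lemma emeasure_mu: "A \<in> sets borel \<Longrightarrow> emeasure (\<mu> \<psi>) A = ennreal ((norm (E A \<psi>))\<^sup>2)"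
proof -
 assume A: "A \<in> sets borel"
 have val: "Re (cinner \<psi> (E B \<psi>)) = (norm (E B \<psi>))\<^sup>2" if "B \<in> sets borel" for B
  by (simp only: cinner_E[OF that] Re_complex_of_real)
 have "emeasure (\<mu> \<psi>) A = ennreal (Re (cinner \<psi> (E A \<psi>)))"
 proof (rule emeasure_measure_of[OF scalar_measure_def])
  show "positive (sets (\<mu> \<psi>)) (\<lambda>A. ennreal (Re (cinner \<psi> (E A \<psi>))))"
   by (simp add: positive_def E_empty)
  show "countably_additive (sets (\<mu> \<psi>)) (\<lambda>A. ennreal (Re (cinner \<psi> (E A \<psi>))))"
  proof (rule countably_additiveI)
   fix B :: "nat \<Rightarrow> real set"
   assume B: "range B \<subseteq> sets (\<mu> \<psi>)" "disjoint_family B" "(\<Union>i. B i) \<in> sets (\<mu> \<psi>)"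
   have "(\<lambda>n. E (B n) \<psi>) sums E (\<Union>n. B n) \<psi>" using B by (intro E_sums) auto
   then have "(\<lambda>n. cinner \<psi> (E (B n) \<psi>)) sums cinner \<psi> (E (\<Union>n. B n) \<psi>)"
    by (rule bounded_linear.sums[OF bounded_bilinear.bounded_linear_right[OF bounded_bilinear_cinner]])
   then have "(\<lambda>n. Re (cinner \<psi> (E (B n) \<psi>))) sums Re (cinner \<psi> (E (\<Union>n. B n) \<psi>))"
    by (rule sums_Re)
   moreover have "0 \<le> Re (cinner \<psi> (E (B n) \<psi>))" for n
    using B(1) val[of "B n"] by (simp add: image_subset_iff)
   moreover have "0 \<le> Re (cinner \<psi> (E (\<Union>i. B i) \<psi>))"
    using B(3) val[of "\<Union>i. B i"] by simp
   ultimately show "(\<Sum>i. ennreal (Re (cinner \<psi> (E (B i) \<psi>)))) = ennreal (Re (cinner \<psi> (E (\<Union>i. B i) \<psi>)))"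
    by (intro sums_unique[symmetric]) (simp add: sums_ennreal)
  qed
 qed (use A sets.space_closed[of "borel :: real measure"] in auto)
 then show ?thesis by (simp only: val[OF A])
qed

lemma finite_measure_mu: "finite_measure (\<mu> \<psi>)"
 by (rule finite_measureI) (simp add: emeasure_mu)

lemma measure_mu: "A \<in> sets borel \<Longrightarrow> measure (\<mu> \<psi>) A = (norm (E A \<psi>))\<^sup>2"
 by (simp add: measure_def emeasure_mu)

lemma mu_positive: "AE s in \<mu> \<psi>. 0 < s"
proof (rule AE_I)
 show "{s \<in> space (\<mu> \<psi>). \<not> 0 < s} \<subseteq> {..0}" by auto
 have "E {..0} \<psi> = E {..0} (E {0<..} \<psi>)" by (simp add: positive)
 also have "\<dots> = E {} \<psi>" by (subst E_Int) (auto intro!: arg_cong[where f = "\<lambda>A. E A \<psi>"])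
 finally show "emeasure (\<mu> \<psi>) {..0} = 0" by (simp add: emeasure_mu E_empty)
qed simp

lemma mu_measurable [simp]: "borel_measurable (\<mu> \<psi>) = borel_measurable borel"
 by (rule measurable_cong_sets) simp_all

lemma integrable_mu_bounded:
 fixes f :: "real \<Rightarrow> complex"
 assumes "f \<in> borel_measurable borel" "AE s in \<mu> \<psi>. cmod (f s) \<le> B"
 shows "integrable (\<mu> \<psi>) f"
proof -
 interpret finite_measure "\<mu> \<psi>" by (rule finite_measure_mu)
 show ?thesis using assms by (intro integrable_const_bound[where B = B]) auto
qed

lemma mu_scaleC: "\<mu> (c *\<^sub>C \<psi>) = density (\<mu> \<psi>) (\<lambda>_. ennreal ((cmod c)\<^sup>2))"
proof (rule measure_eqI)
 fix A assume "A \<in> sets (\<mu> (c *\<^sub>C \<psi>))"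
 then have A: "A \<in> sets borel" by simp
 then show "emeasure (\<mu> (c *\<^sub>C \<psi>)) A = emeasure (density (\<mu> \<psi>) (\<lambda>_. ennreal ((cmod c)\<^sup>2))) A"
  by (simp add: emeasure_mu emeasure_density nn_integral_cmult_indicator
    bounded_clinearD(2)[OF E_clinear[OF A]] power_mult_distrib ennreal_mult)
qed simp

lemma integral_mu_scaleC:
 fixes f :: "real \<Rightarrow> complex"
 assumes "f \<in> borel_measurable borel"
 shows "(LINT s|\<mu> (c *\<^sub>C \<psi>). f s) = of_real ((cmod c)\<^sup>2) * (LINT s|\<mu> \<psi>. f s)"
 unfolding mu_scaleC using assms
 by (subst integral_density) (auto simp: scaleR_conv_of_real)

lemma form_self:
 assumes "f \<in> borel_measurable borel"
 shows "spectral_form E f \<psi> \<psi> = (LINT s|\<mu> \<psi>. f s)"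
proof -
 have 4: "(\<Sum>k<4. g k) = g 0 + g 1 + g 2 + g (3::nat)" for g :: "nat \<Rightarrow> complex"
  by (simp add: eval_nat_numeral)
 have 3: "\<i> ^ 3 = - \<i>" by (simp add: power3_eq_cube)
 have s: "\<psi> + z *\<^sub>C \<psi> = (1 + z) *\<^sub>C \<psi>" for z by (simp add: scaleC_add_left)
 have c: "(cmod (1 + 1))\<^sup>2 = 4" "(cmod (1 + \<i>))\<^sup>2 = 2" "(cmod (1 + - 1))\<^sup>2 = 0" "(cmod (1 + - \<i>))\<^sup>2 = 2"
  by (simp_all add: cmod_power2)
 have c': "(complex_of_real (cmod (1 - \<i>)))\<^sup>2 = 2" "(complex_of_real (cmod (1 + \<i>)))\<^sup>2 = 2"
   "(complex_of_real (cmod (1 + 1)))\<^sup>2 = 4"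
  by (simp_all only: of_real_power[symmetric] cmod_power2) simp_all
 show ?thesis
  unfolding spectral_form_def s integral_mu_scaleC[OF assms] 4
  by (simp add: 3 c c' del: one_add_one)
qed

lemma form_indicator:
 assumes A: "A \<in> sets borel"
 shows "spectral_form E (indicator A) \<phi> \<psi> = cinner \<phi> (E A \<psi>)"
proof -
 have "(LINT s|\<mu> \<omega>. indicator A s :: complex) = cinner \<omega> (E A \<omega>)" for \<omega>
 proof -
  interpret finite_measure "\<mu> \<omega>" by (rule finite_measure_mu)
  have "(LINT s|\<mu> \<omega>. complex_of_real (indicator A s)) = of_real (LINT s|\<mu> \<omega>. indicator A s)"
   by (rule integral_complex_of_real)
  also have "\<dots> = cinner \<omega> (E A \<omega>)" using A by (simp add: measure_mu cinner_E)
  also have "(\<lambda>s. complex_of_real (indicator A s)) = indicator A" by (auto simp: indicator_def)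
  finally show ?thesis .
 qed
 then show ?thesis
  unfolding spectral_form_def by (simp only: polarization[OF E_clinear[OF A]])
qed

lemma rapidity_measurable: "(\<lambda>s. cis (t * ln s)) \<in> borel_measurable borel"
proof -
 have "(\<lambda>x. cis (t * x)) \<in> borel_measurable borel"
  by (intro borel_measurable_continuous_onI continuous_intros)
 from measurable_compose[OF borel_measurable_ln[OF measurable_ident] this] show ?thesis by simp
qed

lemma cinner_flow: "cinner \<phi> (trans_l2 (2 * pi * t) \<psi>) = spectral_form E (\<lambda>s. cis (t * ln s)) \<phi> \<psi>"
proof -
 interpret F: finite_measure "\<mu> \<phi>" by (rule finite_measure_mu)
 have "(\<psi>, trans_l2 (2 * pi * t) \<psi>) \<in> spectral_op E (\<lambda>s. cis (t * ln s))"
  using power[of t] by (auto simp: imaginary_power_def graph_def)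
 moreover have "\<phi> \<in> spectral_domain E (\<lambda>s. cis (t * ln s))"
  by (simp add: spectral_domain_def)
 ultimately show ?thesis by (simp add: spectral_op_def)
qed

lemma cinner_flow_self: "cinner \<psi> (trans_l2 a \<psi>) = (LINT s|\<mu> \<psi>. cis (a / (2 * pi) * ln s))"
 using cinner_flow[of \<psi> "a / (2 * pi)" \<psi>] unfolding form_self[OF rapidity_measurable] by simp

text \<open>The distribution of \<open>ln s\<close> under \<open>\<mu> \<psi>\<close> has the characteristic function
 \<open>t \<mapsto> \<langle>\<psi>, \<Delta>\<^sup>i\<^sup>t \<psi>\<rangle>\<close>, which translations do not change. By uniqueness, \<open>E\<close> commutes with translations.\<close>

lemma E_trans:
 assumes A: "A \<in> sets borel"
 shows "E A (trans_l2 a \<psi>) = trans_l2 a (E A \<psi>)"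
proof -
 have "distr (\<mu> (trans_l2 a \<psi>)) borel ln = distr (\<mu> \<psi>) borel ln" for \<psi>
 proof (rule char_unique_finite)
  have lm: "ln \<in> measurable (\<mu> \<omega>) borel" for \<omega>
   using borel_measurable_ln[OF measurable_ident[of "borel :: real measure"]] by simp
  show "finite_measure (distr (\<mu> (trans_l2 a \<psi>)) borel ln)" "finite_measure (distr (\<mu> \<psi>) borel ln)"
   by (intro finite_measure.finite_measure_distr finite_measure_mu lm)+
  fix t
  have cm: "(\<lambda>x. cis (t * x)) \<in> borel_measurable borel"
   by (intro borel_measurable_continuous_onI continuous_intros)
  have ch: "(LINT x|distr (\<mu> \<omega>) borel ln. cis (t * x)) = cinner \<omega> (trans_l2 (2 * pi * t) \<omega>)" for \<omega>
   using cinner_flow_self[of \<omega> "2 * pi * t"] by (simp add: integral_distr[OF lm cm])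
  have "cinner (trans_l2 a \<psi>) (trans_l2 (2 * pi * t) (trans_l2 a \<psi>)) = cinner \<psi> (trans_l2 (2 * pi * t) \<psi>)"
   by (subst cinner_trans[of a, symmetric, of \<psi>]) (simp add: trans_trans add.commute)
  then show "(LINT x|distr (\<mu> (trans_l2 a \<psi>)) borel ln. cis (t * x)) = (LINT x|distr (\<mu> \<psi>) borel ln. cis (t * x))"
   by (simp only: ch)
 qed simp_all
 note D = this
 have em: "emeasure (\<mu> \<omega>) A = emeasure (distr (\<mu> \<omega>) borel ln) (exp -` A)" for \<omega>
 proof -
  have lm: "ln \<in> measurable (\<mu> \<omega>) borel"
   using borel_measurable_ln[OF measurable_ident[of "borel :: real measure"]] by simp
  have "(exp :: real \<Rightarrow> real) \<in> borel_measurable borel"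
   by (intro borel_measurable_continuous_onI continuous_intros)
  from measurable_sets[OF this A] have ex: "exp -` A \<in> sets (borel :: real measure)" by simp
  have "emeasure (\<mu> \<omega>) A = emeasure (\<mu> \<omega>) (ln -` (exp -` A) \<inter> space (\<mu> \<omega>))"
  proof (rule emeasure_eq_AE)
   show "AE s in \<mu> \<omega>. s \<in> A \<longleftrightarrow> s \<in> ln -` (exp -` A) \<inter> space (\<mu> \<omega>)"
    using mu_positive[of \<omega>] by eventually_elim simp
   show "ln -` (exp -` A) \<inter> space (\<mu> \<omega>) \<in> sets (\<mu> \<omega>)" using measurable_sets[OF lm ex] .
  qed (use A in simp)
  then show ?thesis by (simp add: emeasure_distr[OF lm ex])
 qed
 have "norm (E A (trans_l2 a \<psi>)) = norm (E A \<psi>)" for \<psi>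
 proof -
  have "ennreal ((norm (E A (trans_l2 a \<psi>)))\<^sup>2) = ennreal ((norm (E A \<psi>))\<^sup>2)"
   by (simp only: emeasure_mu[OF A, symmetric] em D)
  then show ?thesis by simp
 qed
 then have form: "cinner \<psi> ((trans_l2 (- a) \<circ> (E A \<circ> trans_l2 a)) \<psi>) = cinner \<psi> (E A \<psi>)" for \<psi>
  using cinner_trans_left[of a \<psi> "E A (trans_l2 a \<psi>)"] cinner_E[OF A, of \<psi>] cinner_E[OF A, of "trans_l2 a \<psi>"] by simp
 have "(trans_l2 (- a) \<circ> (E A \<circ> trans_l2 a)) \<psi> = E A \<psi>"
  by (rule bounded_clinear_eqI[OF _ _ form])
   (intro bounded_clinear_compose trans_bounded_clinear E_clinear A)+
 then have "trans_l2 a (trans_l2 (- a) (E A (trans_l2 a \<psi>))) = trans_l2 a (E A \<psi>)" by simp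
 then show ?thesis by (simp add: trans_trans)
qed

lemma E_conv: "A \<in> sets borel \<Longrightarrow> integrable lborel k \<Longrightarrow> E A (conv_l2 k \<psi>) = conv_l2 k (E A \<psi>)"
 by (rule conv_commutes) (simp_all add: E_clinear E_self_adjoint E_trans)

subsection \<open>Gaussian regularization\<close>

text \<open>\<open>regularize e y\<close> is \<open>f(ln \<Delta>)\<close> with the Gaussian multiplier
 \<open>f(2 \<pi> r) = exp (y r - e r\<^sup>2 / 2)\<close>; in particular \<open>\<Delta>\<^sup>1\<^sup>/\<^sup>2 regularize e 0 = regularize e \<pi>\<close>.\<close>

definition multiplier :: "real \<Rightarrow> real \<Rightarrow> real \<Rightarrow> complex" where
 "multiplier e y s = of_real (exp (y * (ln s / (2 * pi)) - e * (ln s / (2 * pi))\<^sup>2 / 2))"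

lemma multiplier_measurable [measurable]: "multiplier e y \<in> borel_measurable borel"
 unfolding multiplier_def[abs_def] by measurable

lemma multiplier_bound:
 assumes "e > 0"
 shows "cmod (multiplier e y s) \<le> exp (y\<^sup>2 / (2 * e))"
proof -
 define r where "r = ln s / (2 * pi)"
 have "0 \<le> (e * r - y)\<^sup>2 / (2 * e)" using assms by simp
 also have "\<dots> = y\<^sup>2 / (2 * e) - (y * r - e * r\<^sup>2 / 2)"
  using assms by (simp add: power2_eq_square field_simps)
 finally show ?thesis by (simp add: multiplier_def r_def)
qed

lemma multiplier_sqrt: "s > 0 \<Longrightarrow> of_real (sqrt s) * multiplier e y s = multiplier e (y + pi) s"
proof -
 assume s: "s > 0"
 have "exp (ln (sqrt s)) = sqrt s" using s by (intro exp_ln) simp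
 then have sq: "sqrt s = exp (ln s / 2)" using s by (simp only: ln_sqrt)
 have "(y + pi) * (ln s / (2 * pi)) = ln s / 2 + y * (ln s / (2 * pi))"
  by (simp add: field_simps)
 then have "(y + pi) * (ln s / (2 * pi)) - e * (ln s / (2 * pi))\<^sup>2 / 2
   = ln s / 2 + (y * (ln s / (2 * pi)) - e * (ln s / (2 * pi))\<^sup>2 / 2)"
  by (simp only: add_diff_eq)
 then show ?thesis unfolding multiplier_def sq by (simp only: exp_add of_real_mult)
qed

definition regularize :: "real \<Rightarrow> real \<Rightarrow> real l2 \<Rightarrow> real l2" where
 "regularize e y = conv_l2 (\<lambda>t. gauss_kernel e (Complex t y))"

lemma regularize_bounded_clinear: "e > 0 \<Longrightarrow> bounded_clinear (regularize e y)"
 unfolding regularize_def by (intro conv_bounded_clinear integrable_gauss_kernel)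

lemma regularize_adjoint: "e > 0 \<Longrightarrow> cinner (regularize e y \<phi>) \<psi> = cinner \<phi> (regularize e y \<psi>)"
 unfolding regularize_def by (intro conv_adjoint integrable_gauss_kernel gauss_kernel_sym)

lemma E_regularize: "A \<in> sets borel \<Longrightarrow> e > 0 \<Longrightarrow> E A (regularize e y \<psi>) = regularize e y (E A \<psi>)"
 unfolding regularize_def by (intro E_conv integrable_gauss_kernel)

text \<open>Fubini's theorem for the Gaussian integral of the flow and the spectral integral, followed by the
 Fourier transform of the Gaussian.\<close>

lemma cinner_regularize_self:
 assumes e: "e > 0"
 shows "cinner \<psi> (regularize e y \<psi>) = (LINT s|\<mu> \<psi>. multiplier e y s)"
proof -
 interpret finite_measure "\<mu> \<psi>" by (rule finite_measure_mu)
 interpret P: pair_sigma_finite lborel "\<mu> \<psi>" ..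
 let ?k = "\<lambda>t. gauss_kernel e (Complex t y)"
 have ki: "integrable lborel ?k" by (rule integrable_gauss_kernel[OF e])
 have km[measurable]: "?k \<in> borel_measurable borel" using ki by (auto dest: borel_measurable_integrable)
 have cm: "(\<lambda>(t, s). cis (t / (2 * pi) * ln s)) \<in> borel_measurable (borel \<Otimes>\<^sub>M borel)"
 proof -
  have "cis \<in> borel_measurable borel" by (intro borel_measurable_continuous_onI continuous_intros)
  from measurable_compose[OF _ this, of "\<lambda>(t, s). t / (2 * pi) * ln s"] show ?thesis
   by (simp add: case_prod_beta')
 qed
 then have m: "(\<lambda>(t, s). ?k t * cis (t / (2 * pi) * ln s)) \<in> borel_measurable (lborel \<Otimes>\<^sub>M \<mu> \<psi>)"
 proof -
  have "(\<lambda>(t, s). ?k t * cis (t / (2 * pi) * ln s)) \<in> borel_measurable (borel \<Otimes>\<^sub>M borel)"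
   using cm by (simp add: case_prod_beta')
  then show ?thesis by (simp cong: measurable_cong_sets sets_pair_measure_cong)
 qed
 have int: "integrable (lborel \<Otimes>\<^sub>M \<mu> \<psi>) (\<lambda>(t, s). ?k t * cis (t / (2 * pi) * ln s))"
 proof (rule P.Fubini_integrable[OF m])
  show "integrable lborel (\<lambda>t. LINT s|\<mu> \<psi>. norm (case (t, s) of (t, s) \<Rightarrow> ?k t * cis (t / (2 * pi) * ln s)))"
   using ki by (simp add: norm_mult)
  show "AE t in lborel. integrable (\<mu> \<psi>) (\<lambda>s. case (t, s) of (t, s) \<Rightarrow> ?k t * cis (t / (2 * pi) * ln s))"
  proof (rule AE_I2)
   fix t
   show "integrable (\<mu> \<psi>) (\<lambda>s. case (t, s) of (t, s) \<Rightarrow> ?k t * cis (t / (2 * pi) * ln s))"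
    using rapidity_measurable[of "t / (2 * pi)"]
    by (intro integrable_mu_bounded[where B = "cmod (?k t)"]) (auto simp: norm_mult)
  qed
 qed
 have "cinner \<psi> (regularize e y \<psi>) = (LINT t|lborel. ?k t * (LINT s|\<mu> \<psi>. cis (t / (2 * pi) * ln s)))"
  unfolding regularize_def cinner_conv(1)[OF ki] cinner_flow_self ..
 also have "\<dots> = (LINT t|lborel. LINT s|\<mu> \<psi>. ?k t * cis (t / (2 * pi) * ln s))"
  by simp
 also have "\<dots> = (LINT s|\<mu> \<psi>. LINT t|lborel. ?k t * cis (t / (2 * pi) * ln s))"
  by (rule P.Fubini_integral[OF int, symmetric])
 also have "\<dots> = (LINT s|\<mu> \<psi>. multiplier e y s)"
 proof (rule Bochner_Integration.integral_cong[OF refl])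
  fix s
  have "(LINT t|lborel. ?k t * cis (t / (2 * pi) * ln s)) = (LINT t|lborel. ?k t * cis (t * (ln s / (2 * pi))))"
   by simp
  then show "(LINT t|lborel. ?k t * cis (t / (2 * pi) * ln s)) = multiplier e y s"
   by (simp only: gauss_fourier[OF e] multiplier_def)
 qed
 finally show ?thesis .
qed

lemma mu_E: "A \<in> sets borel \<Longrightarrow> \<mu> (E A \<psi>) = density (\<mu> \<psi>) (indicator A)"
proof (rule measure_eqI)
 fix B assume A: "A \<in> sets borel" and "B \<in> sets (\<mu> (E A \<psi>))"
 then have B: "B \<in> sets borel" by simp
 have "emeasure (density (\<mu> \<psi>) (indicator A)) B = emeasure (\<mu> \<psi>) (A \<inter> B)"
  using A B by (subst emeasure_density) (simp_all flip: indicator_inter_arith)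
 then show "emeasure (\<mu> (E A \<psi>)) B = emeasure (density (\<mu> \<psi>) (indicator A)) B"
  using A B by (simp add: emeasure_mu E_Int Int_commute)
qed simp

lemma cinner_E_regularize_self:
 assumes e: "e > 0" and A: "A \<in> sets borel"
 shows "cinner \<psi> (E A (regularize e y \<psi>)) = (LINT s|\<mu> \<psi>. indicator A s * multiplier e y s)"
proof -
 have "cinner \<psi> (E A (regularize e y \<psi>)) = cinner \<psi> (E A (E A (regularize e y \<psi>)))"
  by (simp only: E_Int[OF A A] Int_absorb)
 also have "\<dots> = cinner (E A \<psi>) (regularize e y (E A \<psi>))"
  by (simp only: E_self_adjoint[OF A, symmetric] E_regularize[OF A e, symmetric])
 also have "\<dots> = (LINT s|density (\<mu> \<psi>) (\<lambda>s. ennreal (indicator A s)). multiplier e y s)"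
  by (simp only: cinner_regularize_self[OF e] mu_E[OF A] ennreal_indicator)
 also have "\<dots> = (LINT s|\<mu> \<psi>. indicator A s *\<^sub>R multiplier e y s)"
  using A by (subst integral_density) auto
 also have "\<dots> = (LINT s|\<mu> \<psi>. indicator A s * multiplier e y s)"
  by (intro Bochner_Integration.integral_cong) (auto simp: indicator_def)
 finally show ?thesis .
qed

lemma form_multiplier:
 assumes e: "e > 0" and A: "A \<in> sets borel"
 shows "spectral_form E (\<lambda>s. indicator A s * multiplier e y s) \<phi> \<psi> = cinner \<phi> (E A (regularize e y \<psi>))"
proof -
 have "bounded_clinear (E A \<circ> regularize e y)"
  by (intro bounded_clinear_compose E_clinear A regularize_bounded_clinear e)
 from polarization[OF this] show ?thesis
  unfolding spectral_form_def by (simp add: cinner_E_regularize_self[OF e A])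
qed

lemma integrable_multiplier: "e > 0 \<Longrightarrow> integrable (\<mu> \<psi>) (multiplier e y)"
 by (intro integrable_mu_bounded[OF multiplier_measurable AE_I2]) (rule multiplier_bound)

text \<open>Regularization can be moved between the arguments of a spectral form and the integrand.\<close>

lemma form_regularize:
 assumes e: "e > 0" and f: "f \<in> borel_measurable borel"
  and int: "\<And>k. integrable (\<mu> (\<psi> + \<i> ^ k *\<^sub>C \<phi>)) (\<lambda>s. f s * multiplier e 0 s)"
 shows "(\<And>k. integrable (\<mu> (regularize e 0 \<psi> + \<i> ^ k *\<^sub>C \<phi>)) f) \<Longrightarrow>
   spectral_form E f \<phi> (regularize e 0 \<psi>) = spectral_form E (\<lambda>s. f s * multiplier e 0 s) \<phi> \<psi>"
  and "(\<And>k. integrable (\<mu> (\<psi> + \<i> ^ k *\<^sub>C regularize e 0 \<phi>)) f) \<Longrightarrow>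
   spectral_form E f (regularize e 0 \<phi>) \<psi> = spectral_form E (\<lambda>s. f s * multiplier e 0 s) \<phi> \<psi>"
proof -
 have one: "integrable (\<mu> \<omega>) (\<lambda>s. 1 :: complex)" for \<omega>
  by (rule integrable_mu_bounded[where B = 1]) auto
 note form = form_multiplier[OF e, where y = 0, unfolded spectral_form_def]
 note ind = form_indicator[unfolded spectral_form_def]
 {
  assume int1: "\<And>k. integrable (\<mu> (regularize e 0 \<psi> + \<i> ^ k *\<^sub>C \<phi>)) f"
  have "(\<Sum>k<4. \<i> ^ k * (LINT s|\<mu> (regularize e 0 \<psi> + \<i> ^ k *\<^sub>C \<phi>). f s * 1)) =
    (\<Sum>k<4. \<i> ^ k * (LINT s|\<mu> (\<psi> + \<i> ^ k *\<^sub>C \<phi>). f s * multiplier e 0 s))"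
  proof (rule combination_of_measures_eq)
   fix A :: "real set" assume A: "A \<in> sets borel"
   show "(\<Sum>k<4. \<i> ^ k * (LINT s|\<mu> (regularize e 0 \<psi> + \<i> ^ k *\<^sub>C \<phi>). indicator A s * 1)) =
     (\<Sum>k<4. \<i> ^ k * (LINT s|\<mu> (\<psi> + \<i> ^ k *\<^sub>C \<phi>). indicator A s * multiplier e 0 s))"
    using form[OF A, of \<psi> \<phi>] ind[OF A, of "regularize e 0 \<psi>" \<phi>] by simp
  qed (use int int1 f one integrable_multiplier[OF e] in simp_all)
  then show "spectral_form E f \<phi> (regularize e 0 \<psi>) = spectral_form E (\<lambda>s. f s * multiplier e 0 s) \<phi> \<psi>"
   by (simp add: spectral_form_def)
 }
 {
  assume int1: "\<And>k. integrable (\<mu> (\<psi> + \<i> ^ k *\<^sub>C regularize e 0 \<phi>)) f"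
  have "(\<Sum>k<4. \<i> ^ k * (LINT s|\<mu> (\<psi> + \<i> ^ k *\<^sub>C regularize e 0 \<phi>). f s * 1)) =
    (\<Sum>k<4. \<i> ^ k * (LINT s|\<mu> (\<psi> + \<i> ^ k *\<^sub>C \<phi>). f s * multiplier e 0 s))"
  proof (rule combination_of_measures_eq)
   fix A :: "real set" assume A: "A \<in> sets borel"
   show "(\<Sum>k<4. \<i> ^ k * (LINT s|\<mu> (\<psi> + \<i> ^ k *\<^sub>C regularize e 0 \<phi>). indicator A s * 1)) =
     (\<Sum>k<4. \<i> ^ k * (LINT s|\<mu> (\<psi> + \<i> ^ k *\<^sub>C \<phi>). indicator A s * multiplier e 0 s))"
    using form[OF A, of \<psi> \<phi>] ind[OF A, of \<psi> "regularize e 0 \<phi>"]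
    by (simp add: E_regularize[OF A e] regularize_adjoint[OF e])
  qed (use int int1 f one integrable_multiplier[OF e] in simp_all)
  then show "spectral_form E f (regularize e 0 \<phi>) \<psi> = spectral_form E (\<lambda>s. f s * multiplier e 0 s) \<phi> \<psi>"
   by (simp add: spectral_form_def)
 }
qed

end

context boost_spectrum
begin

subsection \<open>The square root of the modular operator\<close>

definition sqrt_domain :: "real l2 set" where
 "sqrt_domain = {\<psi>. integrable (\<mu> \<psi>) (\<lambda>s. s)}"

lemma spectral_domain_sqrt: "spectral_domain E (\<lambda>s. complex_of_real (sqrt s)) = sqrt_domain"
proof -
 have "integrable (\<mu> \<psi>) (\<lambda>s. (cmod (complex_of_real (sqrt s)))\<^sup>2) \<longleftrightarrow> integrable (\<mu> \<psi>) (\<lambda>s. s)" for \<psi>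
  by (rule integrable_cong_AE) (use mu_positive[of \<psi>] in \<open>auto elim!: eventually_mono\<close>)
 then show ?thesis by (simp add: spectral_domain_def sqrt_domain_def)
qed

lemma integrable_nonneg_iff:
 fixes f :: "real \<Rightarrow> real"
 assumes "f \<in> borel_measurable borel" "AE s in \<mu> \<psi>. 0 \<le> f s"
 shows "integrable (\<mu> \<psi>) f \<longleftrightarrow> (\<integral>\<^sup>+s. ennreal (f s) \<partial>\<mu> \<psi>) < \<infinity>"
proof -
 have "(\<integral>\<^sup>+s. ennreal (norm (f s)) \<partial>\<mu> \<psi>) = (\<integral>\<^sup>+s. ennreal (f s) \<partial>\<mu> \<psi>)"
  by (rule nn_integral_cong_AE) (use assms(2) in \<open>auto elim!: eventually_mono\<close>)
 then show ?thesis using assms(1) by (simp add: integrable_iff_bounded)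
qed

text \<open>The measures of a sum are only subadditive up to a factor; this suffices to see that the domain is a
 linear space.\<close>

lemma nn_integral_mu_add:
 assumes "u \<in> borel_measurable borel"
 shows "(\<integral>\<^sup>+s. u s \<partial>\<mu> (a + b)) \<le> 2 * (\<integral>\<^sup>+s. u s \<partial>\<mu> a) + 2 * (\<integral>\<^sup>+s. u s \<partial>\<mu> b)"
 using assms
proof (induction rule: borel_measurable_induct)
 case (cong f g)
 then show ?case by (simp add: space_borel)
next
 case (set A)
 have "norm (E A (a + b)) \<le> norm (E A a) + norm (E A b)"
  using set by (simp add: bounded_clinearD(1)[OF E_clinear] norm_triangle_ineq)
 then have "(norm (E A (a + b)))\<^sup>2 \<le> (norm (E A a) + norm (E A b))\<^sup>2" by (rule power_mono) simp
 also have "\<dots> \<le> 2 * (norm (E A a))\<^sup>2 + 2 * (norm (E A b))\<^sup>2"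
  using sum_squares_bound[of "norm (E A a)" "norm (E A b)"] by (simp add: power2_sum)
 finally have "ennreal ((norm (E A (a + b)))\<^sup>2) \<le> ennreal (2 * (norm (E A a))\<^sup>2 + 2 * (norm (E A b))\<^sup>2)"
  by (rule ennreal_leI)
 also have "\<dots> = 2 * ennreal ((norm (E A a))\<^sup>2) + 2 * ennreal ((norm (E A b))\<^sup>2)"
  by (simp add: ennreal_mult)
 finally show ?case using set by (simp add: emeasure_mu)
next
 case (mult u c)
 then have "c * (\<integral>\<^sup>+s. u s \<partial>\<mu> (a + b)) \<le> c * (2 * (\<integral>\<^sup>+s. u s \<partial>\<mu> a) + 2 * (\<integral>\<^sup>+s. u s \<partial>\<mu> b))"
  by (intro mult_left_mono) auto
 then show ?case using mult by (simp add: nn_integral_cmult distrib_left mult.left_commute)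
next
 case (add u v)
 have "(\<integral>\<^sup>+s. u s \<partial>\<mu> (a + b)) + (\<integral>\<^sup>+s. v s \<partial>\<mu> (a + b)) \<le>
   (2 * (\<integral>\<^sup>+s. u s \<partial>\<mu> a) + 2 * (\<integral>\<^sup>+s. u s \<partial>\<mu> b)) + (2 * (\<integral>\<^sup>+s. v s \<partial>\<mu> a) + 2 * (\<integral>\<^sup>+s. v s \<partial>\<mu> b))"
  using add by (intro add_mono) auto
 then show ?case using add by (simp add: nn_integral_add distrib_left add_ac)
next
 case (seq U)
 have "(\<integral>\<^sup>+s. (SUP i. U i s) \<partial>\<mu> (a + b)) = (SUP i. \<integral>\<^sup>+s. U i s \<partial>\<mu> (a + b))"
  using seq by (intro nn_integral_monotone_convergence_SUP) auto
 also have "\<dots> \<le> 2 * (\<integral>\<^sup>+s. (SUP i. U i s) \<partial>\<mu> a) + 2 * (\<integral>\<^sup>+s. (SUP i. U i s) \<partial>\<mu> b)"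
 proof (rule SUP_least)
  fix i
  have "(\<integral>\<^sup>+s. U i s \<partial>\<mu> (a + b)) \<le> 2 * (\<integral>\<^sup>+s. U i s \<partial>\<mu> a) + 2 * (\<integral>\<^sup>+s. U i s \<partial>\<mu> b)" by (rule seq)
  also have "\<dots> \<le> 2 * (\<integral>\<^sup>+s. (SUP i. U i s) \<partial>\<mu> a) + 2 * (\<integral>\<^sup>+s. (SUP i. U i s) \<partial>\<mu> b)"
   by (intro add_mono mult_left_mono nn_integral_mono SUP_upper) auto
  finally show "(\<integral>\<^sup>+s. U i s \<partial>\<mu> (a + b)) \<le> 2 * (\<integral>\<^sup>+s. (SUP i. U i s) \<partial>\<mu> a) + 2 * (\<integral>\<^sup>+s. (SUP i. U i s) \<partial>\<mu> b)" .
 qed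
 finally show ?case by (simp add: image_image SUP_apply)
qed

lemma mu_nonneg: "AE s in \<mu> \<psi>. 0 \<le> s"
 using mu_positive[of \<psi>] by eventually_elim simp

lemma sqrt_domain_add: "a \<in> sqrt_domain \<Longrightarrow> b \<in> sqrt_domain \<Longrightarrow> a + b \<in> sqrt_domain"
proof -
 assume ab: "a \<in> sqrt_domain" "b \<in> sqrt_domain"
 have iff: "c \<in> sqrt_domain \<longleftrightarrow> (\<integral>\<^sup>+s. ennreal s \<partial>\<mu> c) < \<infinity>" for c
  unfolding sqrt_domain_def mem_Collect_eq by (rule integrable_nonneg_iff[OF _ mu_nonneg]) simp
 have "(\<integral>\<^sup>+s. ennreal s \<partial>\<mu> (a + b)) \<le> 2 * (\<integral>\<^sup>+s. ennreal s \<partial>\<mu> a) + 2 * (\<integral>\<^sup>+s. ennreal s \<partial>\<mu> b)"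
  by (rule nn_integral_mu_add) simp
 also have "\<dots> < \<infinity>" using ab by (simp add: iff ennreal_mult_less_top)
 finally show ?thesis by (simp only: iff)
qed

lemma sqrt_domain_scaleC: "a \<in> sqrt_domain \<Longrightarrow> c *\<^sub>C a \<in> sqrt_domain"
proof -
 assume "a \<in> sqrt_domain"
 then have int: "integrable (\<mu> a) (\<lambda>s. (cmod c)\<^sup>2 *\<^sub>R s)"
  unfolding sqrt_domain_def mem_Collect_eq real_scaleR_def by (rule integrable_mult_right)
 show ?thesis
  unfolding sqrt_domain_def mem_Collect_eq mu_scaleC
 proof (subst integrable_density)
  show "integrable (\<mu> a) (\<lambda>s. (cmod c)\<^sup>2 *\<^sub>R s)" by (rule int)
 qed simp_all
qed

lemma sqrt_integrable: "\<psi> \<in> sqrt_domain \<Longrightarrow> integrable (\<mu> \<psi>) (\<lambda>s. complex_of_real (sqrt s))"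
proof -
 assume "\<psi> \<in> sqrt_domain"
 then have i: "integrable (\<mu> \<psi>) (\<lambda>s. s)" by (simp add: sqrt_domain_def)
 interpret finite_measure "\<mu> \<psi>" by (rule finite_measure_mu)
 show ?thesis
 proof (rule Bochner_Integration.integrable_bound)
  show "integrable (\<mu> \<psi>) (\<lambda>s. 1 + s)" using i by simp
  show "(\<lambda>s. complex_of_real (sqrt s)) \<in> borel_measurable (\<mu> \<psi>)" by simp
  show "AE s in \<mu> \<psi>. norm (complex_of_real (sqrt s)) \<le> norm (1 + s)"
   using mu_positive[of \<psi>]
  proof eventually_elim
   case (elim s)
   have "sqrt s \<le> 1 + s"
    using elim by (intro real_le_lsqrt) (auto simp: power2_eq_square distrib_left distrib_right)
   then show ?case using elim by simp
  qed
 qed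
qed

text \<open>The multiplier of the regularized vector compensates the growth of \<open>s\<close>. To stay within bounded
 functions, where the spectral forms are finite, \<open>s\<close> is truncated first.\<close>

lemma regularize_sqrt_domain:
 assumes e: "e > 0"
 shows "regularize e 0 \<psi> \<in> sqrt_domain"
proof -
 let ?R = "regularize e 0 \<psi>"
 have mult2: "of_real s * multiplier e 0 s = multiplier e (2 * pi) s" if "s > 0" for s
 proof -
  have "complex_of_real s = of_real (sqrt s) * of_real (sqrt s)" using that by (simp flip: of_real_mult)
  then show ?thesis using multiplier_sqrt[OF that, of e 0] multiplier_sqrt[OF that, of e pi] by (simp add: mult.assoc)
 qed
 define C where "C = exp ((2 * pi)\<^sup>2 / (2 * e))"
 define B where "B = (\<Sum>k<4. C * (norm (\<psi> + \<i> ^ k *\<^sub>C ?R))\<^sup>2) / 4"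
 define f where "f n s = min (max s 0) (real n)" for n and s :: real
 have fm: "f n \<in> borel_measurable borel" for n unfolding f_def by measurable
 have fb: "0 \<le> f n s" "f n s \<le> real n" for n s by (auto simp: f_def)
 have bound: "(\<integral>\<^sup>+s. ennreal (f n s) \<partial>\<mu> ?R) \<le> ennreal B" for n
 proof -
  have fi: "integrable (\<mu> \<omega>) (\<lambda>s. complex_of_real (f n s))" for \<omega>
   using fm fb by (intro integrable_mu_bounded[where B = "real n"]) auto
  have fmi: "integrable (\<mu> \<omega>) (\<lambda>s. complex_of_real (f n s) * multiplier e 0 s)" for \<omega>
  proof (rule integrable_mu_bounded[where B = "real n * exp (0\<^sup>2 / (2 * e))"])
   show "(\<lambda>s. complex_of_real (f n s) * multiplier e 0 s) \<in> borel_measurable borel"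
    using fm by (intro borel_measurable_times) auto
   show "AE s in \<mu> \<omega>. cmod (complex_of_real (f n s) * multiplier e 0 s) \<le> real n * exp (0\<^sup>2 / (2 * e))"
    unfolding norm_mult using fb multiplier_bound[OF e, of 0] by (intro AE_I2 mult_mono) auto
  qed
  have ptb: "AE s in \<mu> \<omega>. cmod (complex_of_real (f n s) * multiplier e 0 s) \<le> C" for \<omega>
   using mu_positive[of \<omega>]
  proof eventually_elim
   case (elim s)
   have "cmod (complex_of_real (f n s) * multiplier e 0 s) \<le> cmod (complex_of_real s * multiplier e 0 s)"
    unfolding norm_mult using elim fb(1)[of n s] by (intro mult_right_mono) (auto simp: f_def)
   also have "\<dots> \<le> C" unfolding mult2[OF elim] C_def by (rule multiplier_bound[OF e])
   finally show ?case .
  qed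
  have "complex_of_real (LINT s|\<mu> ?R. f n s) = (LINT s|\<mu> ?R. complex_of_real (f n s))" by simp
  also have "\<dots> = spectral_form E (\<lambda>s. of_real (f n s)) ?R ?R"
   using fm by (intro form_self[symmetric]) auto
  also have "\<dots> = spectral_form E (\<lambda>s. of_real (f n s) * multiplier e 0 s) ?R \<psi>"
   using fm fi fmi by (intro form_regularize(1)[OF e]) auto
  finally have "(LINT s|\<mu> ?R. f n s) \<le> cmod (spectral_form E (\<lambda>s. of_real (f n s) * multiplier e 0 s) ?R \<psi>)"
   by (metis norm_of_real abs_ge_self)
  also have "\<dots> \<le> B"
  proof -
   have "cmod (\<Sum>k<4. \<i> ^ k * (LINT s|\<mu> (\<psi> + \<i> ^ k *\<^sub>C ?R). of_real (f n s) * multiplier e 0 s))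
     \<le> (\<Sum>k<4. C * (norm (\<psi> + \<i> ^ k *\<^sub>C ?R))\<^sup>2)"
   proof (rule order_trans[OF norm_sum], rule sum_mono)
   fix k :: nat
   let ?\<omega> = "\<psi> + \<i> ^ k *\<^sub>C ?R"
   interpret finite_measure "\<mu> ?\<omega>" by (rule finite_measure_mu)
   have "cmod (LINT s|\<mu> ?\<omega>. of_real (f n s) * multiplier e 0 s) \<le> (LINT s|\<mu> ?\<omega>. C)"
    using fmi ptb[of ?\<omega>] by (intro order_trans[OF integral_norm_bound] integral_mono_AE) auto
   also have "\<dots> = C * (norm ?\<omega>)\<^sup>2" by (simp add: measure_mu E_UNIV mult.commute)
   finally show "cmod (\<i> ^ k * (LINT s|\<mu> ?\<omega>. of_real (f n s) * multiplier e 0 s)) \<le> C * (norm ?\<omega>)\<^sup>2"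
    by (simp add: norm_mult norm_power)
   qed
   then show ?thesis unfolding spectral_form_def B_def norm_divide by (simp add: divide_right_mono)
  qed
  finally have "(LINT s|\<mu> ?R. f n s) \<le> B" .
  moreover have "(\<integral>\<^sup>+s. ennreal (f n s) \<partial>\<mu> ?R) = ennreal (LINT s|\<mu> ?R. f n s)"
  proof (rule nn_integral_eq_integral)
   interpret finite_measure "\<mu> ?R" by (rule finite_measure_mu)
   show "integrable (\<mu> ?R) (f n)"
    using fm fb by (intro integrable_const_bound[where B = "real n"]) auto
  qed (use fb in auto)
  ultimately show ?thesis by (simp add: ennreal_leI)
 qed
 have "(\<integral>\<^sup>+s. ennreal s \<partial>\<mu> ?R) \<le> (\<integral>\<^sup>+s. (SUP n. ennreal (f n s)) \<partial>\<mu> ?R)"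
 proof (rule nn_integral_mono)
  fix s :: real
  obtain n where "s \<le> real n" using real_arch_simple by blast
  then have "ennreal s \<le> ennreal (f n s)" by (cases "s \<ge> 0") (auto simp: f_def ennreal_neg)
  also have "\<dots> \<le> (SUP n. ennreal (f n s))" by (rule SUP_upper) simp
  finally show "ennreal s \<le> (SUP n. ennreal (f n s))" .
 qed
 also have "\<dots> = (SUP n. \<integral>\<^sup>+s. ennreal (f n s) \<partial>\<mu> ?R)"
 proof (rule nn_integral_monotone_convergence_SUP)
  show "incseq (\<lambda>n s. ennreal (f n s))"
   by (auto simp: incseq_def le_fun_def f_def intro!: ennreal_leI)
 qed (use fm in auto)
 also have "\<dots> \<le> ennreal B" by (rule SUP_least) (rule bound)
 finally have "(\<integral>\<^sup>+s. ennreal s \<partial>\<mu> ?R) < \<infinity>" by (rule le_less_trans) simp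
 then show ?thesis
  unfolding sqrt_domain_def mem_Collect_eq by (subst integrable_nonneg_iff[OF _ mu_nonneg]) simp_all
qed

lemma sqrt_multiplier:
 "spectral_form E (\<lambda>s. complex_of_real (sqrt s) * multiplier e 0 s) \<phi> \<psi> = cinner \<phi> (regularize e pi \<psi>)"
 "integrable (\<mu> \<psi>) (\<lambda>s. complex_of_real (sqrt s) * multiplier e 0 s)" if e: "e > 0"
proof -
 have ae: "AE s in \<mu> \<omega>. complex_of_real (sqrt s) * multiplier e 0 s = multiplier e pi s" for \<omega>
  using mu_positive[of \<omega>] by eventually_elim (use multiplier_sqrt[of _ e 0] in simp)
 have "(LINT s|\<mu> \<omega>. complex_of_real (sqrt s) * multiplier e 0 s) = (LINT s|\<mu> \<omega>. indicator UNIV s * multiplier e pi s)" for \<omega>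
  by (rule integral_cong_AE) (use ae[of \<omega>] in auto)
 then have "spectral_form E (\<lambda>s. complex_of_real (sqrt s) * multiplier e 0 s) \<phi> \<psi> =
   spectral_form E (\<lambda>s. indicator UNIV s * multiplier e pi s) \<phi> \<psi>"
  by (simp only: spectral_form_def)
 then show "spectral_form E (\<lambda>s. complex_of_real (sqrt s) * multiplier e 0 s) \<phi> \<psi> = cinner \<phi> (regularize e pi \<psi>)"
  using form_multiplier[OF e, of UNIV pi \<phi> \<psi>] by (simp add: E_UNIV)
 show "integrable (\<mu> \<psi>) (\<lambda>s. complex_of_real (sqrt s) * multiplier e 0 s)"
  using integrable_cong_AE[OF _ _ ae[of \<psi>]] integrable_multiplier[OF e, of \<psi> pi] by simp
qed

abbreviation sqrt_op :: "(real l2 \<times> real l2) set" where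
 "sqrt_op \<equiv> spectral_op E (\<lambda>s. complex_of_real (sqrt s))"

theorem regularize_in_sqrt_op:
 assumes e: "e > 0"
 shows "(regularize e 0 \<psi>, regularize e pi \<psi>) \<in> sqrt_op"
 unfolding spectral_op_def spectral_domain_sqrt mem_Collect_eq case_prod_conv
proof (intro conjI ballI)
 show dom: "regularize e 0 \<psi> \<in> sqrt_domain" by (rule regularize_sqrt_domain[OF e])
 fix \<phi> assume \<phi>: "\<phi> \<in> sqrt_domain"
 have "spectral_form E (\<lambda>s. complex_of_real (sqrt s)) \<phi> (regularize e 0 \<psi>) =
   spectral_form E (\<lambda>s. complex_of_real (sqrt s) * multiplier e 0 s) \<phi> \<psi>"
  by (rule form_regularize(1)[OF e])
    (simp_all add: sqrt_multiplier(2)[OF e] sqrt_integrable sqrt_domain_add sqrt_domain_scaleC dom \<phi>)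
 then show "cinner \<phi> (regularize e pi \<psi>) = spectral_form E (\<lambda>s. complex_of_real (sqrt s)) \<phi> (regularize e 0 \<psi>)"
  by (simp only: sqrt_multiplier(1)[OF e])
qed

theorem sqrt_op_regularize:
 assumes e: "e > 0" and xy: "(x, y) \<in> sqrt_op"
 shows "regularize e 0 y = regularize e pi x"
proof (rule cinner_ext)
 fix \<phi>
 have x: "x \<in> sqrt_domain" and y: "\<And>\<phi>. \<phi> \<in> sqrt_domain \<Longrightarrow> cinner \<phi> y = spectral_form E (\<lambda>s. complex_of_real (sqrt s)) \<phi> x"
  using xy unfolding spectral_op_def spectral_domain_sqrt mem_Collect_eq case_prod_conv by blast+
 have "cinner \<phi> (regularize e 0 y) = cinner (regularize e 0 \<phi>) y" by (simp only: regularize_adjoint[OF e])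
 also have "\<dots> = spectral_form E (\<lambda>s. complex_of_real (sqrt s)) (regularize e 0 \<phi>) x"
  by (rule y[OF regularize_sqrt_domain[OF e]])
 also have "\<dots> = spectral_form E (\<lambda>s. complex_of_real (sqrt s) * multiplier e 0 s) \<phi> x"
  by (rule form_regularize(2)[OF e])
    (simp_all add: sqrt_multiplier(2)[OF e] sqrt_integrable sqrt_domain_add sqrt_domain_scaleC x regularize_sqrt_domain[OF e])
 also have "\<dots> = cinner \<phi> (regularize e pi x)" by (rule sqrt_multiplier(1)[OF e])
 finally show "cinner \<phi> (regularize e 0 y) = cinner \<phi> (regularize e pi x)" .
qed

lemma norm_regularize_le: "e > 0 \<Longrightarrow> norm (regularize e 0 \<psi>) \<le> norm \<psi>"
proof -
 assume e: "e > 0"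
 have "(LINT t|lborel. cmod (gauss_kernel e (Complex t 0))) = 1"
  unfolding cmod_gauss_kernel[OF e] using integral_normal_density[of "sqrt e" 0] e by simp
 then show ?thesis
  using norm_conv_le[OF integrable_gauss_kernel[OF e, of 0], of \<psi>] by (simp add: regularize_def)
qed

text \<open>The norm of the difference is controlled by a spectral integral, to which dominated convergence
 applies.\<close>

theorem regularize_tendsto: "(\<lambda>n. regularize (1 / real (Suc n)) 0 \<psi>) \<longlonglongrightarrow> \<psi>"
proof -
 let ?R = "\<lambda>n. regularize (1 / real (Suc n)) 0 \<psi>"
 interpret finite_measure "\<mu> \<psi>" by (rule finite_measure_mu)
 have "(\<lambda>n. LINT s|\<mu> \<psi>. multiplier (1 / real (Suc n)) 0 s) \<longlonglongrightarrow> (LINT s|\<mu> \<psi>. 1)"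
 proof (rule integral_dominated_convergence[where w = "\<lambda>_. 1"])
  show "AE s in \<mu> \<psi>. norm (multiplier (1 / real (Suc n)) 0 s) \<le> 1" for n
   using multiplier_bound[of "1 / real (Suc n)" 0] by (intro AE_I2) simp
  show "AE s in \<mu> \<psi>. (\<lambda>n. multiplier (1 / real (Suc n)) 0 s) \<longlonglongrightarrow> 1"
  proof (rule AE_I2)
   fix s :: real
   define c where "c = (ln s / (2 * pi))\<^sup>2 / 2"
   have "(\<lambda>n. - (1 / real (Suc n)) * c) \<longlonglongrightarrow> - 0 * c"
    by (rule tendsto_mult_right[OF tendsto_minus[OF LIMSEQ_Suc[OF lim_1_over_n]]])
   from tendsto_of_real[OF tendsto_exp[OF this], where 'a = complex]
   have "(\<lambda>n. complex_of_real (exp (- (1 / real (Suc n)) * c))) \<longlonglongrightarrow> 1" by simp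
   moreover have "multiplier (1 / real (Suc n)) 0 s = of_real (exp (- (1 / real (Suc n)) * c))" for n
    unfolding multiplier_def c_def by simp
   ultimately show "(\<lambda>n. multiplier (1 / real (Suc n)) 0 s) \<longlonglongrightarrow> 1" by simp
  qed
 qed auto
 then have "(\<lambda>n. cinner \<psi> (?R n)) \<longlonglongrightarrow> of_real ((norm \<psi>)\<^sup>2)"
  by (simp add: cinner_regularize_self measure_mu E_UNIV scaleR_conv_of_real)
 from tendsto_Re[OF this] have "(\<lambda>n. Re (cinner \<psi> (?R n))) \<longlonglongrightarrow> (norm \<psi>)\<^sup>2"
  by (simp only: Re_complex_of_real)
 then have lim: "(\<lambda>n. 2 * (norm \<psi>)\<^sup>2 - 2 * Re (cinner \<psi> (?R n))) \<longlonglongrightarrow> 2 * (norm \<psi>)\<^sup>2 - 2 * (norm \<psi>)\<^sup>2"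
  by (rule tendsto_diff[OF tendsto_const tendsto_mult_left])
 have "(norm (?R n - \<psi>))\<^sup>2 \<le> 2 * (norm \<psi>)\<^sup>2 - 2 * Re (cinner \<psi> (?R n))" for n
 proof -
  have "(norm (?R n - \<psi>))\<^sup>2 = (norm (?R n))\<^sup>2 - 2 * Re (cinner \<psi> (?R n)) + (norm \<psi>)\<^sup>2"
   using dot_norm_neg[of "?R n" \<psi>] inner_commute[of "?R n" \<psi>] by (simp add: inner_l2_def)
  moreover have "(norm (?R n))\<^sup>2 \<le> (norm \<psi>)\<^sup>2" by (intro power_mono norm_regularize_le) auto
  ultimately show ?thesis by simp
 qed
 then have "(\<lambda>n. (norm (?R n - \<psi>))\<^sup>2) \<longlonglongrightarrow> 0"
  using lim by (intro tendsto_sandwich[OF _ _ tendsto_const lim[simplified]] always_eventually) auto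
 then have "(\<lambda>n. norm (?R n - \<psi>)) \<longlonglongrightarrow> 0"
  using tendsto_real_sqrt[of "\<lambda>n. (norm (?R n - \<psi>))\<^sup>2" 0] by simp
 then have "(\<lambda>n. ?R n - \<psi>) \<longlonglongrightarrow> 0" by (rule tendsto_norm_zero_cancel)
 then show ?thesis by (rule LIM_zero_cancel)
qed

end

section \<open>Conjugation and exchange operators\<close>

subsection \<open>Complex conjugation\<close>

lemma square_integrable_cnj: "square_integrable f \<Longrightarrow> square_integrable (\<lambda>x. cnj (f x))"
 by (auto simp: square_integrable_def intro!: borel_measurable_continuous_on[of cnj] continuous_intros)

lemma conj_abs: "square_integrable f \<Longrightarrow> conj_l2 (abs_l2 f) = abs_l2 (\<lambda>x. cnj (f x))"
 by (simp add: conj_l2.abs_eq l2_rel_refl)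

lemma conj_conj [simp]: "conj_l2 (conj_l2 a) = a"
 by (rule l2_obtain[of a]) (simp add: conj_abs square_integrable_cnj)

lemma conj_diff: "conj_l2 (a - b) = conj_l2 a - conj_l2 b"
 by (rule l2_obtain[of a], rule l2_obtain[of b])
  (simp add: conj_abs minus_abs square_integrable_cnj square_integrable_diff)

lemma cinner_conj: "cinner (conj_l2 a) (conj_l2 b) = cinner b a"
 by (rule l2_obtain[of a], rule l2_obtain[of b])
  (simp add: conj_abs cinner_abs square_integrable_cnj mult.commute)

lemma norm_conj [simp]: "norm (conj_l2 a) = norm a"
 by (simp add: norm_l2_def inner_l2_def cinner_conj)

lemma tendsto_conj: "(\<lambda>n. a n) \<longlonglongrightarrow> l \<Longrightarrow> (\<lambda>n. conj_l2 (a n)) \<longlonglongrightarrow> conj_l2 l" for a :: "nat \<Rightarrow> real l2"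
 unfolding tendsto_iff dist_norm by (simp add: conj_diff[symmetric])

lemma antilinear_adjoint_conj: "antilinear_adjoint (graph conj_l2) = graph conj_l2"
proof (intro set_eqI iffI; clarify)
 fix v u assume vu: "(v, u) \<in> antilinear_adjoint (graph conj_l2)"
 have "cinner w u = cinner w (conj_l2 v)" for w
 proof -
  have "cinner v (conj_l2 w) = cinner w u"
   using vu by (auto simp: antilinear_adjoint_def graph_def)
  then show ?thesis using cinner_conj[of w "conj_l2 v"] cinner_conj[of "conj_l2 v" w] by simp
 qed
 then have "u = conj_l2 v" by (rule cinner_ext)
 then show "(v, u) \<in> graph conj_l2" by (simp add: graph_def)
next
 fix v u assume "(v, u) \<in> graph conj_l2"
 then have "u = conj_l2 v" by (simp add: graph_def)
 then show "(v, u) \<in> antilinear_adjoint (graph conj_l2)"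
  using cinner_conj[of "conj_l2 v"] by (auto simp: antilinear_adjoint_def graph_def)
qed

subsection \<open>Simple tensors\<close>

lemma tensor_abs': "square_integrable f \<Longrightarrow> square_integrable g \<Longrightarrow>
  abs_l2 f \<otimes> abs_l2 g = abs_l2 (\<lambda>z. f (fst z) * g (snd z))"
 by (simp add: tensor_abs case_prod_beta')

lemma square_integrable_tensor': "square_integrable f \<Longrightarrow> square_integrable g \<Longrightarrow>
  square_integrable (\<lambda>z. f (fst z) * g (snd z))" for f g :: "real \<Rightarrow> complex"
 using square_integrable_tensor[of f g] by (simp add: case_prod_beta')

lemma tensor_total:
 assumes "\<And>\<phi> \<psi>. cinner (\<phi> \<otimes> \<psi>) \<Xi> = 0"
 shows "\<Xi> = 0"
proof -
 have "\<Xi> \<in> {\<Psi>. cinner \<Psi> \<Xi> = 0}"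
 proof (rule l2_tensor_induct)
  have "continuous_on UNIV (\<lambda>\<Psi>. cinner \<Psi> \<Xi>)"
   using bounded_bilinear.bounded_linear_left[OF bounded_bilinear_cinner]
   by (rule linear_continuous_on)
  then show "closed {\<Psi>. cinner \<Psi> \<Xi> = 0}" by (intro closed_Collect_eq continuous_on_const)
 qed (simp_all add: cinner_add_left cinner_scaleC_left assms)
 then show ?thesis by (simp add: cinner_self)
qed

lemma cinner_tensor: "cinner (a \<otimes> b) (c \<otimes> d) = cinner a c * cinner b d"
proof -
 obtain f g h k where si: "square_integrable f" "square_integrable g" "square_integrable h" "square_integrable k"
  and eq: "a = abs_l2 f" "b = abs_l2 g" "c = abs_l2 h" "d = abs_l2 k"
  using l2_obtain[of a] l2_obtain[of b] l2_obtain[of c] l2_obtain[of d] by metis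
 have i: "integrable lborel (\<lambda>z::real \<times> real. cnj (f (fst z) * g (snd z)) * (h (fst z) * k (snd z)))"
  by (rule square_integrable_integrable_product) (intro square_integrable_tensor' si)+
 have "cinner (a \<otimes> b) (c \<otimes> d) = (LINT z|lborel. cnj (f (fst z) * g (snd z)) * (h (fst z) * k (snd z)))"
  unfolding eq using si by (simp only: tensor_abs' cinner_abs square_integrable_tensor')
 also have "\<dots> = (LINT x|lborel. LINT y|lborel. cnj (f x * g y) * (h x * k y))"
  using lborel_pair.integral_fst'[OF i[folded lborel_prod]] by (simp add: lborel_prod)
 also have "\<dots> = (LINT x|lborel. cnj (f x) * h x * (LINT y|lborel. cnj (g y) * k y))"
  by (simp add: mult_ac flip: integral_mult_right_zero)
 also have "\<dots> = cinner a c * cinner b d"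
  unfolding eq using si by (simp add: cinner_abs)
 finally show ?thesis .
qed

lemma norm_tensor: "norm (a \<otimes> b) = norm a * norm b"
proof -
 have "complex_of_real ((norm (a \<otimes> b))\<^sup>2) = of_real ((norm a * norm b)\<^sup>2)"
  by (simp only: cinner_self[symmetric] cinner_tensor) (simp add: cinner_self power_mult_distrib)
 then have "(norm (a \<otimes> b))\<^sup>2 = (norm a * norm b)\<^sup>2" by (simp only: of_real_eq_iff)
 then show ?thesis by (simp add: power2_eq_iff_nonneg)
qed

lemma tensor_diff: "(a - b) \<otimes> c = a \<otimes> c - b \<otimes> c" "c \<otimes> (a - b) = c \<otimes> a - c \<otimes> b"
 by (rule l2_obtain[of a], rule l2_obtain[of b], rule l2_obtain[of c],
   simp add: tensor_abs' minus_abs square_integrable_diff square_integrable_tensor' left_diff_distrib right_diff_distrib)+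

lemma tendsto_tensor:
 fixes a :: "nat \<Rightarrow> real l2"
 assumes "a \<longlonglongrightarrow> l"
 shows tendsto_tensor_left: "(\<lambda>n. a n \<otimes> b) \<longlonglongrightarrow> l \<otimes> b" and tendsto_tensor_right: "(\<lambda>n. b \<otimes> a n) \<longlonglongrightarrow> b \<otimes> l"
proof -
 have "(\<lambda>n. norm (a n - l) * norm b) \<longlonglongrightarrow> 0 * norm b"
  using assms by (intro tendsto_mult_right) (simp add: tendsto_norm_zero LIM_zero)
 then have "(\<lambda>n. norm (a n \<otimes> b - l \<otimes> b)) \<longlonglongrightarrow> 0" "(\<lambda>n. norm (b \<otimes> a n - b \<otimes> l)) \<longlonglongrightarrow> 0"
  by (simp_all add: tensor_diff[symmetric] norm_tensor mult.commute)
 then show "(\<lambda>n. a n \<otimes> b) \<longlonglongrightarrow> l \<otimes> b" "(\<lambda>n. b \<otimes> a n) \<longlonglongrightarrow> b \<otimes> l"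
  by (auto intro: LIM_zero_cancel tendsto_norm_zero_cancel)
qed

lemma bounded_borel_indicator: "A \<in> sets borel \<Longrightarrow> bounded_borel (indicator A)"
 by (rule bounded_borelI[where B = 1]) (auto simp: indicator_def)

text \<open>A vector orthogonal to all tensors \<open>a \<otimes> \<phi>\<close> whose factors live on complementary sets is
 supported on the diagonal, which is a null set.\<close>

lemma off_diagonal_zero:
 fixes \<Xi> :: "(real \<times> real) l2"
 assumes zero: "\<And>A (a :: real l2) \<phi>. A \<in> sets borel \<Longrightarrow>
  cinner (mul_l2 (indicator A) a \<otimes> mul_l2 (indicator (- A)) \<phi>) \<Xi> = 0"
 shows "\<Xi> = 0"
proof -
 obtain F where F: "square_integrable F" "\<Xi> = abs_l2 F" by (rule l2_obtain)
 have ae: "AE z in lborel. indicator A (fst z) * indicator (- A) (snd z) * F z = 0"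
  if A: "A \<in> sets borel" for A :: "real set"
 proof -
  let ?i = "\<lambda>z::real \<times> real. indicator A (fst z) * indicator (- A) (snd z) :: complex"
  have A': "- A \<in> sets borel" using A by auto
  have bb: "bounded_borel ?i"
  proof (rule bounded_borelI[where B = 1])
   show "?i \<in> borel_measurable borel"
    using A A' unfolding borel_prod[symmetric] by measurable
  qed (auto simp: indicator_def)
  have siF: "square_integrable (\<lambda>z. ?i z * F z)" by (rule square_integrable_mul[OF bb F(1)])
  have "abs_l2 (\<lambda>z. ?i z * F z) = 0"
  proof (rule tensor_total)
   fix a \<phi> :: "real l2"
   obtain p q where pq: "square_integrable p" "a = abs_l2 p" "square_integrable q" "\<phi> = abs_l2 q"
    using l2_obtain[of a] l2_obtain[of \<phi>] by metis
   note bi = bounded_borel_indicator[OF A] bounded_borel_indicator[OF A']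
   have "cinner (a \<otimes> \<phi>) (abs_l2 (\<lambda>z. ?i z * F z)) = (LINT z|lborel. cnj (p (fst z) * q (snd z)) * (?i z * F z))"
    using pq siF by (simp add: tensor_abs' cinner_abs square_integrable_tensor')
   also have "\<dots> = (LINT z|lborel. cnj ((indicator A (fst z) * p (fst z)) * (indicator (- A) (snd z) * q (snd z))) * F z)"
    by (intro Bochner_Integration.integral_cong) (auto simp: indicator_def)
   also have "\<dots> = cinner (mul_l2 (indicator A) a \<otimes> mul_l2 (indicator (- A)) \<phi>) \<Xi>"
    using pq F bi square_integrable_tensor'[OF square_integrable_mul[OF bi(1) pq(1)] square_integrable_mul[OF bi(2) pq(3)]]
    by (simp only: mul_abs tensor_abs' cinner_abs square_integrable_mul)
   finally show "cinner (a \<otimes> \<phi>) (abs_l2 (\<lambda>z. ?i z * F z)) = 0" using zero[OF A] by simp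
  qed
  then show ?thesis
   using siF by (simp add: zero_abs abs_l2_eq_iff square_integrable_zero)
 qed
 have "AE z in lborel. \<forall>q\<in>\<rat>. indicator {..<q} (fst z) * indicator (- {..<q}) (snd z) * F z = 0"
  by (intro AE_ball_countable' countable_rat ae) simp
 moreover have "AE z in lborel. \<forall>q\<in>\<rat>. indicator {q..} (fst z) * indicator (- {q..}) (snd z) * F z = 0"
  by (intro AE_ball_countable' countable_rat ae) simp
 ultimately have "AE z in lborel. F z = 0"
  using AE_off_diagonal
 proof eventually_elim
  case (elim z)
  consider "fst z < snd z" | "snd z < fst z" using elim(3) by linarith
  then show "F z = 0"
  proof cases
   case 1
   then obtain q where "q \<in> \<rat>" "fst z < q" "q < snd z" using Rats_dense_in_real by blast
   then show ?thesis using elim(1) by (auto simp: indicator_def split: if_splits)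
  next
   case 2
   then obtain q where "q \<in> \<rat>" "snd z < q" "q < fst z" using Rats_dense_in_real by blast
   then show ?thesis using elim(2) by (auto simp: indicator_def split: if_splits)
  qed
 qed
 then show ?thesis using F by (simp add: zero_abs abs_l2_eq_iff square_integrable_zero)
qed

subsection \<open>Operators \<open>M\<^sub>g\<close> and \<open>M\<^sub>g F\<close>\<close>

lemma mult_diff_cong_AE:
 fixes g h :: "real \<Rightarrow> complex"
 assumes "g \<in> Linf" "h \<in> Linf" "AE x in lborel. g x = h x"
 shows "mult_diff g = mult_diff h"
proof
 fix \<Psi> :: "(real \<times> real) l2"
 obtain F where F: "square_integrable F" "\<Psi> = abs_l2 F" by (rule l2_obtain)
 have m: "square_integrable (\<lambda>z. k (snd z - fst z) * F z)" if k: "k \<in> Linf" for k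
 proof -
  obtain B where B: "AE x in lborel. cmod (k x) \<le> B" and km[measurable]: "k \<in> borel_measurable borel"
   using k by (auto simp: Linf_def)
  have [measurable]: "F \<in> borel_measurable (borel \<Otimes>\<^sub>M borel)" using F(1) by (simp add: square_integrable_def borel_prod)
  show ?thesis
  proof (rule square_integrable_bound[OF F(1)])
   show "(\<lambda>z. k (snd z - fst z) * F z) \<in> borel_measurable borel"
    unfolding borel_prod[symmetric] by measurable
   show "AE z in lborel. cmod (k (snd z - fst z) * F z) \<le> B * cmod (F z)"
    using AE_lborel_diff[OF B] by eventually_elim (auto simp: norm_mult mult_right_mono)
  qed
 qed
 have "AE z in lborel. g (snd z - fst z) * F z = h (snd z - fst z) * F z"
  using AE_lborel_diff[OF assms(3)] by eventually_elim auto
 then show "mult_diff g \<Psi> = mult_diff h \<Psi>"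
  using assms F by (simp add: mult_diff_abs abs_l2_eq_iff m)
qed

lemma Linf_bounded_version:
 assumes g: "g \<in> Linf"
 obtains h where "bounded_borel h" "AE x in lborel. g x = h x" "mult_diff g = mult_diff h"
proof -
 obtain B where B: "AE x in lborel. cmod (g x) \<le> B" and gm[measurable]: "g \<in> borel_measurable borel"
  using g by (auto simp: Linf_def)
 define h where "h x = (if cmod (g x) \<le> B then g x else 0)" for x
 have h: "bounded_borel h"
 proof (rule bounded_borelI[where B = "\<bar>B\<bar>"])
  show "h \<in> borel_measurable borel" unfolding h_def[abs_def] by measurable
 qed (auto simp: h_def)
 have ae: "AE x in lborel. g x = h x" using B by eventually_elim (simp add: h_def)
 show ?thesis by (rule that[OF h ae mult_diff_cong_AE[OF g bounded_borel_Linf[OF h] ae]])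
qed

lemma square_integrable_mult_diff:
 fixes g :: "real \<Rightarrow> complex"
 assumes "bounded_borel g" "square_integrable F"
 shows "square_integrable (\<lambda>z. g (snd z - fst z) * F z)"
 using bounded_borel_rapidity_diff[OF assms(1)] assms(2) by (rule square_integrable_mul)

lemma mult_diff_flip_abs:
 assumes "bounded_borel g" "square_integrable F"
 shows "mult_diff g (flip (abs_l2 F)) = abs_l2 (\<lambda>z. g (snd z - fst z) * F (snd z, fst z))"
 using assms by (simp add: flip_abs' mult_diff_abs bounded_borel_Linf square_integrable_swap')

lemma mult_diff_bounded_clinear: "bounded_borel g \<Longrightarrow> bounded_clinear (mult_diff g)"
 using bounded_borel_rapidity_diff by (simp add: mult_diff_eq_mul mul_bounded_clinear)

lemma exchange_bounded_clinear: "bounded_borel g \<Longrightarrow> bounded_clinear (mult_diff g \<circ> flip)"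
 by (intro bounded_clinear_compose mult_diff_bounded_clinear flip_bounded_clinear)

lemma mult_diff_form:
 assumes "bounded_borel f" "square_integrable p" "square_integrable q" "square_integrable r" "square_integrable s"
 shows "cinner (abs_l2 p \<otimes> abs_l2 q) (mult_diff f (abs_l2 r \<otimes> abs_l2 s)) =
  (LINT z|lborel. cnj (p (fst z) * q (snd z)) * (f (snd z - fst z) * (r (fst z) * s (snd z))))"
 using assms
 by (simp add: tensor_abs' mult_diff_abs bounded_borel_Linf cinner_abs square_integrable_tensor'
   square_integrable_mult_diff[OF _ square_integrable_tensor'] del: complex_cnj_mult)

lemma exchange_form:
 assumes "bounded_borel g" "square_integrable p" "square_integrable q" "square_integrable r" "square_integrable s"
 shows "cinner (abs_l2 p \<otimes> abs_l2 q) (mult_diff g (flip (abs_l2 r \<otimes> abs_l2 s))) =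
  (LINT z|lborel. cnj (p (fst z) * q (snd z)) * (g (snd z - fst z) * (r (snd z) * s (fst z))))"
 using assms
 by (simp add: tensor_abs' mult_diff_flip_abs cinner_abs square_integrable_tensor'
   square_integrable_mult_diff[OF _ square_integrable_swap'[OF square_integrable_tensor', simplified]] del: complex_cnj_mult)

lemma bounded_borel_uminus: "bounded_borel g \<Longrightarrow> bounded_borel (\<lambda>u. g (- u))" for g :: "real \<Rightarrow> complex"
 unfolding bounded_borel_def by (auto intro: measurable_compose[OF borel_measurable_uminus[OF measurable_ident]])

lemma bounded_borel_cnj: "bounded_borel g \<Longrightarrow> bounded_borel (\<lambda>u. cnj (g u))"
 unfolding bounded_borel_def by (auto intro: borel_measurable_continuous_on[of cnj] continuous_intros)

lemma AE_of_AE_diff: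
 assumes "AE z in (lborel :: (real \<times> real) measure). P (snd z - fst z)"
 shows "AE u in (lborel :: real measure). P u"
proof -
 have "AE z in (lborel :: real measure) \<Otimes>\<^sub>M (lborel :: real measure). P (snd z - fst z)"
  unfolding lborel_prod by (rule assms)
 from lborel_pair.AE_pair[OF this] have "AE x in (lborel :: real measure). AE y in lborel. P (y - x)" by simp
 moreover have "\<not> trivial_limit (ae_filter (lborel :: real measure))"
  by (auto simp: trivial_limit_def eventually_ae_filter null_sets_def top.extremum_unique)
 ultimately obtain x :: real where "AE y in lborel. P (y - x)"
  using eventually_happens by blast
 from AE_translate[OF this, of "- x"] show ?thesis by simp
qed

lemma exchange_adjoint:
 assumes g: "bounded_borel g"
 shows "is_adjoint (mult_diff g \<circ> flip) (mult_diff (\<lambda>u. cnj (g (- u))) \<circ> flip)"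
 unfolding is_adjoint_def
proof (intro allI)
 fix \<Phi> \<Psi> :: "(real \<times> real) l2"
 obtain F K where F: "square_integrable F" "\<Phi> = abs_l2 F" and K: "square_integrable K" "\<Psi> = abs_l2 K"
  using l2_obtain[of \<Phi>] l2_obtain[of \<Psi>] by metis
 note bb = bounded_borel_cnj[OF bounded_borel_uminus[OF g]]
 note KS = square_integrable_mult_diff[OF g square_integrable_swap'[OF K(1)]]
 have "cinner (mult_diff (\<lambda>u. cnj (g (- u))) (flip \<Phi>)) \<Psi> =
   (LINT z|lborel. cnj (cnj (g (- (snd z - fst z))) * F (snd z, fst z)) * K z)"
  using F K bb by (simp add: mult_diff_flip_abs cinner_abs square_integrable_mult_diff[OF bb square_integrable_swap'] del: minus_diff_eq complex_cnj_mult)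
 also have "\<dots> = (LINT z|lborel. (\<lambda>z. cnj (F z) * (g (snd z - fst z) * K (snd z, fst z))) (snd z, fst z))"
  by (simp add: mult_ac)
 also have "\<dots> = (LINT z|lborel. cnj (F z) * (g (snd z - fst z) * K (snd z, fst z)))"
  using borel_measurable_integrable[OF square_integrable_integrable_product[OF F(1) KS]] by (intro integral_swap) simp
 also have "\<dots> = cinner \<Phi> (mult_diff g (flip \<Psi>))"
  using F K g KS by (simp only: mult_diff_flip_abs cinner_abs)
 finally show "cinner ((mult_diff (\<lambda>u. cnj (g (- u))) \<circ> flip) \<Phi>) \<Psi> = cinner \<Phi> ((mult_diff g \<circ> flip) \<Psi>)" by simp
qed

lemma adjoint_unique:
 assumes "is_adjoint T C" "is_adjoint T C'"
 shows "C = C'"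
proof
 fix \<phi>
 show "C \<phi> = C' \<phi>"
 proof (rule cinner_ext)
  fix \<psi>
  have "cinner (C \<phi>) \<psi> = cinner (C' \<phi>) \<psi>" using assms by (simp add: is_adjoint_def)
  then show "cinner \<psi> (C \<phi>) = cinner \<psi> (C' \<phi>)" by (metis cinner_commute)
 qed
qed

text \<open>A Gaussian vanishes nowhere, so one vector determines the multiplier.\<close>

lemma mult_diff_inject:
 assumes g: "bounded_borel g" and h: "bounded_borel h"
  and eq: "mult_diff g (abs_l2 gauss2) = mult_diff h (abs_l2 gauss2)"
 shows "AE u in lborel. g u = h u"
proof (rule AE_of_AE_diff)
 have "AE z in lborel. g (snd z - fst z) * gauss2 z = h (snd z - fst z) * gauss2 z"
  using eq g h square_integrable_gauss2
  by (simp add: mult_diff_abs bounded_borel_Linf abs_l2_eq_iff square_integrable_mult_diff)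
 then show "AE z in lborel. g (snd z - fst z) = h (snd z - fst z)"
  by eventually_elim (simp add: gauss2_def)
qed

lemma exchange_inject:
 assumes g: "bounded_borel g" and h: "bounded_borel h"
 shows "mult_diff g \<circ> flip = mult_diff h \<circ> flip \<longleftrightarrow> (AE u in lborel. g u = h u)"
proof
 assume eq: "mult_diff g \<circ> flip = mult_diff h \<circ> flip"
 show "AE u in lborel. g u = h u"
  using fun_cong[OF eq, of "flip (abs_l2 gauss2)"] by (intro mult_diff_inject g h) simp
next
 assume "AE u in lborel. g u = h u"
 then show "mult_diff g \<circ> flip = mult_diff h \<circ> flip"
  using mult_diff_cong_AE[OF bounded_borel_Linf[OF g] bounded_borel_Linf[OF h]] by simp
qed

lemma exchange_compose:
 assumes g: "bounded_borel g" and h: "bounded_borel h"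
 shows "(mult_diff g \<circ> flip) \<circ> (mult_diff h \<circ> flip) = mult_diff (\<lambda>u. g u * h (- u))"
proof
 fix \<Psi> :: "(real \<times> real) l2"
 obtain F where F: "square_integrable F" "\<Psi> = abs_l2 F" by (rule l2_obtain)
 have "mult_diff g (flip (mult_diff h (flip \<Psi>))) = abs_l2 (\<lambda>z. g (snd z - fst z) * (h (- (snd z - fst z)) * F z))"
  using F g h by (simp add: mult_diff_flip_abs square_integrable_mult_diff[OF _ square_integrable_swap'])
 also have "\<dots> = mult_diff (\<lambda>u. g u * h (- u)) \<Psi>"
  using F bounded_borel_mult[OF g bounded_borel_uminus[OF h]]
  by (simp add: mult_diff_abs bounded_borel_Linf mult.assoc)
 finally show "((mult_diff g \<circ> flip) \<circ> (mult_diff h \<circ> flip)) \<Psi> = mult_diff (\<lambda>u. g u * h (- u)) \<Psi>" by simp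
qed

lemma mult_diff_id_iff:
 assumes g: "bounded_borel g"
 shows "mult_diff g = id \<longleftrightarrow> (AE u in lborel. g u = 1)"
proof -
 have one: "mult_diff (\<lambda>_. 1) = id"
  unfolding mult_diff_eq_mul[OF bounded_borel_const] by (rule ext) (simp add: mul_const)
 show ?thesis
 proof
  assume "mult_diff g = id"
  then show "AE u in lborel. g u = 1"
   by (intro mult_diff_inject[OF g bounded_borel_const]) (simp add: one)
 next
  assume "AE u in lborel. g u = 1"
  then show "mult_diff g = id"
   using mult_diff_cong_AE[OF bounded_borel_Linf[OF g] bounded_borel_Linf[OF bounded_borel_const]] one by simp
 qed
qed

lemma exchange_unitary_iff:
 assumes g: "bounded_borel g"
 shows "unitary (mult_diff g \<circ> flip) \<longleftrightarrow> (AE u in lborel. cmod (g u) = 1)"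
proof -
 let ?T = "mult_diff g \<circ> flip" and ?T' = "mult_diff (\<lambda>u. cnj (g (- u))) \<circ> flip"
 note g' = bounded_borel_cnj[OF bounded_borel_uminus[OF g]]
 have unit: "(AE u in lborel. z u * cnj (z u) = 1) \<longleftrightarrow> (AE u in lborel. cmod (z u) = 1)" for z :: "real \<Rightarrow> complex"
 proof (intro AE_cong)
  fix u
  have "z u * cnj (z u) = of_real ((cmod (z u))\<^sup>2)" by (simp only: complex_norm_square)
  moreover have "(cmod (z u))\<^sup>2 = 1 \<longleftrightarrow> cmod (z u) = 1"
   using norm_ge_zero[of "z u"] by (simp only: power2_eq_1_iff) linarith
  ultimately show "z u * cnj (z u) = 1 \<longleftrightarrow> cmod (z u) = 1" by (simp only: of_real_eq_1_iff)
 qed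
 have TT': "?T \<circ> ?T' = id \<longleftrightarrow> (AE u in lborel. cmod (g u) = 1)"
  using mult_diff_id_iff[OF bounded_borel_mult[OF g bounded_borel_uminus[OF g']]] unit[of g]
  by (simp add: exchange_compose[OF g g'])
 show ?thesis
 proof
  assume "unitary ?T"
  then obtain T' where "is_adjoint ?T T'" "?T \<circ> T' = id" unfolding unitary_def by blast
  then show "AE u in lborel. cmod (g u) = 1"
   using adjoint_unique[OF exchange_adjoint[OF g]] TT' by blast
 next
  assume one: "AE u in lborel. cmod (g u) = 1"
  have "AE u in lborel. cmod (g (- u)) = 1"
   using AE_borel_affine[of "-1" "\<lambda>u. cmod (g u) = 1" 0] one g by (auto simp: bounded_borel_measurable)
  then have "?T' \<circ> ?T = id"
   using mult_diff_id_iff[OF bounded_borel_mult[OF g' bounded_borel_uminus[OF g]]] unit[of "\<lambda>u. g (- u)"]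
   by (simp add: exchange_compose[OF g' g] mult.commute)
  then show "unitary ?T"
   unfolding unitary_def using exchange_bounded_clinear[OF g] exchange_adjoint[OF g] TT' one by blast
 qed
qed

section \<open>The crossing identity\<close>

text \<open>For \<open>S = J K\<close> with \<open>K\<close> linear and self-adjoint, the crossing relation becomes a relation between
 pairs in the graph of \<open>K\<close>; the two vectors without a restriction on their domain are arbitrary.\<close>

definition crossing_identity :: "(real l2 \<times> real l2) set \<Rightarrow> ((real \<times> real) l2 \<Rightarrow> (real \<times> real) l2) \<Rightarrow>
  ((real \<times> real) l2 \<Rightarrow> (real \<times> real) l2) \<Rightarrow> bool" where
 "crossing_identity K T C \<longleftrightarrow> (\<forall>(a, a') \<in> K. \<forall>(b, b') \<in> K. \<forall>\<phi> \<psi>.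
   cinner (\<phi> \<otimes> b') (T (conj_l2 a' \<otimes> \<psi>)) = cinner (a \<otimes> \<phi>) (C (\<psi> \<otimes> conj_l2 b)))"

lemma crossing_identityD:
 "crossing_identity K T C \<Longrightarrow> (a, a') \<in> K \<Longrightarrow> (b, b') \<in> K \<Longrightarrow>
  cinner (\<phi> \<otimes> b') (T (conj_l2 a' \<otimes> \<psi>)) = cinner (a \<otimes> \<phi>) (C (\<psi> \<otimes> conj_l2 b))"
 unfolding crossing_identity_def by blast

lemma is_crossed_conj_iff:
 "is_crossed (graph conj_l2) T C \<longleftrightarrow> bounded_clinear C \<and> crossing_identity Id T C"
proof -
 have "Domain (graph conj_l2) = UNIV" by (auto simp: graph_def)
 then have "is_crossed (graph conj_l2) T C \<longleftrightarrow> bounded_clinear C \<and>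
  (\<forall>a \<psi> \<phi> c. cinner (\<phi> \<otimes> conj_l2 c) (T (conj_l2 a \<otimes> \<psi>)) = cinner (a \<otimes> \<phi>) (C (\<psi> \<otimes> c)))"
  unfolding is_crossed_def antilinear_adjoint_conj by (auto simp: graph_def)
 also have "(\<forall>a \<psi> \<phi> c. cinner (\<phi> \<otimes> conj_l2 c) (T (conj_l2 a \<otimes> \<psi>)) = cinner (a \<otimes> \<phi>) (C (\<psi> \<otimes> c)))
   \<longleftrightarrow> crossing_identity Id T C" (is "?L \<longleftrightarrow> ?R")
 proof
  assume *: ?L
  have "cinner (\<phi> \<otimes> b) (T (conj_l2 a \<otimes> \<psi>)) = cinner (a \<otimes> \<phi>) (C (\<psi> \<otimes> conj_l2 b))" for a b \<phi> \<psi>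
   using *[rule_format, of \<phi> "conj_l2 b" a \<psi>] by simp
  then show ?R unfolding crossing_identity_def by blast
 next
  assume ?R
  show ?L using crossing_identityD[OF \<open>?R\<close> IdI IdI, of _ "conj_l2 _"] by simp
 qed
 finally show ?thesis .
qed

text \<open>The vectors of the domain are dense in each of the two arguments that are restricted, and simple
 tensors are total.\<close>

lemma crossed_unique:
 assumes dense: "\<And>x. \<exists>d. (\<forall>n. d n \<in> Domain K) \<and> d \<longlonglongrightarrow> x"
  and C: "bounded_clinear C" "crossing_identity K T C"
  and C': "bounded_clinear C'" "crossing_identity K T C'"
 shows "C = C'"
proof (rule bounded_clinear_eq_tensor[OF C(1) C'(1)])
 have core: "C (\<psi> \<otimes> conj_l2 b) = C' (\<psi> \<otimes> conj_l2 b)" if b: "b \<in> Domain K" for \<psi> b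
 proof -
  obtain b' where b': "(b, b') \<in> K" using b by auto
  have "C (\<psi> \<otimes> conj_l2 b) - C' (\<psi> \<otimes> conj_l2 b) = 0" (is "?D = 0")
  proof (rule tensor_total)
   fix a \<phi>
   obtain d where d: "\<And>n. d n \<in> Domain K" "d \<longlonglongrightarrow> a" using dense by blast
   have "cinner (d n \<otimes> \<phi>) ?D = 0" for n
   proof -
    obtain d' where "(d n, d') \<in> K" using d(1) by auto
    from crossing_identityD[OF C(2) this b', of \<phi> \<psi>] crossing_identityD[OF C'(2) this b', of \<phi> \<psi>]
    show ?thesis by (simp add: cinner_diff_right)
   qed
   moreover have "(\<lambda>n. cinner (d n \<otimes> \<phi>) ?D) \<longlonglongrightarrow> cinner (a \<otimes> \<phi>) ?D"
    by (intro tendsto_cinner tendsto_tensor_left d tendsto_const)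
   ultimately show "cinner (a \<otimes> \<phi>) ?D = 0" by (simp add: LIMSEQ_const_iff)
  qed
  then show ?thesis by simp
 qed
 fix \<phi> \<psi>
 obtain d where d: "\<And>n. d n \<in> Domain K" "d \<longlonglongrightarrow> conj_l2 \<psi>" using dense by blast
 have lim: "(\<lambda>n. \<phi> \<otimes> conj_l2 (d n)) \<longlonglongrightarrow> \<phi> \<otimes> \<psi>"
  using tendsto_tensor_right[OF tendsto_conj[OF d(2)]] by simp
 have "(\<lambda>n. C (\<phi> \<otimes> conj_l2 (d n))) \<longlonglongrightarrow> C (\<phi> \<otimes> \<psi>)"
  by (rule bounded_linear.tendsto[OF bounded_clinearD(5)[OF C(1)] lim])
 moreover have "(\<lambda>n. C (\<phi> \<otimes> conj_l2 (d n))) \<longlonglongrightarrow> C' (\<phi> \<otimes> \<psi>)"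
  unfolding core[OF d(1)] by (rule bounded_linear.tendsto[OF bounded_clinearD(5)[OF C'(1)] lim])
 ultimately show "C (\<phi> \<otimes> \<psi>) = C' (\<phi> \<otimes> \<psi>)" by (rule LIMSEQ_unique)
qed

subsection \<open>Crossing with respect to the conjugation\<close>

text \<open>Exchanging the two variables of integration.\<close>

lemma exchange_crossing_conj:
 assumes g: "bounded_borel g"
 shows "crossing_identity Id (mult_diff g \<circ> flip) (mult_diff (\<lambda>u. g (- u)) \<circ> flip)"
 unfolding crossing_identity_def
proof clarify
 fix a b \<phi> \<psi> :: "real l2"
 obtain p q r s where si: "square_integrable p" "square_integrable q" "square_integrable r" "square_integrable s"
  and eq: "a = abs_l2 p" "b = abs_l2 q" "\<phi> = abs_l2 r" "\<psi> = abs_l2 s"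
  using l2_obtain[of a] l2_obtain[of b] l2_obtain[of \<phi>] l2_obtain[of \<psi>] by metis
 have [measurable]: "g \<in> borel_measurable borel" "p \<in> borel_measurable borel" "q \<in> borel_measurable borel"
   "r \<in> borel_measurable borel" "s \<in> borel_measurable borel"
  using si g by (auto simp: square_integrable_def bounded_borel_def)
 let ?h = "\<lambda>z. cnj (r (fst z) * q (snd z)) * (g (snd z - fst z) * (cnj (p (snd z)) * s (fst z)))"
 have cm: "cnj \<in> borel_measurable borel" by (intro borel_measurable_continuous_onI continuous_intros)
 have "?h \<in> borel_measurable borel"
  unfolding borel_prod[symmetric]
  by (intro borel_measurable_times measurable_compose[OF _ cm]) measurable
 from integral_swap[OF this]
 have "(LINT z|lborel. ?h z) = (LINT z|lborel. cnj (p (fst z) * r (snd z)) * (g (- (snd z - fst z)) * (s (snd z) * cnj (q (fst z)))))"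
  by (simp add: mult_ac)
 then show "cinner (\<phi> \<otimes> b) ((mult_diff g \<circ> flip) (conj_l2 a \<otimes> \<psi>)) =
   cinner (a \<otimes> \<phi>) ((mult_diff (\<lambda>u. g (- u)) \<circ> flip) (\<psi> \<otimes> conj_l2 b))"
  using si unfolding eq
  by (simp add: conj_abs exchange_form[OF g] exchange_form[OF bounded_borel_uminus[OF g]] square_integrable_cnj del: minus_diff_eq)
qed

text \<open>Subtracting the crossed operator of the exchange part leaves an operator whose matrix elements
 between \<open>a \<otimes> \<phi>\<close> and \<open>\<psi> \<otimes> b\<close> only depend on the pointwise product of \<open>a\<close> and \<open>\<phi>\<close>; hence its range is
 supported on the diagonal, and it vanishes.\<close>

lemma crossable_conj_form:
 assumes f: "bounded_borel f" and g: "bounded_borel g"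
  and T: "\<And>\<Psi>. T \<Psi> = mult_diff f \<Psi> + mult_diff g (flip \<Psi>)"
  and cr: "crossing_identity Id T C"
 shows "T = mult_diff g \<circ> flip"
proof -
 let ?C0 = "mult_diff (\<lambda>u. g (- u)) \<circ> flip"
 have form: "cinner (\<phi> \<otimes> b) (mult_diff f (conj_l2 a \<otimes> \<psi>)) =
   cinner (a \<otimes> \<phi>) (C (\<psi> \<otimes> conj_l2 b) - ?C0 (\<psi> \<otimes> conj_l2 b))" for a b \<phi> \<psi>
  using crossing_identityD[OF cr, of a a b b \<phi> \<psi>]
   crossing_identityD[OF exchange_crossing_conj[OF g], of a a b b \<phi> \<psi>]
  by (simp add: T cinner_add_right cinner_diff_right eq_diff_eq)
 have "C (\<psi> \<otimes> conj_l2 b) - ?C0 (\<psi> \<otimes> conj_l2 b) = 0" for b \<psi>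
 proof (rule off_diagonal_zero)
  fix A :: "real set" and a \<phi> :: "real l2" assume A: "A \<in> sets borel"
  obtain p q r s where si: "square_integrable p" "square_integrable q" "square_integrable r" "square_integrable s"
   and eq: "a = abs_l2 p" "b = abs_l2 q" "\<phi> = abs_l2 r" "\<psi> = abs_l2 s"
   using l2_obtain[of a] l2_obtain[of b] l2_obtain[of \<phi>] l2_obtain[of \<psi>] by metis
  have A': "- A \<in> sets borel" using A by auto
  note bi = bounded_borel_indicator[OF A] bounded_borel_indicator[OF A']
  have "cinner (mul_l2 (indicator (- A)) \<phi> \<otimes> b) (mult_diff f (conj_l2 (mul_l2 (indicator A) a) \<otimes> \<psi>)) =
   (LINT z|lborel. cnj (indicator (- A) (fst z) * r (fst z) * q (snd z)) *
    (f (snd z - fst z) * (cnj (indicator A (fst z) * p (fst z)) * s (snd z))))"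
   using si bi unfolding eq
   by (simp only: mul_abs conj_abs square_integrable_mul mult_diff_form[OF f] square_integrable_cnj)
  also have "\<dots> = (LINT z|(lborel :: (real \<times> real) measure). 0)"
   by (intro Bochner_Integration.integral_cong) (auto simp: indicator_def)
  finally show "cinner (mul_l2 (indicator A) a \<otimes> mul_l2 (indicator (- A)) \<phi>)
    (C (\<psi> \<otimes> conj_l2 b) - ?C0 (\<psi> \<otimes> conj_l2 b)) = 0"
   unfolding form[symmetric] by simp
 qed
 then have z: "cinner (\<phi> \<otimes> b) (mult_diff f (conj_l2 a \<otimes> \<psi>)) = 0" for a b \<phi> \<psi>
  unfolding form by simp
 have "mult_diff f (a \<otimes> \<psi>) = 0" for a \<psi>
  by (rule tensor_total) (use z[of _ _ "conj_l2 a" \<psi>] in simp)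
 moreover have "bounded_clinear (\<lambda>\<Psi>. 0 :: (real \<times> real) l2)"
  by (rule bounded_clinearI[where B = 0]) simp_all
 ultimately have "mult_diff f = (\<lambda>\<Psi>. 0)"
  by (intro bounded_clinear_eq_tensor mult_diff_bounded_clinear f) simp_all
 then show ?thesis by (intro ext) (simp add: T)
qed

theorem conj_crossable:
 assumes f: "bounded_borel f" and g: "bounded_borel g"
  and T: "\<And>\<Psi>. T \<Psi> = mult_diff f \<Psi> + mult_diff g (flip \<Psi>)"
 shows "crossable (graph conj_l2) T \<longleftrightarrow> (\<exists>g \<in> Linf. T = mult_diff g \<circ> flip)"
proof
 assume "crossable (graph conj_l2) T"
 then obtain C where "crossing_identity Id T C" unfolding crossable_def is_crossed_conj_iff by blast
 from crossable_conj_form[OF f g T this] show "\<exists>g \<in> Linf. T = mult_diff g \<circ> flip"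
  using bounded_borel_Linf[OF g] by blast
next
 assume "\<exists>g \<in> Linf. T = mult_diff g \<circ> flip"
 then obtain g h where "bounded_borel h" "mult_diff g = mult_diff h" "T = mult_diff g \<circ> flip"
  by (metis Linf_bounded_version)
 then show "crossable (graph conj_l2) T"
  unfolding crossable_def is_crossed_conj_iff
  using exchange_crossing_conj exchange_bounded_clinear[OF bounded_borel_uminus] by metis
qed

lemma AE_uminus: "(AE u in lborel. P (- u)) \<longleftrightarrow> (AE u in lborel. P u)" for P :: "real \<Rightarrow> bool"
proof -
 have imp: "AE u in lborel. Q (- u)" if Q: "AE u in lborel. Q u" for Q :: "real \<Rightarrow> bool"
 proof -
  obtain N where N: "{x. \<not> Q x} \<subseteq> N" "N \<in> null_sets lborel"
   using Q unfolding eventually_ae_filter space_lborel by auto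
  have "AE x in lborel. x \<notin> N" using N(2) by (rule AE_not_in)
  moreover have "N \<in> sets borel" using N(2) by auto
  ultimately have "AE u in lborel. - u \<notin> N"
   using AE_borel_affine[of "-1" "\<lambda>u. u \<notin> N" 0] by (simp add: pred_def)
  then show ?thesis by eventually_elim (use N in auto)
 qed
 show ?thesis
 proof
  assume "AE u in lborel. P (- u)"
  from imp[OF this] show "AE u in lborel. P u" by simp
 qed (rule imp)
qed

text \<open>Both the crossed operator and the adjoint are unique, and both are of the form \<open>M F\<close>; so only their
 functions have to be compared.\<close>

lemma crossing_symmetric_iff:
 assumes S: "\<And>C. is_crossed S T C \<longleftrightarrow> bounded_clinear C \<and> crossing_identity K T C"
  and dense: "\<And>x. \<exists>d. (\<forall>n. d n \<in> Domain K) \<and> d \<longlonglongrightarrow> x"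
  and g: "bounded_borel g" "T = mult_diff g \<circ> flip"
  and h: "bounded_borel h" "crossing_identity K T (mult_diff h \<circ> flip)"
 shows "crossing_symmetric S T \<longleftrightarrow> (AE u in lborel. h (- u) = cnj (g u))"
proof -
 note gb = bounded_borel_cnj[OF bounded_borel_uminus[OF g(1)]]
 have "crossing_symmetric S T \<longleftrightarrow> mult_diff h \<circ> flip = mult_diff (\<lambda>u. cnj (g (- u))) \<circ> flip"
  unfolding crossing_symmetric_def S
  using crossed_unique[OF dense _ _ exchange_bounded_clinear[OF h(1)] h(2)] exchange_bounded_clinear[OF h(1)] h(2)
   adjoint_unique[OF exchange_adjoint[OF g(1), folded g(2)]] exchange_adjoint[OF g(1), folded g(2)]
  by metis
 also have "\<dots> \<longleftrightarrow> (AE u in lborel. h u = cnj (g (- u)))" by (rule exchange_inject[OF h(1) gb])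
 also have "\<dots> \<longleftrightarrow> (AE u in lborel. h (- u) = cnj (g u))"
  using AE_uminus[of "\<lambda>u. h u = cnj (g (- u))"] by simp
 finally show ?thesis .
qed

theorem conj_crossing_symmetric:
 assumes g: "g \<in> Linf" and T: "T = mult_diff g \<circ> flip"
 shows "crossing_symmetric (graph conj_l2) T \<longleftrightarrow> (AE u in lborel. g u \<in> \<real>)"
proof -
 obtain h where h: "bounded_borel h" "AE u in lborel. g u = h u" "mult_diff g = mult_diff h"
  using Linf_bounded_version[OF g] .
 have T': "T = mult_diff h \<circ> flip" by (simp only: T h(3))
 have "crossing_symmetric (graph conj_l2) T \<longleftrightarrow> (AE u in lborel. h (- (- u)) = cnj (h u))"
  using exchange_crossing_conj[OF h(1)]
  by (intro crossing_symmetric_iff[OF is_crossed_conj_iff _ h(1) T' bounded_borel_uminus[OF h(1)]])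
   (auto simp: T' intro!: exI[of _ "\<lambda>n. _"])
 also have "\<dots> \<longleftrightarrow> (AE u in lborel. g u \<in> \<real>)"
 proof
  assume "AE u in lborel. h (- (- u)) = cnj (h u)"
  with h(2) show "AE u in lborel. g u \<in> \<real>" by eventually_elim (simp add: Reals_cnj_iff)
 next
  assume "AE u in lborel. g u \<in> \<real>"
  with h(2) show "AE u in lborel. h (- (- u)) = cnj (h u)" by eventually_elim (simp add: Reals_cnj_iff)
 qed
 finally show ?thesis .
qed

section \<open>Gaussian vectors in the domain of the Tomita operator\<close>

subsection \<open>Convolution against a bounded function\<close>

definition smear :: "(real \<Rightarrow> complex) \<Rightarrow> (real \<Rightarrow> complex) \<Rightarrow> real \<Rightarrow> complex" where
 "smear g w y = (LINT x|lborel. g (y - x) * w x)"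

lemma integrable_difference_kernel:
 fixes p w g :: "real \<Rightarrow> complex"
 assumes p: "integrable lborel p" and w: "integrable lborel w" and g: "bounded_borel g"
 shows "integrable (lborel \<Otimes>\<^sub>M lborel) (\<lambda>(x, y). p y * (g (y - x) * w x))"
proof -
 obtain B where B: "\<And>x. cmod (g x) \<le> B" using bounded_borel_obtain[OF g] by blast
 have [measurable]: "g \<in> borel_measurable borel" "p \<in> borel_measurable borel" "w \<in> borel_measurable borel"
  using g borel_measurable_integrable[OF p] borel_measurable_integrable[OF w] by (simp_all add: bounded_borel_def)
 have "integrable (lborel \<Otimes>\<^sub>M lborel) (\<lambda>(x, y). cmod (w x) * cmod (p y))"
  by (rule lborel_pair.Fubini_integrable) (use p w in simp_all)
 then have "integrable (lborel \<Otimes>\<^sub>M lborel) (\<lambda>z. B * (case z of (x, y) \<Rightarrow> cmod (w x) * cmod (p y)))"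
  by (rule integrable_mult_right)
 then show ?thesis
 proof (rule Bochner_Integration.integrable_bound)
  show "(\<lambda>(x, y). p y * (g (y - x) * w x)) \<in> borel_measurable (lborel \<Otimes>\<^sub>M lborel)" by measurable
  have "cmod (p y) * (cmod (g (y - x)) * cmod (w x)) \<le> \<bar>B\<bar> * (cmod (w x) * cmod (p y))" for x y
  proof -
   have "cmod (g (y - x)) * (cmod (w x) * cmod (p y)) \<le> \<bar>B\<bar> * (cmod (w x) * cmod (p y))"
    using B[of "y - x"] by (intro mult_right_mono) auto
   then show ?thesis by (simp only: mult_ac)
  qed
  then show "AE z in lborel \<Otimes>\<^sub>M lborel. norm (case z of (x, y) \<Rightarrow> p y * (g (y - x) * w x))
    \<le> norm (B * (case z of (x, y) \<Rightarrow> cmod (w x) * cmod (p y)))"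
   by (intro AE_I2) (simp add: split_beta norm_mult abs_mult)
 qed
qed

text \<open>With bounded \<open>g\<close> and integrable \<open>p\<close>, \<open>w\<close> all orders of integration agree.\<close>

lemma smear_integral:
 fixes p w g :: "real \<Rightarrow> complex"
 assumes p: "integrable lborel p" and w: "integrable lborel w" and g: "bounded_borel g"
 shows "(LINT z|lborel. p (snd z) * (g (snd z - fst z) * w (fst z))) = (LINT y|lborel. p y * smear g w y)"
  and "(LINT y|lborel. p y * smear g w y) = (LINT x|lborel. w x * (LINT y|lborel. p y * g (y - x)))"
proof -
 note i = integrable_difference_kernel[OF p w g]
 have "(LINT y|lborel. p y * smear g w y) = (LINT y|lborel. LINT x|lborel. p y * (g (y - x) * w x))"
  by (simp add: smear_def)
 also have "\<dots> = (LINT z|(lborel \<Otimes>\<^sub>M lborel). p (snd z) * (g (snd z - fst z) * w (fst z)))"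
  using lborel_pair.integral_snd[of "\<lambda>x y. p y * (g (y - x) * w x)"] i by (simp add: case_prod_beta')
 finally show one: "(LINT z|lborel. p (snd z) * (g (snd z - fst z) * w (fst z))) = (LINT y|lborel. p y * smear g w y)"
  by (simp add: lborel_prod)
 have "(LINT y|lborel. p y * smear g w y) = (LINT x|lborel. LINT y|lborel. p y * (g (y - x) * w x))"
  using lborel_pair.Fubini_integral[of "\<lambda>x y. p y * (g (y - x) * w x)"] i by (simp add: smear_def case_prod_beta')
 also have "\<dots> = (LINT x|lborel. LINT y|lborel. w x * (p y * g (y - x)))"
  by (simp only: mult_ac)
 also have "\<dots> = (LINT x|lborel. w x * (LINT y|lborel. p y * g (y - x)))" by simp
 finally show "(LINT y|lborel. p y * smear g w y) = (LINT x|lborel. w x * (LINT y|lborel. p y * g (y - x)))" .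
qed

lemma smear_integral_swap:
 fixes p w g :: "real \<Rightarrow> complex"
 assumes p: "integrable lborel p" and w: "integrable lborel w" and g: "bounded_borel g"
 shows "(LINT z|lborel. p (fst z) * (g (snd z - fst z) * w (snd z))) = (LINT y|lborel. p y * smear (\<lambda>u. g (- u)) w y)"
proof -
 have [measurable]: "g \<in> borel_measurable borel" "p \<in> borel_measurable borel" "w \<in> borel_measurable borel"
  using g borel_measurable_integrable[OF p] borel_measurable_integrable[OF w] by (simp_all add: bounded_borel_def)
 have "(\<lambda>z. p (fst z) * (g (snd z - fst z) * w (snd z))) \<in> borel_measurable borel"
  unfolding borel_prod[symmetric] by measurable
 from integral_swap[OF this]
 have "(LINT z|lborel. p (fst z) * (g (snd z - fst z) * w (snd z))) =
   (LINT z|lborel. p (snd z) * ((\<lambda>u. g (- u)) (snd z - fst z) * w (fst z)))" by simp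
 also have "\<dots> = (LINT y|lborel. p y * smear (\<lambda>u. g (- u)) w y)"
  by (rule smear_integral(1)[OF p w bounded_borel_uminus[OF g]])
 finally show ?thesis .
qed

lemma bounded_borel_smear:
 fixes w g :: "real \<Rightarrow> complex"
 assumes w: "integrable lborel w" and g: "bounded_borel g"
 shows "bounded_borel (smear g w)"
proof -
 obtain B where B0: "0 \<le> B" and B: "\<And>x. cmod (g x) \<le> B" using bounded_borel_obtain[OF g] by blast
 have [measurable]: "g \<in> borel_measurable borel" "w \<in> borel_measurable borel"
  using g borel_measurable_integrable[OF w] by (simp_all add: bounded_borel_def)
 show ?thesis
 proof (rule bounded_borelI)
  have "(\<lambda>y. LINT x|lborel. g (y - x) * w x) \<in> borel_measurable borel"
   by (intro lborel.borel_measurable_lebesgue_integral) measurable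
  then show "smear g w \<in> borel_measurable borel" by (simp add: smear_def[abs_def])
  fix y
  have "cmod (smear g w y) \<le> (LINT x|lborel. cmod (g (y - x) * w x))"
   unfolding smear_def by (rule integral_norm_bound)
  also have "\<dots> \<le> (LINT x|lborel. B * cmod (w x))"
  proof (rule integral_mono_AE')
   show "integrable lborel (\<lambda>x. B * cmod (w x))" using w by simp
   show "AE x in lborel. cmod (g (y - x) * w x) \<le> B * cmod (w x)"
    using B by (intro AE_I2) (auto simp: norm_mult intro: mult_right_mono)
  qed (use B0 in simp)
  finally show "cmod (smear g w y) \<le> (LINT x|lborel. B * cmod (w x))" .
 qed
qed

subsection \<open>Entire functions with Gaussian decay on the strip\<close>

definition strip_gaussian :: "(complex \<Rightarrow> complex) \<Rightarrow> bool" where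
 "strip_gaussian W \<longleftrightarrow> W holomorphic_on UNIV \<and>
   (\<exists>C c. 0 < c \<and> (\<forall>x y. 0 \<le> y \<longrightarrow> y \<le> pi \<longrightarrow> cmod (W (Complex x y)) \<le> C * exp (- c * x\<^sup>2)))"

lemma strip_gaussianE:
 assumes "strip_gaussian W"
 obtains C c where "C \<ge> 0" "c > 0" "\<And>x y. 0 \<le> y \<Longrightarrow> y \<le> pi \<Longrightarrow> cmod (W (Complex x y)) \<le> C * exp (- c * x\<^sup>2)"
proof -
 obtain C c where c: "c > 0" "\<And>x y. 0 \<le> y \<Longrightarrow> y \<le> pi \<Longrightarrow> cmod (W (Complex x y)) \<le> C * exp (- c * x\<^sup>2)"
  using assms unfolding strip_gaussian_def by blast
 have "cmod (W (Complex 0 0)) \<le> C" using c(2)[of 0 0] by simp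
 then have "0 \<le> C" by (rule order_trans[OF norm_ge_zero])
 then show ?thesis using that c by blast
qed

lemma strip_gaussian_mult:
 assumes "strip_gaussian V" "strip_gaussian W"
 shows "strip_gaussian (\<lambda>z. V z * W z)"
proof -
 obtain C c where C: "C \<ge> 0" "c > 0" "\<And>x y. 0 \<le> y \<Longrightarrow> y \<le> pi \<Longrightarrow> cmod (V (Complex x y)) \<le> C * exp (- c * x\<^sup>2)"
  using strip_gaussianE[OF assms(1)] by blast
 obtain D d where D: "D \<ge> 0" "d > 0" "\<And>x y. 0 \<le> y \<Longrightarrow> y \<le> pi \<Longrightarrow> cmod (W (Complex x y)) \<le> D * exp (- d * x\<^sup>2)"
  using strip_gaussianE[OF assms(2)] by blast
 have "cmod (V (Complex x y) * W (Complex x y)) \<le> (C * D) * exp (- (c + d) * x\<^sup>2)"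
  if "0 \<le> y" "y \<le> pi" for x y
 proof -
  have "cmod (V (Complex x y) * W (Complex x y)) \<le> (C * exp (- c * x\<^sup>2)) * (D * exp (- d * x\<^sup>2))"
   unfolding norm_mult using C D that by (intro mult_mono) auto
  also have "\<dots> = (C * D) * (exp (- c * x\<^sup>2) * exp (- d * x\<^sup>2))" by (simp only: mult_ac)
  also have "exp (- c * x\<^sup>2) * exp (- d * x\<^sup>2) = exp (- (c + d) * x\<^sup>2)"
   by (simp add: algebra_simps flip: exp_add)
  finally show ?thesis .
 qed
 moreover have "(\<lambda>z. V z * W z) holomorphic_on UNIV"
  using assms by (intro holomorphic_on_mult) (auto simp: strip_gaussian_def)
 ultimately show ?thesis unfolding strip_gaussian_def using C(2) D(2) by (meson add_pos_pos)
qed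

text \<open>A linear term in the exponent is absorbed by half of the quadratic one.\<close>

lemma strip_gaussian_exp:
 assumes a: "a > 0"
 shows "strip_gaussian (\<lambda>z. k * exp (- of_real a * z\<^sup>2 + b * z))"
proof -
 have "cmod (k * exp (- of_real a * (Complex x y)\<^sup>2 + b * Complex x y))
   \<le> (cmod k * exp (a * pi\<^sup>2 + \<bar>Im b\<bar> * pi + (Re b)\<^sup>2 / (2 * a))) * exp (- (a / 2) * x\<^sup>2)"
  if y: "0 \<le> y" "y \<le> pi" for x y
 proof -
  have re: "Re (- of_real a * (Complex x y)\<^sup>2 + b * Complex x y) = - a * (x\<^sup>2 - y\<^sup>2) + Re b * x - Im b * y"
   by (simp add: power2_eq_square)
  have "y\<^sup>2 \<le> pi\<^sup>2" using y by (intro power_mono)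
  then have "a * y\<^sup>2 \<le> a * pi\<^sup>2" using a by (intro mult_left_mono) auto
  moreover have "- Im b * y \<le> \<bar>Im b\<bar> * pi" using y by (intro mult_mono) auto
  moreover have "Re b * x \<le> (a / 2) * x\<^sup>2 + (Re b)\<^sup>2 / (2 * a)"
  proof -
   have "0 \<le> (a * x - Re b)\<^sup>2 / (2 * a)" using a by simp
   also have "\<dots> = (a / 2) * x\<^sup>2 + (Re b)\<^sup>2 / (2 * a) - Re b * x"
    using a by (simp add: power2_eq_square field_simps)
   finally show ?thesis by simp
  qed
  ultimately have "Re (- of_real a * (Complex x y)\<^sup>2 + b * Complex x y)
    \<le> (a * pi\<^sup>2 + \<bar>Im b\<bar> * pi + (Re b)\<^sup>2 / (2 * a)) + (- (a / 2) * x\<^sup>2)"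
   unfolding re by (simp add: algebra_simps)
  then have "exp (Re (- of_real a * (Complex x y)\<^sup>2 + b * Complex x y))
    \<le> exp (a * pi\<^sup>2 + \<bar>Im b\<bar> * pi + (Re b)\<^sup>2 / (2 * a)) * exp (- (a / 2) * x\<^sup>2)"
   by (simp only: exp_add[symmetric] exp_le_cancel_iff)
  then have "cmod k * exp (Re (- of_real a * (Complex x y)\<^sup>2 + b * Complex x y))
    \<le> cmod k * (exp (a * pi\<^sup>2 + \<bar>Im b\<bar> * pi + (Re b)\<^sup>2 / (2 * a)) * exp (- (a / 2) * x\<^sup>2))"
   by (rule mult_left_mono) simp
  then show ?thesis unfolding norm_mult norm_exp_eq_Re by (simp only: mult.assoc)
 qed
 moreover have "(\<lambda>z. k * exp (- of_real a * z\<^sup>2 + b * z)) holomorphic_on UNIV"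
  by (intro holomorphic_intros)
 moreover have "0 < a / 2" using a by simp
 ultimately show ?thesis unfolding strip_gaussian_def by blast
qed

lemma strip_gaussian_kernel:
 assumes e: "e > 0"
 shows "strip_gaussian (\<lambda>z. gauss_kernel e (z - w))"
proof -
 have "(\<lambda>z. gauss_kernel e (z - w)) =
  (\<lambda>z. (exp (- w\<^sup>2 / of_real (2 * e)) / of_real (sqrt (2 * pi * e))) * exp (- of_real (1 / (2 * e)) * z\<^sup>2 + (w / of_real e) * z))"
 proof
  fix z
  have ex: "- (z - w)\<^sup>2 / of_real (2 * e) = - w\<^sup>2 / of_real (2 * e) + (- of_real (1 / (2 * e)) * z\<^sup>2 + (w / of_real e) * z)"
   using e by (simp add: power2_eq_square field_simps)
  show "gauss_kernel e (z - w) =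
   (exp (- w\<^sup>2 / of_real (2 * e)) / of_real (sqrt (2 * pi * e))) * exp (- of_real (1 / (2 * e)) * z\<^sup>2 + (w / of_real e) * z)"
   unfolding gauss_kernel_def ex exp_add by simp
 qed
 moreover have "0 < 1 / (2 * e)" using e by simp
 ultimately show ?thesis using strip_gaussian_exp by (simp only:)
qed

lemma strip_gaussian_continuous: "strip_gaussian W \<Longrightarrow> continuous_on UNIV (\<lambda>x. W (Complex x y))"
 by (rule continuous_on_compose2[OF holomorphic_on_imp_continuous_on continuous_on_Complex(1)])
  (auto simp: strip_gaussian_def)

lemma strip_gaussian_measurable: "strip_gaussian W \<Longrightarrow> (\<lambda>x. W (Complex x y)) \<in> borel_measurable borel"
 by (intro borel_measurable_continuous_onI strip_gaussian_continuous)

lemma strip_gaussian_integrable: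
 assumes W: "strip_gaussian W" and y: "0 \<le> y" "y \<le> pi"
 shows "integrable lborel (\<lambda>x. W (Complex x y))"
proof -
 obtain C c where C: "C \<ge> 0" "c > 0" "\<And>x y. 0 \<le> y \<Longrightarrow> y \<le> pi \<Longrightarrow> cmod (W (Complex x y)) \<le> C * exp (- c * x\<^sup>2)"
  using strip_gaussianE[OF W] by blast
 show ?thesis
  by (rule Bochner_Integration.integrable_bound[OF integrable_gauss[OF C(2), of C]])
   (use C(1) C(3)[OF y] strip_gaussian_measurable[OF W] in auto)
qed

lemma strip_gaussian_square_integrable:
 assumes W: "strip_gaussian W" and y: "0 \<le> y" "y \<le> pi"
 shows "square_integrable (\<lambda>x. W (Complex x y))"
 unfolding square_integrable_def
proof
 show "(\<lambda>x. W (Complex x y)) \<in> borel_measurable borel" by (rule strip_gaussian_measurable[OF W])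
 have "integrable lborel (\<lambda>x. cmod (W (Complex x y) * W (Complex x y)))"
  using strip_gaussian_integrable[OF strip_gaussian_mult[OF W W] y] by (rule integrable_norm)
 then show "integrable lborel (\<lambda>x. (cmod (W (Complex x y)))\<^sup>2)" by (simp add: norm_mult power2_eq_square)
qed

definition strip_vec :: "(complex \<Rightarrow> complex) \<Rightarrow> real \<Rightarrow> real l2" where
 "strip_vec W y = abs_l2 (\<lambda>x. W (Complex x y))"

lemma conv_abs:
 assumes k: "integrable lborel k" and f: "square_integrable f"
 shows "conv_l2 k (abs_l2 f) = abs_l2 (\<lambda>x. LINT s|lborel. k (x - s) * f s)"
proof -
 have [measurable]: "k \<in> borel_measurable borel" "f \<in> borel_measurable borel" "rep_l2 (abs_l2 f) \<in> borel_measurable borel"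
  using borel_measurable_integrable[OF k] f square_integrable_rep[of "abs_l2 f"] by (simp_all add: square_integrable_def)
 have "(LINT t|lborel. k t * rep_l2 (abs_l2 f) (x - t)) = (LINT s|lborel. k (x - s) * f s)" for x
 proof -
  have "(LINT t|lborel. k t * rep_l2 (abs_l2 f) (x - t)) = (LINT s|lborel. k (- s) * rep_l2 (abs_l2 f) (x - - s))"
   by (rule integral_reflect[symmetric, of "\<lambda>t. k t * rep_l2 (abs_l2 f) (x - t)"])
  also have "\<dots> = (LINT s|lborel. k (- (s - x)) * rep_l2 (abs_l2 f) (x - - (s - x)))"
   by (rule integral_translate[symmetric, of "\<lambda>s. k (- s) * rep_l2 (abs_l2 f) (x - - s)"]) measurable
  also have "\<dots> = (LINT s|lborel. k (x - s) * f s)"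
  proof (rule integral_cong_AE)
   show "AE s in lborel. k (- (s - x)) * rep_l2 (abs_l2 f) (x - - (s - x)) = k (x - s) * f s"
    using rep_abs_l2[OF f] by eventually_elim simp
  qed measurable
  finally show ?thesis .
 qed
 then show ?thesis by (simp add: conv_l2_def)
qed

subsection \<open>The graph of the modular operator's square root\<close>

text \<open>The Gaussian regularization reduces every question about \<open>\<Delta>\<^sup>1\<^sup>/\<^sup>2\<close> to boundary values of entire
 functions: a pair lies in the graph once it passes the test against Gaussian vectors.\<close>

locale boost_tomita = boost_spectrum +
 fixes H :: "real l2 set"
 assumes subspace: "subspace H" and closed: "closed H"
  and polar: "tomita H = sqrt_op O graph conj_l2"
begin

lemma tomita_sqrt_op: "(x, conj_l2 y) \<in> tomita H \<longleftrightarrow> (x, y) \<in> sqrt_op"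
proof
 assume "(x, conj_l2 y) \<in> tomita H"
 then obtain z where "(x, z) \<in> sqrt_op" "conj_l2 y = conj_l2 z" unfolding polar by (auto simp: graph_def)
 then show "(x, y) \<in> sqrt_op" by (metis conj_conj)
qed (auto simp: polar graph_def)

text \<open>The two components of a vector in \<open>H + i H\<close> are recovered from its image, so that the graph is
 closed along with \<open>H\<close>.\<close>

lemma tomita_iff: "(a, b) \<in> tomita H \<longleftrightarrow> (1/2) *\<^sub>C (a + b) \<in> H \<and> (- \<i>/2) *\<^sub>C (a - b) \<in> H"
proof
 assume "(a, b) \<in> tomita H"
 then obtain h k where h: "h \<in> H" "k \<in> H" "a = h + \<i> *\<^sub>C k" "b = h - \<i> *\<^sub>C k"
  by (auto simp: tomita_def)
 have "a + b = h + h" "a - b = \<i> *\<^sub>C k + \<i> *\<^sub>C k" using h by simp_all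
 then have "(1/2) *\<^sub>C (a + b) = h" "(- \<i>/2) *\<^sub>C (a - b) = k"
  by (simp_all add: scaleC_add_right flip: scaleC_add_left)
 then show "(1/2) *\<^sub>C (a + b) \<in> H \<and> (- \<i>/2) *\<^sub>C (a - b) \<in> H" using h by simp
next
 assume h: "(1/2) *\<^sub>C (a + b) \<in> H \<and> (- \<i>/2) *\<^sub>C (a - b) \<in> H"
 have half: "(1/2) *\<^sub>C c + (1/2) *\<^sub>C c = c" for c :: "real l2" by (simp flip: scaleC_add_left)
 have "(1/2) *\<^sub>C (a + b) + \<i> *\<^sub>C (- \<i>/2) *\<^sub>C (a - b) = (1/2) *\<^sub>C a + (1/2) *\<^sub>C a"
  by (simp add: scaleC_add_right scaleC_diff_right)
 moreover have "(1/2) *\<^sub>C (a + b) - \<i> *\<^sub>C (- \<i>/2) *\<^sub>C (a - b) = (1/2) *\<^sub>C b + (1/2) *\<^sub>C b"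
  by (simp add: scaleC_add_right scaleC_diff_right)
 ultimately show "(a, b) \<in> tomita H" unfolding tomita_def half using h by force
qed

lemma sqrt_op_closed:
 assumes x: "\<And>n. (x n, y n) \<in> sqrt_op" and lim: "x \<longlonglongrightarrow> a" "y \<longlonglongrightarrow> b"
 shows "(a, b) \<in> sqrt_op"
proof -
 have mem: "(1/2) *\<^sub>C (x n + conj_l2 (y n)) \<in> H" "(- \<i>/2) *\<^sub>C (x n - conj_l2 (y n)) \<in> H" for n
  using x[of n] by (simp_all add: tomita_sqrt_op[symmetric] tomita_iff)
 note lims = tendsto_scaleC[OF tendsto_add[OF lim(1) tendsto_conj[OF lim(2)]], of "1/2"]
  tendsto_scaleC[OF tendsto_diff[OF lim(1) tendsto_conj[OF lim(2)]], of "- \<i>/2"]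
 have "(1/2) *\<^sub>C (a + conj_l2 b) \<in> H"
  by (rule Lim_in_closed_set[OF closed _ sequentially_bot lims(1)]) (simp add: mem)
 moreover have "(- \<i>/2) *\<^sub>C (a - conj_l2 b) \<in> H"
  by (rule Lim_in_closed_set[OF closed _ sequentially_bot lims(2)]) (intro always_eventually allI mem)
 ultimately show ?thesis by (simp add: tomita_sqrt_op[symmetric] tomita_iff)
qed

text \<open>Regularized pairs always lie in the graph, which is closed, and regularization tends to the identity.\<close>

lemma sqrt_op_iff:
 "(x, y) \<in> sqrt_op \<longleftrightarrow> (\<forall>n. regularize (1 / real (Suc n)) 0 y = regularize (1 / real (Suc n)) pi x)"
proof
 assume "(x, y) \<in> sqrt_op"
 then show "\<forall>n. regularize (1 / real (Suc n)) 0 y = regularize (1 / real (Suc n)) pi x"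
  by (intro allI sqrt_op_regularize) simp_all
next
 assume eq: "\<forall>n. regularize (1 / real (Suc n)) 0 y = regularize (1 / real (Suc n)) pi x"
 show "(x, y) \<in> sqrt_op"
 proof (rule sqrt_op_closed[OF _ regularize_tendsto regularize_tendsto])
  fix n
  show "(regularize (1 / real (Suc n)) 0 x, regularize (1 / real (Suc n)) 0 y) \<in> sqrt_op"
   unfolding eq[rule_format] by (rule regularize_in_sqrt_op) simp
 qed
qed

lemma sqrt_op_symmetric:
 assumes x: "(x, x') \<in> sqrt_op" and y: "(y, y') \<in> sqrt_op"
 shows "cinner x' y = cinner x y'"
proof -
 let ?R = "\<lambda>n. regularize (1 / real (Suc n))"
 have "cinner (?R n 0 x') y = cinner (?R n 0 x) y'" for n
 proof -
  have e: "0 < 1 / real (Suc n)" by simp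
  have "cinner (?R n 0 x') y = cinner x (?R n pi y)"
   by (simp only: sqrt_op_regularize[OF e x] regularize_adjoint[OF e])
  also have "\<dots> = cinner (?R n 0 x) y'"
   by (simp only: sqrt_op_regularize[OF e y, symmetric] regularize_adjoint[OF e])
  finally show ?thesis .
 qed
 moreover have "(\<lambda>n. cinner (?R n 0 x') y) \<longlonglongrightarrow> cinner x' y" "(\<lambda>n. cinner (?R n 0 x) y') \<longlonglongrightarrow> cinner x y'"
  by (intro tendsto_cinner regularize_tendsto tendsto_const)+
 ultimately show ?thesis by (simp add: LIMSEQ_unique)
qed

text \<open>The test only needs regularized pairs.\<close>

lemma sqrt_op_adjoint:
 assumes "\<And>x x'. (x, x') \<in> sqrt_op \<Longrightarrow> cinner x' y = cinner x y'"
 shows "(y, y') \<in> sqrt_op"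
 unfolding sqrt_op_iff
proof
 fix n
 have e: "0 < 1 / real (Suc n)" by simp
 show "regularize (1 / real (Suc n)) 0 y' = regularize (1 / real (Suc n)) pi y"
  by (rule cinner_ext)
   (simp only: regularize_adjoint[OF e, symmetric] assms[OF regularize_in_sqrt_op[OF e]])
qed

lemma adjoint_tomita: "(v, u) \<in> antilinear_adjoint (tomita H) \<longleftrightarrow> (conj_l2 v, u) \<in> sqrt_op"
proof -
 have "cinner v (conj_l2 y) = cinner y (conj_l2 v)" for y
  using cinner_conj[of "conj_l2 v" y] by simp
 then have "(v, u) \<in> antilinear_adjoint (tomita H) \<longleftrightarrow> (\<forall>w y. (w, y) \<in> sqrt_op \<longrightarrow> cinner y (conj_l2 v) = cinner w u)"
  unfolding antilinear_adjoint_def polar graph_def relcomp_unfold by fastforce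
 then show ?thesis using sqrt_op_adjoint sqrt_op_symmetric by blast
qed

lemma sqrt_op_dense: "\<exists>d. (\<forall>n. d n \<in> Domain sqrt_op) \<and> d \<longlonglongrightarrow> x"
proof (intro exI conjI allI)
 show "(\<lambda>n. regularize (1 / real (Suc n)) 0 x) \<longlonglongrightarrow> x" by (rule regularize_tendsto)
 show "regularize (1 / real (Suc n)) 0 x \<in> Domain sqrt_op" for n
  by (rule DomainI[OF regularize_in_sqrt_op]) simp
qed

text \<open>The vectors \<open>\<phi>\<close> and \<open>\<psi>\<close> enter the crossing relation without an unbounded operator, so their domain
 restrictions disappear by density.\<close>

lemma is_crossed_tomita_iff:
 assumes T: "bounded_clinear T"
 shows "is_crossed (tomita H) T C \<longleftrightarrow> bounded_clinear C \<and> crossing_identity sqrt_op T C"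
proof
 assume cr: "is_crossed (tomita H) T C"
 then have C: "bounded_clinear C" by (simp add: is_crossed_def)
 have D: "d \<in> Domain (tomita H)" if "d \<in> Domain sqrt_op" for d
  using that tomita_sqrt_op by blast
 have D': "conj_l2 d \<in> Domain (antilinear_adjoint (tomita H))" if "d \<in> Domain sqrt_op" for d
 proof -
  obtain d' where "(d, d') \<in> sqrt_op" using \<open>d \<in> Domain sqrt_op\<close> by blast
  then have "(conj_l2 d, d') \<in> antilinear_adjoint (tomita H)" by (simp add: adjoint_tomita)
  then show ?thesis by blast
 qed
 have "crossing_identity sqrt_op T C"
  unfolding crossing_identity_def
 proof clarify
  fix a a' b b' \<phi> \<psi> assume a: "(a, a') \<in> sqrt_op" and b: "(b, b') \<in> sqrt_op"
  obtain d where d: "\<And>n. d n \<in> Domain sqrt_op" "d \<longlonglongrightarrow> conj_l2 \<phi>" using sqrt_op_dense by blast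
  obtain s where s: "\<And>n. s n \<in> Domain sqrt_op" "s \<longlonglongrightarrow> \<psi>" using sqrt_op_dense by blast
  have d': "(\<lambda>n. conj_l2 (d n)) \<longlonglongrightarrow> \<phi>" using tendsto_conj[OF d(2)] by simp
  have b': "(conj_l2 b, b') \<in> antilinear_adjoint (tomita H)" using b by (simp add: adjoint_tomita)
  have "cinner (conj_l2 (d n) \<otimes> b') (T (conj_l2 a' \<otimes> s n)) = cinner (a \<otimes> conj_l2 (d n)) (C (s n \<otimes> conj_l2 b))" for n
   using bspec[OF bspec[OF bspec[OF bspec[OF cr[unfolded is_crossed_def, THEN conjunct2]
    tomita_sqrt_op[THEN iffD2, OF a], unfolded prod.case] D[OF s(1)]] D'[OF d(1)]] b', unfolded prod.case] .
  moreover have "(\<lambda>n. cinner (conj_l2 (d n) \<otimes> b') (T (conj_l2 a' \<otimes> s n))) \<longlonglongrightarrow> cinner (\<phi> \<otimes> b') (T (conj_l2 a' \<otimes> \<psi>))"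
   by (intro tendsto_cinner tendsto_tensor_left d' bounded_linear.tendsto[OF bounded_clinearD(5)[OF T]] tendsto_tensor_right s)
  moreover have "(\<lambda>n. cinner (a \<otimes> conj_l2 (d n)) (C (s n \<otimes> conj_l2 b))) \<longlonglongrightarrow> cinner (a \<otimes> \<phi>) (C (\<psi> \<otimes> conj_l2 b))"
   by (intro tendsto_cinner tendsto_tensor_left d' bounded_linear.tendsto[OF bounded_clinearD(5)[OF C]] tendsto_tensor_right s)
  ultimately show "cinner (\<phi> \<otimes> b') (T (conj_l2 a' \<otimes> \<psi>)) = cinner (a \<otimes> \<phi>) (C (\<psi> \<otimes> conj_l2 b))"
   by (simp add: LIMSEQ_unique)
 qed
 with C show "bounded_clinear C \<and> crossing_identity sqrt_op T C" by blast
next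
 assume *: "bounded_clinear C \<and> crossing_identity sqrt_op T C"
 then have cr: "crossing_identity sqrt_op T C" by blast
 show "is_crossed (tomita H) T C"
  unfolding is_crossed_def
 proof (intro conjI ballI, use * in blast, clarify)
  fix \<phi>1 S1 \<psi>1 y \<phi>2 z \<psi>2 S2
  assume s1: "(\<phi>1, S1) \<in> tomita H" and s2: "(\<psi>2, S2) \<in> antilinear_adjoint (tomita H)"
  have "(\<phi>1, conj_l2 S1) \<in> sqrt_op" using s1 by (simp add: tomita_sqrt_op[symmetric])
  moreover have "(conj_l2 \<psi>2, S2) \<in> sqrt_op" using s2 by (simp add: adjoint_tomita)
  ultimately show "cinner (\<phi>2 \<otimes> S2) (T (S1 \<otimes> \<psi>1)) = cinner (\<phi>1 \<otimes> \<phi>2) (C (\<psi>1 \<otimes> \<psi>2))"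
   using crossing_identityD[OF cr, of \<phi>1 "conj_l2 S1" "conj_l2 \<psi>2" S2 \<phi>2 \<psi>1] by simp
 qed
qed

lemma regularize_abs:
 assumes e: "e > 0" and f: "square_integrable f"
 shows "regularize e y (abs_l2 f) = abs_l2 (\<lambda>x. LINT s|lborel. gauss_kernel e (Complex (x - s) y) * f s)"
 unfolding regularize_def by (rule conv_abs[OF integrable_gauss_kernel[OF e] f])

text \<open>By the characterization through regularizations this is an identity between two convolutions,
 obtained from each other by shifting the line of integration by \<open>\<pi>\<close>.\<close>

lemma strip_gaussian_sqrt_op:
 assumes W: "strip_gaussian W"
 shows "(strip_vec W 0, strip_vec W pi) \<in> sqrt_op"
 unfolding sqrt_op_iff
proof
 fix n
 define e where "e = 1 / real (Suc n)"
 have e: "e > 0" by (simp add: e_def)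
 obtain C c where C: "C \<ge> 0" "c > 0" "\<And>x y. 0 \<le> y \<Longrightarrow> y \<le> pi \<Longrightarrow> cmod (W (Complex x y)) \<le> C * exp (- c * x\<^sup>2)"
  using strip_gaussianE[OF W] by blast
 have hol: "W holomorphic_on UNIV" using W by (simp add: strip_gaussian_def)
 have "(LINT s|lborel. gauss_kernel e (Complex (x - s) pi) * W (Complex s 0)) =
   (LINT s|lborel. gauss_kernel e (Complex (x - s) 0) * W (Complex s pi))" for x
 proof -
  let ?f = "\<lambda>z. gauss_kernel e (Complex x pi - z) * W z"
  let ?M = "exp (pi\<^sup>2 / (2 * e)) / sqrt (2 * pi * e)"
  have "(LINT s|lborel. ?f (Complex s 0)) = (LINT s|lborel. ?f (Complex s pi))"
  proof (rule strip_shift[where \<alpha> = "-1" and \<beta> = 4])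
   have "(gauss_kernel e \<circ> (\<lambda>z. Complex x pi - z)) holomorphic_on UNIV"
    by (intro holomorphic_on_compose holomorphic_intros gauss_kernel_holomorphic e)
   then have "?f holomorphic_on UNIV" using hol by (intro holomorphic_on_mult) (simp_all add: o_def)
   then show "?f holomorphic_on {z. -1 < Im z \<and> Im z < 4}" by (rule holomorphic_on_subset) simp
   show "pi < 4" using pi_less_4 .
   fix s y assume y: "0 \<le> y" "y \<le> pi"
   have ng: "normal_density 0 (sqrt e) (x - s) \<le> 1 / sqrt (2 * pi * e)"
    using e by (simp add: normal_density_def divide_right_mono)
   have "exp ((pi - y)\<^sup>2 / (2 * e)) \<le> exp (pi\<^sup>2 / (2 * e))"
    using y e by (simp add: divide_right_mono power_mono)
   then have "normal_density 0 (sqrt e) (x - s) * exp ((pi - y)\<^sup>2 / (2 * e)) \<le> 1 / sqrt (2 * pi * e) * exp (pi\<^sup>2 / (2 * e))"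
    using ng e by (intro mult_mono) auto
   then have "cmod (gauss_kernel e (Complex (x - s) (pi - y))) \<le> ?M"
    unfolding cmod_gauss_kernel[OF e] by simp
   moreover have "Complex x pi - Complex s y = Complex (x - s) (pi - y)" by (simp add: complex_eq_iff)
   ultimately have "cmod (?f (Complex s y)) \<le> ?M * (C * exp (- c * s\<^sup>2))"
    unfolding norm_mult using C(3)[OF y] e by (intro mult_mono) auto
   then show "cmod (?f (Complex s y)) \<le> (?M * C) * exp (- c * s\<^sup>2)" by (simp only: mult.assoc)
  qed (use C in simp_all)
  moreover have "Complex x pi - Complex s 0 = Complex (x - s) pi" "Complex x pi - Complex s pi = Complex (x - s) 0" for s
   by (simp_all add: complex_eq_iff)
  ultimately show ?thesis by simp
 qed
 then show "regularize (1 / real (Suc n)) 0 (strip_vec W pi) = regularize (1 / real (Suc n)) pi (strip_vec W 0)"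
  unfolding e_def[symmetric] strip_vec_def
  by (simp only: regularize_abs[OF e strip_gaussian_square_integrable[OF W]] order_refl pi_ge_zero)
qed

text \<open>The values of the regularizations are inner products with translated Gaussians, so the test against
 these already gives the regularized identities.\<close>

lemma gaussian_core:
 assumes test: "\<And>W. strip_gaussian W \<Longrightarrow> cinner (strip_vec W pi) \<eta> = cinner (strip_vec W 0) \<eta>'"
 shows "(\<eta>, \<eta>') \<in> sqrt_op"
 unfolding sqrt_op_iff
proof
 fix n
 define e where "e = 1 / real (Suc n)"
 have e: "e > 0" by (simp add: e_def)
 obtain f f' where f: "square_integrable f" "\<eta> = abs_l2 f" "square_integrable f'" "\<eta>' = abs_l2 f'"
  using l2_obtain[of \<eta>] l2_obtain[of \<eta>'] by metis
 have ev: "cinner (strip_vec (\<lambda>z. gauss_kernel e (z - of_real x)) y) (abs_l2 k) =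
   (LINT s|lborel. gauss_kernel e (Complex (x - s) y) * k s)" if k: "square_integrable k" and y: "0 \<le> y" "y \<le> pi" for x y k
 proof -
  have k1: "cnj (gauss_kernel e (Complex s y - of_real x)) = gauss_kernel e (Complex (x - s) y)" for s
  proof -
   have "Complex s y - of_real x = Complex (- (x - s)) y" by (simp add: complex_eq_iff)
   then show ?thesis by (simp only: gauss_kernel_sym complex_cnj_cnj)
  qed
  have "cinner (strip_vec (\<lambda>z. gauss_kernel e (z - of_real x)) y) (abs_l2 k) =
    (LINT s|lborel. cnj (gauss_kernel e (Complex s y - of_real x)) * k s)"
   unfolding strip_vec_def
   by (rule cinner_abs[OF strip_gaussian_square_integrable[OF strip_gaussian_kernel[OF e] y] k])
  then show ?thesis by (simp only: k1)
 qed
 have "(LINT s|lborel. gauss_kernel e (Complex (x - s) pi) * f s) = (LINT s|lborel. gauss_kernel e (Complex (x - s) 0) * f' s)" for x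
  using test[OF strip_gaussian_kernel[OF e, of "of_real x"]] unfolding f(2,4)
  by (simp only: ev[OF f(1)] ev[OF f(3)] order_refl pi_ge_zero)
 then show "regularize (1 / real (Suc n)) 0 \<eta>' = regularize (1 / real (Suc n)) pi \<eta>"
  unfolding e_def[symmetric] f(2,4) by (simp only: regularize_abs[OF e] f(1,3))
qed

end

section \<open>Crossing of exchange operators with respect to the Tomita operator\<close>

lemma mul_conj_form:
 assumes k: "bounded_borel k" and p: "square_integrable p" and q: "square_integrable q"
 shows "cinner (abs_l2 p) (mul_l2 k (conj_l2 (abs_l2 q))) = (LINT y|lborel. (cnj (p y) * cnj (q y)) * k y)"
 using assms by (simp add: conj_abs mul_abs cinner_abs square_integrable_cnj square_integrable_mul mult_ac)

lemma integrable_cnj_product: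
 assumes p: "square_integrable p" and q: "square_integrable q"
 shows "integrable lborel (\<lambda>y. cnj (p y) * cnj (q y))"
 by (rule square_integrable_integrable_product[OF p square_integrable_cnj[OF q]])

lemma cinner_mul_conj_commute:
 assumes k: "bounded_borel k"
 shows "cinner a (mul_l2 k (conj_l2 b)) = cinner b (mul_l2 k (conj_l2 a))"
 by (rule l2_obtain[of a], rule l2_obtain[of b]) (simp add: mul_conj_form[OF k] mult_ac)

text \<open>The boundary values of a function in \<open>H\<^sup>\<infinity>\<close> on the two edges, tested against the boundary values
 of an entire function with Gaussian decay.\<close>

lemma boundary_pairing:
 assumes G: "G \<in> Hinf" and X: "strip_gaussian X"
  and g: "bounded_borel g" "AE u in lborel. g u = lower_bv G u"
  and k: "bounded_borel k" "AE u in lborel. k u = cnj (lower_bv (strip_reflect G) u)"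
 shows "(LINT y|lborel. cnj (X (Complex y pi)) * g (y - x)) = (LINT y|lborel. cnj (X (Complex y 0)) * k (y - x))"
proof -
 define F where "F = strip_reflect (\<lambda>z. X (z + of_real x))"
 have FC: "F (Complex u y) = cnj (X (Complex (u + x) (pi - y)))" for u y
  unfolding F_def strip_reflect_Complex by (simp add: complex_eq_iff arg_cong[where f = X] add.commute complex_add Complex_eq algebra_simps)
 have Xhol: "X holomorphic_on UNIV" using X by (simp add: strip_gaussian_def)
 obtain C c where C: "C \<ge> 0" "c > 0" "\<And>x y. 0 \<le> y \<Longrightarrow> y \<le> pi \<Longrightarrow> cmod (X (Complex x y)) \<le> C * exp (- c * x\<^sup>2)"
  using strip_gaussianE[OF X] by blast
 have "(\<lambda>w. X (w + \<i> * of_real pi + of_real x)) holomorphic_on cnj ` UNIV"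
 proof -
  have 1: "(\<lambda>w. w + \<i> * of_real pi + of_real x) holomorphic_on cnj ` UNIV" by (intro holomorphic_intros)
  from holomorphic_on_compose_gen[OF 1 Xhol] show ?thesis by (simp only: o_def subset_UNIV)
 qed
 from holomorphic_on_compose_cnj_cnj[OF this open_UNIV]
 have hol: "F holomorphic_on UNIV" by (simp add: F_def strip_reflect_def[abs_def] o_def)
 have "(LINT u|lborel. F (Complex u 0) * lower_bv G u) = (LINT u|lborel. F (Complex u pi) * cnj (lower_bv (strip_reflect G) u))"
 proof (rule boundary_shift(1)[OF G hol])
  show "c / 2 > 0" using C by simp
  fix u y assume y: "0 \<le> y" "y \<le> pi"
  have "0 \<le> (u + 2 * x)\<^sup>2" by simp
  then have "u\<^sup>2 / 2 - x\<^sup>2 \<le> (u + x)\<^sup>2" by (simp add: power2_eq_square algebra_simps)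
  then have "c * (u\<^sup>2 / 2 - x\<^sup>2) \<le> c * (u + x)\<^sup>2" using C by (intro mult_left_mono) auto
  then have "exp (- c * (u + x)\<^sup>2) \<le> exp (c * x\<^sup>2 + - (c / 2) * u\<^sup>2)" by (simp add: algebra_simps)
  then have "C * exp (- c * (u + x)\<^sup>2) \<le> C * exp (c * x\<^sup>2 + - (c / 2) * u\<^sup>2)" using C by (intro mult_left_mono)
  also have "\<dots> = (C * exp (c * x\<^sup>2)) * exp (- (c / 2) * u\<^sup>2)" by (simp only: exp_add mult.assoc)
  finally show "cmod (F (Complex u y)) \<le> (C * exp (c * x\<^sup>2)) * exp (- (c / 2) * u\<^sup>2)"
   unfolding FC complex_mod_cnj using C(3)[of "pi - y" "u + x"] y by linarith
 qed
 moreover have "(LINT y|lborel. cnj (X (Complex y \<eta>)) * h (y - x)) = (LINT u|lborel. cnj (X (Complex (u + x) \<eta>)) * l u)"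
  if h: "bounded_borel h" "AE u in lborel. h u = l u" "l \<in> borel_measurable borel" for \<eta> h l
 proof -
  have [measurable]: "h \<in> borel_measurable borel" using h by (simp add: bounded_borel_def)
  have Xm: "(\<lambda>y. cnj (X (Complex y \<eta>))) \<in> borel_measurable borel"
   using strip_gaussian_measurable[OF X] by (intro borel_measurable_continuous_on[of cnj] continuous_intros)
  have Xm': "(\<lambda>u. cnj (X (Complex (u + x) \<eta>))) \<in> borel_measurable borel"
   by (rule measurable_compose[OF _ Xm]) simp
  have "(LINT y|lborel. cnj (X (Complex y \<eta>)) * h (y - x)) = (LINT y|lborel. (\<lambda>u. cnj (X (Complex (u + x) \<eta>)) * h u) (y - x))" by simp
  also have "\<dots> = (LINT u|lborel. cnj (X (Complex (u + x) \<eta>)) * h u)"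
   by (rule integral_translate) (intro borel_measurable_times Xm', simp)
  also have "\<dots> = (LINT u|lborel. cnj (X (Complex (u + x) \<eta>)) * l u)"
   by (rule integral_cong_AE) (use Xm' h in \<open>auto simp: bounded_borel_def elim!: eventually_mono\<close>)
  finally show ?thesis .
 qed
 note tr = this
 have "lower_bv G \<in> borel_measurable borel" by (rule lower_bv_measurable[OF G])
 note t1 = tr[OF g this, of pi]
 have "(\<lambda>u. cnj (lower_bv (strip_reflect G) u)) \<in> borel_measurable borel"
  using lower_bv_measurable[OF strip_reflect_Hinf[OF G]] by (intro borel_measurable_continuous_on[of cnj] continuous_intros)
 note t2 = tr[OF k this, of 0]
 from calculation show ?thesis unfolding t1 t2 FC by simp
qed

context boost_tomita
begin

text \<open>For fixed \<open>\<phi>\<close> and \<open>\<psi>\<close> both sides are integrals of \<open>a b\<close> against bounded functions, the convolutions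
 \<open>smear\<close>. With Gaussians in both arguments the identity is \<open>boundary_pairing\<close>; the core argument replaces
 first one and then the other Gaussian by an arbitrary vector of the domain.\<close>

theorem exchange_crossing_strip:
 assumes G: "G \<in> Hinf"
  and g: "bounded_borel g" "AE u in lborel. g u = lower_bv G u"
  and k: "bounded_borel k" "AE u in lborel. k u = cnj (lower_bv (strip_reflect G) u)"
 shows "crossing_identity sqrt_op (mult_diff g \<circ> flip) (mult_diff (\<lambda>u. k (- u)) \<circ> flip)"
 unfolding crossing_identity_def
proof clarify
 fix a a' b b' \<phi> \<psi> :: "real l2"
 assume a: "(a, a') \<in> sqrt_op" and b: "(b, b') \<in> sqrt_op"
 obtain p where p: "square_integrable p" "a = abs_l2 p" by (rule l2_obtain)
 obtain p' where p': "square_integrable p'" "a' = abs_l2 p'" by (rule l2_obtain)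
 obtain q where q: "square_integrable q" "b = abs_l2 q" by (rule l2_obtain)
 obtain q' where q': "square_integrable q'" "b' = abs_l2 q'" by (rule l2_obtain)
 obtain r where r: "square_integrable r" "\<phi> = abs_l2 r" by (rule l2_obtain)
 obtain s where s: "square_integrable s" "\<psi> = abs_l2 s" by (rule l2_obtain)
 note si = p(1) p'(1) q(1) q'(1) r(1) s(1) and eq = p(2) p'(2) q(2) q'(2) r(2) s(2)
 define w where "w x = cnj (r x) * s x" for x
 have w: "integrable lborel w" unfolding w_def[abs_def] by (rule square_integrable_integrable_product[OF si(5,6)])
 note k' = bounded_borel_uminus[OF k(1)]
 note sg = bounded_borel_smear[OF w g(1)] and sk = bounded_borel_smear[OF w k(1)]
 have gaussian: "cinner (strip_vec W pi) (mul_l2 (smear g w) (conj_l2 (strip_vec V pi))) =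
   cinner (strip_vec W 0) (mul_l2 (smear k w) (conj_l2 (strip_vec V 0)))"
  if W: "strip_gaussian W" and V: "strip_gaussian V" for V W
 proof -
  let ?X = "\<lambda>z. W z * V z"
  have X: "strip_gaussian ?X" by (rule strip_gaussian_mult[OF W V])
  have form: "cinner (strip_vec W y) (mul_l2 (smear l w) (conj_l2 (strip_vec V y))) =
    (LINT x|lborel. w x * (LINT s|lborel. cnj (?X (Complex s y)) * l (s - x)))"
   if l: "bounded_borel l" and y: "0 \<le> y" "y \<le> pi" for l y
  proof -
   note si = strip_gaussian_square_integrable[OF W y] strip_gaussian_square_integrable[OF V y]
   have "cinner (strip_vec W y) (mul_l2 (smear l w) (conj_l2 (strip_vec V y))) =
     (LINT s|lborel. (cnj (W (Complex s y)) * cnj (V (Complex s y))) * smear l w s)"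
    unfolding strip_vec_def by (rule mul_conj_form[OF bounded_borel_smear[OF w l] si])
   also have "\<dots> = (LINT x|lborel. w x * (LINT s|lborel. (cnj (W (Complex s y)) * cnj (V (Complex s y))) * l (s - x)))"
    by (rule smear_integral(2)[OF integrable_cnj_product[OF si] w l])
   finally show ?thesis by simp
  qed
  show ?thesis
   unfolding form[OF g(1) pi_ge_zero order_refl] form[OF k(1) order_refl pi_ge_zero]
   by (simp only: boundary_pairing[OF G X g k])
 qed
 have "(mul_l2 (smear g w) (conj_l2 (strip_vec V pi)), mul_l2 (smear k w) (conj_l2 (strip_vec V 0))) \<in> sqrt_op"
  if V: "strip_gaussian V" for V
  by (rule gaussian_core) (rule gaussian[OF _ V])
 note sqrt_op_symmetric[OF a this]
 then have "cinner (strip_vec V pi) (mul_l2 (smear g w) (conj_l2 a')) = cinner (strip_vec V 0) (mul_l2 (smear k w) (conj_l2 a))"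
  if "strip_gaussian V" for V
  using that cinner_mul_conj_commute[OF sg, of a'] cinner_mul_conj_commute[OF sk, of a] by simp
 then have "(mul_l2 (smear g w) (conj_l2 a'), mul_l2 (smear k w) (conj_l2 a)) \<in> sqrt_op"
  by (rule gaussian_core)
 from sqrt_op_symmetric[OF b this]
 have key: "cinner a' (mul_l2 (smear g w) (conj_l2 b')) = cinner a (mul_l2 (smear k w) (conj_l2 b))"
  by (simp add: cinner_mul_conj_commute[OF sg, of a'] cinner_mul_conj_commute[OF sk, of a])
 have "cinner (\<phi> \<otimes> b') ((mult_diff g \<circ> flip) (conj_l2 a' \<otimes> \<psi>)) =
   (LINT z|lborel. (cnj (p' (snd z)) * cnj (q' (snd z))) * (g (snd z - fst z) * w (fst z)))"
  using si unfolding eq w_def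
  by (simp add: conj_abs exchange_form[OF g(1)] square_integrable_cnj mult_ac)
 also have "\<dots> = cinner a' (mul_l2 (smear g w) (conj_l2 b'))"
  unfolding eq mul_conj_form[OF sg si(2,4)] by (rule smear_integral(1)[OF integrable_cnj_product[OF si(2,4)] w g(1)])
 also have "\<dots> = cinner a (mul_l2 (smear k w) (conj_l2 b))" by (rule key)
 also have "\<dots> = (LINT z|lborel. (cnj (p (fst z)) * cnj (q (fst z))) * (k (- (snd z - fst z)) * w (snd z)))"
  unfolding eq mul_conj_form[OF sk si(1,3)]
  using smear_integral_swap[OF integrable_cnj_product[OF si(1,3)] w k'] by simp
 also have "\<dots> = cinner (a \<otimes> \<phi>) ((mult_diff (\<lambda>u. k (- u)) \<circ> flip) (\<psi> \<otimes> conj_l2 b))"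
  using si unfolding eq w_def
  by (simp add: conj_abs exchange_form[OF k'] square_integrable_cnj mult_ac del: minus_diff_eq)
 finally show "cinner (\<phi> \<otimes> b') ((mult_diff g \<circ> flip) (conj_l2 a' \<otimes> \<psi>)) =
   cinner (a \<otimes> \<phi>) ((mult_diff (\<lambda>u. k (- u)) \<circ> flip) (\<psi> \<otimes> conj_l2 b))" .
qed

theorem tomita_crossing_of_Hinf:
 assumes G: "G \<in> Hinf" and T: "T = mult_diff (lower_bv G) \<circ> flip"
 shows "crossable (tomita H) T"
  and "crossing_symmetric (tomita H) T \<longleftrightarrow> (AE u in lborel. upper_bv G u = cnj (lower_bv G u))"
  and "unitary T \<longleftrightarrow> (AE u in lborel. cmod (lower_bv G u) = 1)"
proof -
 obtain g where g: "bounded_borel g" "AE u in lborel. lower_bv G u = g u" "mult_diff (lower_bv G) = mult_diff g"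
  using Linf_bounded_version[OF lower_bv_Linf[OF G]] .
 obtain l where l: "bounded_borel l" "AE u in lborel. lower_bv (strip_reflect G) u = l u"
  using Linf_bounded_version[OF lower_bv_Linf[OF strip_reflect_Hinf[OF G]]] .
 note k = bounded_borel_cnj[OF l(1)]
 have g_ae: "AE u in lborel. g u = lower_bv G u" using g(2) by eventually_elim simp
 have k_ae: "AE u in lborel. cnj (l u) = cnj (lower_bv (strip_reflect G) u)" using l(2) by eventually_elim simp
 have T': "T = mult_diff g \<circ> flip" by (simp only: T g(3))
 have T_bd: "bounded_clinear T" unfolding T' by (rule exchange_bounded_clinear[OF g(1)])
 note cr = exchange_crossing_strip[OF G g(1) g_ae k k_ae, folded T']
 note k' = bounded_borel_uminus[OF k]
 show "crossable (tomita H) T"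
  unfolding crossable_def is_crossed_tomita_iff[OF T_bd]
  using cr exchange_bounded_clinear[OF k'] by blast
 have "crossing_symmetric (tomita H) T \<longleftrightarrow> (AE u in lborel. cnj (l (- (- u))) = cnj (g u))"
  by (rule crossing_symmetric_iff[OF is_crossed_tomita_iff[OF T_bd] sqrt_op_dense g(1) T' k' cr])
 also have "\<dots> \<longleftrightarrow> (AE u in lborel. upper_bv G u = cnj (lower_bv G u))"
 proof
  assume "AE u in lborel. cnj (l (- (- u))) = cnj (g u)"
  with g_ae k_ae upper_bv_AE[OF G] show "AE u in lborel. upper_bv G u = cnj (lower_bv G u)"
   by eventually_elim simp
 next
  assume "AE u in lborel. upper_bv G u = cnj (lower_bv G u)"
  with g_ae k_ae upper_bv_AE[OF G] show "AE u in lborel. cnj (l (- (- u))) = cnj (g u)"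
   by eventually_elim simp
 qed
 finally show "crossing_symmetric (tomita H) T \<longleftrightarrow> (AE u in lborel. upper_bv G u = cnj (lower_bv G u))" .
 have "(AE u in lborel. cmod (g u) = 1) \<longleftrightarrow> (AE u in lborel. cmod (lower_bv G u) = 1)"
 proof
  assume "AE u in lborel. cmod (g u) = 1"
  with g_ae show "AE u in lborel. cmod (lower_bv G u) = 1" by eventually_elim simp
 next
  assume "AE u in lborel. cmod (lower_bv G u) = 1"
  with g_ae show "AE u in lborel. cmod (g u) = 1" by eventually_elim simp
 qed
 then show "unitary T \<longleftrightarrow> (AE u in lborel. cmod (lower_bv G u) = 1)"
  unfolding T' exchange_unitary_iff[OF g(1)] .
qed

end

text \<open>The boundary values of \<open>modulated k\<close> on the upper edge exceed those on the lower edge by the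
 factor \<open>exp (\<pi>\<^sup>2 + k \<pi>)\<close>, up to a phase.\<close>

definition modulated :: "real \<Rightarrow> complex \<Rightarrow> complex" where
 "modulated k z = exp (- of_real 1 * z\<^sup>2 + (- \<i> * of_real k) * z)"

lemma modulated_lower: "modulated k (Complex x 0) = of_real (exp (- x\<^sup>2)) * cis (- (k * x))"
proof -
 have "- of_real 1 * (Complex x 0)\<^sup>2 + (- \<i> * of_real k) * Complex x 0 = of_real (- x\<^sup>2) + \<i> * of_real (- (k * x))"
  by (simp add: complex_eq_iff power2_eq_square)
 then show ?thesis unfolding modulated_def by (simp only: exp_add cis_conv_exp exp_of_real)
qed

lemma modulated_upper:
 "modulated k (Complex x pi) = of_real (exp (pi\<^sup>2 + k * pi)) * (of_real (exp (- x\<^sup>2)) * cis (- ((2 * pi + k) * x)))"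
proof -
 have "- of_real 1 * (Complex x pi)\<^sup>2 + (- \<i> * of_real k) * Complex x pi
   = of_real (pi\<^sup>2 + k * pi) + (of_real (- x\<^sup>2) + \<i> * of_real (- ((2 * pi + k) * x)))"
  by (simp add: complex_eq_iff power2_eq_square algebra_simps)
 then show ?thesis unfolding modulated_def by (simp only: exp_add cis_conv_exp exp_of_real)
qed

lemma strip_gaussian_modulated: "strip_gaussian (modulated k)"
 using strip_gaussian_exp[of 1 1 "- \<i> * of_real k"] by (simp add: modulated_def[abs_def])

lemma norm_abs_cong:
 assumes "square_integrable f" "square_integrable g" "\<And>x. cmod (f x) = cmod (g x)"
 shows "norm (abs_l2 f) = norm (abs_l2 g)"
proof -
 have "(norm (abs_l2 f))\<^sup>2 = (norm (abs_l2 g))\<^sup>2" using assms by (simp add: norm_abs)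
 then show ?thesis by (simp add: power2_eq_iff_nonneg)
qed

lemma exponential_bound_zero:
 fixes d :: complex
 assumes "\<And>n::nat. exp (pi\<^sup>2 + real n * pi) * cmod d \<le> M"
 shows "d = 0"
proof (rule ccontr)
 assume "d \<noteq> 0"
 then have d: "cmod d > 0" by simp
 obtain n where n: "M / cmod d < real n" using reals_Archimedean2 by blast
 have "real n \<le> real n * pi" using pi_gt3 by (simp add: mult_le_cancel_left1)
 also have "\<dots> \<le> pi\<^sup>2 + real n * pi" by simp
 also have "\<dots> \<le> exp (pi\<^sup>2 + real n * pi)" using exp_ge_add_one_self[of "pi\<^sup>2 + real n * pi"] by linarith
 finally have "real n * cmod d \<le> M" using assms[of n] d by (meson mult_right_mono less_imp_le order_trans)
 with n d show False by (simp add: field_simps)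
qed

context boost_tomita
begin

text \<open>With complementary supports of \<open>\<phi>\<close> and \<open>\<psi>\<close> only the multiplication part of \<open>T\<close> contributes to
 the crossing relation. For the modulated Gaussians the crossed side stays bounded, while the other
 side carries the factor \<open>exp (2 \<pi>\<^sup>2 + 2 k \<pi>)\<close>; hence the multiplication part vanishes off the diagonal.\<close>

lemma tomita_multiplication_part_zero:
 assumes f: "bounded_borel f" and g: "bounded_borel g"
  and T: "\<And>\<Psi>. T \<Psi> = mult_diff f \<Psi> + mult_diff g (flip \<Psi>)"
  and C: "bounded_clinear C" and cr: "crossing_identity sqrt_op T C"
 shows "T = mult_diff g \<circ> flip"
proof -
 define \<gamma> where "\<gamma> x = complex_of_real (exp (- x\<^sup>2))" for x
 have g2: "gauss2 z = \<gamma> (fst z) * \<gamma> (snd z)" for z by (simp add: gauss2_def \<gamma>_def)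
 let ?\<Xi> = "mult_diff f (abs_l2 gauss2)"
 obtain N where N: "N \<ge> 0" "\<And>\<Psi>. norm (C \<Psi>) \<le> N * norm \<Psi>" using bounded_clinear_norm_le[OF C] by blast
 have "?\<Xi> = 0"
 proof (rule off_diagonal_zero)
  fix A :: "real set" and a b :: "real l2" assume A: "A \<in> sets borel"
  have A': "- A \<in> sets borel" using A by auto
  note bi = bounded_borel_indicator[OF A] bounded_borel_indicator[OF A']
  obtain p0 q0 where pq: "square_integrable p0" "a = abs_l2 p0" "square_integrable q0" "b = abs_l2 q0"
   using l2_obtain[of a] l2_obtain[of b] by metis
  define p where "p x = indicator A x * p0 x" for x
  define q where "q x = indicator (- A) x * q0 x" for x
  have p: "square_integrable p" and q: "square_integrable q"
   unfolding p_def[abs_def] q_def[abs_def] by (intro square_integrable_mul bi pq)+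
  have disj: "p x * q x = 0" for x by (simp add: p_def q_def indicator_def)
  define d where "d = cinner (abs_l2 p \<otimes> abs_l2 q) ?\<Xi>"
  have d: "d = (LINT z|lborel. cnj (p (fst z) * q (snd z)) * (f (snd z - fst z) * gauss2 z))"
   unfolding d_def using p q f square_integrable_gauss2
   by (simp only: tensor_abs' mult_diff_abs bounded_borel_Linf cinner_abs square_integrable_tensor' square_integrable_mult_diff)
  have "exp (pi\<^sup>2 + real n * pi) * cmod d \<le> N * norm (abs_l2 p) * norm (abs_l2 q) * norm (abs_l2 \<gamma>) * norm (abs_l2 \<gamma>)" for n :: nat
  proof -
   define E where "E = exp (pi\<^sup>2 + real n * pi)"
   define u where "u x = cis (- ((2 * pi + real n) * x))" for x
   have uu: "u x * cnj (u x) = 1" "cnj (u x) * u x = 1" for x by (simp_all add: u_def cis_cnj cis_mult)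
   have ub: "bounded_borel u"
    unfolding u_def[abs_def] by (rule bounded_borelI[where B = 1])
     (intro borel_measurable_continuous_onI continuous_intros, simp)
   let ?W = "modulated (real n)"
   note W = strip_gaussian_modulated[of "real n"]
   note Wsi = strip_gaussian_square_integrable[OF W order_refl pi_ge_zero] strip_gaussian_square_integrable[OF W pi_ge_zero order_refl]
   have up: "?W (Complex x pi) = of_real E * (\<gamma> x * u x)" for x
    by (simp only: modulated_upper E_def \<gamma>_def u_def)
   define r where "r x = cnj (u x) * p x" for x
   define s where "s x = u x * cnj (q x)" for x
   have r: "square_integrable r" and s: "square_integrable s"
    unfolding r_def[abs_def] s_def[abs_def]
    by (intro square_integrable_mul bounded_borel_cnj ub p square_integrable_cnj q)+
   have rs: "cnj (r x) * s x = 0" for x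
   proof -
    have "cnj (r x) * s x = u x * u x * cnj (p x * q x)" by (simp add: r_def s_def)
    then show ?thesis by (simp add: disj)
   qed
   note id = crossing_identityD[OF cr strip_gaussian_sqrt_op[OF W] strip_gaussian_sqrt_op[OF W], of "abs_l2 r" "abs_l2 s"]
   have "cinner (abs_l2 r \<otimes> strip_vec ?W pi) (mult_diff g (flip (conj_l2 (strip_vec ?W pi) \<otimes> abs_l2 s))) =
     (LINT z|lborel. cnj (r (fst z) * ?W (Complex (snd z) pi)) * (g (snd z - fst z) * (cnj (?W (Complex (snd z) pi)) * s (fst z))))"
    unfolding strip_vec_def using Wsi r s by (simp only: conj_abs exchange_form[OF g] square_integrable_cnj)
   also have "\<dots> = (LINT z|(lborel :: (real \<times> real) measure). 0)"
    by (intro Bochner_Integration.integral_cong refl) (use rs in auto)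
   finally have z: "cinner (abs_l2 r \<otimes> strip_vec ?W pi) (mult_diff g (flip (conj_l2 (strip_vec ?W pi) \<otimes> abs_l2 s))) = 0" by simp
   have "cinner (abs_l2 r \<otimes> strip_vec ?W pi) (mult_diff f (conj_l2 (strip_vec ?W pi) \<otimes> abs_l2 s)) =
     (LINT z|lborel. cnj (r (fst z) * ?W (Complex (snd z) pi)) * (f (snd z - fst z) * (cnj (?W (Complex (fst z) pi)) * s (snd z))))"
    unfolding strip_vec_def using Wsi r s by (simp only: conj_abs mult_diff_form[OF f] square_integrable_cnj)
   also have "\<dots> = (LINT z|lborel. (of_real E * of_real E) * (cnj (p (fst z) * q (snd z)) * (f (snd z - fst z) * gauss2 z)))"
   proof (intro Bochner_Integration.integral_cong refl)
    fix z :: "real \<times> real"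
    have "cnj (r (fst z) * ?W (Complex (snd z) pi)) * (f (snd z - fst z) * (cnj (?W (Complex (fst z) pi)) * s (snd z)))
     = (u (fst z) * cnj (u (fst z))) * (cnj (u (snd z)) * u (snd z)) *
      ((of_real E * of_real E) * (cnj (p (fst z)) * cnj (q (snd z)) * (f (snd z - fst z) * (\<gamma> (fst z) * \<gamma> (snd z)))))"
     unfolding up by (simp add: r_def s_def \<gamma>_def mult_ac)
    then show "cnj (r (fst z) * ?W (Complex (snd z) pi)) * (f (snd z - fst z) * (cnj (?W (Complex (fst z) pi)) * s (snd z)))
     = (of_real E * of_real E) * (cnj (p (fst z) * q (snd z)) * (f (snd z - fst z) * gauss2 z))"
     by (simp only: uu g2 mult_1_left complex_cnj_mult)
   qed
   also have "\<dots> = (of_real E * of_real E) * d" unfolding d by (rule integral_mult_right_zero)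
   finally have "cinner (abs_l2 r \<otimes> strip_vec ?W pi) (T (conj_l2 (strip_vec ?W pi) \<otimes> abs_l2 s)) = (of_real E * of_real E) * d"
    by (simp add: T cinner_add_right z)
   then have "E * E * cmod d = cmod (cinner (strip_vec ?W 0 \<otimes> abs_l2 r) (C (abs_l2 s \<otimes> conj_l2 (strip_vec ?W 0))))"
    unfolding id[symmetric] by (simp add: norm_mult E_def)
   also have "\<dots> \<le> norm (strip_vec ?W 0 \<otimes> abs_l2 r) * norm (C (abs_l2 s \<otimes> conj_l2 (strip_vec ?W 0)))"
    by (rule cinner_Cauchy_Schwarz)
   also have "\<dots> \<le> norm (strip_vec ?W 0 \<otimes> abs_l2 r) * (N * norm (abs_l2 s \<otimes> conj_l2 (strip_vec ?W 0)))"
    by (intro mult_left_mono N) simp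
   also have "\<dots> = N * norm (abs_l2 r) * norm (abs_l2 s) * norm (strip_vec ?W 0) * norm (strip_vec ?W 0)"
    by (simp add: norm_tensor)
   also have "norm (abs_l2 r) = norm (abs_l2 p)"
    by (rule norm_abs_cong[OF r p]) (simp add: r_def norm_mult u_def)
   also have "norm (abs_l2 s) = norm (abs_l2 q)"
    by (rule norm_abs_cong[OF s q]) (simp add: s_def norm_mult u_def)
   also have "norm (strip_vec ?W 0) = norm (abs_l2 \<gamma>)"
   proof -
    have "square_integrable \<gamma>"
     using strip_gaussian_square_integrable[OF strip_gaussian_modulated[of 0] order_refl pi_ge_zero]
     by (simp add: modulated_lower \<gamma>_def[abs_def])
    then show ?thesis
     unfolding strip_vec_def by (rule norm_abs_cong[OF Wsi(1)]) (simp add: modulated_lower norm_mult \<gamma>_def)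
   qed
   finally have "E * E * cmod d \<le> N * norm (abs_l2 p) * norm (abs_l2 q) * norm (abs_l2 \<gamma>) * norm (abs_l2 \<gamma>)" .
   moreover have "1 \<le> E" unfolding E_def using pi_gt3 by simp
   then have "E * cmod d \<le> E * E * cmod d"
    by (intro mult_right_mono) (simp_all add: mult_le_cancel_left1)
   ultimately show "exp (pi\<^sup>2 + real n * pi) * cmod d \<le> N * norm (abs_l2 p) * norm (abs_l2 q) * norm (abs_l2 \<gamma>) * norm (abs_l2 \<gamma>)"
    unfolding E_def by linarith
  qed
  then have "d = 0" by (rule exponential_bound_zero)
  then show "cinner (mul_l2 (indicator A) a \<otimes> mul_l2 (indicator (- A)) b) ?\<Xi> = 0"
   unfolding d_def pq(2,4) p_def[abs_def] q_def[abs_def] by (simp only: mul_abs bi pq)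
 qed
 moreover have zero: "mult_diff (\<lambda>_. 0) \<Psi> = 0" for \<Psi>
  unfolding mult_diff_eq_mul[OF bounded_borel_const] by (simp add: mul_const)
 ultimately have "AE u in lborel. f u = 0"
  by (intro mult_diff_inject[OF f bounded_borel_const]) simp
 then have "mult_diff f = mult_diff (\<lambda>_. 0)"
  by (intro mult_diff_cong_AE bounded_borel_Linf f bounded_borel_const)
 then show ?thesis by (intro ext) (simp add: T zero)
qed

end

section \<open>Recovering the analytic function\<close>

lemma cmod_exp_minus_one: "cmod (exp w - 1) \<le> cmod w * exp (cmod w)"
proof -
 have "cmod (exp w - exp 0) \<le> exp (cmod w) * cmod (w - 0)"
 proof (rule field_differentiable_bound[where S = "cball 0 (cmod w)"])
  show "cmod (exp z) \<le> exp (cmod w)" if "z \<in> cball 0 (cmod w)" for z :: complex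
   using norm_exp[of z] that by (simp add: order_trans)
  show "(exp has_field_derivative exp z) (at z within cball 0 (cmod w))" for z :: complex
   using DERIV_exp by (rule has_field_derivative_at_within)
 qed auto
 then show ?thesis by (simp add: mult.commute)
qed

text \<open>Differentiation under the integral sign, by dominated convergence.\<close>

lemma laplace_entire:
 fixes k :: "real \<Rightarrow> complex"
 assumes k[measurable]: "k \<in> borel_measurable borel"
  and int: "\<And>R. integrable lborel (\<lambda>y. exp (R * \<bar>y\<bar>) * cmod (k y))"
 shows "(\<lambda>z. LINT y|lborel. exp (z * of_real y) * k y) holomorphic_on UNIV"
proof -
 have em[measurable]: "(\<lambda>y. exp (z * complex_of_real y)) \<in> borel_measurable borel" for z
  by (intro borel_measurable_continuous_onI continuous_intros)
 have bound: "cmod (exp (z * complex_of_real y)) \<le> exp (cmod z * \<bar>y\<bar>)" for z y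
  using norm_exp[of "z * complex_of_real y"] by (simp add: norm_mult)
 have i: "integrable lborel (\<lambda>y. exp (z * complex_of_real y) * k y)" for z
 proof (rule Bochner_Integration.integrable_bound[OF int[of "cmod z"]])
  show "AE y in lborel. norm (exp (z * complex_of_real y) * k y) \<le> norm (exp (cmod z * \<bar>y\<bar>) * cmod (k y))"
   using mult_right_mono[OF bound norm_ge_zero]
   by (intro AE_I2) (simp only: norm_mult real_norm_def abs_mult abs_exp_cancel abs_norm_cancel)
 qed simp
 have "((\<lambda>z. LINT y|lborel. exp (z * of_real y) * k y) has_field_derivative
   (LINT y|lborel. exp (z * of_real y) * of_real y * k y)) (at z)" for z
  unfolding has_field_derivative_iff tendsto_at_iff_sequentially
 proof (intro allI impI)
  fix X :: "nat \<Rightarrow> complex" assume X: "\<forall>n. X n \<in> UNIV - {z}" "X \<longlonglongrightarrow> z"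
  obtain M where M: "\<And>n. cmod (X n - z) \<le> M"
   using convergent_imp_Bseq[OF convergentI[OF LIM_zero[OF X(2)]]] by (auto simp: Bseq_def)
  let ?q = "\<lambda>n y. (exp (X n * complex_of_real y) * k y - exp (z * of_real y) * k y) / (X n - z)"
  have "(\<lambda>n. LINT y|lborel. ?q n y) \<longlonglongrightarrow> (LINT y|lborel. exp (z * of_real y) * of_real y * k y)"
  proof (rule integral_dominated_convergence[where w = "\<lambda>y. exp ((cmod z + M + 1) * \<bar>y\<bar>) * cmod (k y)"])
   show "integrable lborel (\<lambda>y. exp ((cmod z + M + 1) * \<bar>y\<bar>) * cmod (k y))" by (rule int)
   show "AE y in lborel. (\<lambda>n. ?q n y) \<longlonglongrightarrow> exp (z * of_real y) * of_real y * k y"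
   proof (rule AE_I2)
    fix y
    have "((\<lambda>w. exp (w * of_real y) * k y) has_field_derivative exp (z * of_real y) * of_real y * k y) (at z)"
     by (auto intro!: derivative_eq_intros)
    then show "(\<lambda>n. ?q n y) \<longlonglongrightarrow> exp (z * of_real y) * of_real y * k y"
     unfolding has_field_derivative_iff tendsto_at_iff_sequentially using X by (auto simp: o_def)
   qed
   show "AE y in lborel. norm (?q n y) \<le> exp ((cmod z + M + 1) * \<bar>y\<bar>) * cmod (k y)" for n
   proof (rule AE_I2)
    fix y
    define h where "h = X n - z"
    have h0: "h \<noteq> 0" using X(1) by (auto simp: h_def)
    have "X n * complex_of_real y = z * of_real y + h * of_real y" by (simp add: h_def algebra_simps)
    then have "?q n y = exp (z * of_real y) * ((exp (h * of_real y) - 1) / h) * k y"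
     unfolding h_def[symmetric] by (simp add: exp_add field_simps h0)
    moreover have "cmod ((exp (h * of_real y) - 1) / h) \<le> exp ((M + 1) * \<bar>y\<bar>)"
    proof -
     have "cmod (exp (h * of_real y) - 1) \<le> (cmod h * \<bar>y\<bar>) * exp (cmod h * \<bar>y\<bar>)"
      using cmod_exp_minus_one[of "h * of_real y"] by (simp add: norm_mult)
     then have "cmod ((exp (h * of_real y) - 1) / h) \<le> \<bar>y\<bar> * exp (cmod h * \<bar>y\<bar>)"
      using h0 by (simp add: norm_divide field_simps)
     also have "\<dots> \<le> exp \<bar>y\<bar> * exp (M * \<bar>y\<bar>)"
     proof (intro mult_mono)
      show "\<bar>y\<bar> \<le> exp \<bar>y\<bar>" using exp_ge_add_one_self[of "\<bar>y\<bar>"] by linarith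
      show "exp (cmod h * \<bar>y\<bar>) \<le> exp (M * \<bar>y\<bar>)" using M[of n] by (simp add: h_def mult_right_mono)
     qed simp_all
     also have "\<dots> = exp ((M + 1) * \<bar>y\<bar>)" by (simp add: algebra_simps flip: exp_add)
     finally show ?thesis .
    qed
    ultimately have "norm (?q n y) \<le> exp (cmod z * \<bar>y\<bar>) * exp ((M + 1) * \<bar>y\<bar>) * cmod (k y)"
     using bound[of z y] by (simp only: norm_mult) (intro mult_mono mult_right_mono; simp)
    also have "exp (cmod z * \<bar>y\<bar>) * exp ((M + 1) * \<bar>y\<bar>) = exp ((cmod z + M + 1) * \<bar>y\<bar>)"
     by (simp add: algebra_simps flip: exp_add)
    finally show "norm (?q n y) \<le> exp ((cmod z + M + 1) * \<bar>y\<bar>) * cmod (k y)" .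
   qed
  qed simp_all
  moreover have "(LINT y|lborel. ?q n y) =
    ((LINT y|lborel. exp (X n * of_real y) * k y) - (LINT y|lborel. exp (z * of_real y) * k y)) / (X n - z)" for n
   using i by simp
  ultimately show "((\<lambda>w. ((LINT y|lborel. exp (w * of_real y) * k y) - (LINT y|lborel. exp (z * of_real y) * k y)) / (w - z)) \<circ> X)
    \<longlonglongrightarrow> (LINT y|lborel. exp (z * of_real y) * of_real y * k y)"
   by (simp only: o_def)
 qed
 then show ?thesis by (auto simp: holomorphic_on_def field_differentiable_def intro: has_field_derivative_at_within)
qed

text \<open>The three lines theorem in the form needed here: the factor \<open>exp (- \<epsilon> z\<^sup>2)\<close> makes the function
 small on the far vertical sides of a rectangle, where the maximum principle applies.\<close>

lemma strip_maximum:
 assumes hol: "F holomorphic_on UNIV"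
  and bdd: "\<And>x y. 0 \<le> y \<Longrightarrow> y \<le> pi \<Longrightarrow> cmod (F (Complex x y)) \<le> M"
  and edge: "\<And>x. cmod (F (Complex x 0)) \<le> B" "\<And>x. cmod (F (Complex x pi)) \<le> B"
  and B: "B > 0" and y: "0 \<le> y" "y \<le> pi"
 shows "cmod (F (Complex x y)) \<le> B"
proof -
 have ex: "cmod (exp (- of_real e * (Complex u v)\<^sup>2)) = exp (e * v\<^sup>2) * exp (- (e * u\<^sup>2))" for e u v
  unfolding norm_exp_eq_Re by (simp add: power2_eq_square algebra_simps flip: exp_add)
 have main: "cmod (F (Complex x y)) * cmod (exp (- of_real e * (Complex x y)\<^sup>2)) \<le> B * exp (e * pi\<^sup>2)" if e: "e > 0" for e
 proof -
  have M: "0 \<le> M" using bdd[of 0 0] norm_ge_zero[of "F (Complex 0 0)"] by (smt (verit) pi_ge_zero)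
  have "((\<lambda>n. M * exp (- e * (real n)\<^sup>2)) \<longlongrightarrow> 0) sequentially" by (rule gauss_tendsto_0[OF e])
  then have "eventually (\<lambda>n. M * exp (- e * (real n)\<^sup>2) < B) sequentially" using B by (rule order_tendstoD(2))
  moreover have "eventually (\<lambda>n. \<bar>x\<bar> \<le> real n) sequentially"
   using eventually_ge_at_top[of "nat \<lceil>\<bar>x\<bar>\<rceil>"] by eventually_elim linarith
  ultimately obtain n where n: "M * exp (- e * (real n)\<^sup>2) < B" "\<bar>x\<bar> \<le> real n"
   using eventually_happens[OF eventually_conj] sequentially_bot by blast
  let ?S = "cbox (Complex (- real n) 0) (Complex (real n) pi)"
  let ?f = "\<lambda>z. F z * exp (- of_real e * z\<^sup>2)"
  have fh: "?f holomorphic_on UNIV" by (intro holomorphic_intros hol)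
  have "cmod (?f (Complex x y)) \<le> B * exp (e * pi\<^sup>2)"
  proof (rule maximum_modulus_frontier[where S = ?S and f = ?f and \<xi> = "Complex x y"])
   show "?f holomorphic_on interior ?S" by (rule holomorphic_on_subset[OF fh]) simp
   show "continuous_on (closure ?S) ?f"
    by (rule holomorphic_on_imp_continuous_on[OF holomorphic_on_subset[OF fh]]) simp
   show "bounded ?S" by (rule bounded_cbox)
   show "Complex x y \<in> ?S" using y n(2) by (simp add: in_cbox_complex_iff) linarith
   fix z assume "z \<in> frontier ?S"
   then have "z \<in> ?S" "z \<notin> box (Complex (- real n) 0) (Complex (real n) pi)"
    by (simp_all add: frontier_cbox)
   then have z: "- real n \<le> Re z" "Re z \<le> real n" "0 \<le> Im z" "Im z \<le> pi"
    and edge': "Re z = real n \<or> Re z = - real n \<or> Im z = 0 \<or> Im z = pi"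
    by (auto simp: in_cbox_complex_iff in_box_complex_iff)
   have zz: "z = Complex (Re z) (Im z)" by simp
   have v: "exp (e * (Im z)\<^sup>2) \<le> exp (e * pi\<^sup>2)" using z e by (simp add: power_mono)
   have "cmod (F z) * exp (- (e * (Re z)\<^sup>2)) \<le> B"
   proof (cases "Im z = 0 \<or> Im z = pi")
    case True
    then have "cmod (F z) \<le> B" using edge[of "Re z"] by (metis zz)
    moreover have "exp (- (e * (Re z)\<^sup>2)) \<le> 1" using e by simp
    ultimately have "cmod (F z) * exp (- (e * (Re z)\<^sup>2)) \<le> B * 1" using B by (intro mult_mono) auto
    then show ?thesis by simp
   next
    case False
    then have "(Re z)\<^sup>2 = (real n)\<^sup>2" using edge' by auto
    moreover have "cmod (F z) \<le> M" using bdd[OF z(3,4), of "Re z"] by simp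
    ultimately have "cmod (F z) * exp (- (e * (Re z)\<^sup>2)) \<le> M * exp (- e * (real n)\<^sup>2)"
     by (simp add: mult_right_mono)
    then show ?thesis using n(1) by linarith
   qed
   then have "(cmod (F z) * exp (- (e * (Re z)\<^sup>2))) * exp (e * (Im z)\<^sup>2) \<le> B * exp (e * pi\<^sup>2)"
    using v B by (intro mult_mono) auto
   then show "cmod (?f z) \<le> B * exp (e * pi\<^sup>2)"
    using ex[of e "Re z" "Im z"] by (simp add: norm_mult mult_ac)
  qed
  then show ?thesis by (simp only: norm_mult)
 qed
 have lim1: "((\<lambda>e. cmod (F (Complex x y)) * (exp (e * y\<^sup>2) * exp (- (e * x\<^sup>2)))) \<longlongrightarrow>
   cmod (F (Complex x y)) * (exp (0 * y\<^sup>2) * exp (- (0 * x\<^sup>2)))) (at_right 0)"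
  by (intro tendsto_intros)
 have lim2: "((\<lambda>e. B * exp (e * pi\<^sup>2)) \<longlongrightarrow> B * exp (0 * pi\<^sup>2)) (at_right 0)"
  by (intro tendsto_intros)
 have ev: "eventually (\<lambda>e. cmod (F (Complex x y)) * (exp (e * y\<^sup>2) * exp (- (e * x\<^sup>2))) \<le> B * exp (e * pi\<^sup>2)) (at_right 0)"
 proof (rule eventually_at_rightI[of 0 1])
  fix e :: real assume "e \<in> {0<..<1}"
  then have "e > 0" by simp
  from main[OF this] show "cmod (F (Complex x y)) * (exp (e * y\<^sup>2) * exp (- (e * x\<^sup>2))) \<le> B * exp (e * pi\<^sup>2)"
   unfolding ex .
 qed simp
 from tendsto_le[OF trivial_limit_at_right_real lim2 lim1 ev] show ?thesis by simp
qed

subsection \<open>Gaussian mollification of a bounded function\<close>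

definition mollify :: "real \<Rightarrow> (real \<Rightarrow> complex) \<Rightarrow> complex \<Rightarrow> complex" where
 "mollify d g z = (LINT y|lborel. gauss_kernel d (z - of_real y) * g y)"

text \<open>Expanding the square in the Gaussian turns the convolution into a Laplace transform of a function with
 Gaussian decay.\<close>

lemma mollify_entire:
 assumes d: "d > 0" and g: "bounded_borel g"
 shows "mollify d g holomorphic_on UNIV"
proof -
 obtain B where B: "0 \<le> B" "\<And>x. cmod (g x) \<le> B" using bounded_borel_obtain[OF g] by blast
 have gm[measurable]: "g \<in> borel_measurable borel" using g by (simp add: bounded_borel_def)
 let ?k = "\<lambda>y. of_real (exp (- y\<^sup>2 / (2 * d))) * g y"
 have "integrable lborel (\<lambda>y. exp (R * \<bar>y\<bar>) * cmod (?k y))" for R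
 proof (rule Bochner_Integration.integrable_bound)
  show "integrable lborel (\<lambda>y. (B * exp (R\<^sup>2 * d)) * exp (- (1 / (4 * d)) * y\<^sup>2))"
   using d by (intro integrable_gauss) simp
  show "(\<lambda>y. exp (R * \<bar>y\<bar>) * cmod (?k y)) \<in> borel_measurable lborel" by simp
  show "AE y in lborel. norm (exp (R * \<bar>y\<bar>) * cmod (?k y)) \<le> norm ((B * exp (R\<^sup>2 * d)) * exp (- (1 / (4 * d)) * y\<^sup>2))"
  proof (rule AE_I2)
   fix y :: real
   have q: "- y\<^sup>2 / (2 * d) = - 2 * (y\<^sup>2 / (4 * d))" "- (1 / (4 * d)) * y\<^sup>2 = - (y\<^sup>2 / (4 * d))"
    by simp_all
   have "0 \<le> (\<bar>y\<bar> - 2 * d * R)\<^sup>2 / (4 * d)" using d by simp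
   also have "\<dots> = y\<^sup>2 / (4 * d) - R * \<bar>y\<bar> + R\<^sup>2 * d"
    using d by (simp add: power2_eq_square field_simps)
   finally have "R * \<bar>y\<bar> + - y\<^sup>2 / (2 * d) \<le> R\<^sup>2 * d + - (1 / (4 * d)) * y\<^sup>2"
    unfolding q by linarith
   then have "exp (R * \<bar>y\<bar>) * exp (- y\<^sup>2 / (2 * d)) \<le> exp (R\<^sup>2 * d) * exp (- (1 / (4 * d)) * y\<^sup>2)"
    by (simp only: exp_add[symmetric] exp_le_cancel_iff)
   from mult_mono[OF this B(2)[of y]]
   have "(exp (R * \<bar>y\<bar>) * exp (- y\<^sup>2 / (2 * d))) * cmod (g y) \<le> (exp (R\<^sup>2 * d) * exp (- (1 / (4 * d)) * y\<^sup>2)) * B"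
    by simp
   then show "norm (exp (R * \<bar>y\<bar>) * cmod (?k y)) \<le> norm ((B * exp (R\<^sup>2 * d)) * exp (- (1 / (4 * d)) * y\<^sup>2))"
    using B(1) by (simp add: norm_mult abs_mult mult_ac)
  qed
 qed
 from laplace_entire[OF _ this]
 have L: "(\<lambda>z. LINT y|lborel. exp (z * of_real y) * ?k y) holomorphic_on UNIV" by simp
 have "((\<lambda>z. LINT y|lborel. exp (z * of_real y) * ?k y) \<circ> (\<lambda>z. z / of_real d)) holomorphic_on UNIV"
  by (intro holomorphic_on_compose holomorphic_intros holomorphic_on_subset[OF L]) (use d in auto)
 then have L': "(\<lambda>z. LINT y|lborel. exp (z / of_real d * of_real y) * ?k y) holomorphic_on UNIV" by (simp only: o_def)
 have eq: "mollify d g z = gauss_kernel d z * (LINT y|lborel. exp (z / of_real d * of_real y) * ?k y)" for z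
 proof -
  have "gauss_kernel d (z - of_real y) * g y = gauss_kernel d z * (exp (z / of_real d * of_real y) * ?k y)" for y
  proof -
   have ex: "- (z - of_real y)\<^sup>2 / of_real (2 * d) = - z\<^sup>2 / of_real (2 * d) + z / of_real d * of_real y + of_real (- y\<^sup>2 / (2 * d))"
    using d by (simp add: power2_eq_square field_simps)
   show ?thesis unfolding gauss_kernel_def ex exp_add exp_of_real by (simp add: mult_ac)
  qed
  then show ?thesis unfolding mollify_def by (simp only: integral_mult_right_zero)
 qed
 have "(\<lambda>z. gauss_kernel d z * (LINT y|lborel. exp (z / of_real d * of_real y) * ?k y)) holomorphic_on UNIV"
  by (intro holomorphic_on_mult gauss_kernel_holomorphic d L')
 then show ?thesis by (simp only: eq[abs_def])
qed

lemma gauss_kernel_shift_integrable: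
 assumes d: "d > 0"
 shows "integrable lborel (\<lambda>y. gauss_kernel d (Complex x v - of_real y))"
  and "(LINT y|lborel. cmod (gauss_kernel d (Complex x v - of_real y))) = exp (v\<^sup>2 / (2 * d))"
proof -
 have c: "Complex x v - of_real y = Complex (- (y - x)) v" for y by (simp add: complex_eq_iff)
 have i: "integrable lborel (\<lambda>y. gauss_kernel d (Complex y v))" by (rule integrable_gauss_kernel[OF d])
 have "integrable lborel (\<lambda>y. cnj (gauss_kernel d (Complex y v)))" using i by (rule integrable_cnj)
 from integrable_translate[OF this, of x]
 show "integrable lborel (\<lambda>y. gauss_kernel d (Complex x v - of_real y))" by (simp only: c gauss_kernel_sym)
 have "(LINT y|lborel. cmod (gauss_kernel d (Complex x v - of_real y))) = (LINT y|lborel. (\<lambda>y. cmod (gauss_kernel d (Complex y v))) (y - x))"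
  by (simp only: c gauss_kernel_sym complex_mod_cnj)
 also have "\<dots> = (LINT y|lborel. cmod (gauss_kernel d (Complex y v)))"
  using borel_measurable_integrable[OF i] by (intro integral_translate) simp
 also have "\<dots> = exp (v\<^sup>2 / (2 * d))"
  unfolding cmod_gauss_kernel[OF d] using integral_normal_density[of "sqrt d" 0] d by simp
 finally show "(LINT y|lborel. cmod (gauss_kernel d (Complex x v - of_real y))) = exp (v\<^sup>2 / (2 * d))" .
qed

lemma mollify_bound:
 assumes d: "d > 0" and g: "bounded_borel g" "\<And>x. cmod (g x) \<le> B"
 shows "cmod (mollify d g (Complex x v)) \<le> B * exp (v\<^sup>2 / (2 * d))"
proof -
 have "cmod (mollify d g (Complex x v)) \<le> (LINT y|lborel. cmod (gauss_kernel d (Complex x v - of_real y) * g y))"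
  unfolding mollify_def by (rule integral_norm_bound)
 also have "\<dots> \<le> (LINT y|lborel. B * cmod (gauss_kernel d (Complex x v - of_real y)))"
 proof (rule integral_mono_AE')
  show "integrable lborel (\<lambda>y. B * cmod (gauss_kernel d (Complex x v - of_real y)))"
   using gauss_kernel_shift_integrable(1)[OF d] by simp
  show "AE y in lborel. cmod (gauss_kernel d (Complex x v - of_real y) * g y) \<le> B * cmod (gauss_kernel d (Complex x v - of_real y))"
   using g(2) by (intro AE_I2) (auto simp: norm_mult mult.commute intro: mult_right_mono)
  have "0 \<le> B" using g(2)[of 0] norm_ge_zero order_trans by blast
  then show "AE y in lborel. 0 \<le> B * cmod (gauss_kernel d (Complex x v - of_real y))" by simp
 qed
 also have "\<dots> = B * exp (v\<^sup>2 / (2 * d))" by (simp add: gauss_kernel_shift_integrable(2)[OF d])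
 finally show ?thesis .
qed

text \<open>The translation is moved to the test function, which is continuous and has a locally uniform
 integrable bound.\<close>

lemma translate_continuous_pairing:
 assumes f: "strip_gaussian f" and g: "bounded_borel g" and s: "s \<longlonglongrightarrow> (0::real)"
 shows "(\<lambda>n. LINT x|lborel. f (Complex x 0) * g (x - s n)) \<longlonglongrightarrow> (LINT x|lborel. f (Complex x 0) * g x)"
proof -
 obtain B where B: "0 \<le> B" "\<And>x. cmod (g x) \<le> B" using bounded_borel_obtain[OF g] by blast
 have gm[measurable]: "g \<in> borel_measurable borel" using g by (simp add: bounded_borel_def)
 have fm[measurable]: "(\<lambda>x. f (Complex x 0)) \<in> borel_measurable borel" by (rule strip_gaussian_measurable[OF f])
 have fc: "continuous_on UNIV (\<lambda>x. f (Complex x 0))" by (rule strip_gaussian_continuous[OF f])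
 obtain C c where C: "C \<ge> 0" "c > 0" "\<And>x y. 0 \<le> y \<Longrightarrow> y \<le> pi \<Longrightarrow> cmod (f (Complex x y)) \<le> C * exp (- c * x\<^sup>2)"
  using strip_gaussianE[OF f] by blast
 obtain S where S: "\<And>n. \<bar>s n\<bar> \<le> S" using convergent_imp_Bseq[OF convergentI[OF s]] by (auto simp: Bseq_def)
 have tr: "(LINT x|lborel. f (Complex x 0) * g (x - t)) = (LINT x|lborel. f (Complex (x + t) 0) * g x)" for t
 proof -
  have fm': "(\<lambda>x. f (Complex (x + t) 0)) \<in> borel_measurable borel" by (rule measurable_compose[OF _ fm]) simp
  have "(LINT x|lborel. f (Complex x 0) * g (x - t)) = (LINT x|lborel. (\<lambda>x. f (Complex (x + t) 0) * g x) (x - t))" by simp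
  also have "\<dots> = (LINT x|lborel. f (Complex (x + t) 0) * g x)"
   by (rule integral_translate) (intro borel_measurable_times fm' gm)
  finally show ?thesis .
 qed
 show ?thesis
  unfolding tr
 proof (rule integral_dominated_convergence[where w = "\<lambda>x. (B * C * exp (c * S\<^sup>2)) * exp (- (c / 2) * x\<^sup>2)"])
  show "integrable lborel (\<lambda>x. (B * C * exp (c * S\<^sup>2)) * exp (- (c / 2) * x\<^sup>2))" using C by (intro integrable_gauss) simp
  show "(\<lambda>x. f (Complex (x + s n) 0) * g x) \<in> borel_measurable lborel" for n
   using measurable_compose[OF _ fm, of "\<lambda>x. x + s n" borel] by simp
  show "AE x in lborel. (\<lambda>n. f (Complex (x + s n) 0) * g x) \<longlonglongrightarrow> f (Complex x 0) * g x"
  proof (rule AE_I2)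
   fix x
   have "(\<lambda>n. x + s n) \<longlonglongrightarrow> x + 0" by (intro tendsto_add tendsto_const s)
   from continuous_on_tendsto_compose[OF fc this] show "(\<lambda>n. f (Complex (x + s n) 0) * g x) \<longlonglongrightarrow> f (Complex x 0) * g x"
    by (intro tendsto_mult tendsto_const) simp
  qed
  fix n
  show "AE x in lborel. norm (f (Complex (x + s n) 0) * g x) \<le> (B * C * exp (c * S\<^sup>2)) * exp (- (c / 2) * x\<^sup>2)"
  proof (rule AE_I2)
   fix x
   have "0 \<le> (x + 2 * s n)\<^sup>2" by simp
   then have "x\<^sup>2 / 2 - (s n)\<^sup>2 \<le> (x + s n)\<^sup>2" by (simp add: power2_eq_square algebra_simps)
   moreover have "(s n)\<^sup>2 \<le> S\<^sup>2" using S[of n] by (simp add: abs_le_square_iff[symmetric])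
   ultimately have "c * (x\<^sup>2 / 2 - S\<^sup>2) \<le> c * (x + s n)\<^sup>2" using C by (intro mult_left_mono) auto
   then have "exp (- c * (x + s n)\<^sup>2) \<le> exp (c * S\<^sup>2 + - (c / 2) * x\<^sup>2)" by (simp add: algebra_simps)
   then have "C * exp (- c * (x + s n)\<^sup>2) \<le> C * exp (c * S\<^sup>2 + - (c / 2) * x\<^sup>2)" using C by (intro mult_left_mono)
   then have "cmod (f (Complex (x + s n) 0)) \<le> C * exp (c * S\<^sup>2 + - (c / 2) * x\<^sup>2)"
    using C(3)[OF order_refl pi_ge_zero, of "x + s n"] by linarith
   then have "cmod (f (Complex (x + s n) 0)) * cmod (g x) \<le> (C * exp (c * S\<^sup>2 + - (c / 2) * x\<^sup>2)) * B"
    using B C by (intro mult_mono) auto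
   then show "norm (f (Complex (x + s n) 0) * g x) \<le> (B * C * exp (c * S\<^sup>2)) * exp (- (c / 2) * x\<^sup>2)"
    by (simp only: norm_mult exp_add mult_ac)
  qed
 qed simp
qed

text \<open>The pairing is the average of the translated pairings against a normal density of variance \<open>d n\<close>;
 rescaling the density to unit variance makes dominated convergence applicable.\<close>

lemma mollify_weak_limit:
 assumes f: "strip_gaussian f" and g: "bounded_borel g"
  and d: "\<And>n. d n > 0" "d \<longlonglongrightarrow> 0"
 shows "(\<lambda>n. LINT x|lborel. f (Complex x 0) * mollify (d n) g (Complex x 0)) \<longlonglongrightarrow> (LINT x|lborel. f (Complex x 0) * g x)"
proof -
 obtain B where B: "0 \<le> B" "\<And>x. cmod (g x) \<le> B" using bounded_borel_obtain[OF g] by blast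
 have gm[measurable]: "g \<in> borel_measurable borel" using g by (simp add: bounded_borel_def)
 have fm[measurable]: "(\<lambda>x. f (Complex x 0)) \<in> borel_measurable borel" by (rule strip_gaussian_measurable[OF f])
 have fi: "integrable lborel (\<lambda>x. f (Complex x 0))" by (rule strip_gaussian_integrable[OF f order_refl pi_ge_zero])
 define Q where "Q s = (LINT x|lborel. f (Complex x 0) * g (x - s))" for s
 have Qm[measurable]: "Q \<in> borel_measurable borel"
  unfolding Q_def[abs_def] by (intro lborel.borel_measurable_lebesgue_integral) measurable
 have Qb: "cmod (Q s) \<le> (LINT x|lborel. B * cmod (f (Complex x 0)))" for s
 proof -
  have "cmod (Q s) \<le> (LINT x|lborel. cmod (f (Complex x 0) * g (x - s)))" unfolding Q_def by (rule integral_norm_bound)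
  also have "\<dots> \<le> (LINT x|lborel. B * cmod (f (Complex x 0)))"
  proof (rule integral_mono_AE')
   show "integrable lborel (\<lambda>x. B * cmod (f (Complex x 0)))" using fi by simp
   show "AE x in lborel. cmod (f (Complex x 0) * g (x - s)) \<le> B * cmod (f (Complex x 0))"
    using mult_left_mono[OF B(2) norm_ge_zero]
    by (intro AE_I2) (simp only: norm_mult mult.commute[of B])
  qed (use B in simp)
  finally show ?thesis .
 qed
 have eq: "(LINT x|lborel. f (Complex x 0) * mollify (d n) g (Complex x 0)) =
   (LINT u|lborel. of_real (std_normal_density u) * Q (sqrt (d n) * u))" for n
 proof -
  let ?w = "\<lambda>s. complex_of_real (normal_density 0 (sqrt (d n)) s)"
  have wi: "integrable lborel ?w" using integrable_normal_density[of "sqrt (d n)" 0] d(1)[of n] by simp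
  have gk: "gauss_kernel (d n) (Complex s 0) = ?w s" for s
   unfolding gauss_kernel_Complex[OF d(1)] by simp
  have mol: "mollify (d n) g (Complex x 0) = smear g ?w x" for x
  proof -
   have "mollify (d n) g (Complex x 0) = (LINT y|lborel. ?w (x - y) * g y)"
   proof -
    have "Complex x 0 - of_real y = Complex (x - y) 0" for y by (simp add: complex_eq_iff)
    then show ?thesis unfolding mollify_def by (simp only: gk)
   qed
   also have "\<dots> = (LINT y|lborel. ?w (x - (- y)) * g (- y))"
    by (rule integral_reflect[symmetric, of "\<lambda>y. ?w (x - y) * g y"])
   also have "\<dots> = (LINT y|lborel. ?w (x - (- (y - x))) * g (- (y - x)))"
    by (rule integral_translate[symmetric, of "\<lambda>y. ?w (x - (- y)) * g (- y)"]) measurable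
   also have "\<dots> = smear g ?w x" by (simp add: smear_def mult.commute)
   finally show ?thesis .
  qed
  have "(LINT x|lborel. f (Complex x 0) * mollify (d n) g (Complex x 0)) = (LINT s|lborel. ?w s * Q s)"
   unfolding mol Q_def by (rule smear_integral(2)[OF fi wi g])
  also have "\<dots> = \<bar>sqrt (d n)\<bar> *\<^sub>R (LINT u|lborel. ?w (0 + sqrt (d n) * u) * Q (0 + sqrt (d n) * u))"
   by (rule lborel_integral_real_affine) (use d(1)[of n] in simp)
  also have "\<dots> = (LINT u|lborel. \<bar>sqrt (d n)\<bar> *\<^sub>R (?w (0 + sqrt (d n) * u) * Q (0 + sqrt (d n) * u)))"
   by (rule integral_scaleR_right[symmetric])
  also have "\<dots> = (LINT u|lborel. of_real (std_normal_density u) * Q (sqrt (d n) * u))"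
  proof (intro Bochner_Integration.integral_cong refl)
   fix u
   have "sqrt (d n) * normal_density 0 (sqrt (d n)) (sqrt (d n) * u) = std_normal_density u"
    using d(1)[of n] by (simp add: normal_density_def real_sqrt_mult power_mult_distrib)
   then have "complex_of_real (sqrt (d n)) * complex_of_real (normal_density 0 (sqrt (d n)) (sqrt (d n) * u)) = of_real (std_normal_density u)"
    by (simp only: of_real_mult[symmetric])
   then show "\<bar>sqrt (d n)\<bar> *\<^sub>R (?w (0 + sqrt (d n) * u) * Q (0 + sqrt (d n) * u)) = of_real (std_normal_density u) * Q (sqrt (d n) * u)"
    using d(1)[of n] by (simp add: scaleR_conv_of_real flip: mult.assoc)
  qed
  finally show ?thesis .
 qed
 have "(\<lambda>n. LINT u|lborel. of_real (std_normal_density u) * Q (sqrt (d n) * u)) \<longlonglongrightarrow>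
   (LINT u|lborel. of_real (std_normal_density u) * Q 0)"
 proof (rule integral_dominated_convergence[where w = "\<lambda>u. std_normal_density u * (LINT x|lborel. B * cmod (f (Complex x 0)))"])
  show "integrable lborel (\<lambda>u. std_normal_density u * (LINT x|lborel. B * cmod (f (Complex x 0))))"
   using integrable_normal_density[of 1 0] by simp
  show "AE u in lborel. (\<lambda>n. complex_of_real (std_normal_density u) * Q (sqrt (d n) * u)) \<longlonglongrightarrow> of_real (std_normal_density u) * Q 0"
  proof (rule AE_I2)
   fix u
   have "(\<lambda>n. sqrt (d n) * u) \<longlonglongrightarrow> sqrt 0 * u" by (intro tendsto_mult_right tendsto_real_sqrt d)
   then have "(\<lambda>n. sqrt (d n) * u) \<longlonglongrightarrow> 0" by simp
   from translate_continuous_pairing[OF f g this]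
   show "(\<lambda>n. complex_of_real (std_normal_density u) * Q (sqrt (d n) * u)) \<longlonglongrightarrow> of_real (std_normal_density u) * Q 0"
    unfolding Q_def by (intro tendsto_mult tendsto_const) simp
  qed
  show "AE u in lborel. norm (complex_of_real (std_normal_density u) * Q (sqrt (d n) * u)) \<le> std_normal_density u * (LINT x|lborel. B * cmod (f (Complex x 0)))" for n
   unfolding norm_mult by (intro AE_I2 mult_mono Qb) auto
 qed measurable
 also have "(LINT u|lborel. complex_of_real (std_normal_density u) * Q 0) = (LINT x|lborel. f (Complex x 0) * g x)"
  using integral_normal_density[of 1 0] by (simp add: Q_def)
 finally show ?thesis unfolding eq .
qed

text \<open>A Gaussian whose square is the translated kernel; it turns a bound on the crossing relation into a
 bound on the mollification.\<close>

definition half_kernel :: "real \<Rightarrow> real \<Rightarrow> complex \<Rightarrow> complex" where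
 "half_kernel d t z = of_real (sqrt (1 / sqrt (2 * pi * d))) * exp (- (z - of_real t)\<^sup>2 / of_real (4 * d))"

lemma half_kernel_square:
 assumes d: "d > 0"
 shows "half_kernel d t z * half_kernel d t z = gauss_kernel d (z - of_real t)"
proof -
 have "sqrt (1 / sqrt (2 * pi * d)) * sqrt (1 / sqrt (2 * pi * d)) = 1 / sqrt (2 * pi * d)" using d by simp
 then have "complex_of_real (sqrt (1 / sqrt (2 * pi * d))) * of_real (sqrt (1 / sqrt (2 * pi * d))) = of_real (1 / sqrt (2 * pi * d))"
  by (simp only: of_real_mult[symmetric])
 moreover have "exp (- (z - of_real t)\<^sup>2 / of_real (4 * d)) * exp (- (z - of_real t)\<^sup>2 / of_real (4 * d)) = exp (- (z - of_real t)\<^sup>2 / of_real (2 * d))"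
  using d by (simp add: field_simps flip: exp_add)
 ultimately have "(complex_of_real (sqrt (1 / sqrt (2 * pi * d))) * of_real (sqrt (1 / sqrt (2 * pi * d)))) *
   (exp (- (z - of_real t)\<^sup>2 / of_real (4 * d)) * exp (- (z - of_real t)\<^sup>2 / of_real (4 * d)))
  = of_real (1 / sqrt (2 * pi * d)) * exp (- (z - of_real t)\<^sup>2 / of_real (2 * d))" by (simp only:)
 moreover have "of_real (1 / sqrt (2 * pi * d)) * exp (- (z - of_real t)\<^sup>2 / of_real (2 * d)) = gauss_kernel d (z - of_real t)"
  unfolding gauss_kernel_def by simp
 moreover have "half_kernel d t z * half_kernel d t z = (complex_of_real (sqrt (1 / sqrt (2 * pi * d))) * of_real (sqrt (1 / sqrt (2 * pi * d)))) *
   (exp (- (z - of_real t)\<^sup>2 / of_real (4 * d)) * exp (- (z - of_real t)\<^sup>2 / of_real (4 * d)))"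
  unfolding half_kernel_def by (simp only: mult_ac)
 ultimately show ?thesis by (simp only:)
qed

lemma strip_gaussian_half_kernel:
 assumes d: "d > 0"
 shows "strip_gaussian (half_kernel d t)"
proof -
 have "half_kernel d t = (\<lambda>z. (of_real (sqrt (1 / sqrt (2 * pi * d))) * exp (of_real (- t\<^sup>2 / (4 * d)))) *
   exp (- of_real (1 / (4 * d)) * z\<^sup>2 + of_real (t / (2 * d)) * z))"
 proof
  fix z :: complex
  have "- (z - of_real t)\<^sup>2 / of_real (4 * d) = of_real (- t\<^sup>2 / (4 * d)) + (- of_real (1 / (4 * d)) * z\<^sup>2 + of_real (t / (2 * d)) * z)"
   using d by (simp add: power2_eq_square field_simps)
  then show "half_kernel d t z = (of_real (sqrt (1 / sqrt (2 * pi * d))) * exp (of_real (- t\<^sup>2 / (4 * d)))) *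
   exp (- of_real (1 / (4 * d)) * z\<^sup>2 + of_real (t / (2 * d)) * z)"
   unfolding half_kernel_def by (simp only: exp_add mult.assoc)
 qed
 moreover have "0 < 1 / (4 * d)" using d by simp
 ultimately show ?thesis using strip_gaussian_exp by (simp only:)
qed

lemma norm_half_kernel:
 assumes d: "d > 0"
 shows "norm (strip_vec (half_kernel d t) 0) = 1"
proof -
 note si = strip_gaussian_square_integrable[OF strip_gaussian_half_kernel[OF d] order_refl pi_ge_zero]
 have "(norm (strip_vec (half_kernel d t) 0))\<^sup>2 = (LINT x|lborel. (cmod (half_kernel d t (Complex x 0)))\<^sup>2)"
  unfolding strip_vec_def by (rule norm_abs[OF si])
 also have "\<dots> = (LINT x|lborel. cmod (gauss_kernel d (Complex t 0 - of_real x)))"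
 proof (intro Bochner_Integration.integral_cong refl)
  fix x
  have "Complex x 0 - of_real t = - (Complex t 0 - of_real x)" by (simp add: complex_eq_iff)
  then have "half_kernel d t (Complex x 0) * half_kernel d t (Complex x 0) = gauss_kernel d (Complex t 0 - of_real x)"
   by (simp only: half_kernel_square[OF d] gauss_kernel_uminus)
  then show "(cmod (half_kernel d t (Complex x 0)))\<^sup>2 = cmod (gauss_kernel d (Complex t 0 - of_real x))"
   by (metis norm_mult power2_eq_square)
 qed
 also have "\<dots> = 1" by (simp add: gauss_kernel_shift_integrable(2)[OF d])
 finally show ?thesis by (simp add: power2_eq_1_iff) (smt (verit) norm_ge_zero)
qed

text \<open>A bound on the means over small intervals is a bound on the value at the end point.\<close>

lemma average_bound:
 fixes \<Gamma> :: "real \<Rightarrow> complex"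
 assumes cont: "continuous_on UNIV \<Gamma>"
  and bd: "\<And>h. h > 0 \<Longrightarrow> cmod (LINT x|lborel. indicator {0..h} x * \<Gamma> x) \<le> N * h"
 shows "cmod (\<Gamma> 0) \<le> N"
proof (rule field_le_epsilon)
 fix e :: real assume e: "0 < e"
 have "isCont \<Gamma> 0" using cont by (simp add: continuous_on_eq_continuous_at)
 then obtain d where d: "d > 0" "\<And>x. dist x 0 < d \<Longrightarrow> dist (\<Gamma> x) (\<Gamma> 0) < e"
  using e unfolding continuous_at_eps_delta by (metis dist_commute)
 define h where "h = d / 2"
 have h: "h > 0" using d by (simp add: h_def)
 have ci: "integrable lborel (\<lambda>x. indicator {0..h} x * k x)" if k: "continuous_on UNIV k" for k :: "real \<Rightarrow> complex"
 proof -
  have "set_integrable lborel {0..h} k"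
   by (rule borel_integrable_atLeastAtMost') (rule continuous_on_subset[OF k], simp)
  moreover have "(\<lambda>x. indicator {0..h} x *\<^sub>R k x) = (\<lambda>x. indicator {0..h} x * k x)" by (auto simp: indicator_def)
  ultimately show ?thesis by (simp add: set_integrable_def)
 qed
 have i1: "integrable lborel (\<lambda>x. indicator {0..h} x * \<Gamma> x)" and i2: "integrable lborel (\<lambda>x. indicator {0..h} x * (\<Gamma> 0 - \<Gamma> x))"
  by (intro ci continuous_intros cont)+
 have ind: "(LINT x|lborel. indicator {0..h} x) = h" using h by simp
 have "(LINT x|lborel. indicator {0..h} x * \<Gamma> 0) = of_real h * \<Gamma> 0"
 proof -
  have "(LINT x|lborel. complex_of_real (indicator {0..h} x)) = of_real (LINT x|lborel. indicator {0..h} x)"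
   by (rule integral_complex_of_real)
  moreover have "(\<lambda>x. complex_of_real (indicator {0..h} x)) = indicator {0..h}" by (auto simp: indicator_def)
  ultimately have "(LINT x|lborel. (indicator {0..h} x :: complex)) = of_real h" unfolding ind by simp
  then show ?thesis by simp
 qed
 moreover have "(LINT x|lborel. indicator {0..h} x * \<Gamma> 0) = (LINT x|lborel. indicator {0..h} x * \<Gamma> x) + (LINT x|lborel. indicator {0..h} x * (\<Gamma> 0 - \<Gamma> x))"
  by (subst Bochner_Integration.integral_add[OF i1 i2, symmetric]) (simp add: algebra_simps)
 ultimately have eq: "of_real h * \<Gamma> 0 = (LINT x|lborel. indicator {0..h} x * \<Gamma> x) + (LINT x|lborel. indicator {0..h} x * (\<Gamma> 0 - \<Gamma> x))" by (simp only:)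
 have "cmod (LINT x|lborel. indicator {0..h} x * (\<Gamma> 0 - \<Gamma> x)) \<le> (LINT x|lborel. cmod (indicator {0..h} x * (\<Gamma> 0 - \<Gamma> x)))"
  by (rule integral_norm_bound)
 also have "\<dots> \<le> (LINT x|lborel. e * indicator {0..h} x)"
 proof (rule integral_mono_AE')
  have "integrable lborel (indicator {0..h} :: real \<Rightarrow> real)"
   by (rule integrable_real_indicator) (use h in simp_all)
  then show "integrable lborel (\<lambda>x. e * indicator {0..h} x)" by (rule integrable_mult_right)
  show "AE x in lborel. cmod (indicator {0..h} x * (\<Gamma> 0 - \<Gamma> x)) \<le> e * indicator {0..h} x"
  proof (rule AE_I2)
   fix x
   show "cmod (indicator {0..h} x * (\<Gamma> 0 - \<Gamma> x)) \<le> e * indicator {0..h} x"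
   proof (cases "x \<in> {0..h}")
    case True
    then have "dist x 0 < d" using h by (simp add: h_def dist_real_def)
    from d(2)[OF this] True show ?thesis by (simp add: dist_norm norm_minus_commute)
   qed simp
  qed
  show "AE x in lborel. 0 \<le> e * (indicator {0..h} x :: real)" using e by simp
 qed
 also have "\<dots> = e * h" by (simp only: integral_mult_right_zero ind)
 finally have "cmod (LINT x|lborel. indicator {0..h} x * (\<Gamma> 0 - \<Gamma> x)) \<le> e * h" .
 then have "cmod (of_real h * \<Gamma> 0) \<le> N * h + e * h"
  unfolding eq using bd[OF h] norm_triangle_ineq[of "LINT x|lborel. indicator {0..h} x * \<Gamma> x"] by (meson add_mono order_trans)
 then have "h * cmod (\<Gamma> 0) \<le> h * (N + e)" using h by (simp add: norm_mult algebra_simps)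
 then show "cmod (\<Gamma> 0) \<le> N + e" using h by simp
qed

context boost_tomita
begin

text \<open>Concentrating the unrestricted vectors \<open>\<phi> = \<psi>\<close> near a point turns the crossing relation into a
 pointwise bound on the upper edge.\<close>

lemma mollify_upper_bound:
 assumes g: "bounded_borel g" and d: "d > 0"
  and C: "\<And>\<Psi>. norm (C \<Psi>) \<le> N * norm \<Psi>" and cr: "crossing_identity sqrt_op (mult_diff g \<circ> flip) C"
 shows "cmod (mollify d g (Complex t pi)) \<le> N"
proof -
 let ?V = "half_kernel d t"
 note V = strip_gaussian_half_kernel[OF d, of t]
 note Vsi = strip_gaussian_square_integrable[OF V pi_ge_zero order_refl]
 define \<Gamma> where "\<Gamma> x = mollify d g (Complex (t - x) pi)" for x
 have cont: "continuous_on UNIV \<Gamma>"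
 proof -
  have "continuous_on UNIV (\<lambda>x. Complex (t - x) pi)"
   unfolding Complex_eq by (intro continuous_intros)
  from continuous_on_compose2[OF holomorphic_on_imp_continuous_on[OF mollify_entire[OF d g]] this] show ?thesis
   by (simp add: \<Gamma>_def[abs_def])
 qed
 have "cmod (\<Gamma> 0) \<le> N"
 proof (rule average_bound[OF cont])
  fix h :: real assume h: "h > 0"
  let ?i = "indicator {0..h} :: real \<Rightarrow> complex"
  have isi: "square_integrable ?i" by (rule square_integrable_indicator[where r = "h"]) (auto simp: dist_real_def)
  have ii: "integrable lborel ?i"
  proof -
   have "(\<lambda>x. cnj (?i x) * ?i x) = ?i" by (auto simp: indicator_def)
   then show ?thesis using square_integrable_integrable_product[OF isi isi] by (simp only:)
  qed
  have ni: "(norm (abs_l2 ?i))\<^sup>2 = h"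
  proof -
   have "(\<lambda>x. (cmod (?i x))\<^sup>2) = indicator {0..h}" by (auto simp: indicator_def)
   then show ?thesis unfolding norm_abs[OF isi] using h by simp
  qed
  have pi': "integrable lborel (\<lambda>y. cnj (?V (Complex y pi)) * cnj (?V (Complex y pi)))"
   by (rule integrable_cnj_product[OF Vsi Vsi])
  have inner: "(LINT y|lborel. (cnj (?V (Complex y pi)) * cnj (?V (Complex y pi))) * g (y - x)) = \<Gamma> x" for x
  proof -
   have gm[measurable]: "g \<in> borel_measurable borel" using g by (simp add: bounded_borel_def)
   have km[measurable]: "(\<lambda>y. gauss_kernel d (Complex (t - x) pi - of_real y)) \<in> borel_measurable borel"
    using borel_measurable_integrable[OF gauss_kernel_shift_integrable(1)[OF d]] by simp
   have "cnj (?V (Complex y pi)) * cnj (?V (Complex y pi)) = gauss_kernel d (Complex (t - x) pi - of_real (y - x))" for y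
   proof -
    have "Complex y pi - of_real t = Complex (- (t - y)) pi" "Complex (t - x) pi - of_real (y - x) = Complex (t - y) pi"
     by (simp_all add: complex_eq_iff)
    then show ?thesis
     by (simp only: complex_cnj_mult[symmetric] half_kernel_square[OF d] gauss_kernel_sym complex_cnj_cnj)
   qed
   then have "(LINT y|lborel. (cnj (?V (Complex y pi)) * cnj (?V (Complex y pi))) * g (y - x)) =
     (LINT y|lborel. (\<lambda>y. gauss_kernel d (Complex (t - x) pi - of_real y) * g y) (y - x))" by (simp only:)
   also have "\<dots> = (LINT y|lborel. gauss_kernel d (Complex (t - x) pi - of_real y) * g y)"
    by (rule integral_translate) measurable
   finally show ?thesis by (simp only: \<Gamma>_def mollify_def)
  qed
  have "(LINT x|lborel. ?i x * \<Gamma> x) = (LINT y|lborel. (cnj (?V (Complex y pi)) * cnj (?V (Complex y pi))) * smear g ?i y)"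
   by (simp only: inner smear_integral(2)[OF pi' ii g])
  also have "\<dots> = (LINT z|lborel. (cnj (?V (Complex (snd z) pi)) * cnj (?V (Complex (snd z) pi))) * (g (snd z - fst z) * ?i (fst z)))"
   by (rule smear_integral(1)[OF pi' ii g, symmetric])
  also have "\<dots> = (LINT z|lborel. cnj (?i (fst z) * ?V (Complex (snd z) pi)) * (g (snd z - fst z) * (cnj (?V (Complex (snd z) pi)) * ?i (fst z))))"
   by (intro Bochner_Integration.integral_cong refl) (auto simp: indicator_def)
  also have "\<dots> = cinner (abs_l2 ?i \<otimes> strip_vec ?V pi) ((mult_diff g \<circ> flip) (conj_l2 (strip_vec ?V pi) \<otimes> abs_l2 ?i))"
   unfolding strip_vec_def o_def using Vsi isi by (simp only: conj_abs exchange_form[OF g] square_integrable_cnj)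
  also have "\<dots> = cinner (strip_vec ?V 0 \<otimes> abs_l2 ?i) (C (abs_l2 ?i \<otimes> conj_l2 (strip_vec ?V 0)))"
   by (rule crossing_identityD[OF cr strip_gaussian_sqrt_op[OF V] strip_gaussian_sqrt_op[OF V]])
  finally have "cmod (LINT x|lborel. ?i x * \<Gamma> x) \<le> norm (strip_vec ?V 0 \<otimes> abs_l2 ?i) * norm (C (abs_l2 ?i \<otimes> conj_l2 (strip_vec ?V 0)))"
   by (simp only: cinner_Cauchy_Schwarz)
  also have "\<dots> \<le> norm (strip_vec ?V 0 \<otimes> abs_l2 ?i) * (N * norm (abs_l2 ?i \<otimes> conj_l2 (strip_vec ?V 0)))"
   by (intro mult_left_mono C) simp
  also have "\<dots> = N * (norm (abs_l2 ?i))\<^sup>2" by (simp add: norm_tensor norm_half_kernel[OF d] power2_eq_square)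
  finally show "cmod (LINT x|lborel. ?i x * \<Gamma> x) \<le> N * h" by (simp only: ni)
 qed
 then show ?thesis by (simp add: \<Gamma>_def)
qed

text \<open>After multiplication by a fixed Gaussian both functions are square integrable, and all their
 regularizations agree.\<close>

lemma gaussian_test_unique:
 assumes l: "bounded_borel l" and g: "bounded_borel g"
  and eq: "\<And>f. strip_gaussian f \<Longrightarrow> (LINT x|lborel. f (Complex x 0) * l x) = (LINT x|lborel. f (Complex x 0) * g x)"
 shows "AE x in lborel. l x = g x"
proof -
 let ?\<gamma> = "\<lambda>s. modulated 0 (Complex s 0)"
 note G = strip_gaussian_modulated[of 0]
 have si: "square_integrable (\<lambda>s. h s * ?\<gamma> s)" if "bounded_borel h" for h
  by (rule square_integrable_mul[OF that strip_gaussian_square_integrable[OF G order_refl pi_ge_zero]])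
 have eq_reg: "regularize (1 / real (Suc n)) 0 (abs_l2 (\<lambda>s. l s * ?\<gamma> s)) = regularize (1 / real (Suc n)) 0 (abs_l2 (\<lambda>s. g s * ?\<gamma> s))" for n
 proof -
  define e where "e = 1 / real (Suc n)"
  have e: "e > 0" by (simp add: e_def)
  have "(LINT s|lborel. gauss_kernel e (Complex (x - s) 0) * (l s * ?\<gamma> s)) = (LINT s|lborel. gauss_kernel e (Complex (x - s) 0) * (g s * ?\<gamma> s))" for x
  proof -
   have sg: "strip_gaussian (\<lambda>z. gauss_kernel e (z - of_real x) * modulated 0 z)"
    by (rule strip_gaussian_mult[OF strip_gaussian_kernel[OF e] G])
   have "gauss_kernel e (Complex (x - s) 0) * (h s * ?\<gamma> s) = gauss_kernel e (Complex s 0 - of_real x) * ?\<gamma> s * h s" for s h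
   proof -
    have "Complex (x - s) 0 = - (Complex s 0 - of_real x)" by (simp add: complex_eq_iff)
    then show ?thesis by (simp only: gauss_kernel_uminus mult_ac)
   qed
   then show ?thesis using eq[OF sg] by (simp only:)
  qed
  then show ?thesis unfolding e_def[symmetric] by (simp only: regularize_abs[OF e si[OF l]] regularize_abs[OF e si[OF g]])
 qed
 have "(\<lambda>n. regularize (1 / real (Suc n)) 0 (abs_l2 (\<lambda>s. l s * ?\<gamma> s))) \<longlonglongrightarrow> abs_l2 (\<lambda>s. g s * ?\<gamma> s)"
  unfolding eq_reg by (rule regularize_tendsto)
 from LIMSEQ_unique[OF regularize_tendsto this]
 have "abs_l2 (\<lambda>s. l s * ?\<gamma> s) = abs_l2 (\<lambda>s. g s * ?\<gamma> s)" .
 then have "AE s in lborel. l s * ?\<gamma> s = g s * ?\<gamma> s" by (simp only: abs_l2_eq_iff si l g)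
 then show ?thesis by eventually_elim (simp add: modulated_def)
qed

text \<open>The limit is identified through its pairings with Gaussian test functions: on the middle line the
 convergence is bounded and pointwise, and both for the mollifications and for the limit these pairings
 equal those on the real line.\<close>

theorem tomita_exchange_analytic:
 assumes g: "bounded_borel g" and C: "bounded_clinear C" and cr: "crossing_identity sqrt_op (mult_diff g \<circ> flip) C"
 obtains G where "G \<in> Hinf" "AE x in lborel. lower_bv G x = g x"
proof -
 obtain B0 where B0: "0 \<le> B0" "\<And>x. cmod (g x) \<le> B0" using bounded_borel_obtain[OF g] by blast
 obtain N where N: "N \<ge> 0" "\<And>\<Psi>. norm (C \<Psi>) \<le> N * norm \<Psi>" using bounded_clinear_norm_le[OF C] by blast
 define B where "B = B0 + N + 1"
 have B: "B > 0" "B0 \<le> B" "N \<le> B" using B0 N by (simp_all add: B_def)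
 define F where "F n = mollify (1 / real (Suc n)) g" for n
 have dpos: "0 < 1 / real (Suc n)" for n by simp
 have Fhol: "F n holomorphic_on A" for n A
  unfolding F_def by (rule holomorphic_on_subset[OF mollify_entire[OF dpos g]]) simp
 have Fb: "cmod (F n (Complex x y)) \<le> B" if y: "0 \<le> y" "y \<le> pi" for n x y
 proof (rule strip_maximum[OF Fhol _ _ _ B(1) y])
  show "cmod (F n (Complex x 0)) \<le> B" for x
   using mollify_bound[OF dpos g B0(2), of n x 0] B by (simp add: F_def)
  show "cmod (F n (Complex x pi)) \<le> B" for x
   using mollify_upper_bound[OF g dpos N(2) cr, of n x] B by (simp add: F_def)
  fix x y assume y: "0 \<le> y" "y \<le> pi"
  have "cmod (F n (Complex x y)) \<le> B0 * exp (y\<^sup>2 / (2 * (1 / real (Suc n))))"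
   unfolding F_def by (rule mollify_bound[OF dpos g B0(2)])
  also have "\<dots> \<le> B0 * exp (pi\<^sup>2 / (2 * (1 / real (Suc n))))"
  proof (intro mult_left_mono B0)
   have "y\<^sup>2 \<le> pi\<^sup>2" using y by (intro power_mono)
   then show "exp (y\<^sup>2 / (2 * (1 / real (Suc n)))) \<le> exp (pi\<^sup>2 / (2 * (1 / real (Suc n))))"
    unfolding exp_le_cancel_iff by (rule divide_right_mono) simp
  qed
  finally show "cmod (F n (Complex x y)) \<le> B0 * exp (pi\<^sup>2 / (2 * (1 / real (Suc n))))" .
 qed
 have Fstrip: "cmod (F n z) \<le> B" if "z \<in> strip" for n z
  using Fb[of "Im z" n "Re z"] that by (simp add: strip_def)
 obtain G r where G: "G holomorphic_on strip" and r: "strict_mono (r :: nat \<Rightarrow> nat)"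
  and lim: "\<And>z. z \<in> strip \<Longrightarrow> (\<lambda>n. F (r n) z) \<longlonglongrightarrow> G z"
 proof (rule Montel[of strip "range F" F])
  show "\<exists>B. \<forall>h\<in>range F. \<forall>z\<in>K. cmod (h z) \<le> B" if "compact K" "K \<subseteq> strip" for K
   using Fstrip that by blast
 qed (use open_strip Fhol in auto)
 have Gb: "cmod (G z) \<le> B" if "z \<in> strip" for z
  by (rule Lim_norm_ubound[OF sequentially_bot lim[OF that]]) (simp add: Fstrip[OF that])
 have GH: "G \<in> Hinf" using G Gb by (auto simp: Hinf_def bounded_iff)
 obtain l where l: "bounded_borel l" "AE u in lborel. lower_bv G u = l u"
  using Linf_bounded_version[OF lower_bv_Linf[OF GH]] .
 have test: "(LINT x|lborel. f (Complex x 0) * l x) = (LINT x|lborel. f (Complex x 0) * g x)" if f: "strip_gaussian f" for f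
 proof -
  obtain K c where K: "K \<ge> 0" "c > 0" "\<And>x y. 0 \<le> y \<Longrightarrow> y \<le> pi \<Longrightarrow> cmod (f (Complex x y)) \<le> K * exp (- c * x\<^sup>2)"
   using strip_gaussianE[OF f] by blast
  have fhol: "f holomorphic_on A" for A using f holomorphic_on_subset by (auto simp: strip_gaussian_def)
  have fm[measurable]: "(\<lambda>x. f (Complex x y)) \<in> borel_measurable borel" for y by (rule strip_gaussian_measurable[OF f])
  have Fm[measurable]: "(\<lambda>x. F n (Complex x y)) \<in> borel_measurable borel" for n y
   by (intro borel_measurable_continuous_onI continuous_on_compose2[OF holomorphic_on_imp_continuous_on[OF Fhol, of UNIV] continuous_on_Complex(1)]) simp
  have Gm[measurable]: "(\<lambda>x. G (Complex x (pi / 2))) \<in> borel_measurable borel"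
   by (intro borel_measurable_continuous_onI continuous_on_compose2[OF holomorphic_on_imp_continuous_on[OF G] continuous_on_Complex(1)]) auto
  have lm: "l \<in> borel_measurable borel" using l by (simp add: bounded_borel_def)
  have fF: "cmod (f (Complex x y) * F n (Complex x y)) \<le> (K * B) * exp (- c * x\<^sup>2)" if y: "0 \<le> y" "y \<le> pi" for x y n
  proof -
   have "cmod (f (Complex x y) * F n (Complex x y)) \<le> (K * exp (- c * x\<^sup>2)) * B"
    unfolding norm_mult using K(3)[OF y] Fb[OF y] K(1) by (intro mult_mono) auto
   then show ?thesis by (simp only: mult_ac)
  qed
  have "(LINT x|lborel. f (Complex x 0) * l x) = (LINT x|lborel. f (Complex x 0) * lower_bv G x)"
   by (rule integral_cong_AE) (use l lm lower_bv_measurable[OF GH] in \<open>auto elim!: eventually_mono\<close>)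
  also have "\<dots> = (LINT x|lborel. f (Complex x (pi / 2)) * G (Complex x (pi / 2)))"
   by (rule boundary_shift(2)[OF GH fhol K(2,3)]) simp_all
  finally have one: "(LINT x|lborel. f (Complex x 0) * l x) = (LINT x|lborel. f (Complex x (pi / 2)) * G (Complex x (pi / 2)))" .
  have "(\<lambda>n. LINT x|lborel. f (Complex x (pi / 2)) * F (r n) (Complex x (pi / 2))) \<longlonglongrightarrow> (LINT x|lborel. f (Complex x (pi / 2)) * G (Complex x (pi / 2)))"
  proof (rule integral_dominated_convergence[where w = "\<lambda>x. (K * B) * exp (- c * x\<^sup>2)"])
   show "integrable lborel (\<lambda>x. (K * B) * exp (- c * x\<^sup>2))" by (rule integrable_gauss[OF K(2)])
   show "AE x in lborel. (\<lambda>n. f (Complex x (pi / 2)) * F (r n) (Complex x (pi / 2))) \<longlonglongrightarrow> f (Complex x (pi / 2)) * G (Complex x (pi / 2))"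
    by (intro AE_I2 tendsto_mult tendsto_const lim) simp
   show "AE x in lborel. norm (f (Complex x (pi / 2)) * F (r n) (Complex x (pi / 2))) \<le> (K * B) * exp (- c * x\<^sup>2)" for n
    by (intro AE_I2 fF) simp_all
  qed measurable
  moreover have "(LINT x|lborel. f (Complex x 0) * F n (Complex x 0)) = (LINT x|lborel. f (Complex x (pi / 2)) * F n (Complex x (pi / 2)))" for n
  proof (rule strip_shift[where f = "\<lambda>z. f z * F n z" and \<alpha> = "-1" and \<beta> = 4, OF _ _ _ _ K(2)])
   show "(\<lambda>z. f z * F n z) holomorphic_on {z. -1 < Im z \<and> Im z < 4}" by (intro holomorphic_on_mult fhol Fhol)
   show "pi / 2 < 4" using pi_less_4 by simp
   show "cmod (f (Complex x y) * F n (Complex x y)) \<le> (K * B) * exp (- c * x\<^sup>2)" if "0 \<le> y" "y \<le> pi / 2" for x y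
    using that by (intro fF) auto
  qed simp_all
  ultimately have two: "(\<lambda>n. LINT x|lborel. f (Complex x 0) * F (r n) (Complex x 0)) \<longlonglongrightarrow> (LINT x|lborel. f (Complex x (pi / 2)) * G (Complex x (pi / 2)))"
   by simp
  have "(\<lambda>n. LINT x|lborel. f (Complex x 0) * F (r n) (Complex x 0)) \<longlonglongrightarrow> (LINT x|lborel. f (Complex x 0) * g x)"
   unfolding F_def
  proof (rule mollify_weak_limit[OF f g])
   show "(\<lambda>n. 1 / real (Suc (r n))) \<longlonglongrightarrow> 0"
    using LIMSEQ_subseq_LIMSEQ[OF LIMSEQ_Suc[OF lim_1_over_n] r] by (simp add: o_def)
  qed simp
  from LIMSEQ_unique[OF two this] one show ?thesis by simp
 qed
 have "AE x in lborel. l x = g x" by (rule gaussian_test_unique[OF l(1) g]) (rule test)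
 with l(2) have "AE x in lborel. lower_bv G x = g x"
  by eventually_elim simp
 with GH show ?thesis by (rule that)
qed

end

section \<open>Crossable operators in the commutant\<close>

theorem theorem5p7:
  fixes m :: real
    and H :: "real l2 set"
    and E :: "real set \<Rightarrow> real l2 \<Rightarrow> real l2"
    and T :: "(real \<times> real) l2 \<Rightarrow> (real \<times> real) l2"
  assumes "m > 0"
    and "standard_subspace H"
    and "modular_data H conj_l2 E"
    and "\<And>t. imaginary_power E t = graph (U m ((0, 0), 2 * pi * t))"
    and "T \<in> commutant (range (U2 m))"
  shows
    "((crossable (graph conj_l2) T \<longleftrightarrow> (\<exists>g \<in> Linf. T = mult_diff g \<circ> flip)) \<and>
      (\<forall>g \<in> Linf. T = mult_diff g \<circ> flip \<longrightarrow>
         (crossing_symmetric (graph conj_l2) T \<longleftrightarrow> (AE \<theta> in lborel. g \<theta> \<in> \<real>)))) \<and>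
     ((crossable (tomita H) T \<longleftrightarrow> (\<exists>G \<in> Hinf. T = mult_diff (lower_bv G) \<circ> flip)) \<and>
      (\<forall>G \<in> Hinf. T = mult_diff (lower_bv G) \<circ> flip \<longrightarrow>
         (crossing_symmetric (tomita H) T \<longleftrightarrow>
            (AE \<theta> in lborel. upper_bv G \<theta> = cnj (lower_bv G \<theta>))) \<and>
         (inner_function G \<longrightarrow> unitary T) \<and>
         (crossing_symmetric (tomita H) T \<longrightarrow> unitary T \<longrightarrow> inner_function G)))"
proof -
 obtain f g where f: "bounded_borel f" and g: "bounded_borel g"
  and T: "\<And>\<Psi>. T \<Psi> = mult_diff f \<Psi> + mult_diff g (flip \<Psi>)"
 proof (rule commutant_form[OF assms(1,5)])
  fix f g
  assume "bounded_borel f" "bounded_borel g" "\<And>\<Psi>. T \<Psi> = mult_diff f \<Psi> + mult_diff g (flip \<Psi>)"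
  then show thesis by (rule that)
 qed
 have T_bd: "bounded_clinear T" using assms(5) by (simp add: commutant_def)
 interpret boost_tomita E H
 proof
  show "spectral_measure E" "E {0<..} = id" "tomita H = spectral_op E (\<lambda>s. complex_of_real (sqrt s)) O graph conj_l2"
   using assms(3) by (simp_all add: modular_data_def)
  show "imaginary_power E t = graph (trans_l2 (2 * pi * t))" for t
   by (simp only: assms(4) U_boost)
  show "subspace H" "closed H" using assms(2) by (simp_all add: standard_subspace_def)
 qed
 have analytic: "crossable (tomita H) T \<longleftrightarrow> (\<exists>G \<in> Hinf. T = mult_diff (lower_bv G) \<circ> flip)"
 proof
  assume "crossable (tomita H) T"
  then obtain C where C: "bounded_clinear C" "crossing_identity sqrt_op T C"
   unfolding crossable_def is_crossed_tomita_iff[OF T_bd] by blast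
  have Tg: "T = mult_diff g \<circ> flip" by (rule tomita_multiplication_part_zero[OF f g T C])
  obtain G where G: "G \<in> Hinf" "AE x in lborel. lower_bv G x = g x"
   by (rule tomita_exchange_analytic[OF g C(1) C(2)[unfolded Tg]])
  have "mult_diff (lower_bv G) = mult_diff g"
   by (rule mult_diff_cong_AE[OF lower_bv_Linf[OF G(1)] bounded_borel_Linf[OF g] G(2)])
  with G(1) Tg show "\<exists>G \<in> Hinf. T = mult_diff (lower_bv G) \<circ> flip" by metis
 qed (use tomita_crossing_of_Hinf(1) in blast)
 have strip: "(crossing_symmetric (tomita H) T \<longleftrightarrow> (AE \<theta> in lborel. upper_bv G \<theta> = cnj (lower_bv G \<theta>))) \<and>
   (inner_function G \<longrightarrow> unitary T) \<and> (crossing_symmetric (tomita H) T \<longrightarrow> unitary T \<longrightarrow> inner_function G)"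
  if G: "G \<in> Hinf" and TG: "T = mult_diff (lower_bv G) \<circ> flip" for G
 proof (intro conjI impI)
  note sym = tomita_crossing_of_Hinf(2)[OF G TG] and uni = tomita_crossing_of_Hinf(3)[OF G TG]
  show "crossing_symmetric (tomita H) T \<longleftrightarrow> (AE \<theta> in lborel. upper_bv G \<theta> = cnj (lower_bv G \<theta>))" by (rule sym)
  show "unitary T" if "inner_function G"
   unfolding uni using that by (auto simp: inner_function_def elim: eventually_mono)
  assume "crossing_symmetric (tomita H) T" "unitary T"
  then have "AE \<theta> in lborel. upper_bv G \<theta> = cnj (lower_bv G \<theta>)" "AE \<theta> in lborel. cmod (lower_bv G \<theta>) = 1"
   by (simp_all only: sym uni)
  then have "AE \<theta> in lborel. cmod (lower_bv G \<theta>) = 1 \<and> cmod (upper_bv G \<theta>) = 1"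
   by eventually_elim simp
  with G show "inner_function G" by (simp add: inner_function_def)
 qed
 show ?thesis
  using conj_crossable[OF f g T] conj_crossing_symmetric analytic strip by blast
qed

end
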